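(* We have $$ N_{W}(F,P)= \frac{c_{Q}2^{r_2 n}}{D_{K}^{n/2}Q^{2d}} \sum_{\mathfrak{b}} \sum_{\mathbf{m}\in \hat{\mathfrak{b}}^n}(\mathrm{N} \mathfrak{b} )^{-n}S_\mathfrak{b} (\mathbf{m}) I_\mathfrak{b} (\mathbf{m}), $$ where the sum over $\mathfrak{b}$ is over non-zero integral ideals and \begin{align*} S_\mathfrak{b} (\mathbf{m}) &=\sum^{*}_{\sigma\bmod{\mathfrak{b}}}\sum_{\mathbf{a}\bmod{\mathfrak{b} }}\sigma(F(\mathbf{a}))\mathrm{e}(\mathbf{m}. \mathbf{a}),\\ I_\mathfrak{b} (\mathbf{m}) &=\int_{ V^{n}}W(\mathbf{x}/P)h\left(\frac{\mathrm{N} \mathfrak{b}}{Q^d} ,\frac{\mathrm{Nm}(F(\mathbf{x}))}{Q^{2d}}\right)\mathrm{e}\left(-\mathbf{m}.\mathbf{x} \right)\mathrm{d}\mathbf{x}. \end{align*}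
   Context: $K$ is a number field of degree $d=r_1+2r_2$ ($r_1$ real, $2r_2$ complex embeddings), ring of integers $\mathfrak{o}$, absolute discriminant $D_K$, ideal norm $\mathrm{N}$. $V=K\otimes_\mathbb{Q}\mathbb{R}\cong\mathbb{R}^{r_1}\times\mathbb{C}^{r_2}$, with $\mathrm{Nm}(v)=v^{(1)}\cdots v^{(r_1)}|v^{(r_1+1)}|^2\cdots|v^{(r_1+r_2)}|^2$, $\mathrm{tr}(v)=\sum_{l\le r_1}v^{(l)}+\sum_{l>r_1}2\Re(v^{(l)})$, and $\mathrm{e}(\cdot)=e^{2\pi i\,\mathrm{tr}(\cdot)}$; $K$ is embedded in $V$ and $\mathrm{d}\mathbf{x}$ is Lebesgue measure on $V^n$. $\hat{\mathfrak{b}}=\{\alpha\in K:\mathrm{tr}_{K/\mathbb{Q}}(\alpha x)\in\mathbb{Z}\ \forall x\in\mathfrak{b}\}$ is the dual ideal. $F\in\mathfrak{o}[X_1,\dots,X_n]$ is a polynomial, $W$ is a smooth compactly supported weight on $V^n$, $P\ge1$, and $N_W(F,P)=\sum_{\mathbf{x}\in\mathfrak{o}^n}\delta_K(F(\mathbf{x}))W(\mathbf{x}/P)$ with $\delta_K(\alpha)=1$ if $\alpha=0$ and $0$ otherwise. $Q\ge1$, and $c_Q$, $h$ are the constant and function from the smooth delta-function identity: $\delta_K(\mathfrak{a})=\frac{c_Q}{Q^{2d}}\sum_{(0)\neq\mathfrak{b}}\sum^*_{\sigma\bmod\mathfrak{b}}\sigma(\mathfrak{a})h(\mathrm{N}\mathfrak{b}/Q^d,\mathrm{N}\mathfrak{a}/Q^{2d})$,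 with $c_Q=1+O_N(Q^{-N})$, $h$ smooth on $(0,\infty)\times\mathbb{R}$, $h(x,y)\ll x^{-1}$, and $h(x,y)=0$ unless $x\le\max\{1,2|y|\}$. $\sum^*_{\sigma\bmod\mathfrak{b}}$ denotes the sum over primitive additive characters modulo $\mathfrak{b}$. *)

theory Defs
  imports
    "HOL-Analysis.Analysis"
    "HOL-Library.Landau_Symbols"
    "HOL-Library.Poly_Mapping"
    "HOL-Algebra.QuotRing"
    "Jordan_Normal_Form.Determinant"
begin

(* In the sequel x $ i is the i-th component of a vector of type 'a ^ 'n. *)
no_notation Matrix.vec_index (infixl "$" 100)

section \<open>Number fields\<close>

class number_field = field_char_0 +
  assumes finite_over_Rats:
    "\<exists>B. finite B \<and> (\<forall>x. \<exists>q. (\<forall>b\<in>B. q b \<in> \<rat>) \<and> x = (\<Sum>b\<in>B. q b * b))"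

definition nf_degree :: "'k::number_field itself \<Rightarrow> nat" where
  "nf_degree _ = vector_space.dim (\<lambda>(q::rat) (x::'k). of_rat q * x) UNIV"

definition ring_of_integers :: "'k::number_field ring" where
  "ring_of_integers =
     \<lparr>carrier = {x. algebraic_int x}, mult = (*), one = 1, zero = 0, add = (+)\<rparr>"

definition embeddings :: "('k::number_field \<Rightarrow> complex) set" where
  "embeddings = {\<tau>. \<tau> 1 = 1 \<and> (\<forall>x y. \<tau> (x + y) = \<tau> x + \<tau> y) \<and> (\<forall>x y. \<tau> (x * y) = \<tau> x * \<tau> y)}"

definition trace_K :: "'k::number_field \<Rightarrow> complex" where
  "trace_K \<alpha> = (\<Sum>\<tau>\<in>embeddings. \<tau> \<alpha>)"

definition integral_basis :: "(nat \<Rightarrow> 'k::number_field) \<Rightarrow> bool" where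
  "integral_basis \<omega> \<longleftrightarrow>
     (\<forall>i<nf_degree TYPE('k). \<omega> i \<in> carrier ring_of_integers) \<and>
     (\<forall>\<alpha>\<in>carrier ring_of_integers.
        \<exists>!a::nat \<Rightarrow> int. (\<forall>i\<ge>nf_degree TYPE('k). a i = 0) \<and>
          \<alpha> = (\<Sum>i<nf_degree TYPE('k). of_int (a i) * \<omega> i))"

text \<open>The absolute discriminant; it does not depend on the integral basis chosen.\<close>

definition abs_discriminant :: "'k::number_field itself \<Rightarrow> real" where
  "abs_discriminant _ =
     (let d = nf_degree TYPE('k); \<omega> = (SOME \<omega>::nat \<Rightarrow> 'k. integral_basis \<omega>)
      in cmod (Determinant.det (Matrix.mat d d (\<lambda>(i, j). trace_K (\<omega> i * \<omega> j)))))"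

definition nonzero_ideals :: "'k::number_field set set" where
  "nonzero_ideals = {\<bb>. ideal \<bb> ring_of_integers \<and> \<bb> \<noteq> {0}}"

text \<open>Since \<^const>\<open>card\<close> of an infinite set is 0, the zero ideal gets norm 0, as it should.\<close>

definition ideal_norm :: "'k::number_field set \<Rightarrow> nat" where
  "ideal_norm \<bb> = card (carrier (ring_of_integers Quot \<bb>))"

definition dual_ideal :: "'k::number_field set \<Rightarrow> 'k set" where
  "dual_ideal \<bb> = {\<alpha>. \<forall>x\<in>\<bb>. trace_K (\<alpha> * x) \<in> \<int>}"

text \<open>A complete system of representatives of the residue classes modulo \<open>\<bb>\<close>.\<close>

definition residue_reps :: "'k::number_field set \<Rightarrow> 'k set" where
  "residue_reps \<bb> = (\<lambda>A. SOME a. a \<in> A) ` carrier (ring_of_integers Quot \<bb>)"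

text \<open>
  An additive character modulo \<open>\<bb>\<close> is a homomorphism from the additive group of the residue
  ring to the nonzero complex numbers. It is represented by its pullback to the ring of integers,
  made extensional so that distinct functions are distinct characters.
\<close>

definition add_chars :: "'k::number_field set \<Rightarrow> ('k \<Rightarrow> complex) set" where
  "add_chars \<bb> =
     {\<sigma> \<in> extensional (carrier ring_of_integers).
        (\<forall>x\<in>carrier ring_of_integers. \<sigma> x \<noteq> 0) \<and>
        (\<forall>x\<in>carrier ring_of_integers. \<forall>y\<in>carrier ring_of_integers. \<sigma> (x + y) = \<sigma> x * \<sigma> y) \<and>
        (\<forall>x\<in>carrier ring_of_integers. \<forall>y\<in>carrier ring_of_integers. x - y \<in> \<bb> \<longrightarrow> \<sigma> x = \<sigma> y)}"

text \<open>Primitive: not a character modulo a proper divisor \<open>\<cc>\<close> of \<open>\<bb>\<close>, that is, modulo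
  an ideal \<open>\<cc>\<close> properly containing \<open>\<bb>\<close>.\<close>

definition primitive_chars :: "'k::number_field set \<Rightarrow> ('k \<Rightarrow> complex) set" where
  "primitive_chars \<bb> =
     {\<sigma> \<in> add_chars \<bb>. \<not> (\<exists>\<cc>. ideal \<cc> ring_of_integers \<and> \<bb> \<subset> \<cc> \<and> \<sigma> \<in> add_chars \<cc>)}"

section \<open>The space V\<close>

text \<open>
  The coordinates \<open>l < r1\<close> are the real places and \<open>r1 \<le> l < r1 + r2\<close> the complex places;
  \<open>s l\<close> is the embedding chosen at the place \<open>l\<close>.
\<close>

definition place_enumeration :: "nat \<Rightarrow> nat \<Rightarrow> (nat \<Rightarrow> 'k::number_field \<Rightarrow> complex) \<Rightarrow> bool" where
  "place_enumeration r1 r2 s \<longleftrightarrow>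
     (\<forall>l<r1 + r2. s l \<in> embeddings \<and> (range (s l) \<subseteq> \<real> \<longleftrightarrow> l < r1)) \<and>
     (\<forall>\<tau>\<in>embeddings. \<exists>!l. l < r1 + r2 \<and> (\<tau> = s l \<or> \<tau> = cnj \<circ> s l))"

text \<open>
  Because \<open>r1\<close> or \<open>r2\<close> may be 0 and depend on the field, \<open>V\<close> is an arbitrary Euclidean space with a
  linear isometry \<open>v \<mapsto> (crd v l)\<^bsub>l < r1 + r2\<^esub>\<close> onto the product of \<open>r1\<close> copies of the real line
  and \<open>r2\<close> copies of the complex plane. By isometry \<^const>\<open>lborel\<close> is the usual Lebesgue
  measure of this product, with Lebesgue measure \<open>dx dy\<close> on each complex factor.
\<close>

definition V_coordinates :: "nat \<Rightarrow> nat \<Rightarrow> ('v::euclidean_space \<Rightarrow> nat \<Rightarrow> complex) \<Rightarrow> bool" where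
  "V_coordinates r1 r2 crd \<longleftrightarrow>
     (\<forall>l<r1 + r2. linear (\<lambda>v. crd v l)) \<and>
     (\<forall>v. \<forall>l<r1. crd v l \<in> \<real>) \<and>
     (\<forall>v. (norm v)\<^sup>2 = (\<Sum>l<r1 + r2. (cmod (crd v l))\<^sup>2)) \<and>
     (\<forall>w. (\<forall>l<r1. w l \<in> \<real>) \<longrightarrow> (\<exists>v. \<forall>l<r1 + r2. crd v l = w l))"

definition embed_V ::
  "nat \<Rightarrow> nat \<Rightarrow> (nat \<Rightarrow> 'k::number_field \<Rightarrow> complex) \<Rightarrow> ('v::euclidean_space \<Rightarrow> nat \<Rightarrow> complex) \<Rightarrow> 'k \<Rightarrow> 'v"
  where "embed_V r1 r2 s crd \<alpha> = (THE v. \<forall>l<r1 + r2. crd v l = s l \<alpha>)"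

text \<open>
  Norm, trace and the character \<open>e\<close> on \<open>V\<close>, as functions of the coordinate family \<open>w\<close>
  (whose entries \<open>w l\<close>, \<open>l < r1\<close>, are real).
\<close>

definition Nm_V :: "nat \<Rightarrow> nat \<Rightarrow> (nat \<Rightarrow> complex) \<Rightarrow> real" where
  "Nm_V r1 r2 w = (\<Prod>l<r1. Re (w l)) * (\<Prod>l=r1..<r1 + r2. (cmod (w l))\<^sup>2)"

definition tr_V :: "nat \<Rightarrow> nat \<Rightarrow> (nat \<Rightarrow> complex) \<Rightarrow> real" where
  "tr_V r1 r2 w = (\<Sum>l<r1. Re (w l)) + (\<Sum>l=r1..<r1 + r2. 2 * Re (w l))"

definition e_V :: "nat \<Rightarrow> nat \<Rightarrow> (nat \<Rightarrow> complex) \<Rightarrow> complex" where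
  "e_V r1 r2 w = exp (2 * pi * \<i> * tr_V r1 r2 w)"

section \<open>Polynomials and smooth functions\<close>

text \<open>
  A polynomial in variables indexed by \<open>'n\<close> maps exponent vectors to coefficients; it is
  evaluated through a map \<open>\<phi>\<close> on coefficients (the identity on \<open>K\<close>, an embedding for a
  coordinate of \<open>V\<close>).
\<close>

definition mpoly_eval ::
  "('k::zero \<Rightarrow> 'r::comm_ring_1) \<Rightarrow> (('n::finite \<Rightarrow>\<^sub>0 nat) \<Rightarrow>\<^sub>0 'k) \<Rightarrow> ('n \<Rightarrow> 'r) \<Rightarrow> 'r" where
  "mpoly_eval \<phi> F x = (\<Sum>t\<in>Poly_Mapping.keys F. \<phi> (poly_mapping.lookup F t) * (\<Prod>i\<in>UNIV. x i ^ poly_mapping.lookup t i))"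

text \<open>\<open>k\<close>-fold continuous differentiability on an open set \<open>S\<close>.\<close>

primrec Ck_on :: "nat \<Rightarrow> ('a::real_normed_vector \<Rightarrow> 'b::real_normed_vector) \<Rightarrow> 'a set \<Rightarrow> bool" where
  "Ck_on 0 f S \<longleftrightarrow> continuous_on S f"
| "Ck_on (Suc k) f S \<longleftrightarrow>
     (\<exists>f'. (\<forall>x\<in>S. (f has_derivative f' x) (at x)) \<and> (\<forall>v. Ck_on k (\<lambda>x. f' x v) S))"

definition smooth_on :: "('a::real_normed_vector \<Rightarrow> 'b::real_normed_vector) \<Rightarrow> 'a set \<Rightarrow> bool" where
  "smooth_on f S \<longleftrightarrow> (\<forall>k. Ck_on k f S)"

section \<open>The smooth delta function\<close>

definition delta_K :: "'k::zero \<Rightarrow> real" where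
  "delta_K \<alpha> = (if \<alpha> = 0 then 1 else 0)"

text \<open>
  The identity for the given parameter \<open>Q\<close>. Only principal ideals \<open>(\<alpha>)\<close> are required, so
  that characters need not be extended to ideals. It must not be demanded of every \<open>Q \<ge> 1\<close>:
  the support condition and continuity force \<open>h 1 0 = 0\<close>, so that it fails at \<open>Q = 1\<close> for
  \<open>\<alpha> = 0\<close>.
\<close>

definition delta_identity ::
  "'k::number_field itself \<Rightarrow> real \<Rightarrow> real \<Rightarrow> (real \<Rightarrow> real \<Rightarrow> real) \<Rightarrow> bool" where
  "delta_identity K Q cQ h \<longleftrightarrow>
     (\<forall>\<alpha>::'k \<in> carrier ring_of_integers.
        complex_of_real (delta_K \<alpha>) =
          complex_of_real (cQ / Q ^ (2 * nf_degree K)) *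
          (\<Sum>\<^sub>\<infinity>\<bb>\<in>nonzero_ideals. \<Sum>\<sigma>\<in>primitive_chars \<bb>.
             \<sigma> \<alpha> * complex_of_real
               (h (ideal_norm \<bb> / Q ^ nf_degree K)
                  (ideal_norm (cgenideal ring_of_integers \<alpha>) / Q ^ (2 * nf_degree K)))))"

text \<open>
  The remaining properties of \<open>h\<close> and \<open>c\<close>. The identity evaluates \<open>h (x, y)\<close> only at ideal norms
  \<open>y \<ge> 0\<close>, whereas \<open>Nm (F (x))\<close> may be negative; evenness in \<open>y\<close> records that the function
  \<open>h\<close> constructed for the identity depends on \<open>y\<close> only through its absolute value.
\<close>

definition delta_weight :: "(real \<Rightarrow> real) \<Rightarrow> (real \<Rightarrow> real \<Rightarrow> real) \<Rightarrow> bool" where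
  "delta_weight c h \<longleftrightarrow>
     (\<forall>N>0. (\<lambda>Q. c Q - 1) \<in> O[at_top](\<lambda>Q. Q powr (- N))) \<and>
     smooth_on (\<lambda>(x, y). h x y) ({0<..} \<times> UNIV) \<and>
     (\<exists>C. \<forall>x>0. \<forall>y. \<bar>h x y\<bar> \<le> C / x) \<and>
     (\<forall>x>0. \<forall>y. h x y \<noteq> 0 \<longrightarrow> x \<le> max 1 (2 * \<bar>y\<bar>)) \<and>
     (\<forall>x>0. \<forall>y. h x (- y) = h x y)"

section \<open>The counting function, exponential sums and integrals\<close>

definition N_count ::
  "nat \<Rightarrow> nat \<Rightarrow> (nat \<Rightarrow> 'k::number_field \<Rightarrow> complex) \<Rightarrow> ('v::euclidean_space \<Rightarrow> nat \<Rightarrow> complex) \<Rightarrow>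
   ('v ^ 'n::finite \<Rightarrow> real) \<Rightarrow> (('n \<Rightarrow>\<^sub>0 nat) \<Rightarrow>\<^sub>0 'k) \<Rightarrow> real \<Rightarrow> real" where
  "N_count r1 r2 s crd W F P =
     (\<Sum>\<^sub>\<infinity>x\<in>{x :: 'k ^ 'n. \<forall>i. x $ i \<in> carrier ring_of_integers}.
        delta_K (mpoly_eval id F (\<lambda>i. x $ i)) * W ((\<chi> i. embed_V r1 r2 s crd (x $ i)) /\<^sub>R P))"

definition exp_sum ::
  "nat \<Rightarrow> nat \<Rightarrow> (nat \<Rightarrow> 'k::number_field \<Rightarrow> complex) \<Rightarrow>
   (('n::finite \<Rightarrow>\<^sub>0 nat) \<Rightarrow>\<^sub>0 'k) \<Rightarrow> 'k set \<Rightarrow> 'k ^ 'n \<Rightarrow> complex" where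
  "exp_sum r1 r2 s F \<bb> m =
     (\<Sum>\<sigma>\<in>primitive_chars \<bb>. \<Sum>a\<in>{a :: 'k ^ 'n. \<forall>i. a $ i \<in> residue_reps \<bb>}.
        \<sigma> (mpoly_eval id F (\<lambda>i. a $ i)) * e_V r1 r2 (\<lambda>l. s l (\<Sum>i\<in>UNIV. m $ i * a $ i)))"

definition exp_integral ::
  "nat \<Rightarrow> nat \<Rightarrow> (nat \<Rightarrow> 'k::number_field \<Rightarrow> complex) \<Rightarrow> ('v::euclidean_space \<Rightarrow> nat \<Rightarrow> complex) \<Rightarrow>
   ('v ^ 'n::finite \<Rightarrow> real) \<Rightarrow> (('n \<Rightarrow>\<^sub>0 nat) \<Rightarrow>\<^sub>0 'k) \<Rightarrow> (real \<Rightarrow> real \<Rightarrow> real) \<Rightarrow> real \<Rightarrow> real \<Rightarrow>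
   'k set \<Rightarrow> 'k ^ 'n \<Rightarrow> complex" where
  "exp_integral r1 r2 s crd W F h P Q \<bb> m =
     (LINT x|lborel.
        complex_of_real
          (W (x /\<^sub>R P) *
           h (ideal_norm \<bb> / Q ^ nf_degree TYPE('k))
             (Nm_V r1 r2 (\<lambda>l. mpoly_eval (s l) F (\<lambda>i. crd (x $ i) l)) / Q ^ (2 * nf_degree TYPE('k)))) *
        e_V r1 r2 (\<lambda>l. - (\<Sum>i\<in>UNIV. s l (m $ i) * crd (x $ i) l)))"

end

theory Submission
  imports
    Defs
    "Jordan_Normal_Form.Char_Poly"
    "HOL-Computational_Algebra.Field_as_Ring"
begin

text \<open>
  Insert the delta identity into the counting function and split the integral points into residue
  classes \<open>a + \<bb>\<^sup>n\<close>. Since \<open>\<sigma> (F x)\<close> depends only on the class, what is left for each \<open>\<bb>\<close> and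
  \<open>a\<close> is the sum of a smooth compactly supported function over the lattice \<open>\<bb>\<^sup>n\<close> translated by
  \<open>a\<close>, to which Poisson summation applies. The dual lattice for the trace pairing is the dual
  ideal, and the covolume of \<open>\<bb>\<close> in \<open>V\<close> is \<open>N \<bb> \<surd>D / 2\<^sup>r\<^sup>2\<close>: the square of the determinant of the
  matrix of embeddings of an integral basis is the discriminant, and passing from the embeddings to
  the real coordinates costs a factor 2 at each complex place. As \<open>W\<close> has compact support and
  \<open>h (x, y)\<close> vanishes for large \<open>x\<close>, only finitely many \<open>\<bb>\<close> and integral points contribute, so the
  sums may be interchanged.
\<close>

text \<open>The lattice has full rank in V only because there are as many embeddings as the degree.
  The embeddings come from linear algebra: multiplications by elements of K act on the additive maps
  from K to the complex numbers, commute, and are diagonalisable since minimal polynomials over the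
  rationals are separable; their joint eigenvectors are multiples of embeddings. Expanding rational
  coordinate functions in embeddings then yields the degree, the rationality of the trace and an
  inverse of the matrix of embeddings. Poisson summation is reached without pointwise convergence of
  Fourier series: the periodised function is tested against powers of a nonnegative trigonometric
  polynomial, which takes only orthogonality of characters and decay of the transform. Evenness of
  \<open>h\<close> is used because the delta identity sees the norm of the ideal generated by F(x),
  the absolute value of Nm(F(x)). The factor N(b)^(-n) cancels the same power in the covolume, so
  one constant is left for all ideals and the identity can be applied point by point.\<close>

no_notation scalar_prod (infix "\<bullet>" 70)

section \<open>Algebraic integers\<close>

text \<open>The relations say that \<open>w\<close> is an eigenvector of the coefficient matrix with
  eigenvalue \<open>x\<close>. Integer coefficients give integrality, rational ones
  algebraicity.\<close>

lemma char_poly_root: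
  fixes x :: "'a::field" and w :: "nat \<Rightarrow> 'a"
  assumes eq: "\<And>i. i < n \<Longrightarrow> x * w i = (\<Sum>j<n. a i j * w j)"
    and nz: "\<exists>i<n. w i \<noteq> 0"
  shows "poly (char_poly (Matrix.mat n n (\<lambda>(i, j). a i j))) x = 0"
proof -
  let ?A = "Matrix.mat n n (\<lambda>(i, j). a i j)" and ?v = "Matrix.vec n w"
  have "?A *\<^sub>v ?v = x \<cdot>\<^sub>v ?v"
    by (rule eq_vecI) (auto simp: scalar_prod_def eq atLeast0LessThan)
  moreover have "?v \<noteq> 0\<^sub>v n"
  proof
    assume "?v = 0\<^sub>v n"
    then have "Matrix.vec_index ?v i = 0" if "i < n" for i using that by simp
    with nz show False by auto
  qed
  ultimately have "eigenvalue ?A x"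
    unfolding eigenvalue_def eigenvector_def by (intro exI[of _ ?v]) auto
  then show ?thesis by (subst eigenvalue_root_char_poly[symmetric, of _ n]) auto
qed

text \<open>The additive group generated by \<open>S\<close> if \<open>S\<close> is finite; for
  infinite \<open>S\<close> the sum is 0 by convention and only 0 is left.\<close>

definition zspan :: "'a::comm_ring_1 set \<Rightarrow> 'a set" where
  "zspan S = {x. \<exists>u. x = (\<Sum>s\<in>S. of_int (u s) * s)}"

lemma zspan_base: "finite S \<Longrightarrow> s \<in> S \<Longrightarrow> s \<in> zspan S"
  unfolding zspan_def by (auto intro!: exI[of _ "\<lambda>t. if t = s then 1 else 0"] simp: if_distrib if_distribR sum.delta cong: if_cong)

lemma zspan_0: "0 \<in> zspan S"
  unfolding zspan_def by (auto intro!: exI[of _ "\<lambda>_. 0"])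

lemma zspan_add: "x \<in> zspan S \<Longrightarrow> y \<in> zspan S \<Longrightarrow> x + y \<in> zspan S"
  unfolding zspan_def
proof clarify
  fix u v
  show "\<exists>w. (\<Sum>s\<in>S. of_int (u s) * s) + (\<Sum>s\<in>S. of_int (v s) * s) = (\<Sum>s\<in>S. of_int (w s) * s)"
    by (rule exI[of _ "\<lambda>s. u s + v s"]) (simp add: sum.distrib algebra_simps)
qed

lemma zspan_mult: "x \<in> zspan S \<Longrightarrow> of_int k * x \<in> zspan S"
  unfolding zspan_def
proof clarify
  fix u
  show "\<exists>w. of_int k * (\<Sum>s\<in>S. of_int (u s) * s) = (\<Sum>s\<in>S. of_int (w s) * s)"
    by (rule exI[of _ "\<lambda>s. k * u s"]) (simp add: sum_distrib_left algebra_simps)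
qed

lemma zspan_sum: "(\<And>i. i \<in> I \<Longrightarrow> f i \<in> zspan S) \<Longrightarrow> (\<Sum>i\<in>I. f i) \<in> zspan S"
  by (induction I rule: infinite_finite_induct) (auto intro: zspan_0 zspan_add)

lemma zspan_stable:
  assumes "\<And>s. s \<in> S \<Longrightarrow> x * s \<in> zspan S" "y \<in> zspan S"
  shows "x * y \<in> zspan S"
proof -
  from assms(2) obtain u where u: "y = (\<Sum>s\<in>S. of_int (u s) * s)" by (auto simp: zspan_def)
  have "x * y = (\<Sum>s\<in>S. of_int (u s) * (x * s))"
    unfolding u by (simp add: sum_distrib_left mult.left_commute)
  also have "\<dots> \<in> zspan S" by (intro zspan_sum zspan_mult assms)
  finally show ?thesis .
qed

text \<open>Multiplication by \<open>x\<close> preserves a finitely generated group, so it is given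
  by an integer matrix, whose characteristic polynomial is monic and vanishes at
  \<open>x\<close>.\<close>

lemma algebraic_int_of_zspan:
  fixes x :: "'a::field_char_0"
  assumes fin: "finite S" and nz: "\<exists>s\<in>S. s \<noteq> 0"
    and stable: "\<And>s. s \<in> S \<Longrightarrow> x * s \<in> zspan S"
  shows "algebraic_int x"
proof -
  define n where "n = card S"
  obtain w where w: "bij_betw w {..<n} S"
    using ex_bij_betw_nat_finite[OF fin] unfolding n_def by (auto simp: atLeast0LessThan)
  have "\<forall>s\<in>S. \<exists>u. x * s = (\<Sum>t\<in>S. of_int (u t) * t)"
    using stable by (auto simp: zspan_def)
  then obtain u where u: "\<And>s. s \<in> S \<Longrightarrow> x * s = (\<Sum>t\<in>S. of_int (u s t) * t)" by metis
  let ?A = "Matrix.mat n n (\<lambda>(i, j). u (w i) (w j))"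
  have eq: "x * w i = (\<Sum>j<n. of_int (u (w i) (w j)) * w j)" if "i < n" for i
  proof -
    have "w i \<in> S" using w that by (auto simp: bij_betw_def)
    then have "x * w i = (\<Sum>t\<in>S. of_int (u (w i) t) * t)" by (rule u)
    also have "\<dots> = (\<Sum>j<n. of_int (u (w i) (w j)) * w j)"
      by (rule sum.reindex_bij_betw[OF w, symmetric])
    finally show ?thesis .
  qed
  have "\<exists>i<n. w i \<noteq> 0" using nz w by (auto simp: bij_betw_def)
  from char_poly_root[OF eq this]
  have "poly (char_poly (Matrix.mat n n (\<lambda>(i, j). of_int (u (w i) (w j))))) x = 0" .
  also have "Matrix.mat n n (\<lambda>(i, j). of_int (u (w i) (w j))) = map_mat of_int ?A"
    by (rule eq_matI) auto
  also have "char_poly (map_mat of_int ?A) = map_poly (of_int :: int \<Rightarrow> 'a) (char_poly ?A)"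
    by (rule of_int_hom.char_poly_hom[of _ n]) auto
  finally have "poly (map_poly of_int (char_poly ?A)) x = 0" .
  moreover have "lead_coeff (char_poly ?A) = 1"
    using degree_monic_char_poly[of ?A n] by auto
  ultimately show ?thesis unfolding algebraic_int_altdef_ipoly by blast
qed

lemma algebraic_int_power_zspan:
  fixes x :: "'a::field_char_0"
  assumes "algebraic_int x"
  obtains m where "m > 0" "x ^ m \<in> zspan ((\<lambda>i. x ^ i) ` {..<m})"
proof -
  from assms obtain p where p: "poly (map_poly of_int p) x = 0" "lead_coeff p = 1"
    unfolding algebraic_int_altdef_ipoly by blast
  let ?m = "degree p"
  have "?m > 0"
  proof (rule ccontr)
    assume "\<not> ?m > 0"
    then have "p = 1" using p(2) by (auto elim!: degree_eq_zeroE)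
    with p(1) show False by simp
  qed
  moreover have "x ^ ?m \<in> zspan ((\<lambda>i. x ^ i) ` {..<?m})"
  proof -
    have "0 = (\<Sum>i\<le>?m. of_int (coeff p i) * x ^ i)"
      using p(1) by (simp add: poly_altdef degree_map_poly coeff_map_poly)
    also have "\<dots> = (\<Sum>i<?m. of_int (coeff p i) * x ^ i) + x ^ ?m"
      using p(2) by (simp add: lessThan_Suc_atMost[symmetric])
    finally have "x ^ ?m = (\<Sum>i<?m. of_int (- coeff p i) * x ^ i)"
      by (simp add: eq_neg_iff_add_eq_0 sum_negf add.commute)
    also have "\<dots> \<in> zspan ((\<lambda>i. x ^ i) ` {..<?m})"
      by (intro zspan_sum zspan_mult zspan_base) auto
    finally show ?thesis .
  qed
  ultimately show thesis by (rule that)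
qed

lemma zspan_image_mult:
  assumes "finite S" "x \<in> zspan S" "(\<lambda>s. s * y) ` S \<subseteq> zspan T"
  shows "x * y \<in> zspan T"
proof -
  from assms(2) obtain u where u: "x = (\<Sum>s\<in>S. of_int (u s) * s)" by (auto simp: zspan_def)
  have "x * y = (\<Sum>s\<in>S. of_int (u s) * (s * y))"
    unfolding u by (simp add: sum_distrib_right mult.assoc)
  also have "\<dots> \<in> zspan T" using assms(3) by (intro zspan_sum zspan_mult) auto
  finally show ?thesis .
qed

text \<open>One module serves both claims: the span of the products x^i y^j with i < m and j < n is
  stable under \<open>x\<close> and under \<open>y\<close>, hence under their sum and their
  product.\<close>

lemma
  fixes x y :: "'a::field_char_0"
  assumes "algebraic_int x" "algebraic_int y"
  shows algebraic_int_add: "algebraic_int (x + y)"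
    and algebraic_int_times: "algebraic_int (x * y)"
proof -
  from assms(1) obtain m where m: "m > 0" "x ^ m \<in> zspan ((\<lambda>i. x ^ i) ` {..<m})"
    by (rule algebraic_int_power_zspan)
  from assms(2) obtain n where n: "n > 0" "y ^ n \<in> zspan ((\<lambda>i. y ^ i) ` {..<n})"
    by (rule algebraic_int_power_zspan)
  define S where "S = (\<lambda>(i, j). x ^ i * y ^ j) ` ({..<m} \<times> {..<n})"
  have fin: "finite S" unfolding S_def by auto
  have mem: "x ^ i * y ^ j \<in> S" if "i < m" "j < n" for i j
    using that unfolding S_def by auto
  have nz: "\<exists>s\<in>S. s \<noteq> 0" by (rule bexI[of _ 1]) (use mem[OF m(1) n(1)] in simp_all)
  have x: "x * s \<in> zspan S" if s: "s \<in> S" for s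
  proof -
    from s obtain i j where ij: "s = x ^ i * y ^ j" "i < m" "j < n" by (auto simp: S_def)
    show ?thesis
    proof (cases "Suc i < m")
      case True
      then have "x ^ Suc i * y ^ j \<in> S" using ij by (intro mem)
      then have "x ^ Suc i * y ^ j \<in> zspan S" by (rule zspan_base[OF fin])
      then show ?thesis by (simp add: ij mult.assoc)
    \<comment> \<open>At the edge \<open>Suc i = m\<close> the power x^m leaves the list and is
      rewritten through lower powers by integrality of \<open>x\<close>.\<close>
    next
      case False
      then have "x * s = x ^ m * y ^ j" using ij
        by (metis Suc_lessI mult.assoc power_Suc)
      also have "\<dots> \<in> zspan S"
        by (rule zspan_image_mult[OF _ m(2)]) (auto intro!: zspan_base fin mem ij)
      finally show ?thesis .
    qed
  qed
  have y: "y * s \<in> zspan S" if s: "s \<in> S" for s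
  proof -
    from s obtain i j where ij: "s = x ^ i * y ^ j" "i < m" "j < n" by (auto simp: S_def)
    show ?thesis
    proof (cases "Suc j < n")
      case True
      then have "x ^ i * y ^ Suc j \<in> S" using ij by (intro mem)
      then have "x ^ i * y ^ Suc j \<in> zspan S" by (rule zspan_base[OF fin])
      then show ?thesis by (simp add: ij mult.left_commute)
    next
      case False
      then have "y * s = y ^ n * x ^ i" using ij
        by (metis Suc_lessI mult.assoc mult.commute power_Suc)
      also have "\<dots> \<in> zspan S"
        by (rule zspan_image_mult[OF _ n(2)])
          (auto intro!: zspan_base fin mem ij simp: mult.commute[of "y ^ _"])
      finally show ?thesis .
    qed
  qed
  show "algebraic_int (x + y)"
    by (rule algebraic_int_of_zspan[OF fin nz]) (simp add: distrib_right zspan_add x y)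
  show "algebraic_int (x * y)"
    by (rule algebraic_int_of_zspan[OF fin nz]) (simp add: mult.assoc zspan_stable x y)
qed

lemma algebraic_int_diff:
  fixes x y :: "'a::field_char_0"
  shows "algebraic_int x \<Longrightarrow> algebraic_int y \<Longrightarrow> algebraic_int (x - y)"
  using algebraic_int_add[of x "- y"] by simp

lemma algebraic_int_sum:
  fixes f :: "'b \<Rightarrow> 'a::field_char_0"
  shows "(\<And>i. i \<in> I \<Longrightarrow> algebraic_int (f i)) \<Longrightarrow> algebraic_int (\<Sum>i\<in>I. f i)"
  by (induction I rule: infinite_finite_induct) (auto intro: algebraic_int_add)

lemma algebraic_int_pow:
  fixes x :: "'a::field_char_0"
  shows "algebraic_int x \<Longrightarrow> algebraic_int (x ^ n)"
  by (induction n) (auto intro: algebraic_int_times)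

lemma algebraic_int_prod:
  fixes f :: "'b \<Rightarrow> 'a::field_char_0"
  shows "(\<And>i. i \<in> I \<Longrightarrow> algebraic_int (f i)) \<Longrightarrow> algebraic_int (\<Prod>i\<in>I. f i)"
  by (induction I rule: infinite_finite_induct) (auto intro: algebraic_int_times)

section \<open>Rational coordinates and embeddings\<close>

lemma vector_space_rat: "vector_space (\<lambda>(q::rat) (x::'k::field_char_0). of_rat q * x)"
  by unfold_locales (auto simp: algebra_simps of_rat_add of_rat_mult)

lemma finite_dim_rat:
  "\<exists>B::'k::number_field set. finite_dimensional_vector_space (\<lambda>(q::rat) x. of_rat q * x) B"
proof -
  interpret QV: vector_space "\<lambda>(q::rat) (x::'k). of_rat q * x" by (rule vector_space_rat)
  obtain B :: "'k set" where B: "finite B"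
    "\<And>x. \<exists>q. (\<forall>b\<in>B. q b \<in> \<rat>) \<and> x = (\<Sum>b\<in>B. q b * b)"
    using finite_over_Rats by blast
  have spanB: "x \<in> QV.span B" for x
  proof -
    from B(2)[of x] obtain q where q: "\<forall>b\<in>B. q b \<in> \<rat>" "x = (\<Sum>b\<in>B. q b * b)" by blast
    have "q b * b \<in> QV.span B" if b: "b \<in> B" for b
    proof -
      from q(1) b obtain r where "q b = of_rat r" by (auto simp: Rats_def)
      then show ?thesis using QV.span_scale[OF QV.span_base[OF b], of r] by simp
    qed
    then show ?thesis unfolding q(2) by (rule QV.span_sum)
  qed
  obtain B' where B': "B' \<subseteq> B" "QV.independent B'" "B \<subseteq> QV.span B'"
    using QV.maximal_independent_subset by blast
  have "QV.span B' = UNIV"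
    using spanB QV.span_mono[OF B'(3)] by (auto simp: QV.span_span)
  moreover have "finite B'" using B' B finite_subset by blast
  ultimately have "finite_dimensional_vector_space (\<lambda>(q::rat) (x::'k). of_rat q * x) B'"
    by unfold_locales (use B' in auto)
  then show ?thesis by blast
qed

text \<open>Coordinates are provided as functions additive in \<open>x\<close>: composed with the
  inclusion of the rationals they become additive maps into the complex numbers, to be expanded in
  embeddings.\<close>

lemma rational_coordinates:
  obtains \<beta> :: "nat \<Rightarrow> 'k::number_field" and q :: "'k \<Rightarrow> nat \<Rightarrow> rat" where
    "\<And>x. x = (\<Sum>i<nf_degree TYPE('k). of_rat (q x i) * \<beta> i)"
    "\<And>x y i. q (x + y) i = q x i + q y i"
    "\<And>i j. i < nf_degree TYPE('k) \<Longrightarrow> j < nf_degree TYPE('k) \<Longrightarrow> q (\<beta> j) i = (if i = j then 1 else 0)"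
proof -
  obtain B :: "'k set" where "finite_dimensional_vector_space (\<lambda>(q::rat) x. of_rat q * x) B"
    using finite_dim_rat by blast
  then interpret QV: finite_dimensional_vector_space "\<lambda>(q::rat) (x::'k). of_rat q * x" B .
  define d where "d = nf_degree TYPE('k)"
  have d: "d = card B" unfolding d_def nf_degree_def using QV.dim_eq_card[of B UNIV] QV.independent_Basis QV.span_Basis by simp
  obtain \<beta> where \<beta>: "bij_betw \<beta> {..<d} B"
    using ex_bij_betw_nat_finite[OF QV.finite_Basis] unfolding d by (auto simp: atLeast0LessThan)
  have mem: "\<beta> i \<in> B" if "i < d" for i using \<beta> that by (auto simp: bij_betw_def)
  define q where "q = (\<lambda>x i. QV.representation B x (\<beta> i))"
  show thesis
  proof (rule that[of q \<beta>, folded d_def])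
    fix x
    have "(\<Sum>i<d. of_rat (q x i) * \<beta> i) = (\<Sum>b\<in>B. of_rat (QV.representation B x b) * b)"
      unfolding q_def by (rule sum.reindex_bij_betw[OF \<beta>])
    also have "\<dots> = x"
      by (rule QV.sum_representation_eq[OF QV.independent_Basis _ QV.finite_Basis])
        (auto simp: QV.span_Basis)
    finally show "x = (\<Sum>i<d. of_rat (q x i) * \<beta> i)" by simp
  next
    fix x y i
    show "q (x + y) i = q x i + q y i"
      unfolding q_def by (subst QV.representation_add) (auto simp: QV.independent_Basis QV.span_Basis)
  next
    fix i j assume "i < d" "j < d"
    then show "q (\<beta> j) i = (if i = j then 1 else 0)"
      unfolding q_def using \<beta>
      by (subst QV.representation_basis) (auto simp: QV.independent_Basis mem bij_betw_def inj_on_def)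
  qed
qed

text \<open>In rational coordinates multiplication by \<open>x\<close> is a rational matrix; its
  characteristic polynomial is the required one.\<close>

lemma rational_matrix_poly:
  fixes x :: "'k::number_field"
  obtains p :: "rat poly" where "lead_coeff p = 1" "poly (map_poly of_rat p) x = 0"
proof -
  obtain \<beta> :: "nat \<Rightarrow> 'k" and q where q:
    "\<And>x. x = (\<Sum>i<nf_degree TYPE('k). of_rat (q x i) * \<beta> i)"
    using rational_coordinates by metis
  let ?d = "nf_degree TYPE('k)"
  have "\<exists>i<?d. \<beta> i \<noteq> 0"
  proof (rule ccontr)
    assume "\<not> (\<exists>i<?d. \<beta> i \<noteq> 0)"
    then have "(1::'k) = 0" by (subst q) simp
    then show False by simp
  qed
  from char_poly_root[OF q[of "x * \<beta> _"] this]
  have "poly (char_poly (Matrix.mat ?d ?d (\<lambda>(i, j). of_rat (q (x * \<beta> i) j)))) x = 0" .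
  also have "Matrix.mat ?d ?d (\<lambda>(i, j). of_rat (q (x * \<beta> i) j)) = map_mat of_rat (Matrix.mat ?d ?d (\<lambda>(i, j). q (x * \<beta> i) j))"
    by (rule eq_matI) auto
  also have "char_poly \<dots> = map_poly (of_rat :: rat \<Rightarrow> 'k) (char_poly (Matrix.mat ?d ?d (\<lambda>(i, j). q (x * \<beta> i) j)))"
    by (rule of_rat_hom.char_poly_hom[of _ ?d]) auto
  finally show thesis
    by (rule that[rotated]) (use degree_monic_char_poly[of "Matrix.mat ?d ?d (\<lambda>(i, j). q (x * \<beta> i) j)" ?d] in auto)
qed

lemma common_denominator:
  assumes "finite I"
  obtains N :: nat where "N > 0" "\<And>i. i \<in> I \<Longrightarrow> of_nat N * f i \<in> (\<int> :: rat set)"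
proof -
  define g where "g = (\<lambda>i. nat (snd (quotient_of (f i))))"
  have pos: "g i > 0" for i unfolding g_def using quotient_of_denom_pos'[of "f i"] by simp
  have int: "of_nat (g i) * f i \<in> \<int>" for i
  proof -
    obtain a b where ab: "quotient_of (f i) = (a, b)" by (cases "quotient_of (f i)")
    have "b > 0" using quotient_of_denom_pos[OF ab] .
    moreover have "g i = nat b" by (simp add: g_def ab)
    ultimately have "of_nat (g i) * f i = of_int a"
      using quotient_of_div[OF ab] by simp
    then show ?thesis by simp
  qed
  show thesis
  proof (rule that[of "\<Prod>i\<in>I. g i"])
    show "(\<Prod>i\<in>I. g i) > 0" using pos by (simp add: prod_pos)
    fix i assume i: "i \<in> I"
    have "of_nat (\<Prod>i\<in>I. g i) * f i = of_nat (\<Prod>j\<in>I - {i}. g j) * (of_nat (g i) * f i)"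
      using prod.remove[OF assms i, of g] by (simp add: mult_ac)
    also have "\<dots> \<in> \<int>" by (rule Ints_mult[OF Ints_of_nat int])
    finally show "of_nat (\<Prod>i\<in>I. g i) * f i \<in> \<int>" .
  qed
qed

text \<open>Scaling the roots of a monic polynomial by a common denominator of its coefficients
  makes the coefficients integral and keeps it monic.\<close>

lemma algebraic_int_multiple:
  fixes x :: "'k::number_field"
  obtains N :: nat where "N > 0" "algebraic_int (of_nat N * x)"
proof -
  obtain p :: "rat poly" where p: "lead_coeff p = 1" "poly (map_poly of_rat p) x = 0"
    by (rule rational_matrix_poly)
  let ?n = "degree p"
  obtain N :: nat where N: "N > 0" "\<And>i. i \<in> {..?n} \<Longrightarrow> of_nat N * coeff p i \<in> \<int>"
    by (rule common_denominator[of "{..?n}" "coeff p"]) auto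
  have npos: "?n > 0"
  proof (rule ccontr)
    assume "\<not> ?n > 0"
    then have "p = 1" using p(1) by (auto elim!: degree_eq_zeroE)
    with p(2) show False by simp
  qed
  \<comment> \<open>The polynomial with roots multiplied by \<open>N\<close> has coefficients
    N^(n-i) p_i; below the top degree at least one factor \<open>N\<close> is present and clears the
    denominator.\<close>
  define c :: "nat \<Rightarrow> 'k" where "c = (\<lambda>i. if i \<le> ?n then of_rat (of_nat N ^ (?n - i) * coeff p i) else 0)"
  define r where "r = (\<Sum>i\<le>?n. Polynomial.monom (c i) i)"
  have coeff: "coeff r i = c i" for i
    unfolding r_def by (simp add: coeff_sum c_def)
  have deg: "degree r = ?n"
  proof (rule antisym)
    show "degree r \<le> ?n" by (rule degree_le) (simp add: coeff c_def)
    show "?n \<le> degree r" by (rule le_degree) (use p(1) in \<open>simp add: coeff c_def\<close>)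
  qed
  have "algebraic_int (of_nat N * x)"
  proof (rule algebraic_int.intros)
    show "lead_coeff r = 1" unfolding deg coeff c_def using p(1) by simp
    show "\<forall>i. coeff r i \<in> \<int>"
    proof
      fix i
      show "coeff r i \<in> \<int>"
      proof (cases "i < ?n")
        case True
        then obtain k where k: "?n - i = Suc k" by (metis Suc_diff_Suc)
        have "of_nat N ^ (?n - i) * coeff p i = of_nat (N ^ k) * (of_nat N * coeff p i)"
          unfolding k by simp
        also have "\<dots> \<in> \<int>" by (rule Ints_mult[OF Ints_of_nat N(2)]) (use True in simp)
        finally obtain z where "of_nat N ^ (?n - i) * coeff p i = of_int z" by (elim Ints_cases)
        then show ?thesis using True unfolding coeff c_def by (simp only: if_True less_imp_le of_rat_of_int_eq Ints_of_int)
      next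
        case False
        then show ?thesis using p(1) unfolding coeff c_def by (cases "i = ?n") auto
      qed
    qed
    have "poly r (of_nat N * x) = (\<Sum>i\<le>?n. of_nat N ^ ?n * (of_rat (coeff p i) * x ^ i))"
      unfolding r_def poly_sum poly_monom
    proof (rule sum.cong[OF refl])
      fix i assume "i \<in> {..?n}"
      then have "(of_nat N :: 'k) ^ ?n = of_nat N ^ (?n - i) * of_nat N ^ i"
        by (simp flip: power_add)
      then show "c i * (of_nat N * x) ^ i = of_nat N ^ ?n * (of_rat (coeff p i) * x ^ i)"
        using \<open>i \<in> {..?n}\<close> by (simp add: c_def of_rat_mult of_rat_power power_mult_distrib)
    qed
    also have "\<dots> = 0"
      using p(2) by (simp add: poly_altdef sum_distrib_left[symmetric])
    finally show "poly r (of_nat N * x) = 0" .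
  qed
  with N(1) show thesis by (rule that)
qed

section \<open>Embeddings and additive maps\<close>

lemma
  assumes "\<tau> \<in> embeddings"
  shows embedding_1: "\<tau> 1 = 1"
    and embedding_add: "\<tau> (x + y) = \<tau> x + \<tau> y"
    and embedding_mult: "\<tau> (x * y) = \<tau> x * \<tau> y"
  using assms by (auto simp: embeddings_def)

lemma additive_0:
  fixes \<phi> :: "'a::ab_group_add \<Rightarrow> 'b::ab_group_add"
  assumes "\<And>x y. \<phi> (x + y) = \<phi> x + \<phi> y"
  shows "\<phi> 0 = 0"
  using assms[of 0 0] by simp

lemma additive_sum':
  fixes \<phi> :: "'a::ab_group_add \<Rightarrow> 'b::ab_group_add"
  assumes "\<And>x y. \<phi> (x + y) = \<phi> x + \<phi> y"
  shows "\<phi> (\<Sum>i\<in>I. f i) = (\<Sum>i\<in>I. \<phi> (f i))"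
  by (induction I rule: infinite_finite_induct) (auto simp: assms additive_0[of \<phi>, OF assms])

lemma additive_uminus:
  fixes \<phi> :: "'a::ab_group_add \<Rightarrow> 'b::ab_group_add"
  assumes "\<And>x y. \<phi> (x + y) = \<phi> x + \<phi> y"
  shows "\<phi> (- x) = - \<phi> x"
  using assms[of x "- x"] additive_0[of \<phi>, OF assms] by (simp add: eq_neg_iff_add_eq_0 add.commute)

lemma additive_of_nat:
  fixes \<phi> :: "'a::ring_1 \<Rightarrow> 'b::ring_1"
  assumes "\<And>x y. \<phi> (x + y) = \<phi> x + \<phi> y"
  shows "\<phi> (of_nat n * x) = of_nat n * \<phi> x"
  by (induction n) (auto simp: assms additive_0[of \<phi>, OF assms] distrib_right)

lemma additive_of_int:
  fixes \<phi> :: "'a::ring_1 \<Rightarrow> 'b::ring_1"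
  assumes "\<And>x y. \<phi> (x + y) = \<phi> x + \<phi> y"
  shows "\<phi> (of_int n * x) = of_int n * \<phi> x"
  by (cases n rule: int_cases2) (auto simp: additive_of_nat[of \<phi>, OF assms] additive_uminus[of \<phi>, OF assms])

text \<open>Additivity alone forces linearity over the rationals: multiply by the denominator, where
  the integer case applies, and cancel it.\<close>

lemma additive_of_rat:
  fixes \<phi> :: "'a::field_char_0 \<Rightarrow> 'b::field_char_0"
  assumes add: "\<And>x y. \<phi> (x + y) = \<phi> x + \<phi> y"
  shows "\<phi> (of_rat r * x) = of_rat r * \<phi> x"
proof (cases r)
  case (Fract a b)
  have a: "of_int b * of_rat r = (of_int a :: 'a)" and b: "of_int b * of_rat r = (of_int a :: 'b)"
    using Fract by (simp_all add: of_rat_rat)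
  have "of_int b * \<phi> (of_rat r * x) = \<phi> (of_int b * (of_rat r * x))"
    by (rule additive_of_int[of \<phi>, OF add, symmetric])
  also have "of_int b * (of_rat r * x) = of_int a * x"
    by (simp only: mult.assoc[symmetric] a)
  also have "\<phi> (of_int a * x) = of_int a * \<phi> x"
    by (rule additive_of_int[of \<phi>, OF add])
  also have "\<dots> = of_int b * (of_rat r * \<phi> x)"
    by (simp only: mult.assoc[symmetric] b)
  finally have "of_int b * \<phi> (of_rat r * x) = of_int b * (of_rat r * \<phi> x)" .
  then show ?thesis using Fract by simp
qed

section \<open>Separability of minimal polynomials\<close>

lemma minimal_rational_poly:
  fixes x :: "'k::number_field"
  obtains p :: "rat poly" where "p \<noteq> 0" "poly (map_poly of_rat p) x = 0"
    "\<And>r::rat poly. r \<noteq> 0 \<Longrightarrow> poly (map_poly of_rat r) x = 0 \<Longrightarrow> degree p \<le> degree r"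
proof -
  let ?P = "\<lambda>n. \<exists>p::rat poly. p \<noteq> 0 \<and> poly (map_poly of_rat p) x = 0 \<and> degree p = n"
  obtain p0 :: "rat poly" where "lead_coeff p0 = 1" "poly (map_poly of_rat p0) x = 0"
    by (rule rational_matrix_poly)
  then have "p0 \<noteq> 0 \<and> poly (map_poly of_rat p0) x = 0 \<and> degree p0 = degree p0" by auto
  then have "?P (degree p0)" by blast
  then have "?P (LEAST n. ?P n)" by (rule LeastI)
  then obtain p :: "rat poly" where p: "p \<noteq> 0" "poly (map_poly of_rat p) x = 0" "degree p = (LEAST n. ?P n)"
    by blast
  show thesis
  proof (rule that[OF p(1,2)])
    fix r :: "rat poly" assume "r \<noteq> 0" "poly (map_poly of_rat r) x = 0"
    then have "?P (degree r)" by blast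
    then show "degree p \<le> degree r" unfolding p(3) by (rule Least_le)
  qed
qed

text \<open>Splitting off a root \<open>z\<close> leaves a cofactor whose value at \<open>z\<close>
  is the derivative of \<open>f\<close> there. It is nonzero, so \<open>z\<close> does not recur,
  and simplicity of the roots passes to the cofactor.\<close>

lemma poly_eq_prod_distinct_roots:
  fixes f :: "complex poly"
  assumes "f \<noteq> 0" "\<And>z. poly f z = 0 \<Longrightarrow> poly (pderiv f) z \<noteq> 0"
  obtains l c where "distinct l" "c \<noteq> 0" "f = Polynomial.smult c (\<Prod>\<mu>\<leftarrow>l. [:- \<mu>, 1:])"
proof -
  have "\<exists>l c. distinct l \<and> c \<noteq> 0 \<and> f = Polynomial.smult c (\<Prod>\<mu>\<leftarrow>l. [:- \<mu>, 1:])"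
    using assms
  proof (induction "degree f" arbitrary: f)
    case 0
    then obtain c where "f = [:c:]" by (metis degree_eq_zeroE)
    then show ?case using 0 by (intro exI[of _ "[]"] exI[of _ c]) auto
  next
    case (Suc n)
    then have "\<not> constant (poly f)" by (simp add: constant_degree)
    then obtain z where z: "poly f z = 0" using fundamental_theorem_of_algebra by blast
    then obtain g where g: "f = [:- z, 1:] * g" by (auto simp: poly_eq_0_iff_dvd elim: dvdE)
    have g0: "g \<noteq> 0" using g Suc.prems by auto
    have d: "pderiv f = [:- z, 1:] * pderiv g + g"
      unfolding g pderiv_mult by (simp add: pderiv_pCons)
    have "poly (pderiv f) z \<noteq> 0" using Suc.prems(2) z by blast
    then have gz: "poly g z \<noteq> 0" by (simp add: d)
    have "degree f = Suc (degree g)" unfolding g using g0 by (subst degree_mult_eq) auto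
    with Suc.hyps(2) have "n = degree g" by simp
    moreover have "poly (pderiv g) y \<noteq> 0" if "poly g y = 0" for y
    proof
      assume "poly (pderiv g) y = 0"
      then have "poly (pderiv f) y = 0" unfolding d using that by simp
      moreover have "poly f y = 0" unfolding g using that by simp
      ultimately show False using Suc.prems(2) by blast
    qed
    ultimately obtain l c where l: "distinct l" "c \<noteq> 0" "g = Polynomial.smult c (\<Prod>\<mu>\<leftarrow>l. [:- \<mu>, 1:])"
      using Suc.hyps(1)[of g] g0 by blast
    have "z \<notin> set l"
    proof
      assume "z \<in> set l"
      then have "poly (\<Prod>\<mu>\<leftarrow>l. [:- \<mu>, 1:]) z = 0" by (auto simp: poly_prod_list prod_list_zero_iff)
      with gz l(3) show False by simp
    qed
    then show ?case using l g by (intro exI[of _ "z # l"] exI[of _ c]) simp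
  qed
  then show thesis using that by blast
qed

text \<open>A polynomial of least degree with root \<open>x\<close> is coprime to its derivative: a
  common factor would split it into two factors of smaller degree, one of which still vanishes at
  \<open>x\<close>.\<close>

lemma split_separable:
  fixes x :: "'k::number_field"
  obtains p :: "rat poly" and l c where "poly (map_poly of_rat p) x = 0" "distinct l" "c \<noteq> 0"
    "map_poly of_rat p = Polynomial.smult c (\<Prod>\<mu>\<leftarrow>l. [:- \<mu>, 1::complex:])"
proof -
  obtain p :: "rat poly" where p: "p \<noteq> 0" "poly (map_poly of_rat p) x = 0"
    "\<And>r::rat poly. r \<noteq> 0 \<Longrightarrow> poly (map_poly of_rat r) x = 0 \<Longrightarrow> degree p \<le> degree r"
    by (rule minimal_rational_poly) (rule that)
  let ?c = "map_poly of_rat :: rat poly \<Rightarrow> complex poly"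
  interpret rk: map_poly_comm_semiring_hom "of_rat :: rat \<Rightarrow> 'k" ..
  interpret rc: map_poly_comm_semiring_hom "of_rat :: rat \<Rightarrow> complex" ..
  have deg: "degree p > 0"
  proof (rule ccontr)
    assume "\<not> degree p > 0"
    then obtain a where "p = [:a:]" by (auto elim: degree_eq_zeroE)
    with p(1,2) show False by simp
  qed
  have pd: "pderiv p \<noteq> 0" using deg by (simp add: pderiv_eq_0_iff)
  have "coprime p (pderiv p)"
  proof (rule ccontr)
    let ?g = "gcd p (pderiv p)"
    assume "\<not> coprime p (pderiv p)"
    then have ng: "\<not> is_unit ?g" by (metis is_unit_gcd)
    obtain r where r: "p = ?g * r" using gcd_dvd1[of p "pderiv p"] by (elim dvdE)
    have g0: "?g \<noteq> 0" and r0: "r \<noteq> 0" using p(1) r by auto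
    have dg: "degree ?g > 0" by (metis ng is_unit_iff_degree[OF g0] gr0I)
    have "degree ?g \<le> degree (pderiv p)" using pd by (intro dvd_imp_degree_le) auto
    then have dgp: "degree ?g < degree p" using deg by (simp add: degree_pderiv)
    have "degree p = degree ?g + degree r" using r g0 r0 degree_mult_eq[of ?g r] by metis
    then have drp: "degree r < degree p" using dg by simp
    have "poly (map_poly of_rat (?g * r)) x = 0" using p(2) r by simp
    then have "poly (map_poly of_rat ?g) x = 0 \<or> poly (map_poly of_rat r) x = 0"
      by (simp add: rk.hom_mult)
    then show False using p(3)[OF g0] p(3)[OF r0] dgp drp by auto
  qed
  \<comment> \<open>The Bezout identity is carried over to complex coefficients, where it excludes a
    common root of the polynomial and its derivative.\<close>
  then obtain u v where uv: "u * p + v * pderiv p = 1"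
    by (metis bezout_coefficients_fst_snd coprime_iff_gcd_eq_1)
  have e: "?c u * ?c p + ?c v * pderiv (?c p) = 1"
  proof -
    have "?c (u * p + v * pderiv p) = ?c 1" by (simp only: uv)
    then show ?thesis
      by (simp add: rc.hom_mult rc.hom_add of_rat_hom.map_poly_pderiv)
  qed
  have "poly (pderiv (?c p)) z \<noteq> 0" if "poly (?c p) z = 0" for z
  proof
    assume "poly (pderiv (?c p)) z = 0"
    with that have "poly (?c u * ?c p + ?c v * pderiv (?c p)) z = 0" by simp
    then show False unfolding e by simp
  qed
  moreover have "?c p \<noteq> 0" using p(1) by simp
  ultimately obtain l c where "distinct l" "c \<noteq> 0" "?c p = Polynomial.smult c (\<Prod>\<mu>\<leftarrow>l. [:- \<mu>, 1:])"
    using poly_eq_prod_distinct_roots[of "?c p"] by metis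
  with p(2) show thesis by (rule that)
qed

section \<open>Simultaneous diagonalisation of the multiplication operators\<close>

text \<open>\<open>poly_act x f \<phi>\<close> is \<open>f(M) \<phi>\<close> for the operator \<open>(M \<phi>)(y) = \<phi>(x y)\<close>.\<close>

definition poly_act :: "'k::number_field \<Rightarrow> complex poly \<Rightarrow> ('k \<Rightarrow> complex) \<Rightarrow> 'k \<Rightarrow> complex" where
  "poly_act x f \<phi> y = (\<Sum>i\<le>degree f. coeff f i * \<phi> (x ^ i * y))"

lemma poly_act_bound:
  assumes "degree f \<le> n"
  shows "poly_act x f \<phi> y = (\<Sum>i\<le>n. coeff f i * \<phi> (x ^ i * y))"
  unfolding poly_act_def
  by (rule sum.mono_neutral_left) (use assms in \<open>auto simp: coeff_eq_0\<close>)

text \<open>Shifting the index in the \<open>pCons\<close> part turns x^(i+1) y into x^i (x y), so a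
  linear factor is absorbed into the function. This permits roots to be removed one at a
  time.\<close>

lemma poly_act_linear_factor:
  "poly_act x ([:- \<mu>, 1:] * f) \<phi> y = poly_act x f (\<lambda>z. \<phi> (x * z) - \<mu> * \<phi> z) y"
proof -
  let ?n = "degree f"
  have "poly_act x ([:- \<mu>, 1:] * f) \<phi> y
      = (\<Sum>i\<le>Suc ?n. (coeff (pCons 0 f) i - \<mu> * coeff f i) * \<phi> (x ^ i * y))"
    by (subst poly_act_bound[of _ "Suc ?n"]) (auto intro!: degree_diff_le degree_pCons_le order.trans[OF degree_smult_le])
  also have "\<dots> = (\<Sum>i\<le>Suc ?n. coeff (pCons 0 f) i * \<phi> (x ^ i * y)) - (\<Sum>i\<le>Suc ?n. \<mu> * coeff f i * \<phi> (x ^ i * y))"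
    by (simp add: left_diff_distrib sum_subtractf del: sum.atMost_Suc)
  also have "(\<Sum>i\<le>Suc ?n. coeff (pCons 0 f) i * \<phi> (x ^ i * y)) = (\<Sum>i\<le>?n. coeff f i * \<phi> (x ^ i * (x * y)))"
    by (subst sum.atMost_Suc_shift) (simp add: mult_ac)
  also have "(\<Sum>i\<le>Suc ?n. \<mu> * coeff f i * \<phi> (x ^ i * y)) = (\<Sum>i\<le>?n. coeff f i * (\<mu> * \<phi> (x ^ i * y)))"
    by (simp add: coeff_eq_0 mult_ac)
  finally show ?thesis
    by (simp add: poly_act_def right_diff_distrib sum_subtractf mult.left_commute)
qed

definition in_emb_span :: "('k::number_field \<Rightarrow> complex) \<Rightarrow> bool" where
  "in_emb_span \<phi> \<longleftrightarrow> (\<exists>c. \<forall>y. \<phi> y = (\<Sum>\<tau>\<in>embeddings. c \<tau> * \<tau> y))"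

lemma in_emb_span_zero: "in_emb_span (\<lambda>_. 0)"
  unfolding in_emb_span_def by (rule exI[of _ "\<lambda>_. 0"]) simp

lemma in_emb_span_add:
  assumes "in_emb_span \<phi>" "in_emb_span \<psi>"
  shows "in_emb_span (\<lambda>y. \<phi> y + \<psi> y)"
proof -
  from assms obtain c e where "\<And>y. \<phi> y = (\<Sum>\<tau>\<in>embeddings. c \<tau> * \<tau> y)" "\<And>y. \<psi> y = (\<Sum>\<tau>\<in>embeddings. e \<tau> * \<tau> y)"
    unfolding in_emb_span_def by metis
  then show ?thesis unfolding in_emb_span_def
    by (intro exI[of _ "\<lambda>\<tau>. c \<tau> + e \<tau>"]) (simp add: distrib_right sum.distrib)
qed

text \<open>Splitting off one root \<open>\<mu>\<close> at a time: if \<open>\<psi> = (M - \<mu>) \<phi>\<close> is a sum of eigenvectors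
  \<open>\<psi>\<^sub>\<nu>\<close> with \<open>\<nu> \<noteq> \<mu>\<close>, then \<open>\<phi> - \<Sum>\<^sub>\<nu> \<psi>\<^sub>\<nu> / (\<nu> - \<mu>)\<close> is an eigenvector for \<open>\<mu>\<close>.\<close>

lemma eigenvector_decomposition:
  fixes x :: "'k::number_field"
  assumes closed: "\<And>\<phi> \<psi>. W \<phi> \<Longrightarrow> W \<psi> \<Longrightarrow> W (\<lambda>y. \<phi> y + \<psi> y)"
    "\<And>\<phi> a. W \<phi> \<Longrightarrow> W (\<lambda>y. a * \<phi> y)" "\<And>\<phi>. W \<phi> \<Longrightarrow> W (\<lambda>y. \<phi> (x * y))"
  assumes "distinct l" "W \<phi>" "\<And>y. poly_act x (\<Prod>\<mu>\<leftarrow>l. [:- \<mu>, 1:]) \<phi> y = 0"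
  shows "\<exists>\<psi>. (\<forall>\<nu>\<in>set l. W (\<psi> \<nu>) \<and> (\<forall>y. \<psi> \<nu> (x * y) = \<nu> * \<psi> \<nu> y)) \<and>
    (\<forall>y. \<phi> y = (\<Sum>\<nu>\<in>set l. \<psi> \<nu> y))"
  using assms(4-)
proof (induction l arbitrary: \<phi>)
  case Nil
  then show ?case by (simp add: poly_act_def)
next
  case (Cons \<mu> l)
  let ?\<psi> = "\<lambda>z. \<phi> (x * z) - \<mu> * \<phi> z"
  have "W ?\<psi>" using closed(1)[OF closed(3)[OF Cons.prems(2)] closed(2)[OF Cons.prems(2), of "- \<mu>"]] by simp
  moreover have "poly_act x (\<Prod>\<mu>\<leftarrow>l. [:- \<mu>, 1:]) ?\<psi> y = 0" for y
    using Cons.prems(3)[of y] unfolding list.map prod_list.Cons poly_act_linear_factor .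
  ultimately obtain \<psi> where \<psi>: "\<And>\<nu>. \<nu> \<in> set l \<Longrightarrow> W (\<psi> \<nu>)"
    "\<And>\<nu> y. \<nu> \<in> set l \<Longrightarrow> \<psi> \<nu> (x * y) = \<nu> * \<psi> \<nu> y"
    "\<And>y. \<phi> (x * y) - \<mu> * \<phi> y = (\<Sum>\<nu>\<in>set l. \<psi> \<nu> y)"
    using Cons.IH[of ?\<psi>] Cons.prems(1) by auto
  define \<eta> where "\<eta> = (\<lambda>y. \<phi> y + (\<Sum>\<nu>\<in>set l. (- 1 / (\<nu> - \<mu>)) * \<psi> \<nu> y))"
  have sumW: "W (\<lambda>y. \<phi> y + (\<Sum>\<nu>\<in>A. (- 1 / (\<nu> - \<mu>)) * \<psi> \<nu> y))" if "finite A" "A \<subseteq> set l" for A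
    using that
  proof (induction A)
    case empty
    then show ?case using Cons.prems(2) by simp
  next
    case (insert \<nu> A)
    then have *: "W (\<lambda>y. \<phi> y + (\<Sum>\<nu>\<in>A. (- 1 / (\<nu> - \<mu>)) * \<psi> \<nu> y))" and "\<nu> \<in> set l"
      by blast+
    have "W (\<lambda>y. (\<phi> y + (\<Sum>\<nu>\<in>A. (- 1 / (\<nu> - \<mu>)) * \<psi> \<nu> y)) + (- 1 / (\<nu> - \<mu>)) * \<psi> \<nu> y)"
      by (rule closed(1)[OF * closed(2)[OF \<psi>(1)[OF \<open>\<nu> \<in> set l\<close>]]])
    then show ?case using insert.hyps by (simp add: add_ac)
  qed
  have ne: "\<nu> - \<mu> \<noteq> 0" if "\<nu> \<in> set l" for \<nu> using that Cons.prems(1) by auto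
  have eig: "\<eta> (x * y) = \<mu> * \<eta> y" for y
  proof -
    have "\<eta> (x * y) - \<mu> * \<eta> y
        = (\<phi> (x * y) - \<mu> * \<phi> y) + (\<Sum>\<nu>\<in>set l. (- 1 / (\<nu> - \<mu>)) * \<psi> \<nu> (x * y) - \<mu> * ((- 1 / (\<nu> - \<mu>)) * \<psi> \<nu> y))"
      unfolding \<eta>_def sum_subtractf sum_distrib_left[symmetric] by (simp only: algebra_simps)
    also have "(\<Sum>\<nu>\<in>set l. (- 1 / (\<nu> - \<mu>)) * \<psi> \<nu> (x * y) - \<mu> * ((- 1 / (\<nu> - \<mu>)) * \<psi> \<nu> y))
        = (\<Sum>\<nu>\<in>set l. - \<psi> \<nu> y)"
    proof (rule sum.cong[OF refl])
      fix \<nu> assume \<nu>: "\<nu> \<in> set l"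
      have "(- 1 / (\<nu> - \<mu>)) * \<psi> \<nu> (x * y) - \<mu> * ((- 1 / (\<nu> - \<mu>)) * \<psi> \<nu> y)
          = - ((\<nu> - \<mu>) * \<psi> \<nu> y / (\<nu> - \<mu>))"
        by (simp add: \<psi>(2)[OF \<nu>] left_diff_distrib diff_divide_distrib)
      then show "(- 1 / (\<nu> - \<mu>)) * \<psi> \<nu> (x * y) - \<mu> * ((- 1 / (\<nu> - \<mu>)) * \<psi> \<nu> y) = - \<psi> \<nu> y"
        using ne[OF \<nu>] by simp
    qed
    finally show ?thesis using \<psi>(3)[of y] by (simp add: sum_negf)
  qed
  let ?\<Psi> = "\<lambda>\<nu>. if \<nu> = \<mu> then \<eta> else (\<lambda>y. (1 / (\<nu> - \<mu>)) * \<psi> \<nu> y)"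
  have "\<phi> y = (\<Sum>\<nu>\<in>set (\<mu> # l). ?\<Psi> \<nu> y)" for y
  proof -
    have "(\<Sum>\<nu>\<in>set (\<mu> # l). ?\<Psi> \<nu> y) = \<eta> y + (\<Sum>\<nu>\<in>set l. ?\<Psi> \<nu> y)"
      using Cons.prems(1) by simp
    also have "(\<Sum>\<nu>\<in>set l. ?\<Psi> \<nu> y) = (\<Sum>\<nu>\<in>set l. (1 / (\<nu> - \<mu>)) * \<psi> \<nu> y)"
      by (rule sum.cong) (use Cons.prems(1) in auto)
    finally show ?thesis by (simp add: \<eta>_def sum_negf)
  qed
  moreover have "W (?\<Psi> \<nu>) \<and> (\<forall>y. ?\<Psi> \<nu> (x * y) = \<nu> * ?\<Psi> \<nu> y)" if "\<nu> \<in> set (\<mu> # l)" for \<nu>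
  proof (cases "\<nu> = \<mu>")
    case True
    then show ?thesis using sumW[of "set l"] eig by (simp add: \<eta>_def)
  next
    case False
    with that have l: "\<nu> \<in> set l" by simp
    show ?thesis using False closed(2)[OF \<psi>(1)[OF l], of "1 / (\<nu> - \<mu>)"] \<psi>(2)[OF l] by simp
  qed
  ultimately show ?case by (intro exI[of _ ?\<Psi>]) blast
qed

text \<open>Since an additive map commutes with rational scalars, p(x) = 0 makes p of the
  multiplication operator kill \<open>\<phi>\<close>, and \<open>p\<close> has distinct linear
  factors. The predicate \<open>W\<close> preserves whatever eigenvalue relations for other elements
  are already known.\<close>

lemma additive_eigenvectors:
  fixes x :: "'k::number_field" and \<phi> :: "'k \<Rightarrow> complex"
  assumes closed: "\<And>\<phi> \<psi>. W \<phi> \<Longrightarrow> W \<psi> \<Longrightarrow> W (\<lambda>y. \<phi> y + \<psi> y)"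
    "\<And>\<phi> a. W \<phi> \<Longrightarrow> W (\<lambda>y. a * \<phi> y)" "\<And>\<phi>. W \<phi> \<Longrightarrow> W (\<lambda>y. \<phi> (x * y))"
  assumes \<phi>: "W \<phi>" "\<And>y z. \<phi> (y + z) = \<phi> y + \<phi> z"
  shows "\<exists>R \<psi>. finite R \<and> (\<forall>\<nu>\<in>R. W (\<psi> \<nu>) \<and> (\<forall>y. \<psi> \<nu> (x * y) = \<nu> * \<psi> \<nu> y)) \<and>
    (\<forall>y. \<phi> y = (\<Sum>\<nu>\<in>R. \<psi> \<nu> y))"
proof -
  obtain p :: "rat poly" and l c where p: "poly (map_poly of_rat p) x = 0" "distinct l" "c \<noteq> 0"
    "map_poly of_rat p = Polynomial.smult c (\<Prod>\<mu>\<leftarrow>l. [:- \<mu>, 1::complex:])"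
    by (rule split_separable)
  have "poly_act x (\<Prod>\<mu>\<leftarrow>l. [:- \<mu>, 1:]) \<phi> y = 0" for y
  proof -
    have "c * poly_act x (\<Prod>\<mu>\<leftarrow>l. [:- \<mu>, 1:]) \<phi> y = poly_act x (map_poly of_rat p) \<phi> y"
      unfolding p(4) poly_act_def using p(3) by (simp add: sum_distrib_left mult.assoc)
    also have "\<dots> = (\<Sum>i\<le>degree p. of_rat (coeff p i) * \<phi> (x ^ i * y))"
      by (simp add: poly_act_def degree_map_poly coeff_map_poly)
    also have "\<dots> = \<phi> (\<Sum>i\<le>degree p. of_rat (coeff p i) * (x ^ i * y))"
      by (simp only: additive_sum'[of \<phi>, OF \<phi>(2)] additive_of_rat[of \<phi>, OF \<phi>(2)])
    also have "(\<Sum>i\<le>degree p. of_rat (coeff p i) * (x ^ i * y)) = poly (map_poly of_rat p) x * y"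
      by (simp add: poly_altdef degree_map_poly coeff_map_poly sum_distrib_right mult.assoc)
    finally show ?thesis using p(1,3) additive_0[of \<phi>, OF \<phi>(2)] by simp
  qed
  from eigenvector_decomposition[of W, OF closed p(2) \<phi>(1) this]
  show ?thesis by blast
qed

definition additive_eigen :: "'k::number_field set \<Rightarrow> ('k \<Rightarrow> complex) \<Rightarrow> ('k \<Rightarrow> complex) \<Rightarrow> bool" where
  "additive_eigen S \<nu> \<phi> \<longleftrightarrow> (\<forall>y z. \<phi> (y + z) = \<phi> y + \<phi> z) \<and> (\<forall>x\<in>S. \<forall>y. \<phi> (x * y) = \<nu> x * \<phi> y)"

lemma in_emb_span_sum:
  "(\<And>i. i \<in> R \<Longrightarrow> in_emb_span (f i)) \<Longrightarrow> in_emb_span (\<lambda>y. \<Sum>i\<in>R. f i y)"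
  by (induction R rule: infinite_finite_induct) (auto intro: in_emb_span_zero in_emb_span_add)

text \<open>An embedding is determined by its values on a rational basis, and each of these values
  is a root of a fixed rational polynomial.\<close>

lemma finite_embeddings: "finite (embeddings :: ('k::number_field \<Rightarrow> complex) set)"
proof -
  obtain \<beta> :: "nat \<Rightarrow> 'k" and q where q:
    "\<And>x. x = (\<Sum>i<nf_degree TYPE('k). of_rat (q x i) * \<beta> i)"
    using rational_coordinates by metis
  let ?d = "nf_degree TYPE('k)"
  have "\<forall>i. \<exists>p::rat poly. p \<noteq> 0 \<and> poly (map_poly of_rat p) (\<beta> i) = 0"
    using minimal_rational_poly by metis
  then obtain p :: "nat \<Rightarrow> rat poly" where p: "\<And>i. p i \<noteq> 0" "\<And>i. poly (map_poly of_rat (p i)) (\<beta> i) = 0" by metis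
  let ?r = "\<lambda>\<tau>. restrict (\<tau> \<circ> \<beta>) {..<?d}"
  have "?r ` embeddings \<subseteq> PiE {..<?d} (\<lambda>i. {z::complex. poly (map_poly of_rat (p i)) z = 0})"
  proof (rule image_subsetI, rule restrict_PiE_iff[THEN iffD2], rule ballI)
    fix \<tau> i assume \<tau>: "\<tau> \<in> (embeddings :: ('k \<Rightarrow> complex) set)"
    note add = embedding_add[OF \<tau>]
    have pow: "\<tau> (y ^ n) = \<tau> y ^ n" for y n
      by (induction n) (simp_all add: embedding_1[OF \<tau>] embedding_mult[OF \<tau>])
    have "poly (map_poly of_rat (p i)) (\<tau> (\<beta> i)) = \<tau> (poly (map_poly of_rat (p i)) (\<beta> i))"
      by (simp add: poly_altdef degree_map_poly coeff_map_poly additive_sum'[of \<tau>, OF add]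
          additive_of_rat[of \<tau>, OF add] pow)
    also have "\<dots> = 0" unfolding p(2) by (rule additive_0[of \<tau>, OF add])
    finally show "(\<tau> \<circ> \<beta>) i \<in> {z. poly (map_poly of_rat (p i)) z = 0}" by simp
  qed
  moreover have "finite (PiE {..<?d} (\<lambda>i. {z::complex. poly (map_poly of_rat (p i)) z = 0}))"
    using p(1) by (intro finite_PiE ballI poly_roots_finite) auto
  moreover have "inj_on ?r embeddings"
  proof (rule inj_onI)
    fix \<tau> \<tau>' :: "'k \<Rightarrow> complex" assume \<tau>: "\<tau> \<in> embeddings" "\<tau>' \<in> embeddings" and eq: "?r \<tau> = ?r \<tau>'"
    have *: "\<tau> (\<beta> i) = \<tau>' (\<beta> i)" if "i < ?d" for i
      using fun_cong[OF eq, of i] that by simp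
    have "\<tau> x = \<tau>' x" for x
      by (subst (1 2) q[of x])
        (simp add: * additive_sum'[of \<tau>, OF embedding_add[OF \<tau>(1)]] additive_of_rat[of \<tau>, OF embedding_add[OF \<tau>(1)]]
          additive_sum'[of \<tau>', OF embedding_add[OF \<tau>(2)]] additive_of_rat[of \<tau>', OF embedding_add[OF \<tau>(2)]])
    then show "\<tau> = \<tau>'" by blast
  qed
  ultimately show ?thesis by (meson finite_imageD finite_subset)
qed

text \<open>The operators of multiplication by the basis elements commute and are diagonalised one
  after the other. A joint eigenvector is an eigenvector for every element of K, hence a scalar
  multiple of a ring homomorphism.\<close>

theorem additive_in_emb_span:
  fixes \<phi> :: "'k::number_field \<Rightarrow> complex"
  assumes add: "\<And>x y. \<phi> (x + y) = \<phi> x + \<phi> y"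
  shows "in_emb_span \<phi>"
proof -
  obtain \<beta> :: "nat \<Rightarrow> 'k" and q where q:
    "\<And>x. x = (\<Sum>i<nf_degree TYPE('k). of_rat (q x i) * \<beta> i)"
    using rational_coordinates by metis
  let ?d = "nf_degree TYPE('k)"
  define B where "B = \<beta> ` {..<?d}"
  have simult: "in_emb_span \<phi>" if "additive_eigen B \<nu> \<phi>" for \<nu> \<phi>
  proof -
    have add: "\<phi> (y + z) = \<phi> y + \<phi> z" for y z using that by (auto simp: additive_eigen_def)
    have eig: "\<phi> (\<beta> i * y) = \<nu> (\<beta> i) * \<phi> y" if "i < ?d" for i y
      using \<open>additive_eigen B \<nu> \<phi>\<close> that by (auto simp: additive_eigen_def B_def)
    \<comment> \<open>The eigenvalue of an arbitrary \<open>x\<close>, by rational linearity from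
      those of the basis elements.\<close>
    define \<Lambda> where "\<Lambda> = (\<lambda>x. \<Sum>i<?d. of_rat (q x i) * \<nu> (\<beta> i))"
    have all: "\<phi> (x * y) = \<Lambda> x * \<phi> y" for x y
    proof -
      have "\<phi> (x * y) = \<phi> (\<Sum>i<?d. of_rat (q x i) * (\<beta> i * y))"
        by (subst (1) q[of x]) (simp add: sum_distrib_right mult.assoc)
      also have "\<dots> = (\<Sum>i<?d. of_rat (q x i) * (\<nu> (\<beta> i) * \<phi> y))"
        by (simp add: additive_sum'[of \<phi>, OF add] additive_of_rat[of \<phi>, OF add] eig)
      finally show ?thesis by (simp add: \<Lambda>_def sum_distrib_right mult.assoc)
    qed
    show ?thesis
    proof (cases "\<phi> 1 = 0")
      \<comment> \<open>\<open>\<phi> y = \<Lambda> y * \<phi> 1\<close>, so an eigenvector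
        vanishing at 1 is zero; otherwise division by \<open>\<phi> 1\<close> normalises it to an
        embedding.\<close>
      case True
      have "\<phi> y = 0" for y using all[of y 1] True by simp
      then have "\<phi> = (\<lambda>_. 0)" by blast
      then show ?thesis by (simp add: in_emb_span_zero)
    next
      case False
      define \<tau> where "\<tau> = (\<lambda>y. \<phi> y / \<phi> 1)"
      have L: "\<Lambda> x = \<tau> x" for x
        unfolding \<tau>_def using all[of x 1] False by (metis mult.right_neutral nonzero_mult_div_cancel_right)
      have \<tau>: "\<tau> \<in> embeddings"
        unfolding embeddings_def mem_Collect_eq
      proof (intro conjI allI)
        show "\<tau> 1 = 1" using False by (simp add: \<tau>_def)
        show "\<tau> (x + y) = \<tau> x + \<tau> y" for x y unfolding \<tau>_def add add_divide_distrib ..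
        show "\<tau> (x * y) = \<tau> x * \<tau> y" for x y
          unfolding L[symmetric] using L[of "x * y"] L[of y] unfolding \<tau>_def all by simp
      qed
      have "\<phi> y = (\<Sum>\<sigma>\<in>embeddings. (if \<sigma> = \<tau> then \<phi> 1 else 0) * \<sigma> y)" for y
      proof -
        have "(\<Sum>\<sigma>\<in>embeddings. (if \<sigma> = \<tau> then \<phi> 1 else 0) * \<sigma> y) = (\<Sum>\<sigma>\<in>embeddings. if \<sigma> = \<tau> then \<phi> 1 * \<tau> y else 0)"
          by (rule sum.cong) auto
        also have "\<dots> = \<phi> 1 * \<tau> y" by (subst sum.delta[OF finite_embeddings]) (use \<tau> in simp)
        finally show ?thesis using False by (simp add: \<tau>_def)
      qed
      then show ?thesis unfolding in_emb_span_def
        by (intro exI[of _ "\<lambda>\<sigma>. if \<sigma> = \<tau> then \<phi> 1 else 0"] allI)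
    qed
  qed
  \<comment> \<open>Induction on the set \<open>T\<close> of basis elements still to be treated;
    \<open>S\<close> collects those whose eigenvalues are already fixed.\<close>
  have "in_emb_span \<phi>" if "finite T" "S \<union> T = B" "additive_eigen S \<nu> \<phi>" for S T \<nu> \<phi>
    using that
  proof (induction T arbitrary: S \<nu> \<phi>)
    case empty
    then show ?case using simult by simp
  next
    case (insert x T)
    have c1: "additive_eigen S \<nu> (\<lambda>y. f y + g y)" if "additive_eigen S \<nu> f" "additive_eigen S \<nu> g" for f g
      using that by (auto simp: additive_eigen_def algebra_simps)
    have c2: "additive_eigen S \<nu> (\<lambda>y. a * f y)" if "additive_eigen S \<nu> f" for f a
      using that by (auto simp: additive_eigen_def algebra_simps)
    have c3: "additive_eigen S \<nu> (\<lambda>y. f (x * y))" if "additive_eigen S \<nu> f" for f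
      using that unfolding additive_eigen_def by (metis distrib_left mult.left_commute)
    have "\<phi> (y + z) = \<phi> y + \<phi> z" for y z using insert.prems by (auto simp: additive_eigen_def)
    from additive_eigenvectors[of "additive_eigen S \<nu>" x \<phi>, OF c1 c2 c3 insert.prems(2) this]
    obtain R \<psi> where R: "finite R"
      "\<And>\<mu>. \<mu> \<in> R \<Longrightarrow> additive_eigen S \<nu> (\<psi> \<mu>)" "\<And>\<mu> y. \<mu> \<in> R \<Longrightarrow> \<psi> \<mu> (x * y) = \<mu> * \<psi> \<mu> y"
      "\<And>y. \<phi> y = (\<Sum>\<mu>\<in>R. \<psi> \<mu> y)" by blast
    have "in_emb_span (\<psi> \<mu>)" if "\<mu> \<in> R" for \<mu>
    proof (rule insert.IH)
      show "insert x S \<union> T = B" using insert.prems by auto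
      show "additive_eigen (insert x S) (\<lambda>z. if z = x then \<mu> else \<nu> z) (\<psi> \<mu>)"
        using R(2)[OF that] R(3)[OF that] by (auto simp: additive_eigen_def)
    qed
    then have "in_emb_span (\<lambda>y. \<Sum>\<mu>\<in>R. \<psi> \<mu> y)" by (rule in_emb_span_sum)
    moreover have "\<phi> = (\<lambda>y. \<Sum>\<mu>\<in>R. \<psi> \<mu> y)" using R(4) by blast
    ultimately show ?case by simp
  qed
  from this[of B "{}" \<nu>0 \<phi> for \<nu>0] show ?thesis
    using add by (auto simp: additive_eigen_def B_def)
qed

text \<open>Artin's argument: replace y by x y and subtract \<open>\<sigma> x\<close> times the
  relation. The term of \<open>\<sigma>\<close> drops out, and the coefficient of
  \<open>\<tau>\<close> survives if \<open>x\<close> separates \<open>\<tau>\<close> from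
  \<open>\<sigma>\<close>.\<close>

lemma embeddings_independent:
  fixes c :: "('k::number_field \<Rightarrow> complex) \<Rightarrow> complex"
  assumes "finite T" "T \<subseteq> embeddings" "\<And>y. (\<Sum>\<tau>\<in>T. c \<tau> * \<tau> y) = 0" "\<tau> \<in> T"
  shows "c \<tau> = 0"
  using assms
proof (induction T arbitrary: c \<tau> rule: finite_induct)
  case (insert \<sigma> T)
  have zero: "c \<tau> = 0" if \<tau>: "\<tau> \<in> T" for \<tau>
  proof -
    have "\<tau> \<noteq> \<sigma>" using insert \<tau> by auto
    then obtain x where x: "\<tau> x \<noteq> \<sigma> x" by blast
    have "(\<Sum>\<rho>\<in>T. (c \<rho> * (\<rho> x - \<sigma> x)) * \<rho> y) = 0" for y
    proof -
      have emb: "\<rho> (x * y) = \<rho> x * \<rho> y" if "\<rho> \<in> insert \<sigma> T" for \<rho>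
        using insert.prems(1) that embedding_mult by blast
      have "0 = (\<Sum>\<rho>\<in>insert \<sigma> T. c \<rho> * \<rho> (x * y)) - \<sigma> x * (\<Sum>\<rho>\<in>insert \<sigma> T. c \<rho> * \<rho> y)"
        using insert.prems(2) by simp
      also have "\<dots> = (\<Sum>\<rho>\<in>insert \<sigma> T. (c \<rho> * (\<rho> x - \<sigma> x)) * \<rho> y)"
        unfolding sum_distrib_left sum_subtractf[symmetric]
        by (rule sum.cong[OF refl]) (simp add: emb algebra_simps)
      also have "\<dots> = (\<Sum>\<rho>\<in>T. (c \<rho> * (\<rho> x - \<sigma> x)) * \<rho> y)"
        using insert.hyps by simp
      finally show ?thesis by simp
    qed
    from insert.IH[of "\<lambda>\<rho>. c \<rho> * (\<rho> x - \<sigma> x)", OF _ this \<tau>] insert.prems(1) x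
    show ?thesis by auto
  qed
  have "c \<sigma> = 0"
  proof -
    have "(\<Sum>\<rho>\<in>insert \<sigma> T. c \<rho> * \<rho> 1) = c \<sigma>"
      using insert.hyps insert.prems(1) zero by (simp add: embedding_1)
    then show ?thesis using insert.prems(2) by simp
  qed
  then show ?case using zero insert.prems(3) by auto
qed simp

text \<open>The coordinate functions are additive, hence combinations of embeddings. Applying
  \<open>\<sigma>\<close> to the expansion of y in the basis and comparing coefficients shows that
  \<open>C\<close> inverts the matrix of the values \<open>\<sigma> (\<beta> i)\<close>.\<close>

lemma embeddings_dual_coefficients:
  fixes \<beta> :: "nat \<Rightarrow> 'k::number_field"
  assumes q: "\<And>x. x = (\<Sum>i<nf_degree TYPE('k). of_rat (q x i) * \<beta> i)"
    "\<And>x y i. q (x + y) i = q x i + q y i"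
  obtains C where "\<And>y i. of_rat (q y i) = (\<Sum>\<tau>\<in>embeddings. C i \<tau> * \<tau> y)"
    "\<And>\<tau> \<sigma>. \<tau> \<in> embeddings \<Longrightarrow> \<sigma> \<in> embeddings \<Longrightarrow>
      (\<Sum>i<nf_degree TYPE('k). C i \<tau> * \<sigma> (\<beta> i)) = (if \<tau> = \<sigma> then 1 else 0)"
proof -
  let ?d = "nf_degree TYPE('k)"
  have "\<forall>i. \<exists>c. \<forall>y. of_rat (q y i) = (\<Sum>\<tau>\<in>embeddings. c \<tau> * \<tau> y)"
    using additive_in_emb_span[of "\<lambda>y. of_rat (q y _)"] by (simp add: q(2) of_rat_add in_emb_span_def)
  then obtain C where C: "\<And>i y. of_rat (q y i) = (\<Sum>\<tau>\<in>embeddings. C i \<tau> * \<tau> y)" by metis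
  show thesis
  proof (rule that[OF C])
    fix \<tau> \<sigma> :: "'k \<Rightarrow> complex" assume \<tau>: "\<tau> \<in> embeddings" and \<sigma>: "\<sigma> \<in> embeddings"
    let ?c = "\<lambda>\<tau>. (\<Sum>i<?d. C i \<tau> * \<sigma> (\<beta> i)) - (if \<tau> = \<sigma> then 1 else 0)"
    have "(\<Sum>\<tau>\<in>embeddings. ?c \<tau> * \<tau> y) = 0" for y
    proof -
      have "(\<Sum>\<tau>\<in>embeddings. (if \<tau> = \<sigma> then 1 else 0) * \<tau> y) = (\<Sum>\<tau>\<in>embeddings. if \<tau> = \<sigma> then \<sigma> y else 0)"
        by (rule sum.cong) auto
      also have "\<dots> = \<sigma> y" by (subst sum.delta[OF finite_embeddings]) (use \<sigma> in simp)
      also have "\<dots> = \<sigma> (\<Sum>i<?d. of_rat (q y i) * \<beta> i)" by (subst q(1)) (rule refl)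
      also have "\<dots> = (\<Sum>i<?d. of_rat (q y i) * \<sigma> (\<beta> i))"
        by (simp only: additive_sum'[of \<sigma>, OF embedding_add[OF \<sigma>]] additive_of_rat[of \<sigma>, OF embedding_add[OF \<sigma>]])
      also have "\<dots> = (\<Sum>i<?d. \<Sum>\<tau>\<in>embeddings. C i \<tau> * \<tau> y * \<sigma> (\<beta> i))"
        by (simp only: C sum_distrib_right)
      also have "\<dots> = (\<Sum>\<tau>\<in>embeddings. \<Sum>i<?d. C i \<tau> * \<tau> y * \<sigma> (\<beta> i))" by (rule sum.swap)
      also have "\<dots> = (\<Sum>\<tau>\<in>embeddings. (\<Sum>i<?d. C i \<tau> * \<sigma> (\<beta> i)) * \<tau> y)"
        unfolding sum_distrib_right by (intro sum.cong refl) (simp only: mult_ac)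
      finally show ?thesis by (simp only: left_diff_distrib sum_subtractf diff_self)
    qed
    from embeddings_independent[OF finite_embeddings order_refl this \<tau>]
    show "(\<Sum>i<?d. C i \<tau> * \<sigma> (\<beta> i)) = (if \<tau> = \<sigma> then 1 else 0)" by simp
  qed
qed

text \<open>The double sum of C_i(\<tau>) \<tau>(\<beta>_i) is the degree when summed over \<tau>
  first and the number of embeddings when summed over i first.\<close>

theorem card_embeddings: "card (embeddings :: ('k::number_field \<Rightarrow> complex) set) = nf_degree TYPE('k)"
proof -
  let ?d = "nf_degree TYPE('k)"
  obtain \<beta> :: "nat \<Rightarrow> 'k" and q where q:
    "\<And>x. x = (\<Sum>i<?d. of_rat (q x i) * \<beta> i)" "\<And>x y i. q (x + y) i = q x i + q y i"
    "\<And>i j. i < ?d \<Longrightarrow> j < ?d \<Longrightarrow> q (\<beta> j) i = (if i = j then 1 else 0)"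
    by (rule rational_coordinates) (rule that)
  obtain C where C: "\<And>y i. of_rat (q y i) = (\<Sum>\<tau>\<in>embeddings. C i \<tau> * \<tau> y)"
    "\<And>\<tau> \<sigma>. \<tau> \<in> embeddings \<Longrightarrow> \<sigma> \<in> embeddings \<Longrightarrow>
      (\<Sum>i<?d. C i \<tau> * \<sigma> (\<beta> i)) = (if \<tau> = \<sigma> then 1 else 0)"
    by (rule embeddings_dual_coefficients[of q \<beta>, OF q(1,2)]) (rule that)
  have "of_nat ?d = (\<Sum>i<?d. of_rat (q (\<beta> i) i) :: complex)" by (simp add: q(3))
  also have "\<dots> = (\<Sum>i<?d. \<Sum>\<tau>\<in>embeddings. C i \<tau> * \<tau> (\<beta> i))" by (simp only: C(1))
  also have "\<dots> = (\<Sum>\<tau>\<in>embeddings. \<Sum>i<?d. C i \<tau> * \<tau> (\<beta> i))" by (rule sum.swap)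
  also have "\<dots> = (\<Sum>\<tau>\<in>(embeddings :: ('k \<Rightarrow> complex) set). 1)" by (rule sum.cong) (auto simp: C(2))
  also have "\<dots> = of_nat (card (embeddings :: ('k \<Rightarrow> complex) set))" by simp
  finally show ?thesis by (simp only: of_nat_eq_iff)
qed

section \<open>Rationality and nondegeneracy of the trace\<close>

lemma trace_K_add: "trace_K (x + y) = trace_K x + trace_K y"
  unfolding trace_K_def sum.distrib[symmetric] by (rule sum.cong) (auto simp: embedding_add)

text \<open>The dual coefficients turn the sum of conjugates into the trace of the rational matrix
  of multiplication by \<open>x\<close>.\<close>

lemma trace_K_rational: "\<exists>r. trace_K (x::'k::number_field) = of_rat r"
proof -
  let ?d = "nf_degree TYPE('k)"
  obtain \<beta> :: "nat \<Rightarrow> 'k" and q where q: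
    "\<And>x. x = (\<Sum>i<?d. of_rat (q x i) * \<beta> i)" "\<And>x y i. q (x + y) i = q x i + q y i"
    by (rule rational_coordinates) (rule that)
  obtain C where C: "\<And>y i. of_rat (q y i) = (\<Sum>\<tau>\<in>embeddings. C i \<tau> * \<tau> y)"
    "\<And>\<tau> \<sigma>. \<tau> \<in> embeddings \<Longrightarrow> \<sigma> \<in> embeddings \<Longrightarrow>
      (\<Sum>i<?d. C i \<tau> * \<sigma> (\<beta> i)) = (if \<tau> = \<sigma> then 1 else 0)"
    by (rule embeddings_dual_coefficients[of q \<beta>, OF q(1,2)]) (rule that)
  have "trace_K x = (\<Sum>\<tau>\<in>embeddings. (\<Sum>i<?d. C i \<tau> * \<tau> (\<beta> i)) * \<tau> x)"
    unfolding trace_K_def by (rule sum.cong) (auto simp: C(2))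
  also have "\<dots> = (\<Sum>\<tau>\<in>embeddings. \<Sum>i<?d. C i \<tau> * \<tau> (x * \<beta> i))"
    unfolding sum_distrib_right by (intro sum.cong refl) (simp add: embedding_mult mult_ac)
  also have "\<dots> = (\<Sum>i<?d. \<Sum>\<tau>\<in>embeddings. C i \<tau> * \<tau> (x * \<beta> i))" by (rule sum.swap)
  also have "\<dots> = (\<Sum>i<?d. of_rat (q (x * \<beta> i) i))" by (simp only: C(1))
  also have "\<dots> = of_rat (\<Sum>i<?d. q (x * \<beta> i) i)" by (simp only: of_rat_sum)
  finally show ?thesis by blast
qed

lemma algebraic_int_embedding:
  assumes \<tau>: "\<tau> \<in> embeddings" and "algebraic_int x"
  shows "algebraic_int (\<tau> x)"
proof -
  note add = embedding_add[OF \<tau>]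
  have pow: "\<tau> (y ^ n) = \<tau> y ^ n" for y n
    by (induction n) (simp_all add: embedding_1[OF \<tau>] embedding_mult[OF \<tau>])
  from assms(2) obtain p where p: "poly (map_poly of_int p) x = 0" "lead_coeff p = 1"
    unfolding algebraic_int_altdef_ipoly by blast
  have "poly (map_poly of_int p) (\<tau> x) = \<tau> (poly (map_poly of_int p) x)"
    by (simp add: poly_altdef degree_map_poly coeff_map_poly additive_sum'[of \<tau>, OF add]
        additive_of_int[of \<tau>, OF add] pow)
  also have "\<dots> = 0" unfolding p(1) by (rule additive_0[of \<tau>, OF add])
  finally show ?thesis using p(2) unfolding algebraic_int_altdef_ipoly by blast
qed

lemma trace_K_int:
  assumes "algebraic_int x"
  shows "trace_K x \<in> \<int>"
proof -
  obtain r where r: "trace_K x = of_rat r" using trace_K_rational by blast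
  have "algebraic_int (trace_K x)" unfolding trace_K_def
    by (rule algebraic_int_sum) (auto intro: algebraic_int_embedding assms)
  then show ?thesis by (rule rational_algebraic_int_is_int) (simp add: r)
qed

lemma embedding_eq_0:
  assumes "\<tau> \<in> embeddings" "\<tau> x = 0"
  shows "x = 0"
proof (rule ccontr)
  assume "x \<noteq> 0"
  then have "1 = \<tau> (x * inverse x)" by (simp add: embedding_1[OF assms(1)])
  then show False by (simp only: embedding_mult[OF assms(1)] assms(2) mult_zero_left one_neq_zero)
qed

lemma embeddings_nonempty: "(embeddings :: ('k::number_field \<Rightarrow> complex) set) \<noteq> {}"
proof
  assume e: "(embeddings :: ('k \<Rightarrow> complex) set) = {}"
  let ?d = "nf_degree TYPE('k)"
  obtain \<beta> :: "nat \<Rightarrow> 'k" and q where q: "\<And>x. x = (\<Sum>i<?d. of_rat (q x i) * \<beta> i)"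
    by (rule rational_coordinates) (rule that)
  have "?d = 0" using card_embeddings[where 'k = 'k] e by simp
  then have "(1::'k) = 0" by (subst q) simp
  then show False by simp
qed

text \<open>A vanishing pairing is a linear relation among the embeddings with coefficients
  \<open>\<tau> x\<close>, so independence makes these zero.\<close>

lemma trace_K_nondegenerate:
  fixes x :: "'k::number_field"
  assumes "\<And>y. trace_K (x * y) = 0"
  shows "x = 0"
proof -
  obtain \<tau> :: "'k \<Rightarrow> complex" where \<tau>: "\<tau> \<in> embeddings" using embeddings_nonempty by blast
  have "(\<Sum>\<tau>\<in>embeddings. \<tau> x * \<tau> y) = 0" for y
    using assms[of y] unfolding trace_K_def
    by (subst (asm) sum.cong[OF refl embedding_mult]) auto
  from embeddings_independent[OF finite_embeddings order_refl this \<tau>]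
  show ?thesis by (rule embedding_eq_0[OF \<tau>])
qed

text \<open>Only spanning is demanded. As there are exactly as many vectors as the degree,
  independence follows; it is \<open>rat_basis_unique\<close>.\<close>

definition rat_basis :: "(nat \<Rightarrow> 'k::number_field) \<Rightarrow> bool" where
  "rat_basis \<beta> \<longleftrightarrow> (\<forall>x. \<exists>a::nat \<Rightarrow> rat. x = (\<Sum>i<nf_degree TYPE('k). of_rat (a i) * \<beta> i))"

lemma rat_basis_unique:
  fixes \<beta> :: "nat \<Rightarrow> 'k::number_field"
  assumes "rat_basis \<beta>"
    "(\<Sum>i<nf_degree TYPE('k). of_rat (a i) * \<beta> i) = (\<Sum>i<nf_degree TYPE('k). of_rat (b i) * \<beta> i)"
    "i < nf_degree TYPE('k)"
  shows "a i = b i"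
proof -
  obtain B :: "'k set" where "finite_dimensional_vector_space (\<lambda>(q::rat) x. of_rat q * x) B"
    using finite_dim_rat by blast
  then interpret QV: finite_dimensional_vector_space "\<lambda>(q::rat) (x::'k). of_rat q * x" B .
  define d where "d = nf_degree TYPE('k)"
  have d: "d = QV.dim UNIV" unfolding d_def nf_degree_def ..
  let ?S = "\<beta> ` {..<d}"
  have span: "UNIV \<subseteq> QV.span ?S"
  proof
    fix x :: 'k
    obtain a where "x = (\<Sum>i<d. of_rat (a i) * \<beta> i)" using assms(1) unfolding rat_basis_def d_def by blast
    then show "x \<in> QV.span ?S"
      by (auto intro!: QV.span_sum intro: QV.span_scale[OF QV.span_base])
  qed
  have "QV.dim UNIV \<le> card ?S" by (rule QV.dim_le_card[OF span]) simp
  then have "d \<le> card ?S" using d by simp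
  moreover have "card ?S \<le> d" using card_image_le[of "{..<d}" \<beta>] by simp
  ultimately have card: "card ?S = d" by simp
  then have inj: "inj_on \<beta> {..<d}" by (intro eq_card_imp_inj_on) auto
  have indep: "QV.independent ?S"
    by (rule QV.card_le_dim_spanning[of _ UNIV]) (use span card d in auto)
  have "(\<Sum>v\<in>?S. of_rat ((\<lambda>v. a (the_inv_into {..<d} \<beta> v) - b (the_inv_into {..<d} \<beta> v)) v) * v)
      = (\<Sum>i<d. of_rat (a i - b i) * \<beta> i)"
    by (subst sum.reindex[OF inj]) (auto intro!: sum.cong simp: the_inv_into_f_f[OF inj])
  also have "\<dots> = 0"
    using assms(2) by (simp add: d_def of_rat_diff left_diff_distrib sum_subtractf)
  finally have z: "(\<Sum>v\<in>?S. of_rat ((\<lambda>v. a (the_inv_into {..<d} \<beta> v) - b (the_inv_into {..<d} \<beta> v)) v) * v) = 0" .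
  have "(\<lambda>v. a (the_inv_into {..<d} \<beta> v) - b (the_inv_into {..<d} \<beta> v)) (\<beta> i) = 0"
    by (rule QV.independentD[OF indep _ subset_refl z]) (use assms(3) in \<open>auto simp: d_def\<close>)
  then show ?thesis using assms(3) the_inv_into_f_f[OF inj, of i] by (simp add: d_def)
qed

lemma ex_rat_basis: "\<exists>\<beta> :: nat \<Rightarrow> 'k::number_field. rat_basis \<beta>"
proof -
  obtain \<beta> :: "nat \<Rightarrow> 'k" and q where "\<And>x. x = (\<Sum>i<nf_degree TYPE('k). of_rat (q x i) * \<beta> i)"
    by (rule rational_coordinates) (rule that)
  then show ?thesis unfolding rat_basis_def by blast
qed

lemma ex_rat_basis_integral:
  "\<exists>\<beta> :: nat \<Rightarrow> 'k::number_field. rat_basis \<beta> \<and> (\<forall>i. algebraic_int (\<beta> i))"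
proof -
  obtain \<beta> :: "nat \<Rightarrow> 'k" where \<beta>: "rat_basis \<beta>" using ex_rat_basis by blast
  have "\<forall>i. \<exists>N. N > 0 \<and> algebraic_int (of_nat N * \<beta> i)"
    using algebraic_int_multiple by blast
  then obtain N where N: "\<And>i. (N::nat \<Rightarrow> nat) i > 0" "\<And>i. algebraic_int (of_nat (N i) * \<beta> i)" by metis
  have "rat_basis (\<lambda>i. of_nat (N i) * \<beta> i)"
    unfolding rat_basis_def
  proof
    fix x
    obtain a where a: "x = (\<Sum>i<nf_degree TYPE('k). of_rat (a i) * \<beta> i)" using \<beta> unfolding rat_basis_def by blast
    show "\<exists>a. x = (\<Sum>i<nf_degree TYPE('k). of_rat (a i) * (of_nat (N i) * \<beta> i))"
      by (rule exI[of _ "\<lambda>i. a i / of_nat (N i)"]) (subst a, rule sum.cong, use N(1) in \<open>auto simp: of_rat_divide less_imp_neq[THEN not_sym]\<close>)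
  qed
  with N(2) show ?thesis by blast
qed

text \<open>The trace form identifies K with its dual over the rationals. It supplies the dual basis
  for the ring of integers and, later, a field element for each integer frequency of the dual
  lattice.\<close>

lemma trace_K_functional:
  fixes \<beta> :: "nat \<Rightarrow> 'k::number_field"
  assumes \<beta>: "rat_basis \<beta>"
  shows "\<exists>\<alpha>. \<forall>i<nf_degree TYPE('k). trace_K (\<alpha> * \<beta> i) = of_rat (k i)"
proof -
  obtain B :: "'k set" where "finite_dimensional_vector_space (\<lambda>(q::rat) x. of_rat q * x) B"
    using finite_dim_rat by blast
  then interpret QV: finite_dimensional_vector_space "\<lambda>(q::rat) (x::'k). of_rat q * x" B .
  define d where "d = nf_degree TYPE('k)"
  obtain tr :: "'k \<Rightarrow> rat" where tr: "\<And>x. trace_K x = of_rat (tr x)" using trace_K_rational by metis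
  have tr_add: "tr (x + y) = tr x + tr y" for x y
  proof -
    have "of_rat (tr (x + y)) = (of_rat (tr x + tr y) :: complex)"
      by (simp only: tr[symmetric] of_rat_add trace_K_add)
    then show ?thesis by (simp only: of_rat_eq_iff)
  qed
  have tr_scale: "tr (of_rat r * x) = r * tr x" for r x
    using additive_of_rat[of tr r x, OF tr_add] by simp
  \<comment> \<open>The values of the functional are stored as coordinates in the same basis, so
    \<open>T\<close> is an endomorphism of K and injectivity, from nondegeneracy, gives
    surjectivity.\<close>
  define T where "T = (\<lambda>\<alpha>. \<Sum>i<d. of_rat (tr (\<alpha> * \<beta> i)) * \<beta> i)"
  have lin: "Vector_Spaces.linear (\<lambda>q x. of_rat q * x) (\<lambda>q x. of_rat q * x) T"
  proof (rule Vector_Spaces.linear_iff[THEN iffD2], intro conjI allI)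
    show "vector_space (\<lambda>(q::rat) (x::'k). of_rat q * x)" "vector_space (\<lambda>(q::rat) (x::'k). of_rat q * x)"
      by (rule vector_space_rat)+
    show "T (x + y) = T x + T y" for x y
      by (simp add: T_def distrib_right tr_add of_rat_add sum.distrib)
    show "T (of_rat r * x) = of_rat r * T x" for r x
      by (simp only: T_def mult.assoc tr_scale of_rat_mult sum_distrib_left)
  qed
  have "inj T"
  proof (rule injI)
    fix x y assume xy: "T x = T y"
    have *: "tr (x * \<beta> i) = tr (y * \<beta> i)" if "i < d" for i
      by (rule rat_basis_unique[OF \<beta>]) (use xy that in \<open>auto simp: T_def d_def\<close>)
    have neg: "tr (- z) = - tr z" for z by (rule additive_uminus[of tr, OF tr_add])
    have **: "tr ((x - y) * \<beta> i) = 0" if "i < d" for i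
    proof -
      have "tr ((x - y) * \<beta> i) = tr (x * \<beta> i + - (y * \<beta> i))" by (simp add: left_diff_distrib)
      then show ?thesis using *[OF that] by (simp only: tr_add neg add.right_inverse)
    qed
    have "trace_K ((x - y) * z) = 0" for z
    proof -
      obtain a where a: "z = (\<Sum>i<d. of_rat (a i) * \<beta> i)" using \<beta> unfolding rat_basis_def d_def by blast
      have "tr ((x - y) * z) = tr (\<Sum>i<d. of_rat (a i) * ((x - y) * \<beta> i))"
        unfolding a by (simp only: sum_distrib_left mult.left_commute)
      also have "\<dots> = 0"
        by (simp only: additive_sum'[of tr, OF tr_add] tr_scale) (simp add: **)
      finally show ?thesis by (simp add: tr)
    qed
    then have "x - y = 0" by (rule trace_K_nondegenerate)
    then show "x = y" by simp
  qed
  then have "surj T" by (rule QV.linear_inj_imp_surj[OF lin])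
  then obtain \<alpha> where \<alpha>: "T \<alpha> = (\<Sum>i<d. of_rat (k i) * \<beta> i)" by (metis surjD)
  have "tr (\<alpha> * \<beta> i) = k i" if "i < d" for i
    by (rule rat_basis_unique[OF \<beta>]) (use \<alpha> that in \<open>auto simp: T_def d_def\<close>)
  then show ?thesis unfolding tr d_def by auto
qed

section \<open>Sublattices of the integer lattice\<close>

text \<open>Vectors of length \<open>d\<close> are functions vanishing from \<open>d\<close> on, so
  that equality of vectors is equality of functions. The last clause is finite index.\<close>

definition int_lattice :: "nat \<Rightarrow> (nat \<Rightarrow> int) set \<Rightarrow> bool" where
  "int_lattice d L \<longleftrightarrow> (\<forall>x\<in>L. \<forall>i\<ge>d. x i = 0) \<and> (\<lambda>_. 0) \<in> L \<and> (\<forall>x\<in>L. \<forall>y\<in>L. (\<lambda>i. x i - y i) \<in> L) \<and>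
    (\<exists>N>0. \<forall>j<d. (\<lambda>i. if i = j then N else 0) \<in> L)"

lemma
  assumes "int_lattice d L"
  shows int_lattice_0: "(\<lambda>_. 0) \<in> L"
    and int_lattice_diff: "x \<in> L \<Longrightarrow> y \<in> L \<Longrightarrow> (\<lambda>i. x i - y i) \<in> L"
    and int_lattice_support: "x \<in> L \<Longrightarrow> i \<ge> d \<Longrightarrow> x i = 0"
  using assms by (auto simp: int_lattice_def)

lemma int_lattice_add:
  assumes L: "int_lattice d L" and xy: "x \<in> L" "y \<in> L"
  shows "(\<lambda>i. x i + y i) \<in> L"
proof -
  have "(\<lambda>i. x i - (0 - y i)) \<in> L"
    by (rule int_lattice_diff[OF L xy(1) int_lattice_diff[OF L int_lattice_0[OF L] xy(2)]])
  then show ?thesis by simp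
qed

lemma int_lattice_scale:
  assumes L: "int_lattice d L" and x: "x \<in> L"
  shows "(\<lambda>i. c * x i) \<in> L"
proof -
  have nat: "(\<lambda>i. int n * x i) \<in> L" for n
  proof (induction n)
    case 0
    then show ?case using int_lattice_0[OF L] by simp
  next
    case (Suc n)
    then show ?case using int_lattice_add[OF L x Suc] by (simp add: distrib_right)
  qed
  show ?thesis
  proof (cases "c \<ge> 0")
    case True
    then show ?thesis using nat[of "nat c"] by simp
  next
    case False
    then show ?thesis using int_lattice_diff[OF L int_lattice_0[OF L] nat[of "nat (- c)"]] by simp
  qed
qed

text \<open>A basis in Hermite form without the reduction of off-diagonal entries:
  \<open>t j j\<close> generates the group of j-th entries of the lattice vectors that vanish beyond
  j.\<close>

definition triangular_basis :: "nat \<Rightarrow> (nat \<Rightarrow> int) set \<Rightarrow> (nat \<Rightarrow> nat \<Rightarrow> int) \<Rightarrow> bool" where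
  "triangular_basis d L t \<longleftrightarrow> (\<forall>j<d. t j \<in> L \<and> t j j > 0 \<and> (\<forall>i>j. t j i = 0) \<and>
     (\<forall>x\<in>L. (\<forall>i>j. x i = 0) \<longrightarrow> t j j dvd x j))"

text \<open>Take a vector with least positive j-th entry; division with remainder of any other
  vector by it would give a smaller entry unless the division is exact.\<close>

lemma ex_triangular_basis:
  assumes L: "int_lattice d L"
  shows "\<exists>t. triangular_basis d L t"
proof -
  have "\<exists>u. u \<in> L \<and> u j > 0 \<and> (\<forall>i>j. u i = 0) \<and> (\<forall>x\<in>L. (\<forall>i>j. x i = 0) \<longrightarrow> u j dvd x j)" if j: "j < d" for j
  proof -
    let ?P = "\<lambda>n::nat. n > 0 \<and> (\<exists>x\<in>L. (\<forall>i>j. x i = 0) \<and> x j = int n)"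
    obtain N where N: "N > 0" "(\<lambda>i. if i = j then N else 0) \<in> L"
      using L j by (auto simp: int_lattice_def)
    have "?P (nat N)" using N by (auto intro!: bexI[OF _ N(2)])
    then have "?P (LEAST n. ?P n)" by (rule LeastI)
    then obtain u where u: "u \<in> L" "\<forall>i>j. u i = 0" "u j = int (LEAST n. ?P n)" "(LEAST n. ?P n) > 0" by blast
    have "u j dvd x j" if x: "x \<in> L" "\<forall>i>j. x i = 0" for x
    proof (rule ccontr)
      assume nd: "\<not> u j dvd x j"
      let ?y = "\<lambda>i. x i - (x j div u j) * u i"
      have y: "?y \<in> L" by (rule int_lattice_diff[OF L x(1) int_lattice_scale[OF L u(1)]])
      have upos: "u j > 0" using u by simp
      have yj: "?y j = x j mod u j" by (simp add: minus_div_mult_eq_mod)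
      have pos: "x j mod u j > 0" using nd upos by (metis dvd_eq_mod_eq_0 le_less pos_mod_sign)
      have lt: "x j mod u j < u j" using upos by simp
      have "?P (nat (x j mod u j))"
        using pos y x(2) u(2) yj by (auto intro!: bexI[OF _ y])
      then have "(LEAST n. ?P n) \<le> nat (x j mod u j)" by (rule Least_le)
      then show False using lt pos u(3) by linarith
    qed
    then show ?thesis using u by auto
  qed
  then obtain t where "\<And>j. j < d \<Longrightarrow> t j \<in> L \<and> t j j > 0 \<and> (\<forall>i>j. t j i = 0) \<and> (\<forall>x\<in>L. (\<forall>i>j. x i = 0) \<longrightarrow> t j j dvd x j)"
    by metis
  then show ?thesis unfolding triangular_basis_def by blast
qed

text \<open>Entries are cleared from the last one downwards; the divisibility clause makes each
  quotient an integer.\<close>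

lemma triangular_basis_span:
  assumes L: "int_lattice d L" and t: "triangular_basis d L t" and x: "x \<in> L"
  shows "\<exists>a. \<forall>i. x i = (\<Sum>j<d. a j * t j i)"
proof -
  have "\<exists>a. \<forall>i. x i = (\<Sum>j<m. a j * t j i)" if "m \<le> d" "x \<in> L" "\<forall>i\<ge>m. x i = 0" for m x
    using that
  proof (induction m arbitrary: x)
    case 0
    then show ?case by auto
  next
    case (Suc m)
    from t Suc.prems(1) have tm: "t m \<in> L" "t m m > 0" "\<forall>i>m. t m i = 0" "\<forall>x\<in>L. (\<forall>i>m. x i = 0) \<longrightarrow> t m m dvd x m"
      by (auto simp: triangular_basis_def)
    have "t m m dvd x m" using tm(4) Suc.prems by auto
    then obtain c where c: "x m = c * t m m" by (metis dvdE mult.commute)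
    have "(\<lambda>i. x i - c * t m i) \<in> L" by (rule int_lattice_diff[OF L Suc.prems(2) int_lattice_scale[OF L tm(1)]])
    moreover have "x i - c * t m i = 0" if "i \<ge> m" for i
      using c tm(3) Suc.prems(3) that by (cases "i = m") auto
    ultimately obtain a where a: "\<And>i. x i - c * t m i = (\<Sum>j<m. a j * t j i)"
      using Suc.IH[of "\<lambda>i. x i - c * t m i"] Suc.prems(1) by auto
    have "x i = (\<Sum>j<Suc m. (a(m := c)) j * t j i)" for i
      using a[of i] by simp
    then show ?case by blast
  qed
  from this[of d x] x int_lattice_support[OF L x] show ?thesis by auto
qed

definition lattice_reps :: "nat \<Rightarrow> (nat \<Rightarrow> int) set \<Rightarrow> (nat \<Rightarrow> int) set \<Rightarrow> bool" where
  "lattice_reps d L R \<longleftrightarrow> finite R \<and> (\<forall>r\<in>R. \<forall>i\<ge>d. r i = 0) \<and>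
     (\<forall>x. (\<forall>i\<ge>d. x i = 0) \<longrightarrow> (\<exists>!r. r \<in> R \<and> (\<lambda>i. x i - r i) \<in> L))"

text \<open>The box with side lengths \<open>t i i\<close> is a fundamental domain, so the index is
  the product of the diagonal.\<close>

lemma triangular_reps:
  assumes L: "int_lattice d L" and t: "triangular_basis d L t"
  shows "\<exists>R. lattice_reps d L R \<and> int (card R) = (\<Prod>i<d. t i i)"
proof -
  define R where "R = {x. (\<forall>i\<ge>d. x i = 0) \<and> (\<forall>i<d. 0 \<le> x i \<and> x i < t i i)}"
  have tt: "t j \<in> L" "t j j > 0" "\<And>i. i > j \<Longrightarrow> t j i = 0" "\<And>x. x \<in> L \<Longrightarrow> \<forall>i>j. x i = 0 \<Longrightarrow> t j j dvd x j"
    if "j < d" for j using t that by (auto simp: triangular_basis_def)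
  have bij: "bij_betw (\<lambda>x i. if i < d then x i else 0) (PiE {..<d} (\<lambda>i. {0..<t i i})) R"
  proof (rule bij_betw_byWitness[where f' = "\<lambda>x. restrict x {..<d}"]; (intro ballI image_subsetI)?)
    fix x assume "x \<in> PiE {..<d} (\<lambda>i. {0..<t i i})"
    then show "restrict (\<lambda>i. if i < d then x i else 0) {..<d} = x"
      by (intro ext) (auto simp: PiE_def extensional_def)
  next
    fix x assume "x \<in> R"
    then show "(\<lambda>i. if i < d then restrict x {..<d} i else 0) = x"
      by (intro ext) (auto simp: R_def)
  next
    fix x assume "x \<in> PiE {..<d} (\<lambda>i. {0..<t i i})"
    then have "x i \<in> {0..<t i i}" if "i < d" for i using that by blast
    then show "(\<lambda>i. if i < d then x i else 0) \<in> R" by (simp add: R_def)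
  next
    fix x assume "x \<in> R"
    then show "restrict x {..<d} \<in> PiE {..<d} (\<lambda>i. {0..<t i i})"
      by (intro restrict_PiE_iff[THEN iffD2] ballI) (simp add: R_def)
  qed
  have card: "int (card R) = (\<Prod>i<d. t i i)"
  proof -
    have "int (card R) = int (card (PiE {..<d} (\<lambda>i. {0..<t i i})))" using bij_betw_same_card[OF bij] by simp
    also have "\<dots> = (\<Prod>i<d. int (card {0..<t i i}))" by (simp add: card_PiE)
    also have "\<dots> = (\<Prod>i<d. t i i)" by (rule prod.cong) (use tt(2) in \<open>auto intro: less_imp_le\<close>)
    finally show ?thesis .
  qed
  have fin: "finite R" using bij_betw_finite[OF bij] by (simp add: finite_PiE)
  have ex: "\<exists>r. r \<in> R \<and> (\<lambda>i. x i - r i) \<in> L" if x: "\<forall>i\<ge>d. x i = 0" for x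
  proof -
    \<comment> \<open>The last \<open>m\<close> entries are already reduced. Subtracting a multiple
      of \<open>t j\<close> leaves the entries beyond j alone, since \<open>t j\<close> vanishes
      there.\<close>
    have "\<exists>y. (\<lambda>i. x i - y i) \<in> L \<and> (\<forall>i. d - m \<le> i \<longrightarrow> i < d \<longrightarrow> 0 \<le> y i \<and> y i < t i i)" if "m \<le> d" for m
      using that
    proof (induction m)
      case 0
      then show ?case by (intro exI[of _ x]) (use int_lattice_0[OF L] in auto)
    next
      case (Suc m)
      then obtain y where y: "(\<lambda>i. x i - y i) \<in> L" "\<And>i. d - m \<le> i \<Longrightarrow> i < d \<Longrightarrow> 0 \<le> y i \<and> y i < t i i" by auto
      define j where "j = d - Suc m"
      have j: "j < d" "d - m = Suc j" using Suc.prems by (auto simp: j_def)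
      let ?z = "\<lambda>i. y i - (y j div t j j) * t j i"
      have "(\<lambda>i. (x i - y i) + (y j div t j j) * t j i) \<in> L"
        by (rule int_lattice_add[OF L y(1) int_lattice_scale[OF L tt(1)[OF j(1)]]])
      then have "(\<lambda>i. x i - ?z i) \<in> L" by (simp add: algebra_simps)
      moreover have "0 \<le> ?z i \<and> ?z i < t i i" if i: "j \<le> i" "i < d" for i
      proof (cases "i = j")
        case True
        then have "?z i = y j mod t j j" by (simp add: minus_div_mult_eq_mod)
        then show ?thesis using tt(2)[OF j(1)] True by simp
      next
        case False
        then show ?thesis using i y(2)[of i] j tt(3)[OF j(1), of i] by simp
      qed
      ultimately show ?case unfolding j_def[symmetric] by (intro exI[of _ ?z]) simp
    qed
    from this[of d] obtain y where y: "(\<lambda>i. x i - y i) \<in> L" "\<And>i. i < d \<Longrightarrow> 0 \<le> y i \<and> y i < t i i" by auto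
    have "y i = 0" if "i \<ge> d" for i using int_lattice_support[OF L y(1) that] x that by simp
    with y show ?thesis by (intro exI[of _ y]) (auto simp: R_def)
  qed
  have uniq: "r = r'" if r: "r \<in> R" "(\<lambda>i. x i - r i) \<in> L" and r': "r' \<in> R" "(\<lambda>i. x i - r' i) \<in> L" for x r r'
  proof (rule ccontr)
    assume ne: "r \<noteq> r'"
    have diff: "(\<lambda>i. r i - r' i) \<in> L"
      using int_lattice_diff[OF L r'(2) r(2)] by simp
    have supp: "r i = r' i" if "i \<ge> d" for i using r(1) r'(1) that by (simp add: R_def)
    let ?J = "{i. r i \<noteq> r' i}"
    have sub: "?J \<subseteq> {..<d}" using supp by (auto simp: not_le[symmetric])
    then have finJ: "finite ?J" by (rule finite_subset) simp
    have "?J \<noteq> {}" using ne by auto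
    \<comment> \<open>At the last place where two representatives differ, the difference is
      divisible by \<open>t j j\<close> and smaller than it in absolute value.\<close>
    define j where "j = Max ?J"
    have j: "j \<in> ?J" unfolding j_def using finJ \<open>?J \<noteq> {}\<close> by (rule Max_in)
    have jd: "j < d" using j sub by auto
    have "r i - r' i = 0" if "i > j" for i
      using Max_ge[OF finJ, of i] that unfolding j_def by force
    then have "t j j dvd r j - r' j" using tt(4)[OF jd diff] by simp
    moreover have "0 \<le> r j \<and> r j < t j j" "0 \<le> r' j \<and> r' j < t j j" using r(1) r'(1) jd by (auto simp: R_def)
    then have "\<bar>r j - r' j\<bar> < t j j" by linarith
    moreover have "r j - r' j \<noteq> 0" using j by simp
    ultimately show False using dvd_imp_le_int[of "r j - r' j" "t j j"] tt(2)[OF jd] by simp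
  qed
  have "lattice_reps d L R"
    unfolding lattice_reps_def using fin ex uniq by (auto simp: R_def)
  with card show ?thesis by blast
qed

text \<open>A triangular and an arbitrary basis are integer combinations of each other, so the two
  transition determinants multiply to 1 and the absolute determinant does not depend on the
  basis.\<close>

theorem index_eq_det:
  assumes L: "int_lattice d L" and u: "\<And>j. j < d \<Longrightarrow> u j \<in> L"
    and span: "\<And>x. x \<in> L \<Longrightarrow> \<exists>a. \<forall>i. x i = (\<Sum>j<d. a j * u j i)"
  shows "\<exists>R. lattice_reps d L R \<and> int (card R) = \<bar>Determinant.det (Matrix.mat d d (\<lambda>(i, j). u i j))\<bar> \<and> card R > 0"
proof -
  obtain t where t: "triangular_basis d L t" using ex_triangular_basis[OF L] by blast
  obtain R where R: "lattice_reps d L R" "int (card R) = (\<Prod>i<d. t i i)" using triangular_reps[OF L t] by blast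
  have tt: "t j \<in> L" "t j j > 0" "\<And>i. i > j \<Longrightarrow> t j i = 0" if "j < d" for j
    using t that by (auto simp: triangular_basis_def)
  have "\<forall>j. \<exists>a. j < d \<longrightarrow> (\<forall>i. t j i = (\<Sum>k<d. a k * u k i))" using span tt(1) by blast
  then obtain a where a: "\<And>j i. j < d \<Longrightarrow> t j i = (\<Sum>k<d. a j k * u k i)" by metis
  have "\<forall>j. \<exists>b. j < d \<longrightarrow> (\<forall>i. u j i = (\<Sum>k<d. b k * t k i))" using triangular_basis_span[OF L t u] by blast
  then obtain b where b: "\<And>j i. j < d \<Longrightarrow> u j i = (\<Sum>k<d. b j k * t k i)" by metis
  let ?T = "Matrix.mat d d (\<lambda>(i, j). t i j)" and ?U = "Matrix.mat d d (\<lambda>(i, j). u i j)"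
  let ?A = "Matrix.mat d d (\<lambda>(i, j). a i j)" and ?B = "Matrix.mat d d (\<lambda>(i, j). b i j)"
  have TA: "?T = ?A * ?U" by (rule eq_matI) (auto simp: scalar_prod_def a atLeast0LessThan)
  have UB: "?U = ?B * ?T" by (rule eq_matI) (auto simp: scalar_prod_def b atLeast0LessThan)
  have dT: "Determinant.det ?T = Determinant.det ?A * Determinant.det ?U"
    unfolding TA by (rule det_mult[of _ d]) auto
  have dU: "Determinant.det ?U = Determinant.det ?B * Determinant.det ?T"
    by (subst UB, rule det_mult[of _ d]) auto
  have tri: "Determinant.det ?T = (\<Prod>i<d. t i i)"
  proof -
    have "Determinant.det ?T = prod_list (diag_mat ?T)"
      by (rule det_lower_triangular[of d]) (auto simp: tt(3))
    also have "\<dots> = (\<Prod>i<d. t i i)" by (simp add: prod_list_diag_prod atLeast0LessThan)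
    finally show ?thesis .
  qed
  have pos: "(\<Prod>i<d. t i i) > 0" by (rule prod_pos) (auto simp: tt(2))
  \<comment> \<open>Both transitions combined reproduce the determinant of the triangular matrix,
    which is positive and may be cancelled.\<close>
  have "Determinant.det ?T * (1 - Determinant.det ?A * Determinant.det ?B) = 0"
    using dT dU by (simp add: algebra_simps)
  moreover have "Determinant.det ?T \<noteq> 0" using pos unfolding tri by (rule less_imp_neq[symmetric])
  ultimately have "Determinant.det ?A * Determinant.det ?B = 1"
    by (simp only: mult_eq_0_iff simp_thms right_minus_eq) 
  then have "\<bar>Determinant.det ?A\<bar> = 1" by (metis dvd_triv_left zdvd1_eq)
  then have "\<bar>Determinant.det ?T\<bar> = \<bar>Determinant.det ?U\<bar>" unfolding dT by (simp add: abs_mult)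
  moreover have "\<bar>Determinant.det ?T\<bar> = int (card R)" unfolding tri R(2) using pos by (rule abs_of_pos)
  ultimately have "int (card R) = \<bar>Determinant.det ?U\<bar>" by (rule trans[OF sym, rotated])
  moreover have "card R > 0" using R(2) pos by linarith
  ultimately show ?thesis using R(1) by blast
qed

section \<open>Integral bases of ideals\<close>

definition zlattice :: "'k::number_field set \<Rightarrow> bool" where
  "zlattice L \<longleftrightarrow> 0 \<in> L \<and> (\<forall>x\<in>L. \<forall>y\<in>L. x - y \<in> L)"

lemma
  assumes "zlattice L"
  shows zlattice_0: "0 \<in> L" and zlattice_diff: "x \<in> L \<Longrightarrow> y \<in> L \<Longrightarrow> x - y \<in> L"
  using assms by (auto simp: zlattice_def)

lemma zlattice_uminus: "zlattice L \<Longrightarrow> x \<in> L \<Longrightarrow> - x \<in> L"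
  using zlattice_diff[of L 0 x] zlattice_0[of L] by simp

lemma zlattice_add: "zlattice L \<Longrightarrow> x \<in> L \<Longrightarrow> y \<in> L \<Longrightarrow> x + y \<in> L"
  using zlattice_diff[of L x "- y"] zlattice_uminus[of L y] by simp

lemma zlattice_of_nat: "zlattice L \<Longrightarrow> x \<in> L \<Longrightarrow> of_nat n * x \<in> L"
  by (induction n) (auto simp: zlattice_0 distrib_right intro: zlattice_add)

lemma zlattice_of_int: "zlattice L \<Longrightarrow> x \<in> L \<Longrightarrow> of_int n * x \<in> L"
  by (cases n rule: int_cases2) (auto simp: zlattice_of_nat zlattice_uminus)

lemma zlattice_sum: "zlattice L \<Longrightarrow> (\<And>i. i \<in> I \<Longrightarrow> f i \<in> L) \<Longrightarrow> (\<Sum>i\<in>I. f i) \<in> L"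
  by (induction I rule: infinite_finite_induct) (auto simp: zlattice_0 intro: zlattice_add)

definition int_basis :: "(nat \<Rightarrow> 'k::number_field) \<Rightarrow> 'k set \<Rightarrow> bool" where
  "int_basis \<gamma> L \<longleftrightarrow> rat_basis \<gamma> \<and> (\<forall>i<nf_degree TYPE('k). \<gamma> i \<in> L) \<and>
     (\<forall>x\<in>L. \<exists>a::nat \<Rightarrow> int. x = (\<Sum>i<nf_degree TYPE('k). of_int (a i) * \<gamma> i))"

lemma int_basis_coords:
  fixes \<gamma> :: "nat \<Rightarrow> 'k::number_field"
  assumes "int_basis \<gamma> L" "x \<in> L"
  obtains a :: "nat \<Rightarrow> int" where "x = (\<Sum>i<nf_degree TYPE('k). of_int (a i) * \<gamma> i)"
proof -
  have "\<exists>a::nat \<Rightarrow> int. x = (\<Sum>i<nf_degree TYPE('k). of_int (a i) * \<gamma> i)"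
    using assms unfolding int_basis_def by (elim conjE bspec)
  then show thesis by (elim exE) (rule that)
qed

lemma int_basis_iff:
  fixes \<gamma> :: "nat \<Rightarrow> 'k::number_field"
  assumes "int_basis \<gamma> L" "zlattice L"
  shows "x \<in> L \<longleftrightarrow> (\<exists>a::nat \<Rightarrow> int. x = (\<Sum>i<nf_degree TYPE('k). of_int (a i) * \<gamma> i))"
proof
  assume "\<exists>a::nat \<Rightarrow> int. x = (\<Sum>i<nf_degree TYPE('k). of_int (a i) * \<gamma> i)"
  then obtain a :: "nat \<Rightarrow> int" where "x = (\<Sum>i<nf_degree TYPE('k). of_int (a i) * \<gamma> i)" by blast
  then show "x \<in> L" using assms by (auto simp: int_basis_def intro!: zlattice_sum zlattice_of_int)
next
  assume "x \<in> L"
  with assms(1) show "\<exists>a::nat \<Rightarrow> int. x = (\<Sum>i<nf_degree TYPE('k). of_int (a i) * \<gamma> i)"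
    unfolding int_basis_def by (elim conjE bspec)
qed

lemma rat_basis_unique_int:
  fixes \<beta> :: "nat \<Rightarrow> 'k::number_field"
  assumes "rat_basis \<beta>"
    "(\<Sum>i<nf_degree TYPE('k). of_int (a i) * \<beta> i) = (\<Sum>i<nf_degree TYPE('k). of_int (b i) * \<beta> i)"
    "i < nf_degree TYPE('k)"
  shows "a i = b i"
proof -
  have "(of_int (a i) :: rat) = of_int (b i)"
    by (rule rat_basis_unique[OF assms(1) _ assms(3), of "\<lambda>i. of_int (a i)" "\<lambda>i. of_int (b i)"])
      (use assms(2) in simp)
  then show ?thesis by simp
qed

text \<open>Zero entries from the degree on make the coordinate vector of an element a single
  function, as \<open>int_lattice\<close> requires.\<close>

definition coord_lattice :: "(nat \<Rightarrow> 'k::number_field) \<Rightarrow> 'k set \<Rightarrow> (nat \<Rightarrow> int) set" where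
  "coord_lattice \<beta> L = {a. (\<forall>i\<ge>nf_degree TYPE('k). a i = 0) \<and>
     (\<Sum>i<nf_degree TYPE('k). of_int (a i) * \<beta> i) \<in> L}"

lemma int_lattice_coord_lattice:
  fixes \<beta> :: "nat \<Rightarrow> 'k::number_field"
  assumes L: "zlattice L" and N: "N > 0" "\<And>i. i < nf_degree TYPE('k) \<Longrightarrow> of_nat N * \<beta> i \<in> L"
  shows "int_lattice (nf_degree TYPE('k)) (coord_lattice \<beta> L)"
proof -
  let ?d = "nf_degree TYPE('k)"
  have "(\<lambda>i. x i - y i) \<in> coord_lattice \<beta> L" if "x \<in> coord_lattice \<beta> L" "y \<in> coord_lattice \<beta> L" for x y
    using that zlattice_diff[OF L] by (auto simp: coord_lattice_def left_diff_distrib sum_subtractf)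
  moreover have "(\<lambda>i. if i = j then int N else 0) \<in> coord_lattice \<beta> L" if "j < ?d" for j
  proof -
    have "(\<Sum>i<?d. of_int (if i = j then int N else 0) * \<beta> i) = (\<Sum>i<?d. if i = j then of_nat N * \<beta> j else 0)"
      by (rule sum.cong) auto
    also have "\<dots> = of_nat N * \<beta> j" using that by simp
    finally show ?thesis using N(2)[OF that] that by (simp add: coord_lattice_def)
  qed
  ultimately show ?thesis unfolding int_lattice_def
    using N(1) zlattice_0[OF L] by (auto simp: coord_lattice_def intro!: exI[of _ "int N"])
qed

text \<open>\<open>L\<close> lies between \<open>N\<close> times the span of \<open>\<beta>\<close>
  and the span itself, so its coordinate vectors form a lattice of finite index, and a triangular
  basis of that lattice is transported back.\<close>

lemma ex_int_basis:
  fixes \<beta> :: "nat \<Rightarrow> 'k::number_field"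
  assumes L: "zlattice L" and \<beta>: "rat_basis \<beta>"
    and sub: "\<And>x. x \<in> L \<Longrightarrow> \<exists>a::nat \<Rightarrow> int. x = (\<Sum>i<nf_degree TYPE('k). of_int (a i) * \<beta> i)"
    and N: "N > 0" "\<And>i. i < nf_degree TYPE('k) \<Longrightarrow> of_nat N * \<beta> i \<in> L"
  shows "\<exists>\<gamma>. int_basis \<gamma> L"
proof -
  let ?d = "nf_degree TYPE('k)"
  let ?c = "\<lambda>a::nat \<Rightarrow> int. \<Sum>i<?d. of_int (a i) * \<beta> i"
  have il: "int_lattice ?d (coord_lattice \<beta> L)" by (rule int_lattice_coord_lattice[OF L N])
  obtain t where t: "triangular_basis ?d (coord_lattice \<beta> L) t" using ex_triangular_basis[OF il] by blast
  define \<gamma> where "\<gamma> = (\<lambda>j. ?c (t j))"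
  have mem: "\<gamma> j \<in> L" if "j < ?d" for j
    using t that by (auto simp: triangular_basis_def coord_lattice_def \<gamma>_def)
  have span: "\<exists>a::nat \<Rightarrow> int. x = (\<Sum>i<?d. of_int (a i) * \<gamma> i)" if x: "x \<in> L" for x
  proof -
    obtain a0 where a0: "x = ?c a0" using sub[OF x] by blast
    define a where "a = (\<lambda>i. if i < ?d then a0 i else 0)"
    have a: "x = ?c a" unfolding a0 a_def by (rule sum.cong) auto
    have "a \<in> coord_lattice \<beta> L" using x a by (auto simp: coord_lattice_def a_def)
    from triangular_basis_span[OF il t this] obtain e where e: "\<And>i. a i = (\<Sum>j<?d. e j * t j i)" by blast
    have "x = (\<Sum>i<?d. \<Sum>j<?d. of_int (e j) * (of_int (t j i) * \<beta> i))"
      unfolding a e of_int_sum of_int_mult sum_distrib_right mult.assoc ..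
    also have "\<dots> = (\<Sum>j<?d. \<Sum>i<?d. of_int (e j) * (of_int (t j i) * \<beta> i))" by (rule sum.swap)
    also have "\<dots> = (\<Sum>j<?d. of_int (e j) * \<gamma> j)" unfolding \<gamma>_def sum_distrib_left ..
    finally show ?thesis by blast
  qed
  have "rat_basis \<gamma>" unfolding rat_basis_def
  proof
    fix x
    obtain q where q: "x = (\<Sum>i<?d. of_rat (q i) * \<beta> i)" using \<beta> unfolding rat_basis_def by blast
    obtain M :: nat where M: "M > 0" "\<And>i. i \<in> {..<?d} \<Longrightarrow> of_nat M * q i \<in> \<int>"
      by (rule common_denominator[of "{..<?d}" q]) auto
    have "\<forall>i\<in>{..<?d}. \<exists>z::int. of_nat M * q i = of_int z" using M(2) by (meson Ints_cases)
    then obtain z :: "nat \<Rightarrow> int" where z: "\<And>i. i < ?d \<Longrightarrow> of_nat M * q i = of_int (z i)" by (metis lessThan_iff)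
    \<comment> \<open>\<open>M\<close> clears the denominators of the coordinates of
      \<open>x\<close> and \<open>N\<close> moves the result into \<open>L\<close>, so every element
      of K has a multiple in \<open>L\<close>.\<close>
    have "of_nat (N * M) * x = (\<Sum>i<?d. of_int (z i) * (of_nat N * \<beta> i))"
      unfolding q sum_distrib_left
    proof (rule sum.cong[OF refl])
      fix i assume "i \<in> {..<?d}"
      then have "of_rat (of_nat M * q i) = (of_rat (of_int (z i)) :: 'k)" using z by simp
      then have *: "of_nat M * of_rat (q i) = (of_int (z i) :: 'k)" by (simp add: of_rat_mult)
      have "of_nat (N * M) * (of_rat (q i) * \<beta> i) = of_nat N * (of_nat M * of_rat (q i)) * \<beta> i"
        by (simp add: mult_ac)
      then show "of_nat (N * M) * (of_rat (q i) * \<beta> i) = of_int (z i) * (of_nat N * \<beta> i)"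
        unfolding * by (simp add: mult_ac)
    qed
    also have "\<dots> \<in> L" using N(2) by (intro zlattice_sum[OF L] zlattice_of_int[OF L]) auto
    finally obtain a :: "nat \<Rightarrow> int" where a: "of_nat (N * M) * x = (\<Sum>i<?d. of_int (a i) * \<gamma> i)" using span by blast
    have NM: "(of_nat (N * M) :: 'k) \<noteq> 0" using N(1) M(1) by simp
    have "x = (of_nat (N * M) * x) / of_nat (N * M)" using NM by simp
    also have "\<dots> = (\<Sum>i<?d. of_rat (of_int (a i) / of_nat (N * M)) * \<gamma> i)"
      unfolding a sum_divide_distrib by (intro sum.cong refl) (simp add: of_rat_divide of_rat_mult)
    finally show "\<exists>a. x = (\<Sum>i<?d. of_rat (a i) * \<gamma> i)"
      by (rule exI[where x = "\<lambda>i. of_int (a i) / of_nat (N * M)"])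
  qed
  then show ?thesis using mem span unfolding int_basis_def by blast
qed

lemma ring_of_integers_iff [simp]: "x \<in> carrier ring_of_integers \<longleftrightarrow> algebraic_int x"
  by (simp add: ring_of_integers_def)

lemma zlattice_integers: "zlattice {x. algebraic_int x}"
  by (auto simp: zlattice_def algebraic_int_diff)

text \<open>For a rational basis \<open>\<beta>\<close> of integers, an integer x has integral
  traces against \<open>\<beta>\<close>. Hence the ring of integers lies in the integer span of the
  dual basis \<open>\<delta>\<close>, and it contains a multiple of that span.\<close>

lemma ex_int_basis_integers: "\<exists>\<omega> :: nat \<Rightarrow> 'k::number_field. int_basis \<omega> {x. algebraic_int x}"
proof -
  let ?d = "nf_degree TYPE('k)"
  obtain \<beta> :: "nat \<Rightarrow> 'k" where \<beta>: "rat_basis \<beta>" "\<And>i. algebraic_int (\<beta> i)"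
    using ex_rat_basis_integral by blast
  have "\<forall>j. \<exists>\<alpha>. \<forall>i<?d. trace_K (\<alpha> * \<beta> i) = of_rat (if i = j then 1 else 0)"
    by (intro allI trace_K_functional[OF \<beta>(1)])
  then obtain \<delta> where \<delta>: "\<And>j i. i < ?d \<Longrightarrow> trace_K (\<delta> j * \<beta> i) = of_rat (if i = j then 1 else 0)" by metis
  \<comment> \<open>The coordinates in the dual basis are the traces against \<open>\<beta>\<close>:
    the difference of the two sides is orthogonal to all \<open>\<beta> i\<close>, hence to
    K.\<close>
  have exp: "x = (\<Sum>j<?d. of_rat (a j) * \<delta> j)" if a: "\<And>i. i < ?d \<Longrightarrow> trace_K (x * \<beta> i) = of_rat (a i)" for x a
  proof -
    let ?y = "x - (\<Sum>j<?d. of_rat (a j) * \<delta> j)"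
    have add: "trace_K (y + z) = trace_K y + trace_K z" for y z :: 'k by (rule trace_K_add)
    have z: "trace_K (?y * \<beta> i) = 0" if i: "i < ?d" for i
    proof -
      have "?y * \<beta> i = x * \<beta> i + - (\<Sum>j<?d. of_rat (a j) * (\<delta> j * \<beta> i))"
        by (simp add: left_diff_distrib sum_distrib_right mult.assoc)
      then have "trace_K (?y * \<beta> i) = of_rat (a i) - (\<Sum>j<?d. of_rat (a j) * trace_K (\<delta> j * \<beta> i))"
        by (simp only: add additive_uminus[of trace_K, OF add] additive_sum'[of trace_K, OF add]
            additive_of_rat[of trace_K, OF add] a[OF i]) simp
      also have "(\<Sum>j<?d. of_rat (a j) * trace_K (\<delta> j * \<beta> i)) = (\<Sum>j<?d. if j = i then of_rat (a i) else 0)"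
        by (rule sum.cong[OF refl]) (simp add: \<delta>[OF i])
      also have "\<dots> = of_rat (a i)" using i by simp
      finally show ?thesis by simp
    qed
    have "trace_K (?y * w) = 0" for w
    proof -
      obtain b where b: "w = (\<Sum>i<?d. of_rat (b i) * \<beta> i)" using \<beta>(1) unfolding rat_basis_def by blast
      have "?y * w = (\<Sum>i<?d. of_rat (b i) * (?y * \<beta> i))"
        unfolding b sum_distrib_left by (intro sum.cong refl) (rule mult.left_commute)
      then show ?thesis
        by (simp only: additive_sum'[of trace_K, OF add] additive_of_rat[of trace_K, OF add]) (simp add: z)
    qed
    then have "?y = 0" by (rule trace_K_nondegenerate)
    then show ?thesis by simp
  qed
  have \<delta>b: "rat_basis \<delta>" unfolding rat_basis_def
  proof
    fix x
    have "\<forall>i. \<exists>r. trace_K (x * \<beta> i) = of_rat r" using trace_K_rational by blast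
    then obtain a where "\<And>i. trace_K (x * \<beta> i) = of_rat (a i)" by metis
    then have "x = (\<Sum>j<?d. of_rat (a j) * \<delta> j)" by (intro exp)
    then show "\<exists>a. x = (\<Sum>i<?d. of_rat (a i) * \<delta> i)" by blast
  qed
  have "\<forall>i. \<exists>N>0. algebraic_int (of_nat N * \<delta> i)" using algebraic_int_multiple by metis
  then obtain M where M: "\<And>i. M i > 0" "\<And>i. algebraic_int (of_nat (M i) * \<delta> i)" by metis
  \<comment> \<open>A single multiplier for all dual basis elements at once.\<close>
  let ?N = "\<Prod>i<?d. M i"
  show ?thesis
  proof (rule ex_int_basis[OF zlattice_integers \<delta>b, of ?N])
    fix x :: 'k assume "x \<in> {x. algebraic_int x}"
    then have "trace_K (x * \<beta> i) \<in> \<int>" for i by (auto intro!: trace_K_int algebraic_int_times \<beta>(2))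
    then have "\<forall>i. \<exists>z::int. trace_K (x * \<beta> i) = of_int z" by (meson Ints_cases)
    then obtain z :: "nat \<Rightarrow> int" where "\<And>i. trace_K (x * \<beta> i) = of_int (z i)" by metis
    then have "x = (\<Sum>j<?d. of_rat (of_int (z j)) * \<delta> j)" by (intro exp) simp
    then show "\<exists>a::nat \<Rightarrow> int. x = (\<Sum>i<?d. of_int (a i) * \<delta> i)" by auto
  next
    show "?N > 0" using M(1) by (intro prod_pos) auto
    fix i assume "i < ?d"
    then have "?N = (\<Prod>j\<in>{..<?d} - {i}. M j) * M i" by (subst prod.remove[of _ i]) auto
    then have "of_nat ?N * \<delta> i = of_nat (\<Prod>j\<in>{..<?d} - {i}. M j) * (of_nat (M i) * \<delta> i)"
      by (simp only: of_nat_mult mult.assoc)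
    then show "of_nat ?N * \<delta> i \<in> {x. algebraic_int x}"
      by (simp only: mem_Collect_eq algebraic_int_times[OF algebraic_int_of_nat M(2)])
  qed
qed

text \<open>Connects unique integer coordinates with the form used here. Spanning over the rationals
  comes from the integral multiples of every field element; uniqueness from
  \<open>rat_basis_unique_int\<close> and zero padding.\<close>

lemma integral_basis_iff:
  fixes \<omega> :: "nat \<Rightarrow> 'k::number_field"
  shows "integral_basis \<omega> \<longleftrightarrow> int_basis \<omega> {x. algebraic_int x}"
proof
  let ?d = "nf_degree TYPE('k)"
  assume \<omega>: "integral_basis \<omega>"
  have span: "\<exists>a::nat \<Rightarrow> int. x = (\<Sum>i<?d. of_int (a i) * \<omega> i)" if "algebraic_int x" for x
    using \<omega> that unfolding integral_basis_def by auto
  have "rat_basis \<omega>" unfolding rat_basis_def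
  proof
    fix x :: 'k
    obtain N :: nat where N: "N > 0" "algebraic_int (of_nat N * x)" by (rule algebraic_int_multiple)
    obtain a :: "nat \<Rightarrow> int" where a: "of_nat N * x = (\<Sum>i<?d. of_int (a i) * \<omega> i)" using span[OF N(2)] by blast
    have "x = (of_nat N * x) / of_nat N" using N(1) by simp
    also have "\<dots> = (\<Sum>i<?d. of_rat (of_int (a i) / of_nat N) * \<omega> i)"
      unfolding a sum_divide_distrib by (intro sum.cong refl) (simp add: of_rat_divide)
    finally show "\<exists>a. x = (\<Sum>i<?d. of_rat (a i) * \<omega> i)"
      by (rule exI[where x = "\<lambda>i. of_int (a i) / of_nat N"])
  qed
  then show "int_basis \<omega> {x. algebraic_int x}"
    using \<omega> span unfolding int_basis_def integral_basis_def by auto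
next
  let ?d = "nf_degree TYPE('k)"
  assume \<omega>: "int_basis \<omega> {x. algebraic_int x}"
  have "\<exists>!a::nat \<Rightarrow> int. (\<forall>i\<ge>?d. a i = 0) \<and> x = (\<Sum>i<?d. of_int (a i) * \<omega> i)" if "algebraic_int x" for x
  proof -
    have "x \<in> {x. algebraic_int x}" using that by simp
    then obtain a :: "nat \<Rightarrow> int" where a: "x = (\<Sum>i<?d. of_int (a i) * \<omega> i)" by (rule int_basis_coords[OF \<omega>])
    show ?thesis
    proof (rule ex1I[of _ "\<lambda>i. if i < ?d then a i else 0"])
      show "(\<forall>i\<ge>?d. (if i < ?d then a i else 0) = 0) \<and> x = (\<Sum>i<?d. of_int (if i < ?d then a i else 0) * \<omega> i)"
        unfolding a by (auto intro!: sum.cong)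
      fix b :: "nat \<Rightarrow> int" assume b: "(\<forall>i\<ge>?d. b i = 0) \<and> x = (\<Sum>i<?d. of_int (b i) * \<omega> i)"
      have "b i = a i" if "i < ?d" for i
        by (rule rat_basis_unique_int[of \<omega>]) (use \<omega> a b that in \<open>auto simp: int_basis_def\<close>)
      with b show "b = (\<lambda>i. if i < ?d then a i else 0)" by auto
    qed
  qed
  then show "integral_basis \<omega>" using \<omega> unfolding integral_basis_def int_basis_def by auto
qed

section \<open>Ideals and their norms\<close>

lemma ideal_props:
  assumes "ideal \<bb> (ring_of_integers :: 'k::number_field ring)"
  shows "\<bb> \<subseteq> {x. algebraic_int x}" "zlattice \<bb>" "\<And>a x. algebraic_int a \<Longrightarrow> x \<in> \<bb> \<Longrightarrow> a * x \<in> \<bb>"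
proof -
  interpret ideal \<bb> "ring_of_integers :: 'k ring" by (rule assms)
  show "\<bb> \<subseteq> {x. algebraic_int x}" using a_subset by auto
  show mult: "a * x \<in> \<bb>" if "algebraic_int a" "x \<in> \<bb>" for a x
    using I_l_closed[of x a] that by (simp add: ring_of_integers_def)
  show "zlattice \<bb>"
    unfolding zlattice_def
  proof (intro conjI ballI)
    show "0 \<in> \<bb>" using additive_subgroup.zero_closed[OF is_additive_subgroup] by (simp add: ring_of_integers_def)
    fix x y assume xy: "x \<in> \<bb>" "y \<in> \<bb>"
    have "x + (- 1) * y \<in> \<bb>"
      using additive_subgroup.a_closed[OF is_additive_subgroup xy(1) mult[OF _ xy(2), of "- 1"]] by (simp add: ring_of_integers_def)
    then show "x - y \<in> \<bb>" by simp
  qed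
qed

lemma nonzero_ideal_props:
  assumes "\<bb> \<in> (nonzero_ideals :: 'k::number_field set set)"
  shows "\<bb> \<subseteq> {x. algebraic_int x}" "zlattice \<bb>" "\<And>a x. algebraic_int a \<Longrightarrow> x \<in> \<bb> \<Longrightarrow> a * x \<in> \<bb>"
    "\<exists>N>0. of_nat N \<in> \<bb>"
proof -
  have id: "ideal \<bb> (ring_of_integers :: 'k ring)" using assms by (simp add: nonzero_ideals_def)
  note p = ideal_props[OF id]
  show "\<bb> \<subseteq> {x. algebraic_int x}" "zlattice \<bb>" "\<And>a x. algebraic_int a \<Longrightarrow> x \<in> \<bb> \<Longrightarrow> a * x \<in> \<bb>"
    using p by auto
  \<comment> \<open>Some N / \<alpha> is an integer of K; multiplied by \<alpha> it shows that the
    ideal contains the natural number N.\<close>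
  obtain \<alpha> where \<alpha>: "\<alpha> \<in> \<bb>" "\<alpha> \<noteq> 0"
    using assms zlattice_0[OF p(2)] by (auto simp: nonzero_ideals_def)
  obtain N :: nat where N: "N > 0" "algebraic_int (of_nat N * inverse \<alpha>)" by (rule algebraic_int_multiple)
  have "of_nat N * inverse \<alpha> * \<alpha> \<in> \<bb>" by (rule p(3)[OF N(2) \<alpha>(1)])
  then show "\<exists>N>0. of_nat N \<in> \<bb>" using \<alpha>(2) N(1) by (auto simp: mult.assoc)
qed

lemma quotient_carrier:
  "carrier ((ring_of_integers :: 'k::number_field ring) Quot \<bb>) = (\<lambda>x. (\<lambda>b. b + x) ` \<bb>) ` {x. algebraic_int x}"
  unfolding FactRing_def A_RCOSETS_def' a_r_coset_def' by (auto simp: ring_of_integers_def)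

lemma coset_eq_iff:
  assumes L: "zlattice L"
  shows "(\<lambda>b. b + x) ` L = (\<lambda>b. b + y) ` L \<longleftrightarrow> x - y \<in> L"
proof
  assume "(\<lambda>b. b + x) ` L = (\<lambda>b. b + y) ` L"
  moreover have "x \<in> (\<lambda>b. b + x) ` L" using zlattice_0[OF L] by force
  ultimately obtain b where "b \<in> L" "x = b + y" by auto
  then show "x - y \<in> L" by simp
next
  have *: "(\<lambda>b. b + x) ` L \<subseteq> (\<lambda>b. b + y) ` L" if "x - y \<in> L" for x y
  proof (rule image_subsetI)
    fix b assume "b \<in> L"
    then have "b + (x - y) \<in> L" by (rule zlattice_add[OF L _ that])
    then show "b + x \<in> (\<lambda>b. b + y) ` L" by (rule rev_image_eqI) simp
  qed
  assume "x - y \<in> L"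
  moreover from this have "y - x \<in> L" using zlattice_uminus[OF L] by fastforce
  ultimately show "(\<lambda>b. b + x) ` L = (\<lambda>b. b + y) ` L" using * by blast
qed

text \<open>Frees the norm from cosets: any complete system of representatives may be
  counted.\<close>

lemma ideal_norm_eq_card:
  fixes \<bb> R :: "'k::number_field set"
  assumes L: "zlattice \<bb>" and R: "\<And>r. r \<in> R \<Longrightarrow> algebraic_int r"
    and ex1: "\<And>x. algebraic_int x \<Longrightarrow> \<exists>!r. r \<in> R \<and> x - r \<in> \<bb>"
  shows "ideal_norm \<bb> = card R"
proof -
  let ?f = "\<lambda>x. (\<lambda>b. b + x) ` \<bb>"
  have "inj_on ?f R"
  proof (rule inj_onI)
    fix r r' assume r: "r \<in> R" "r' \<in> R" and "?f r = ?f r'"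
    then have "r - r' \<in> \<bb>" by (simp only: coset_eq_iff[OF L])
    moreover have "r - r \<in> \<bb>" using zlattice_0[OF L] by simp
    ultimately show "r = r'" using ex1[OF R[OF r(1)]] r by blast
  qed
  moreover have "?f ` R = carrier (ring_of_integers Quot \<bb>)"
    unfolding quotient_carrier
  proof (intro equalityI image_subsetI)
    fix x :: 'k assume "x \<in> {x. algebraic_int x}"
    then obtain r where r: "r \<in> R" "x - r \<in> \<bb>" using ex1 by blast
    then have "?f x = ?f r" by (simp only: coset_eq_iff[OF L])
    with r(1) show "?f x \<in> ?f ` R" by (rule rev_image_eqI)
  qed (use R in auto)
  ultimately show ?thesis unfolding ideal_norm_def by (metis card_image)
qed

text \<open>Coordinates with respect to \<open>\<omega>\<close> identify the residue ring, as a
  group, with the quotient of the integer vectors by the coordinate lattice of the ideal;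
  \<open>\<gamma>\<close> has the rows of \<open>A\<close> as coordinates.\<close>

lemma ideal_norm_eq_det:
  fixes \<omega> \<gamma> :: "nat \<Rightarrow> 'k::number_field"
  assumes \<omega>: "int_basis \<omega> {x. algebraic_int x}" and \<gamma>: "int_basis \<gamma> \<bb>"
    and sub: "\<bb> \<subseteq> {x. algebraic_int x}" and L: "zlattice \<bb>" and N: "N > 0" "\<And>i. of_nat N * \<omega> i \<in> \<bb> \<or> i \<ge> nf_degree TYPE('k)"
    and A: "\<And>j. j < nf_degree TYPE('k) \<Longrightarrow> \<gamma> j = (\<Sum>i<nf_degree TYPE('k). of_int (A j i) * \<omega> i)"
  shows "int (ideal_norm \<bb>) = \<bar>Determinant.det (Matrix.mat (nf_degree TYPE('k)) (nf_degree TYPE('k)) (\<lambda>(i, j). A i j))\<bar>"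
    and "ideal_norm \<bb> > 0"
proof -
  let ?d = "nf_degree TYPE('k)"
  let ?c = "\<lambda>a::nat \<Rightarrow> int. \<Sum>i<?d. of_int (a i) * \<omega> i"
  let ?L = "coord_lattice \<omega> \<bb>"
  have il: "int_lattice ?d ?L" by (rule int_lattice_coord_lattice[OF L N(1)]) (use N(2) in force)
  have \<omega>b: "rat_basis \<omega>" using \<omega> by (simp add: int_basis_def)
  have uniq: "(\<And>i. i < ?d \<Longrightarrow> a i = b i)" if "?c a = ?c b" for a b
    by (rule rat_basis_unique_int[OF \<omega>b that])
  \<comment> \<open>The rows of \<open>A\<close> may be arbitrary from the degree on and are cut off
    there to become members of the coordinate lattice.\<close>
  define u where "u = (\<lambda>j i. if i < ?d then A j i else 0)"
  have cu: "?c (u j) = \<gamma> j" if "j < ?d" for j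
    unfolding A[OF that] u_def by (rule sum.cong) auto
  have "\<exists>R. lattice_reps ?d ?L R \<and> int (card R) = \<bar>Determinant.det (Matrix.mat ?d ?d (\<lambda>(i, j). u i j))\<bar> \<and> card R > 0"
  proof (rule index_eq_det[OF il])
    show "u j \<in> ?L" if "j < ?d" for j
      using \<gamma> that cu[OF that] by (simp add: coord_lattice_def int_basis_def) (simp add: u_def)
    fix x assume x: "x \<in> ?L"
    then have "?c x \<in> \<bb>" by (simp add: coord_lattice_def)
    then obtain a :: "nat \<Rightarrow> int" where a: "?c x = (\<Sum>j<?d. of_int (a j) * \<gamma> j)" by (rule int_basis_coords[OF \<gamma>])
    have "?c x = ?c (\<lambda>i. \<Sum>j<?d. a j * u j i)"
    proof -
      have "?c x = (\<Sum>j<?d. \<Sum>i<?d. of_int (a j) * (of_int (u j i) * \<omega> i))"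
        unfolding a by (rule sum.cong) (auto simp: cu[symmetric] sum_distrib_left)
      also have "\<dots> = (\<Sum>i<?d. \<Sum>j<?d. of_int (a j) * (of_int (u j i) * \<omega> i))" by (rule sum.swap)
      also have "\<dots> = ?c (\<lambda>i. \<Sum>j<?d. a j * u j i)" unfolding of_int_sum of_int_mult sum_distrib_right mult.assoc ..
      finally show ?thesis .
    qed
    then have *: "x i = (\<Sum>j<?d. a j * u j i)" if "i < ?d" for i using uniq[of x "\<lambda>i. \<Sum>j<?d. a j * u j i"] that by blast
    have "x i = (\<Sum>j<?d. a j * u j i)" for i
      using * x by (cases "i < ?d") (auto simp: coord_lattice_def u_def)
    then show "\<exists>a. \<forall>i. x i = (\<Sum>j<?d. a j * u j i)" by blast
  qed
  then obtain R where R: "lattice_reps ?d ?L R" "int (card R) = \<bar>Determinant.det (Matrix.mat ?d ?d (\<lambda>(i, j). u i j))\<bar>" "card R > 0"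
    by blast
  have Rs: "\<forall>i\<ge>?d. r i = 0" if "r \<in> R" for r using R(1) that by (auto simp: lattice_reps_def)
  have inj: "inj_on ?c R"
  proof (rule inj_onI)
    fix r r' assume r: "r \<in> R" "r' \<in> R" "?c r = ?c r'"
    show "r = r'"
    proof
      fix i show "r i = r' i" using uniq[OF r(3), of i] Rs[OF r(1)] Rs[OF r(2)] by (cases "i < ?d") auto
    qed
  qed
  have "ideal_norm \<bb> = card (?c ` R)"
  proof (rule ideal_norm_eq_card[OF L])
    fix x assume "x \<in> ?c ` R"
    then obtain a where "x = ?c a" by blast
    then show "algebraic_int x" using int_basis_iff[OF \<omega> zlattice_integers, of x] by blast
  next
    fix x :: 'k assume "algebraic_int x"
    then have "x \<in> {x. algebraic_int x}" by simp
    then obtain a0 :: "nat \<Rightarrow> int" where a0: "x = ?c a0" by (rule int_basis_coords[OF \<omega>])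
    define a where "a = (\<lambda>i. if i < ?d then a0 i else 0)"
    have a: "x = ?c a" unfolding a0 a_def by (rule sum.cong) auto
    have mem: "x - ?c r \<in> \<bb> \<longleftrightarrow> (\<lambda>i. a i - r i) \<in> ?L" if "r \<in> R" for r
      using Rs[OF that] by (simp add: coord_lattice_def a left_diff_distrib sum_subtractf) (simp add: a_def)
    have "\<forall>i\<ge>?d. a i = 0" by (simp add: a_def)
    then have "\<exists>!r. r \<in> R \<and> (\<lambda>i. a i - r i) \<in> ?L" using R(1) by (simp only: lattice_reps_def)
    then obtain r where r: "r \<in> R" "(\<lambda>i. a i - r i) \<in> ?L" "\<And>r'. r' \<in> R \<Longrightarrow> (\<lambda>i. a i - r' i) \<in> ?L \<Longrightarrow> r' = r" by blast
    show "\<exists>!y. y \<in> ?c ` R \<and> x - y \<in> \<bb>"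
    proof (rule ex1I[of _ "?c r"])
      show "?c r \<in> ?c ` R \<and> x - ?c r \<in> \<bb>" using r mem by blast
      fix y assume "y \<in> ?c ` R \<and> x - y \<in> \<bb>"
      then obtain r' where r': "r' \<in> R" "y = ?c r'" "x - ?c r' \<in> \<bb>" by auto
      then show "y = ?c r" using r(3)[OF r'(1)] mem[OF r'(1)] by blast
    qed
  qed
  then have card: "ideal_norm \<bb> = card R" by (simp add: card_image[OF inj])
  have "Matrix.mat ?d ?d (\<lambda>(i, j). u i j) = Matrix.mat ?d ?d (\<lambda>(i, j). A i j)"
    by (rule eq_matI) (auto simp: u_def)
  then show "int (ideal_norm \<bb>) = \<bar>Determinant.det (Matrix.mat ?d ?d (\<lambda>(i, j). A i j))\<bar>" "ideal_norm \<bb> > 0"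
    using card R(2,3) by simp_all
qed

lemma rat_basis_coordinates:
  fixes \<beta> :: "nat \<Rightarrow> 'k::number_field"
  assumes "rat_basis \<beta>"
  obtains q where "\<And>x. x = (\<Sum>i<nf_degree TYPE('k). of_rat (q x i) * \<beta> i)" "\<And>x y i. q (x + y) i = q x i + q y i"
proof -
  let ?d = "nf_degree TYPE('k)"
  have "\<forall>x. \<exists>a::nat \<Rightarrow> rat. x = (\<Sum>i<?d. of_rat (a i) * \<beta> i)" using assms unfolding rat_basis_def .
  then obtain a where a: "\<And>x. x = (\<Sum>i<?d. of_rat (a x i) * \<beta> i)" by metis
  define q where "q = (\<lambda>x i. if i < ?d then a x i else 0)"
  have q: "x = (\<Sum>i<?d. of_rat (q x i) * \<beta> i)" for x
    by (subst a) (auto simp: q_def intro: sum.cong)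
  have add: "q (x + y) i = q x i + q y i" for x y i
  proof (cases "i < ?d")
    case True
    show ?thesis
    proof (rule rat_basis_unique[OF assms _ True])
      have "(\<Sum>i<?d. of_rat (q (x + y) i) * \<beta> i) = (\<Sum>i<?d. of_rat (q x i) * \<beta> i) + (\<Sum>i<?d. of_rat (q y i) * \<beta> i)"
        by (simp only: q[symmetric])
      then show "(\<Sum>i<?d. of_rat (q (x + y) i) * \<beta> i) = (\<Sum>i<?d. of_rat (q x i + q y i) * \<beta> i)"
        by (simp only: of_rat_add distrib_right sum.distrib)
    qed
  qed (simp add: q_def)
  show thesis by (rule that[OF q add])
qed

lemma enumerate_embeddings:
  obtains \<tau> :: "nat \<Rightarrow> 'k::number_field \<Rightarrow> complex" where "bij_betw \<tau> {..<nf_degree TYPE('k)} embeddings"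
  using ex_bij_betw_nat_finite[OF finite_embeddings[where 'k = 'k]] card_embeddings[where 'k = 'k]
  by (auto simp: atLeast0LessThan)

text \<open>The dual coefficients of the coordinate functions form a left inverse of the
  matrix.\<close>

lemma det_embeddings_nonzero:
  fixes \<beta> :: "nat \<Rightarrow> 'k::number_field"
  assumes \<beta>: "rat_basis \<beta>" and \<tau>: "bij_betw \<tau> {..<nf_degree TYPE('k)} embeddings"
  shows "Determinant.det (Matrix.mat (nf_degree TYPE('k)) (nf_degree TYPE('k)) (\<lambda>(i, j). \<tau> j (\<beta> i))) \<noteq> 0"
proof -
  let ?d = "nf_degree TYPE('k)"
  obtain q where q: "\<And>x. x = (\<Sum>i<?d. of_rat (q x i) * \<beta> i)" "\<And>x y i. q (x + y) i = q x i + q y i"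
    by (rule rat_basis_coordinates[OF \<beta>]) (rule that)
  obtain C where C: "\<And>\<tau> \<sigma>. \<tau> \<in> embeddings \<Longrightarrow> \<sigma> \<in> embeddings \<Longrightarrow>
      (\<Sum>i<?d. C i \<tau> * \<sigma> (\<beta> i)) = (if \<tau> = \<sigma> then 1 else 0)"
    by (rule embeddings_dual_coefficients[of q \<beta>, OF q]) (rule that)
  let ?M = "Matrix.mat ?d ?d (\<lambda>(i, j). \<tau> j (\<beta> i))" and ?C = "Matrix.mat ?d ?d (\<lambda>(k, i). C i (\<tau> k))"
  have mem: "\<tau> k \<in> embeddings" if "k < ?d" for k using \<tau> that by (auto simp: bij_betw_def)
  have "?C * ?M = 1\<^sub>m ?d"
    by (rule eq_matI)
      (use \<tau> in \<open>auto simp: scalar_prod_def atLeast0LessThan C mem bij_betw_def inj_on_def\<close>)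
  then have "Determinant.det ?C * Determinant.det ?M = 1"
    using det_mult[of ?C ?d ?M] by simp
  then show ?thesis by auto
qed

text \<open>The elements \<alpha> \<omega>_i form a basis of the ideal, so its norm is the absolute
  determinant of multiplication by \<alpha>. The matrix of embeddings diagonalises this
  multiplication, with the conjugates of \<alpha> on the diagonal.\<close>

theorem ideal_norm_principal:
  fixes \<alpha> :: "'k::number_field"
  assumes "algebraic_int \<alpha>"
  shows "real (ideal_norm (cgenideal ring_of_integers \<alpha>)) = cmod (\<Prod>\<tau>\<in>embeddings. \<tau> \<alpha>)"
proof -
  let ?d = "nf_degree TYPE('k)"
  have gen: "cgenideal ring_of_integers \<alpha> = {x * \<alpha> |x. algebraic_int x}"
    by (auto simp: cgenideal_def ring_of_integers_def)
  show ?thesis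
  proof (cases "\<alpha> = 0")
    \<comment> \<open>The quotient by the zero ideal is infinite, so its \<open>card\<close> is 0,
      in agreement with the vanishing product.\<close>
    case True
    obtain \<tau> :: "'k \<Rightarrow> complex" where \<tau>: "\<tau> \<in> embeddings" using embeddings_nonempty by blast
    have "(\<Prod>\<tau>\<in>embeddings. \<tau> \<alpha>) = 0"
      by (rule prod_zero[OF finite_embeddings], rule bexI[OF _ \<tau>])
        (simp add: True additive_0[of \<tau>, OF embedding_add[OF \<tau>]])
    moreover have "ideal_norm (cgenideal ring_of_integers \<alpha>) = card {x::'k. algebraic_int x}"
    proof -
      have "cgenideal ring_of_integers \<alpha> = {0}" unfolding gen by (auto simp: True intro: exI[of _ 0])
      moreover have "ideal_norm {0::'k} = card {x::'k. algebraic_int x}"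
        by (rule ideal_norm_eq_card) (auto simp: zlattice_def)
      ultimately show ?thesis by simp
    qed
    moreover have "infinite {x::'k. algebraic_int x}"
    proof
      assume fin: "finite {x::'k. algebraic_int x}"
      have "range (of_nat :: nat \<Rightarrow> 'k) \<subseteq> {x::'k. algebraic_int x}" by auto
      then have "finite (range (of_nat :: nat \<Rightarrow> 'k))" using fin by (rule finite_subset)
      then show False using finite_imageD[of "of_nat :: nat \<Rightarrow> 'k" UNIV] by (simp add: inj_on_def)
    qed
    ultimately show ?thesis by simp
  next
    case False
    define \<bb> where "\<bb> = {x * \<alpha> |x. algebraic_int x}"
    obtain \<omega> :: "nat \<Rightarrow> 'k" where \<omega>: "int_basis \<omega> {x. algebraic_int x}" using ex_int_basis_integers by blast
    have \<omega>b: "rat_basis \<omega>" and \<omega>i: "\<And>i. i < ?d \<Longrightarrow> algebraic_int (\<omega> i)"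
      using \<omega> by (auto simp: int_basis_def)
    have L: "zlattice \<bb>" unfolding zlattice_def \<bb>_def
    proof (safe)
      show "\<exists>x. 0 = x * \<alpha> \<and> algebraic_int x" by (rule exI[of _ 0]) simp
      fix x y :: 'k assume "algebraic_int x" "algebraic_int y"
      then show "\<exists>z. x * \<alpha> - y * \<alpha> = z * \<alpha> \<and> algebraic_int z"
        by (intro exI[of _ "x - y"]) (simp add: left_diff_distrib algebraic_int_diff)
    qed
    have sub: "\<bb> \<subseteq> {x. algebraic_int x}"
      unfolding \<bb>_def by (auto intro: algebraic_int_times assms)
    obtain N :: nat where N: "N > 0" "algebraic_int (of_nat N * inverse \<alpha>)" by (rule algebraic_int_multiple)
    have Nmem: "of_nat N * \<omega> i \<in> \<bb> \<or> i \<ge> ?d" for i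
    proof (cases "i < ?d")
      case True
      have "of_nat N * \<omega> i = (of_nat N * inverse \<alpha> * \<omega> i) * \<alpha>" using False by simp
      moreover have "algebraic_int (of_nat N * inverse \<alpha> * \<omega> i)" by (rule algebraic_int_times[OF N(2) \<omega>i[OF True]])
      ultimately show ?thesis unfolding \<bb>_def by blast
    qed simp
    have \<gamma>: "int_basis (\<lambda>i. \<omega> i * \<alpha>) \<bb>"
      unfolding int_basis_def
    proof (intro conjI allI impI ballI)
      show "rat_basis (\<lambda>i. \<omega> i * \<alpha>)" unfolding rat_basis_def
      proof
        fix x
        have "\<exists>a. x * inverse \<alpha> = (\<Sum>i<?d. of_rat (a i) * \<omega> i)" using \<omega>b unfolding rat_basis_def ..
        then obtain a where a: "x * inverse \<alpha> = (\<Sum>i<?d. of_rat (a i) * \<omega> i)" ..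
        have "x = (x * inverse \<alpha>) * \<alpha>" using False by simp
        also have "\<dots> = (\<Sum>i<?d. of_rat (a i) * (\<omega> i * \<alpha>))" unfolding a by (simp only: sum_distrib_right mult.assoc)
        finally show "\<exists>a. x = (\<Sum>i<?d. of_rat (a i) * (\<omega> i * \<alpha>))" by (rule exI[where x = a])
      qed
      show "\<omega> i * \<alpha> \<in> \<bb>" if "i < ?d" for i unfolding \<bb>_def using \<omega>i[OF that] by blast
      fix x assume "x \<in> \<bb>"
      then obtain y where y: "x = y * \<alpha>" "algebraic_int y" unfolding \<bb>_def by blast
      then have "y \<in> {x. algebraic_int x}" by simp
      then obtain a :: "nat \<Rightarrow> int" where a: "y = (\<Sum>i<?d. of_int (a i) * \<omega> i)" by (rule int_basis_coords[OF \<omega>])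
      have "x = (\<Sum>i<?d. of_int (a i) * (\<omega> i * \<alpha>))" unfolding y(1) a by (simp only: sum_distrib_right mult.assoc)
      then show "\<exists>a::nat \<Rightarrow> int. x = (\<Sum>i<?d. of_int (a i) * (\<omega> i * \<alpha>))" by (rule exI[where x = a])
    qed
    have "\<forall>j. \<exists>a::nat \<Rightarrow> int. j < ?d \<longrightarrow> \<omega> j * \<alpha> = (\<Sum>i<?d. of_int (a i) * \<omega> i)"
    proof
      fix j
      show "\<exists>a::nat \<Rightarrow> int. j < ?d \<longrightarrow> \<omega> j * \<alpha> = (\<Sum>i<?d. of_int (a i) * \<omega> i)"
      proof (cases "j < ?d")
        case True
        then have "\<omega> j * \<alpha> \<in> {x. algebraic_int x}" by (simp add: algebraic_int_times \<omega>i assms)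
        then obtain a :: "nat \<Rightarrow> int" where "\<omega> j * \<alpha> = (\<Sum>i<?d. of_int (a i) * \<omega> i)" by (rule int_basis_coords[OF \<omega>])
        then show ?thesis by (intro exI[of _ a] impI)
      qed simp
    qed
    then obtain A :: "nat \<Rightarrow> nat \<Rightarrow> int" where A: "\<And>j. j < ?d \<Longrightarrow> \<omega> j * \<alpha> = (\<Sum>i<?d. of_int (A j i) * \<omega> i)" by metis
    let ?A = "Matrix.mat ?d ?d (\<lambda>(i, j). A i j)"
    have norm: "int (ideal_norm \<bb>) = \<bar>Determinant.det ?A\<bar>"
      by (rule ideal_norm_eq_det(1)[OF \<omega> \<gamma> sub L N(1) Nmem A])
    obtain \<tau> :: "nat \<Rightarrow> 'k \<Rightarrow> complex" where \<tau>: "bij_betw \<tau> {..<?d} embeddings" by (rule enumerate_embeddings)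
    have mem: "\<tau> k \<in> embeddings" if "k < ?d" for k using \<tau> that by (auto simp: bij_betw_def)
    let ?M = "Matrix.mat ?d ?d (\<lambda>(i, j). \<tau> j (\<omega> i))"
    let ?D = "Matrix.mat ?d ?d (\<lambda>(i, j). if i = j then \<tau> i \<alpha> else 0)"
    let ?Ac = "map_mat (of_int :: int \<Rightarrow> complex) ?A"
    \<comment> \<open>Entry (i, k) on both sides is the k-th embedding of \<omega>_i
      \<alpha>.\<close>
    have "?Ac * ?M = ?M * ?D"
    proof (rule eq_matI)
      fix i k assume "i < dim_row (?M * ?D)" "k < dim_col (?M * ?D)"
      then have ik: "i < ?d" "k < ?d" by auto
      note add = embedding_add[OF mem[OF ik(2)]]
      have "(?Ac * ?M) $$ (i, k) = (\<Sum>j<?d. of_int (A i j) * \<tau> k (\<omega> j))"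
        using ik by (simp add: scalar_prod_def atLeast0LessThan)
      also have "\<dots> = \<tau> k (\<omega> i * \<alpha>)"
        unfolding A[OF ik(1)] additive_sum'[of "\<tau> k", OF add] additive_of_int[of "\<tau> k", OF add] ..
      also have "\<dots> = \<tau> k (\<omega> i) * \<tau> k \<alpha>" by (rule embedding_mult[OF mem[OF ik(2)]])
      also have "\<dots> = (\<Sum>j<?d. if j = k then \<tau> j (\<omega> i) * \<tau> j \<alpha> else 0)" using ik by simp
      also have "\<dots> = (\<Sum>j<?d. \<tau> j (\<omega> i) * (if j = k then \<tau> j \<alpha> else 0))" by (rule sum.cong) auto
      also have "\<dots> = (?M * ?D) $$ (i, k)"
        using ik by (simp add: scalar_prod_def atLeast0LessThan)
      finally show "(?Ac * ?M) $$ (i, k) = (?M * ?D) $$ (i, k)" .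
    qed auto
    moreover have "Determinant.det (?Ac * ?M) = Determinant.det ?Ac * Determinant.det ?M"
      by (rule det_mult[of _ ?d]) auto
    moreover have "Determinant.det (?M * ?D) = Determinant.det ?M * Determinant.det ?D"
      by (rule det_mult[of _ ?d]) auto
    ultimately have "Determinant.det ?M * Determinant.det ?Ac = Determinant.det ?M * Determinant.det ?D"
      by (simp only: mult.commute)
    then have "Determinant.det ?Ac = Determinant.det ?D"
      by (simp only: mult_left_cancel[OF det_embeddings_nonzero[OF \<omega>b \<tau>]])
    also have "Determinant.det ?D = prod_list (diag_mat ?D)" by (rule det_lower_triangular[of ?d]) auto
    also have "\<dots> = (\<Prod>i<?d. \<tau> i \<alpha>)" by (simp add: prod_list_diag_prod atLeast0LessThan)
    also have "\<dots> = (\<Prod>\<tau>\<in>embeddings. \<tau> \<alpha>)" by (rule prod.reindex_bij_betw[OF \<tau>])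
    finally have det: "Determinant.det ?Ac = (\<Prod>\<tau>\<in>embeddings. \<tau> \<alpha>)" .
    have "Determinant.det ?Ac = of_int (Determinant.det ?A)" by (rule of_int_hom.hom_det)
    then have "cmod (\<Prod>\<tau>\<in>embeddings. \<tau> \<alpha>) = \<bar>real_of_int (Determinant.det ?A)\<bar>"
      unfolding det[symmetric] by simp
    also have "\<dots> = real_of_int \<bar>Determinant.det ?A\<bar>" by simp
    also have "\<dots> = real (ideal_norm \<bb>)" unfolding norm[symmetric] by simp
    finally show ?thesis unfolding gen \<bb>_def by simp
  qed
qed

text \<open>The trace matrix is the matrix of embeddings times its transpose. The basis chosen by
  \<open>SOME\<close> is integral because integral bases exist, and it is handed on so that later
  determinants refer to the same basis.\<close>

lemma abs_discriminant_eq: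
  fixes \<tau> :: "nat \<Rightarrow> 'k::number_field \<Rightarrow> complex"
  assumes \<tau>: "bij_betw \<tau> {..<nf_degree TYPE('k)} embeddings"
  obtains \<omega> :: "nat \<Rightarrow> 'k" where "int_basis \<omega> {x. algebraic_int x}"
    "abs_discriminant TYPE('k) = (cmod (Determinant.det (Matrix.mat (nf_degree TYPE('k)) (nf_degree TYPE('k)) (\<lambda>(i, j). \<tau> j (\<omega> i)))))\<^sup>2"
proof -
  let ?d = "nf_degree TYPE('k)"
  define \<omega> :: "nat \<Rightarrow> 'k" where "\<omega> = (SOME \<omega>. integral_basis \<omega>)"
  have "\<exists>\<omega> :: nat \<Rightarrow> 'k. integral_basis \<omega>" unfolding integral_basis_iff by (rule ex_int_basis_integers)
  then have \<omega>: "int_basis \<omega> {x. algebraic_int x}"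
    unfolding \<omega>_def integral_basis_iff[symmetric] by (rule someI_ex)
  let ?M = "Matrix.mat ?d ?d (\<lambda>(i, j). \<tau> j (\<omega> i))"
  have mem: "\<tau> k \<in> embeddings" if "k < ?d" for k using \<tau> that by (auto simp: bij_betw_def)
  have "Matrix.mat ?d ?d (\<lambda>(i, j). trace_K (\<omega> i * \<omega> j)) = ?M * transpose_mat ?M"
  proof (rule eq_matI)
    fix i j assume "i < dim_row (?M * transpose_mat ?M)" "j < dim_col (?M * transpose_mat ?M)"
    then have ij: "i < ?d" "j < ?d" by auto
    have "trace_K (\<omega> i * \<omega> j) = (\<Sum>k<?d. \<tau> k (\<omega> i * \<omega> j))"
      unfolding trace_K_def by (rule sum.reindex_bij_betw[OF \<tau>, symmetric])
    also have "\<dots> = (\<Sum>k<?d. \<tau> k (\<omega> i) * \<tau> k (\<omega> j))" by (rule sum.cong) (auto simp: embedding_mult mem)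
    finally show "Matrix.mat ?d ?d (\<lambda>(i, j). trace_K (\<omega> i * \<omega> j)) $$ (i, j) = (?M * transpose_mat ?M) $$ (i, j)"
      using ij by (simp add: scalar_prod_def atLeast0LessThan)
  qed auto
  moreover have "Determinant.det (?M * transpose_mat ?M) = Determinant.det ?M * Determinant.det ?M"
    using det_mult[of ?M ?d "transpose_mat ?M"] det_transpose[of ?M ?d] by simp
  ultimately have "abs_discriminant TYPE('k) = (cmod (Determinant.det ?M))\<^sup>2"
    unfolding abs_discriminant_def Let_def \<omega>_def[symmetric] by (simp add: norm_mult power2_eq_square)
  with \<omega> show thesis by (rule that)
qed

section \<open>Residue classes, dual ideals and finiteness\<close>

text \<open>The ideal contains a natural number N, so it lies between N times the ring of integers
  and the ring itself.\<close>

lemma ideal_int_basis: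
  fixes \<omega> :: "nat \<Rightarrow> 'k::number_field"
  assumes \<omega>: "int_basis \<omega> {x. algebraic_int x}" and \<bb>: "\<bb> \<in> nonzero_ideals"
  obtains \<gamma> A where "int_basis \<gamma> \<bb>"
    "\<And>j. j < nf_degree TYPE('k) \<Longrightarrow> \<gamma> j = (\<Sum>i<nf_degree TYPE('k). of_int (A j i) * \<omega> i)"
    "int (ideal_norm \<bb>) = \<bar>Determinant.det (Matrix.mat (nf_degree TYPE('k)) (nf_degree TYPE('k)) (\<lambda>(i, j). A i j))\<bar>"
    "ideal_norm \<bb> > 0"
proof -
  let ?d = "nf_degree TYPE('k)"
  note p = nonzero_ideal_props[OF \<bb>]
  obtain N where N: "N > 0" "of_nat N \<in> \<bb>" using p(4) by blast
  have Nmem: "of_nat N * \<omega> i \<in> \<bb>" if "i < ?d" for i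
  proof -
    have "algebraic_int (\<omega> i)" using \<omega> that by (auto simp: int_basis_def)
    from p(3)[OF this N(2)] show ?thesis by (simp add: mult.commute)
  qed
  have span: "\<exists>a::nat \<Rightarrow> int. x = (\<Sum>i<?d. of_int (a i) * \<omega> i)" if "x \<in> \<bb>" for x
  proof -
    have "x \<in> {x. algebraic_int x}" using that p(1) by blast
    then obtain a :: "nat \<Rightarrow> int" where "x = (\<Sum>i<?d. of_int (a i) * \<omega> i)" by (rule int_basis_coords[OF \<omega>])
    then show ?thesis by (rule exI[where x = a])
  qed
  have \<omega>b: "rat_basis \<omega>" using \<omega> by (simp add: int_basis_def)
  obtain \<gamma> where \<gamma>: "int_basis \<gamma> \<bb>" using ex_int_basis[OF p(2) \<omega>b span N(1) Nmem] by blast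
  have "\<forall>j. \<exists>a::nat \<Rightarrow> int. j < ?d \<longrightarrow> \<gamma> j = (\<Sum>i<?d. of_int (a i) * \<omega> i)"
  proof
    fix j
    show "\<exists>a::nat \<Rightarrow> int. j < ?d \<longrightarrow> \<gamma> j = (\<Sum>i<?d. of_int (a i) * \<omega> i)"
    proof (cases "j < ?d")
      case True
      then have "\<gamma> j \<in> \<bb>" using \<gamma> by (auto simp: int_basis_def)
      from span[OF this] obtain a :: "nat \<Rightarrow> int" where "\<gamma> j = (\<Sum>i<?d. of_int (a i) * \<omega> i)" ..
      then show ?thesis by (intro exI[of _ a] impI)
    qed simp
  qed
  then obtain A :: "nat \<Rightarrow> nat \<Rightarrow> int" where A: "\<And>j. j < ?d \<Longrightarrow> \<gamma> j = (\<Sum>i<?d. of_int (A j i) * \<omega> i)" by metis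
  have "of_nat N * \<omega> i \<in> \<bb> \<or> i \<ge> ?d" for i using Nmem[of i] by linarith
  from ideal_norm_eq_det[OF \<omega> \<gamma> p(1,2) N(1) this A]
  show thesis by (intro that[OF \<gamma> A]) auto
qed

lemma ideal_norm_pos: "\<bb> \<in> nonzero_ideals \<Longrightarrow> ideal_norm \<bb> > 0"
proof -
  assume \<bb>: "\<bb> \<in> (nonzero_ideals :: 'a set set)"
  obtain \<omega> :: "nat \<Rightarrow> 'a" where \<omega>: "int_basis \<omega> {x. algebraic_int x}" using ex_int_basis_integers by blast
  show ?thesis by (rule ideal_int_basis[OF \<omega> \<bb>])
qed

text \<open>An infinite set has \<open>card\<close> 0, so a positive norm already means a finite
  quotient.\<close>

lemma finite_quotient:
  assumes "\<bb> \<in> nonzero_ideals"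
  shows "finite (carrier (ring_of_integers Quot \<bb>))"
  using ideal_norm_pos[OF assms] unfolding ideal_norm_def by (rule card_ge_0_finite)

lemma
  assumes \<bb>: "\<bb> \<in> (nonzero_ideals :: 'k::number_field set set)"
  shows finite_residue_reps: "finite (residue_reps \<bb>)"
    and residue_reps_integral: "a \<in> residue_reps \<bb> \<Longrightarrow> algebraic_int a"
    and residue_reps_ex1: "algebraic_int x \<Longrightarrow> \<exists>!a. a \<in> residue_reps \<bb> \<and> x - a \<in> \<bb>"
proof -
  note p = nonzero_ideal_props[OF \<bb>]
  let ?f = "\<lambda>x. (\<lambda>b. b + x) ` \<bb>"
  define g where "g = (\<lambda>x. SOME a. a \<in> ?f x)"
  have reps: "residue_reps \<bb> = g ` {x. algebraic_int x}"
    unfolding residue_reps_def quotient_carrier g_def by (simp add: image_image)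
  have g: "g x \<in> ?f x" for x
  proof -
    have "x \<in> ?f x" using zlattice_0[OF p(2)] by force
    then show ?thesis unfolding g_def by (rule someI)
  qed
  have gd: "x - g x \<in> \<bb>" for x
  proof -
    obtain b where "b \<in> \<bb>" "g x = b + x" using g[of x] by blast
    then show ?thesis using zlattice_uminus[OF p(2), of b] by simp
  qed
  show "finite (residue_reps \<bb>)" unfolding residue_reps_def by (intro finite_imageI finite_quotient \<bb>)
  show "algebraic_int a" if "a \<in> residue_reps \<bb>" for a
  proof -
    obtain y where y: "a = g y" "algebraic_int y" using \<open>a \<in> residue_reps \<bb>\<close> unfolding reps by blast
    obtain b where "b \<in> \<bb>" "g y = b + y" using g[of y] by blast
    then show ?thesis using y p(1) by (auto intro: algebraic_int_add)
  qed
  show "\<exists>!a. a \<in> residue_reps \<bb> \<and> x - a \<in> \<bb>" if x: "algebraic_int x" for x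
  proof (rule ex1I[of _ "g x"])
    show "g x \<in> residue_reps \<bb> \<and> x - g x \<in> \<bb>" using x gd unfolding reps by blast
    fix a assume a: "a \<in> residue_reps \<bb> \<and> x - a \<in> \<bb>"
    then obtain y where y: "a = g y" unfolding reps by blast
    have "(x - a) - (y - g y) \<in> \<bb>" by (rule zlattice_diff[OF p(2) conjunct2[OF a] gd])
    then have "x - y \<in> \<bb>" by (simp add: y)
    \<comment> \<open>The choice of a representative depends on the coset alone, so equal cosets
      have the same one.\<close>
    then have "?f x = ?f y" by (simp only: coset_eq_iff[OF p(2)])
    then show "a = g x" by (simp add: y g_def)
  qed
qed

text \<open>Pigeonhole: among the numbers from 0 to the norm, one more than there are classes, two
  are congruent.\<close>

lemma nat_in_ideal:
  assumes \<bb>: "\<bb> \<in> (nonzero_ideals :: 'k::number_field set set)"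
  obtains m where "0 < m" "m \<le> ideal_norm \<bb>" "of_nat m \<in> \<bb>"
proof -
  note p = nonzero_ideal_props[OF \<bb>]
  let ?f = "\<lambda>n::nat. (\<lambda>b. b + (of_nat n :: 'k)) ` \<bb>"
  have "?f ` {..ideal_norm \<bb>} \<subseteq> carrier (ring_of_integers Quot \<bb>)" unfolding quotient_carrier by auto
  then have "card (?f ` {..ideal_norm \<bb>}) \<le> ideal_norm \<bb>"
    unfolding ideal_norm_def by (rule card_mono[OF finite_quotient[OF \<bb>]])
  then have "\<not> inj_on ?f {..ideal_norm \<bb>}" using card_image[of ?f "{..ideal_norm \<bb>}"] by auto
  then obtain i j where ij: "i \<le> ideal_norm \<bb>" "j \<le> ideal_norm \<bb>" "i \<noteq> j" "?f i = ?f j"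
    unfolding inj_on_def by auto
  have *: thesis if "i < j" "j \<le> ideal_norm \<bb>" "?f j = ?f i" for i j
  proof (rule that(1)[THEN zero_less_diff[THEN iffD2], THEN \<open>\<And>m. 0 < m \<Longrightarrow> m \<le> ideal_norm \<bb> \<Longrightarrow> of_nat m \<in> \<bb> \<Longrightarrow> thesis\<close>])
    show "j - i \<le> ideal_norm \<bb>" using that by simp
    have "(of_nat j :: 'k) - of_nat i \<in> \<bb>" using that(3) by (simp only: coset_eq_iff[OF p(2)])
    then show "of_nat (j - i) \<in> \<bb>" using that(1) by (simp add: of_nat_diff)
  qed
  show thesis using *[of i j] *[of j i] ij by (metis nat_neq_iff)
qed

text \<open>An ideal of norm at most n contains some m with 0 < m and m at most n, hence all
  multiples of n!. It is therefore determined by its intersection with the finite set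
  \<open>R\<close> of representatives modulo n!.\<close>

lemma finite_ideals_bounded_norm:
  "finite {\<bb> \<in> (nonzero_ideals :: 'k::number_field set set). ideal_norm \<bb> \<le> n}"
proof -
  let ?d = "nf_degree TYPE('k)" and ?N = "fact n :: nat"
  obtain \<omega> :: "nat \<Rightarrow> 'k" where \<omega>: "int_basis \<omega> {x. algebraic_int x}" using ex_int_basis_integers by blast
  define R where "R = (\<lambda>a. \<Sum>i<?d. of_int (a i) * \<omega> i) ` (PiE {..<?d} (\<lambda>_. {0..<int ?N}))"
  have finR: "finite R" unfolding R_def by (intro finite_imageI finite_PiE) auto
  have fact: "of_nat ?N * y \<in> \<bb>" if \<bb>: "\<bb> \<in> nonzero_ideals" "ideal_norm \<bb> \<le> n" and y: "algebraic_int y" for \<bb> and y :: 'k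
  proof -
    obtain m where m: "0 < m" "m \<le> ideal_norm \<bb>" "of_nat m \<in> \<bb>" using nat_in_ideal[OF \<bb>(1)] .
    have "m dvd ?N" by (rule dvd_fact) (use m \<bb>(2) in auto)
    then obtain k where k: "?N = m * k" ..
    have "(of_nat k * y) * of_nat m \<in> \<bb>"
      by (rule nonzero_ideal_props(3)[OF \<bb>(1) _ m(3)]) (rule algebraic_int_times[OF algebraic_int_of_nat y])
    moreover have "of_nat ?N * y = (of_nat k * y) * of_nat m" unfolding k by (simp add: mult_ac)
    ultimately show ?thesis by (simp only:)
  qed
  have rep: "\<exists>r\<in>R. \<exists>y. algebraic_int y \<and> x - r = of_nat ?N * y" if x: "algebraic_int x" for x
  proof -
    have "x \<in> {x. algebraic_int x}" using x by simp
    then obtain a :: "nat \<Rightarrow> int" where a: "x = (\<Sum>i<?d. of_int (a i) * \<omega> i)" by (rule int_basis_coords[OF \<omega>])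
    let ?r = "\<lambda>i. a i mod int ?N" and ?y = "\<Sum>i<?d. of_int (a i div int ?N) * \<omega> i"
    have "(\<Sum>i<?d. of_int (?r i) * \<omega> i) \<in> R"
      unfolding R_def
      by (rule image_eqI[of _ _ "restrict ?r {..<?d}"]) (auto intro!: sum.cong simp: fact_gt_zero)
    moreover have "?y \<in> {x. algebraic_int x}"
      unfolding int_basis_iff[OF \<omega> zlattice_integers]
      by (rule exI[where x = "\<lambda>i. a i div int ?N"]) (rule refl)
    then have "algebraic_int ?y" by simp
    moreover note this
    moreover have "x - (\<Sum>i<?d. of_int (?r i) * \<omega> i) = of_nat ?N * ?y"
    proof -
      have "x - (\<Sum>i<?d. of_int (?r i) * \<omega> i) = (\<Sum>i<?d. of_int (a i - ?r i) * \<omega> i)"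
        unfolding a by (simp only: of_int_diff left_diff_distrib sum_subtractf)
      also have "\<dots> = (\<Sum>i<?d. of_nat ?N * (of_int (a i div int ?N) * \<omega> i))"
      proof (rule sum.cong[OF refl])
        fix i
        have "of_int (a i - ?r i) = (of_int (int ?N * (a i div int ?N)) :: 'k)"
          by (simp only: minus_mod_eq_mult_div)
        then show "of_int (a i - ?r i) * \<omega> i = of_nat ?N * (of_int (a i div int ?N) * \<omega> i)"
          by (simp only: of_int_mult of_int_of_nat_eq mult.assoc)
      qed
      finally show ?thesis by (simp only: sum_distrib_left)
    qed
    ultimately show ?thesis by blast
  qed
  have "inj_on (\<lambda>\<bb>. \<bb> \<inter> R) {\<bb> \<in> nonzero_ideals. ideal_norm \<bb> \<le> n}"
  proof (rule inj_onI)
    have sub: "\<bb> \<subseteq> \<cc>" if \<bb>: "\<bb> \<in> nonzero_ideals" "ideal_norm \<bb> \<le> n"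
      and \<cc>: "\<cc> \<in> nonzero_ideals" "ideal_norm \<cc> \<le> n" and eq: "\<bb> \<inter> R = \<cc> \<inter> R" for \<bb> \<cc>
    proof
      fix x assume x: "x \<in> \<bb>"
      then obtain r y where r: "r \<in> R" "algebraic_int y" "x - r = of_nat ?N * y"
        using rep[of x] nonzero_ideal_props(1)[OF \<bb>(1)] by blast
      have "x - (x - r) \<in> \<bb>"
        by (rule zlattice_diff[OF nonzero_ideal_props(2)[OF \<bb>(1)] x]) (simp only: r(3) fact[OF \<bb> r(2)])
      then have "r \<in> \<bb>" by simp
      then have "r \<in> \<cc>" using r(1) eq by blast
      have "r + (x - r) \<in> \<cc>"
        by (rule zlattice_add[OF nonzero_ideal_props(2)[OF \<cc>(1)] \<open>r \<in> \<cc>\<close>]) (simp only: r(3) fact[OF \<cc> r(2)])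
      then show "x \<in> \<cc>" by simp
    qed
    fix \<bb> \<cc> :: "'k set" assume "\<bb> \<in> {\<bb> \<in> nonzero_ideals. ideal_norm \<bb> \<le> n}"
      "\<cc> \<in> {\<bb> \<in> nonzero_ideals. ideal_norm \<bb> \<le> n}" "\<bb> \<inter> R = \<cc> \<inter> R"
    then show "\<bb> = \<cc>" using sub[of \<bb> \<cc>] sub[of \<cc> \<bb>] by blast
  qed
  moreover have "finite ((\<lambda>\<bb>. \<bb> \<inter> R) ` {\<bb> \<in> nonzero_ideals. ideal_norm \<bb> \<le> n})"
    by (rule finite_subset[of _ "Pow R"]) (use finR in auto)
  ultimately show ?thesis by (rule finite_imageD[rotated])
qed

lemma dual_ideal_iff:
  fixes \<gamma> :: "nat \<Rightarrow> 'k::number_field"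
  assumes \<gamma>: "int_basis \<gamma> \<bb>"
  shows "m \<in> dual_ideal \<bb> \<longleftrightarrow> (\<forall>j<nf_degree TYPE('k). trace_K (m * \<gamma> j) \<in> \<int>)"
proof
  assume "m \<in> dual_ideal \<bb>"
  then show "\<forall>j<nf_degree TYPE('k). trace_K (m * \<gamma> j) \<in> \<int>"
    using \<gamma> by (auto simp: dual_ideal_def int_basis_def)
next
  let ?d = "nf_degree TYPE('k)"
  assume int: "\<forall>j<?d. trace_K (m * \<gamma> j) \<in> \<int>"
  have add: "trace_K (y + z) = trace_K y + trace_K z" for y z :: 'k by (rule trace_K_add)
  show "m \<in> dual_ideal \<bb>" unfolding dual_ideal_def
  proof (intro CollectI ballI)
    fix x assume "x \<in> \<bb>"
    then obtain a :: "nat \<Rightarrow> int" where a: "x = (\<Sum>i<?d. of_int (a i) * \<gamma> i)" by (rule int_basis_coords[OF \<gamma>])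
    have "m * x = (\<Sum>i<?d. of_int (a i) * (m * \<gamma> i))"
      unfolding a sum_distrib_left by (intro sum.cong refl) (rule mult.left_commute)
    then have "trace_K (m * x) = (\<Sum>i<?d. of_int (a i) * trace_K (m * \<gamma> i))"
      by (simp only: additive_sum'[of trace_K, OF add] additive_of_int[of trace_K, OF add])
    also have "\<dots> \<in> \<int>" using int by (intro Ints_sum Ints_mult) auto
    finally show "trace_K (m * x) \<in> \<int>" .
  qed
qed

lemma trace_K_determines:
  fixes \<gamma> :: "nat \<Rightarrow> 'k::number_field"
  assumes \<gamma>: "rat_basis \<gamma>" and eq: "\<And>j. j < nf_degree TYPE('k) \<Longrightarrow> trace_K (m * \<gamma> j) = trace_K (m' * \<gamma> j)"
  shows "m = m'"
proof -
  let ?d = "nf_degree TYPE('k)"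
  have add: "trace_K (y + z) = trace_K y + trace_K z" for y z :: 'k by (rule trace_K_add)
  have "trace_K ((m - m') * x) = 0" for x
  proof -
    have "\<exists>a. x = (\<Sum>i<?d. of_rat (a i) * \<gamma> i)" using \<gamma> unfolding rat_basis_def ..
    then obtain a where a: "x = (\<Sum>i<?d. of_rat (a i) * \<gamma> i)" ..
    have "(m - m') * x = (\<Sum>i<?d. of_rat (a i) * (m * \<gamma> i)) + - (\<Sum>i<?d. of_rat (a i) * (m' * \<gamma> i))"
      unfolding a by (simp add: left_diff_distrib sum_distrib_left mult.left_commute sum_subtractf)
    then have "trace_K ((m - m') * x)
        = (\<Sum>i<?d. of_rat (a i) * trace_K (m * \<gamma> i)) + - (\<Sum>i<?d. of_rat (a i) * trace_K (m' * \<gamma> i))"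
      by (simp only: add additive_uminus[of trace_K, OF add] additive_sum'[of trace_K, OF add]
          additive_of_rat[of trace_K, OF add])
    also have "\<dots> = 0" using eq by simp
    finally show ?thesis .
  qed
  then have "m - m' = 0" by (rule trace_K_nondegenerate)
  then show ?thesis by simp
qed

section \<open>Calculus of \<open>C\<^sup>k\<close> functions\<close>

lemma Ck_on_SucD: "Ck_on (Suc k) f S \<Longrightarrow> Ck_on k f S"
proof (induction k arbitrary: f)
  case 0
  then obtain f' where "\<forall>x\<in>S. (f has_derivative f' x) (at x)" by auto
  then show ?case
    by (auto intro!: continuous_at_imp_continuous_on intro: has_derivative_continuous)
next
  case (Suc k)
  then obtain f' where "\<forall>x\<in>S. (f has_derivative f' x) (at x)" "\<And>v. Ck_on (Suc k) (\<lambda>x. f' x v) S"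
    by (auto simp del: Ck_on.simps(2) simp: Ck_on.simps(2)[of "Suc k"])
  then show ?case using Suc.IH by auto
qed

lemma Ck_on_const: "Ck_on k (\<lambda>_. c) S"
  by (induction k arbitrary: c) (auto intro!: exI[of _ "\<lambda>_ _. 0"] continuous_on_const)

lemma Ck_on_add: "Ck_on k f S \<Longrightarrow> Ck_on k g S \<Longrightarrow> Ck_on k (\<lambda>x. f x + g x) S"
proof (induction k arbitrary: f g)
  case (Suc k)
  then obtain f' g' where "\<forall>x\<in>S. (f has_derivative f' x) (at x)" "\<And>v. Ck_on k (\<lambda>x. f' x v) S"
    "\<forall>x\<in>S. (g has_derivative g' x) (at x)" "\<And>v. Ck_on k (\<lambda>x. g' x v) S" by auto
  then show ?case
    by (auto intro!: exI[of _ "\<lambda>x v. f' x v + g' x v"] has_derivative_add Suc.IH)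
qed (auto intro: continuous_on_add)

lemma Ck_on_bounded_linear:
  assumes L: "bounded_linear L" and "Ck_on k f S"
  shows "Ck_on k (\<lambda>x. L (f x)) S"
  using assms(2)
proof (induction k arbitrary: f)
  case 0
  then show ?case using bounded_linear.continuous_on[OF L] by simp
next
  case (Suc k)
  then obtain f' where f': "\<forall>x\<in>S. (f has_derivative f' x) (at x)" "\<And>v. Ck_on k (\<lambda>x. f' x v) S" by auto
  then show ?case
    by (auto intro!: exI[of _ "\<lambda>x v. L (f' x v)"] bounded_linear.has_derivative[OF L] Suc.IH)
qed

lemma Ck_on_compose_affine:
  fixes f :: "'b::real_normed_vector \<Rightarrow> 'c::real_normed_vector" and L :: "'a::real_normed_vector \<Rightarrow> 'b"
  assumes L: "bounded_linear L" and "Ck_on k f S" and ST: "\<And>y. y \<in> T \<Longrightarrow> a + L y \<in> S"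
  shows "Ck_on k (\<lambda>y. f (a + L y)) T"
  using assms(2)
proof (induction k arbitrary: f)
  case 0
  then have "continuous_on S f" by simp
  then show ?case using ST
    by (auto intro!: continuous_on_compose2[of S f T] continuous_intros bounded_linear.continuous_on[OF L])
next
  case (Suc k)
  then obtain f' where f': "\<forall>x\<in>S. (f has_derivative f' x) (at x)" "\<And>v. Ck_on k (\<lambda>x. f' x v) S" by auto
  have "((\<lambda>y. f (a + L y)) has_derivative (\<lambda>v. f' (a + L y) (L v))) (at y)" if y: "y \<in> T" for y
  proof -
    have "((\<lambda>y. a + L y) has_derivative L) (at y)"
      using bounded_linear_imp_has_derivative[OF L, of "at y"] by (auto intro!: derivative_eq_intros)
    moreover have "(f has_derivative f' (a + L y)) (at (a + L y))" using f'(1) ST[OF y] by blast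
    ultimately show ?thesis by (rule has_derivative_compose)
  qed
  moreover have "Ck_on k (\<lambda>y. f' (a + L y) (L v)) T" for v by (rule Suc.IH[OF f'(2)])
  ultimately show ?case unfolding Ck_on.simps
    by (intro exI[of _ "\<lambda>y v. f' (a + L y) (L v)"]) blast
qed

lemma Ck_on_mult:
  fixes f g :: "'a::real_normed_vector \<Rightarrow> 'b::real_normed_algebra"
  shows "Ck_on k f S \<Longrightarrow> Ck_on k g S \<Longrightarrow> Ck_on k (\<lambda>x. f x * g x) S"
proof (induction k arbitrary: f g)
  case (Suc k)
  have *: "Ck_on k f S" "Ck_on k g S" using Suc.prems by (auto simp del: Ck_on.simps dest: Ck_on_SucD)
  from Suc obtain f' g' where "\<forall>x\<in>S. (f has_derivative f' x) (at x)" "\<And>v. Ck_on k (\<lambda>x. f' x v) S"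
    "\<forall>x\<in>S. (g has_derivative g' x) (at x)" "\<And>v. Ck_on k (\<lambda>x. g' x v) S" by auto
  then show ?case using *
    by (auto intro!: exI[of _ "\<lambda>x v. f x * g' x v + f' x v * g x"] has_derivative_mult Suc.IH Ck_on_add)
qed (auto intro: continuous_on_mult)

lemma Ck_on_sum: "(\<And>i. i \<in> I \<Longrightarrow> Ck_on k (f i) S) \<Longrightarrow> Ck_on k (\<lambda>x. \<Sum>i\<in>I. f i x) S"
  by (induction I rule: infinite_finite_induct) (auto intro: Ck_on_const Ck_on_add)

lemma Ck_on_prod:
  fixes f :: "'i \<Rightarrow> 'a::real_normed_vector \<Rightarrow> 'b::{real_normed_algebra_1,comm_monoid_mult}"
  shows "(\<And>i. i \<in> I \<Longrightarrow> Ck_on k (f i) S) \<Longrightarrow> Ck_on k (\<lambda>x. \<Prod>i\<in>I. f i x) S"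
  by (induction I rule: infinite_finite_induct) (auto intro: Ck_on_const Ck_on_mult)

lemma Ck_on_power:
  fixes f :: "'a::real_normed_vector \<Rightarrow> 'b::real_normed_algebra_1"
  shows "Ck_on k f S \<Longrightarrow> Ck_on k (\<lambda>x. f x ^ n) S"
  by (induction n) (auto intro: Ck_on_const Ck_on_mult)

text \<open>The chain rule reduces order k + 1 to a product of two functions of order k, the
  derivative of \<open>u\<close> along \<open>q\<close> and the derivative of
  \<open>q\<close>.\<close>

lemma Ck_on_compose_real:
  fixes u :: "real \<Rightarrow> real" and q :: "'a::real_normed_vector \<Rightarrow> real"
  shows "Ck_on k u UNIV \<Longrightarrow> Ck_on k q S \<Longrightarrow> Ck_on k (\<lambda>x. u (q x)) S"
proof (induction k arbitrary: u)
  case 0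
  then show ?case by (auto intro: continuous_on_compose2[of UNIV u])
next
  case (Suc k)
  from Suc.prems(1) obtain u' where u': "\<And>x. (u has_derivative u' x) (at x)" "\<And>v. Ck_on k (\<lambda>x. u' x v) UNIV" by auto
  from Suc.prems(2) obtain q' where q': "\<And>x. x \<in> S \<Longrightarrow> (q has_derivative q' x) (at x)" "\<And>v. Ck_on k (\<lambda>x. q' x v) S" by auto
  have q: "Ck_on k q S" using Suc.prems(2) by (rule Ck_on_SucD)
  \<comment> \<open>The hypothesis controls \<open>u'\<close> only in a fixed direction, whereas the
    chain rule has the moving direction \<open>q' x v\<close>; on the line this is a multiple of
    direction 1.\<close>
  have lin: "u' y v = u' y 1 * v" for y v
    using linear_cmul[OF has_derivative_linear[OF u'(1)[of y]], of v 1] by simp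
  have "Ck_on k (\<lambda>x. u' (q x) 1 * q' x v) S" for v
    by (rule Ck_on_mult[OF Suc.IH[OF u'(2) q] q'(2)])
  then have "Ck_on k (\<lambda>x. u' (q x) (q' x v)) S" for v by (simp only: lin[of _ "q' _ v"])
  moreover have "((\<lambda>x. u (q x)) has_derivative (\<lambda>v. u' (q x) (q' x v))) (at x)" if "x \<in> S" for x
    by (rule has_derivative_compose[OF q'(1)[OF that] u'(1)])
  ultimately show ?case unfolding Ck_on.simps
    by (intro exI[of _ "\<lambda>x v. u' (q x) (q' x v)"]) blast
qed

text \<open>The definition offers a possibly different derivative for every order; uniqueness of
  derivatives makes them one.\<close>

lemma smooth_on_directional:
  assumes "smooth_on f UNIV"
  obtains f' where "\<And>x. (f has_derivative f' x) (at x)" "\<And>v. smooth_on (\<lambda>x. f' x v) UNIV"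
proof -
  have ex: "\<exists>f'. (\<forall>x. (f has_derivative f' x) (at x)) \<and> (\<forall>v. Ck_on k (\<lambda>x. f' x v) UNIV)" for k
    using assms[unfolded smooth_on_def, rule_format, of "Suc k"] by simp
  obtain f' where f': "\<And>x. (f has_derivative f' x) (at x)" using ex[of 0] by blast
  have "Ck_on k (\<lambda>x. f' x v) UNIV" for k v
  proof -
    obtain g where g: "\<And>x. (f has_derivative g x) (at x)" "\<And>v. Ck_on k (\<lambda>x. g x v) UNIV" using ex[of k] by blast
    have "g x = f' x" for x by (rule has_derivative_unique[OF g(1) f'])
    with g(2)[of v] show ?thesis by simp
  qed
  with f' show thesis by (intro that) (auto simp: smooth_on_def)
qed

section \<open>Test functions and their Fourier transforms\<close>

definition test_fun :: "('a::euclidean_space \<Rightarrow> complex) \<Rightarrow> bool" where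
  "test_fun g \<longleftrightarrow> smooth_on g UNIV \<and> bounded {x. g x \<noteq> 0}"

definition unit_char :: "real \<Rightarrow> complex" where
  "unit_char t = cis (2 * pi * t)"

lemma norm_unit_char [simp]: "cmod (unit_char t) = 1"
  by (simp add: unit_char_def)

lemma unit_char_add: "unit_char (s + t) = unit_char s * unit_char t"
  by (simp add: unit_char_def distrib_left cis_mult)

lemma unit_char_0 [simp]: "unit_char 0 = 1"
  by (simp add: unit_char_def)

lemma unit_char_int: "t \<in> \<int> \<Longrightarrow> unit_char t = 1"
  by (auto simp: unit_char_def elim!: Ints_cases)

lemma unit_char_measurable [measurable]: "unit_char \<in> borel_measurable borel"
  unfolding unit_char_def by (intro borel_measurable_continuous_onI continuous_intros)

lemma continuous_on_unit_char [continuous_intros]: "continuous_on S f \<Longrightarrow> continuous_on S (\<lambda>x. unit_char (f x))"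
  unfolding unit_char_def by (intro continuous_intros)

lemma test_fun_continuous: "test_fun g \<Longrightarrow> continuous_on S g"
proof -
  assume "test_fun g"
  then have "Ck_on 0 g UNIV" by (simp add: test_fun_def smooth_on_def del: Ck_on.simps)
  then have "continuous_on UNIV g" by simp
  then show ?thesis by (rule continuous_on_subset) simp
qed

lemma test_fun_measurable: "test_fun g \<Longrightarrow> g \<in> borel_measurable borel"
  by (rule borel_measurable_continuous_onI) (rule test_fun_continuous)

lemma test_fun_support:
  assumes "test_fun g"
  obtains R where "R > 0" "\<And>x. norm x > R \<Longrightarrow> g x = 0"
proof -
  obtain R where R: "R > 0" "\<And>x. x \<in> {x. g x \<noteq> 0} \<Longrightarrow> norm x \<le> R"
    using assms unfolding test_fun_def bounded_pos by blast
  show thesis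
  proof (rule that[OF R(1)])
    fix x :: 'a assume "norm x > R"
    then show "g x = 0" using R(2)[of x] by force
  qed
qed

lemma test_fun_bounded:
  assumes "test_fun g"
  obtains B where "B > 0" "\<And>x. cmod (g x) \<le> B"
proof -
  obtain R where R: "R > 0" "\<And>x. norm x > R \<Longrightarrow> g x = 0" by (rule test_fun_support[OF assms]) (rule that)
  have "compact (g ` cball 0 R)"
    by (rule compact_continuous_image[OF test_fun_continuous[OF assms] compact_cball])
  then obtain B where B: "B > 0" "\<And>y. y \<in> g ` cball 0 R \<Longrightarrow> cmod y \<le> B"
    using compact_imp_bounded bounded_pos by metis
  have "cmod (g x) \<le> B" for x
    using B R(2)[of x] by (cases "norm x \<le> R") auto
  with B(1) show thesis by (rule that)
qed

lemma integrable_scaled_cball: "integrable lborel (\<lambda>x::'a::euclidean_space. B * indicator (cball 0 R) x :: real)"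
proof -
  have "emeasure lborel (cball (0::'a) R) < \<infinity>" by (rule emeasure_bounded_finite) simp
  then show ?thesis by (intro integrable_mult_right integrable_real_indicator) simp_all
qed

lemma integrable_bounded_support:
  fixes f :: "'a::euclidean_space \<Rightarrow> complex"
  assumes "f \<in> borel_measurable borel" "\<And>x. cmod (f x) \<le> B" "\<And>x. norm x > R \<Longrightarrow> f x = 0"
  shows "integrable lborel f"
proof (rule Bochner_Integration.integrable_bound)
  show "integrable lborel (\<lambda>x::'a. B * indicator (cball 0 R) x)"
    by (rule integrable_scaled_cball)
  have "0 \<le> B" using assms(2)[of 0] norm_ge_zero[of "f 0"] by linarith
  then show "AE x in lborel. norm (f x) \<le> norm (B * indicator (cball 0 R) x)"
    using assms(2,3) by (auto simp: indicator_def not_le)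
qed (use assms(1) in simp)

definition fourier :: "('a::euclidean_space \<Rightarrow> complex) \<Rightarrow> 'a \<Rightarrow> complex" where
  "fourier g k = (LINT x|lborel. g x * unit_char (- (k \<bullet> x)))"

lemma fourier_integrable:
  assumes g: "test_fun g"
  shows "integrable lborel (\<lambda>x. g x * unit_char (- (k \<bullet> x)))"
proof -
  obtain R where R: "R > 0" "\<And>x. norm x > R \<Longrightarrow> g x = 0" by (rule test_fun_support[OF g]) (rule that)
  obtain B where B: "B > 0" "\<And>x. cmod (g x) \<le> B" by (rule test_fun_bounded[OF g]) (rule that)
  show ?thesis
  proof (rule integrable_bounded_support[of _ B R])
    show "(\<lambda>x. g x * unit_char (- (k \<bullet> x))) \<in> borel_measurable borel"
      by (rule borel_measurable_continuous_onI) (intro continuous_intros test_fun_continuous[OF g])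
  qed (use R B in \<open>auto simp: norm_mult\<close>)
qed

text \<open>Off the closure of the support the function is locally zero, hence so is its derivative;
  supports stay bounded.\<close>

lemma test_fun_directional:
  assumes "test_fun g"
  obtains g' where "\<And>x. (g has_derivative g' x) (at x)" "\<And>v. test_fun (\<lambda>x. g' x v)"
proof -
  have "smooth_on g UNIV" using assms by (simp add: test_fun_def)
  then obtain g' where g': "\<And>x. (g has_derivative g' x) (at x)" "\<And>v. smooth_on (\<lambda>x. g' x v) UNIV"
    by (rule smooth_on_directional) (rule that)
  have "{x. g' x v \<noteq> 0} \<subseteq> closure {x. g x \<noteq> 0}" for v
  proof (rule subsetI, rule ccontr)
    fix x assume x: "x \<in> {x. g' x v \<noteq> 0}" "x \<notin> closure {x. g x \<noteq> 0}"
    have "((\<lambda>_. 0) has_derivative g' x) (at x)"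
    proof (rule has_derivative_transform_within_open[OF g'(1)])
      show "open (- closure {x. g x \<noteq> 0})" by auto
      show "x \<in> - closure {x. g x \<noteq> 0}" using x by auto
      show "g y = 0" if "y \<in> - closure {x. g x \<noteq> 0}" for y
        using that closure_subset[of "{x. g x \<noteq> 0}"] by auto
    qed
    then have "g' x = (\<lambda>_. 0)" by (rule has_derivative_unique) (rule has_derivative_const)
    then show False using x by simp
  qed
  moreover have "bounded (closure {x. g x \<noteq> 0})" using assms by (simp add: test_fun_def bounded_closure)
  ultimately have "bounded {x. g' x v \<noteq> 0}" for v by (rule bounded_subset[rotated])
  with g' show thesis by (intro that[of g']) (auto simp: test_fun_def)
qed

lemma lborel_integral_translate:
  fixes f :: "'a::euclidean_space \<Rightarrow> complex"
  assumes "f \<in> borel_measurable borel"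
  shows "(LINT x|lborel. f (c + x)) = (LINT x|lborel. f x)"
proof -
  have "(LINT x|lborel. f x) = (LINT x|distr lborel borel ((+) c). f x)" by (simp only: lborel_distr_plus)
  also have "\<dots> = (LINT x|lborel. f (c + x))" by (rule integral_distr) (use assms in auto)
  finally show ?thesis ..
qed

lemma vector_derivative_quotient:
  fixes f :: "real \<Rightarrow> 'b::real_normed_vector"
  assumes "(f has_vector_derivative D) (at 0)"
  shows "((\<lambda>s. (f s - f 0) /\<^sub>R s) \<longlongrightarrow> D) (at 0)"
proof -
  have "((\<lambda>h. norm (f (0 + h) - f 0 - h *\<^sub>R D) / norm h) \<longlongrightarrow> 0) (at 0)"
    using assms unfolding has_vector_derivative_def has_derivative_at by blast
  then have "((\<lambda>h. norm ((f h - f 0) /\<^sub>R h - D)) \<longlongrightarrow> 0) (at 0)"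
  proof (rule Lim_transform_eventually)
    show "\<forall>\<^sub>F h in at 0. norm (f (0 + h) - f 0 - h *\<^sub>R D) / norm h = norm ((f h - f 0) /\<^sub>R h - D)"
      unfolding eventually_at_filter
    proof (intro always_eventually allI impI)
      fix h :: real assume h: "h \<noteq> 0"
      have "(f h - f 0) /\<^sub>R h - D = (f h - f 0 - h *\<^sub>R D) /\<^sub>R h"
        using h by (simp add: scaleR_diff_right)
      then show "norm (f (0 + h) - f 0 - h *\<^sub>R D) / norm h = norm ((f h - f 0) /\<^sub>R h - D)"
        by (simp add: divide_inverse mult.commute)
    qed
  qed
  then show ?thesis by (simp only: tendsto_norm_zero_iff LIM_zero_iff)
qed

text \<open>Translation invariance moves the difference quotient from \<open>g\<close> to the
  character, where its limit is explicit; dominated convergence handles the side of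
  \<open>g\<close>.\<close>

lemma fourier_derivative:
  fixes g :: "'a::euclidean_space \<Rightarrow> complex"
  assumes g: "test_fun g" and g': "\<And>x. (g has_derivative g' x) (at x)" and t': "test_fun (\<lambda>x. g' x b)"
  shows "fourier (\<lambda>x. g' x b) k = 2 * pi * \<i> * (k \<bullet> b) * fourier g k"
proof -
  note [measurable] = test_fun_measurable[OF g] test_fun_measurable[OF t']
  obtain R where R: "R > 0" "\<And>x. norm x > R \<Longrightarrow> g x = 0" by (rule test_fun_support[OF g]) (rule that)
  obtain B where B: "B > 0" "\<And>x. cmod (g' x b) \<le> B" by (rule test_fun_bounded[OF t']) (rule that)
  \<comment> \<open>Step sizes at most 1 keep the supports of all difference quotients in one ball
    of radius \<open>R + norm b\<close>.\<close>
  define t where "t = (\<lambda>n. inverse (real (Suc n)))"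
  have t0: "t n > 0" "t n \<le> 1" for n by (auto simp: t_def field_simps)
  have tlim: "t \<longlonglongrightarrow> 0" unfolding t_def by (rule LIMSEQ_inverse_real_of_nat)
  have tat: "filterlim t (at 0) sequentially"
    unfolding filterlim_at
  proof (intro conjI tlim always_eventually allI)
    show "t n \<in> UNIV" "t n \<noteq> 0" for n using t0(1)[of n] by simp_all
  qed
  define D where "D = (\<lambda>n x. (g (t n *\<^sub>R b + x) - g x) /\<^sub>R t n)"
  have line: "((\<lambda>s. g (x + s *\<^sub>R b)) has_derivative (\<lambda>h. h *\<^sub>R g' (x + s *\<^sub>R b) b)) (at s)" for x s
  proof -
    have "((\<lambda>s. x + s *\<^sub>R b) has_derivative (\<lambda>h. h *\<^sub>R b)) (at s)" by (auto intro!: derivative_eq_intros)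
    from has_derivative_compose[OF this g'[of "x + s *\<^sub>R b"]]
    show ?thesis using linear_cmul[OF has_derivative_linear[OF g'[of "x + s *\<^sub>R b"]]] by simp
  qed
  have Dlim: "(\<lambda>n. D n x) \<longlonglongrightarrow> g' x b" for x
  proof -
    have "((\<lambda>s. g (x + s *\<^sub>R b)) has_vector_derivative g' x b) (at 0)"
      using line[of x 0] by (simp add: has_vector_derivative_def)
    then have "((\<lambda>s. (g (x + s *\<^sub>R b) - g x) /\<^sub>R s) \<longlongrightarrow> g' x b) (at 0)"
      using vector_derivative_quotient by fastforce
    from filterlim_compose[OF this tat] have "((\<lambda>n. (g (x + t n *\<^sub>R b) - g x) /\<^sub>R t n) \<longlongrightarrow> g' x b) sequentially"
      .
    then show ?thesis unfolding D_def by (simp add: add.commute)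
  qed
  \<comment> \<open>The mean value inequality along direction \<open>b\<close> bounds the quotient
    by the maximum of the directional derivative; outside the ball both values of \<open>g\<close>
    are 0.\<close>
  have Dbound: "cmod (D n x) \<le> B * indicator (cball 0 (R + norm b)) x" for n x
  proof (cases "norm x \<le> R + norm b")
    case True
    have "cmod (g (x + t n *\<^sub>R b) - g (x + 0 *\<^sub>R b)) \<le> B * norm (t n - 0)"
    proof (rule differentiable_bound[of UNIV])
      show "((\<lambda>s. g (x + s *\<^sub>R b)) has_derivative (\<lambda>h. h *\<^sub>R g' (x + s *\<^sub>R b) b)) (at s within UNIV)" for s
        by (rule line)
      show "onorm (\<lambda>h. h *\<^sub>R g' (x + s *\<^sub>R b) b) \<le> B" for s
        by (rule onorm_le) (use B(2)[of "x + s *\<^sub>R b"] in \<open>simp add: mult.commute[of B] mult_left_mono\<close>)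
    qed auto
    then have "cmod (g (t n *\<^sub>R b + x) - g x) \<le> B * t n" using t0(1)[of n] by (simp add: add.commute)
    then have "cmod (g (t n *\<^sub>R b + x) - g x) / t n \<le> B" using t0(1)[of n] by (simp only: pos_divide_le_eq)
    moreover have "cmod (D n x) = cmod (g (t n *\<^sub>R b + x) - g x) / t n"
      using t0(1)[of n] unfolding D_def norm_scaleR by (simp add: divide_inverse mult.commute)
    ultimately show ?thesis using True by (simp add: indicator_def)
  next
    case False
    have "norm (t n *\<^sub>R b) \<le> norm b" using t0[of n] by (simp add: mult_left_le_one_le)
    then have "norm (t n *\<^sub>R b + x) > R" using False norm_diff_ineq[of x "t n *\<^sub>R b"] by (simp add: add.commute)
    moreover have "norm x > R" using False norm_ge_zero[of b] by linarith
    ultimately show ?thesis using R(2) False by (simp add: D_def)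
  qed
  have em: "(\<lambda>x. unit_char (- (k \<bullet> x))) \<in> borel_measurable borel"
    by (rule borel_measurable_continuous_onI) (intro continuous_intros)
  have tm: "(\<lambda>x. g (t n *\<^sub>R b + x)) \<in> borel_measurable borel" for n
    by (rule borel_measurable_continuous_onI)
      (auto intro!: continuous_on_compose2[OF test_fun_continuous[OF g]] continuous_intros)
  have Dm: "(\<lambda>x. D n x * unit_char (- (k \<bullet> x))) \<in> borel_measurable lborel" for n
    unfolding D_def using tm[of n] em test_fun_measurable[OF g] by simp
  have gm: "(\<lambda>x. g' x b * unit_char (- (k \<bullet> x))) \<in> borel_measurable lborel"
    using em test_fun_measurable[OF t'] by simp
  have lim: "AE x in lborel. (\<lambda>n. D n x * unit_char (- (k \<bullet> x))) \<longlonglongrightarrow> g' x b * unit_char (- (k \<bullet> x))"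
    by (rule AE_I2) (rule tendsto_mult_right[OF Dlim])
  have bound: "AE x in lborel. norm (D n x * unit_char (- (k \<bullet> x))) \<le> B * indicator (cball 0 (R + norm b)) x" for n
    by (rule AE_I2) (use Dbound[of n] in \<open>simp only: norm_mult norm_unit_char mult_1_right\<close>)
  have "(\<lambda>n. LINT x|lborel. D n x * unit_char (- (k \<bullet> x))) \<longlonglongrightarrow> (LINT x|lborel. g' x b * unit_char (- (k \<bullet> x)))"
    by (rule integral_dominated_convergence[OF gm Dm integrable_scaled_cball lim bound])
  moreover have "(LINT x|lborel. D n x * unit_char (- (k \<bullet> x))) = ((unit_char (k \<bullet> b * t n) - 1) /\<^sub>R t n) * fourier g k" for n
  proof -
    obtain Bg where Bg: "Bg > 0" "\<And>x. cmod (g x) \<le> Bg" by (rule test_fun_bounded[OF g]) (rule that)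
    have int: "integrable lborel (\<lambda>x. g (t n *\<^sub>R b + x) * unit_char (- (k \<bullet> x)))"
    proof (rule integrable_bounded_support[of _ Bg "R + norm b"])
      show "(\<lambda>x. g (t n *\<^sub>R b + x) * unit_char (- (k \<bullet> x))) \<in> borel_measurable borel"
        using tm[of n] em by simp
      show "cmod (g (t n *\<^sub>R b + x) * unit_char (- (k \<bullet> x))) \<le> Bg" for x by (simp add: norm_mult Bg)
    next
      fix x :: 'a assume "R + norm b < norm x"
      moreover have "norm (t n *\<^sub>R b) \<le> norm b" using t0[of n] by (simp add: mult_left_le_one_le)
      ultimately have "norm (t n *\<^sub>R b + x) > R" using norm_diff_ineq[of x "t n *\<^sub>R b"] by (simp add: add.commute)
      then show "g (t n *\<^sub>R b + x) * unit_char (- (k \<bullet> x)) = 0" using R(2) by simp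
    qed
    have "(LINT x|lborel. D n x * unit_char (- (k \<bullet> x)))
        = (LINT x|lborel. (g (t n *\<^sub>R b + x) * unit_char (- (k \<bullet> x)) - g x * unit_char (- (k \<bullet> x))) /\<^sub>R t n)"
      by (simp add: D_def algebra_simps)
    also have "\<dots> = ((LINT x|lborel. g (t n *\<^sub>R b + x) * unit_char (- (k \<bullet> x))) - fourier g k) /\<^sub>R t n"
      using int fourier_integrable[OF g, of k] by (simp add: fourier_def)
    also have "(LINT x|lborel. g (t n *\<^sub>R b + x) * unit_char (- (k \<bullet> x)))
        = (LINT x|lborel. unit_char (k \<bullet> b * t n) * (g (t n *\<^sub>R b + x) * unit_char (- (k \<bullet> (t n *\<^sub>R b + x)))))"
      by (rule Bochner_Integration.integral_cong)
        (auto simp: inner_add_right minus_add_distrib unit_char_add mult.commute simp flip: unit_char_add)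
    also have "\<dots> = unit_char (k \<bullet> b * t n) * (LINT x|lborel. g (t n *\<^sub>R b + x) * unit_char (- (k \<bullet> (t n *\<^sub>R b + x))))"
      by simp
    also have "(LINT x|lborel. g (t n *\<^sub>R b + x) * unit_char (- (k \<bullet> (t n *\<^sub>R b + x)))) = fourier g k"
      unfolding fourier_def by (rule lborel_integral_translate[of "\<lambda>x. g x * unit_char (- (k \<bullet> x))"]) (use em test_fun_measurable[OF g] in simp)
    finally show ?thesis by (simp add: algebra_simps)
  qed
  ultimately have lim1: "(\<lambda>n. ((unit_char (k \<bullet> b * t n) - 1) /\<^sub>R t n) * fourier g k) \<longlonglongrightarrow> fourier (\<lambda>x. g' x b) k"
    by (simp add: fourier_def)
  let ?c = "2 * pi * \<i> * (k \<bullet> b)"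
  have uc: "unit_char (k \<bullet> b * s) = exp (of_real s * ?c)" for s
    unfolding unit_char_def cis_conv_exp by (simp add: mult_ac)
  have "((\<lambda>z. exp (z * ?c)) has_field_derivative ?c) (at (of_real 0))"
    by (auto intro!: derivative_eq_intros)
  then have "((\<lambda>s. exp (of_real s * ?c)) has_vector_derivative ?c) (at 0)"
    by (rule has_vector_derivative_real_field)
  from vector_derivative_quotient[OF this]
  have "((\<lambda>s. (unit_char (k \<bullet> b * s) - 1) /\<^sub>R s) \<longlongrightarrow> ?c) (at 0)"
    unfolding uc by simp
  from filterlim_compose[OF this tat] have "(\<lambda>n. (unit_char (k \<bullet> b * t n) - 1) /\<^sub>R t n) \<longlonglongrightarrow> 2 * pi * \<i> * (k \<bullet> b)"
    .
  then have "(\<lambda>n. ((unit_char (k \<bullet> b * t n) - 1) /\<^sub>R t n) * fourier g k) \<longlonglongrightarrow> 2 * pi * \<i> * (k \<bullet> b) * fourier g k"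
    by (rule tendsto_mult_right)
  from LIMSEQ_unique[OF lim1 this] show ?thesis .
qed

section \<open>Decay of the Fourier transform\<close>

lemma fourier_bound:
  assumes "test_fun g"
  shows "cmod (fourier g k) \<le> (LINT x|lborel. cmod (g x))"
proof -
  have "cmod (fourier g k) \<le> (LINT x|lborel. norm (g x * unit_char (- (k \<bullet> x))))"
    unfolding fourier_def by (rule integral_norm_bound)
  then show ?thesis by (simp add: norm_mult)
qed

text \<open>Two derivatives in direction \<open>b\<close> multiply the transform by (2 pi)^2 (k .
  b)^2 up to sign, which dominates (k . b)^2. Treating each direction separately gives a product
  bound, whose sum over lattice points factors.\<close>

lemma fourier_decay:
  fixes g :: "'a::euclidean_space \<Rightarrow> complex"
  assumes "finite S" "S \<subseteq> Basis" "test_fun g"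
  shows "\<exists>C\<ge>0. \<forall>k. (\<Prod>b\<in>S. 1 + (k \<bullet> b)\<^sup>2) * cmod (fourier g k) \<le> C"
  using assms
proof (induction S arbitrary: g rule: finite_induct)
  case empty
  have "0 \<le> (LINT x|lborel. cmod (g x))" by (rule Bochner_Integration.integral_nonneg) simp
  then show ?case using fourier_bound[OF empty.prems(2)] by (intro exI[of _ "LINT x|lborel. cmod (g x)"]) simp
next
  case (insert b S)
  note g = insert.prems(2)
  obtain g' where g': "\<And>x. (g has_derivative g' x) (at x)" "\<And>v. test_fun (\<lambda>x. g' x v)"
    by (rule test_fun_directional[OF g]) (rule that)
  obtain h' where h': "\<And>x. ((\<lambda>x. g' x b) has_derivative h' x) (at x)" "\<And>v. test_fun (\<lambda>x. h' x v)"
    by (rule test_fun_directional[OF g'(2)[of b]]) (rule that)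
  let ?w = "\<lambda>x. h' x b"
  obtain C1 where C1: "C1 \<ge> 0" "\<And>k. (\<Prod>b\<in>S. 1 + (k \<bullet> b)\<^sup>2) * cmod (fourier g k) \<le> C1"
    using insert.IH[OF _ g] insert.prems by auto
  obtain C2 where C2: "C2 \<ge> 0" "\<And>k. (\<Prod>b\<in>S. 1 + (k \<bullet> b)\<^sup>2) * cmod (fourier ?w k) \<le> C2"
    using insert.IH[OF _ h'(2)[of b]] insert.prems by auto
  have "(\<Prod>b\<in>insert b S. 1 + (k \<bullet> b)\<^sup>2) * cmod (fourier g k) \<le> C1 + C2" for k
  proof -
    have "fourier ?w k = 2 * pi * \<i> * (k \<bullet> b) * (2 * pi * \<i> * (k \<bullet> b) * fourier g k)"
      unfolding fourier_derivative[OF g'(2) h'(1) h'(2)] fourier_derivative[OF g g'(1) g'(2)] ..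
    then have w: "cmod (fourier ?w k) = (2 * pi) ^ 2 * (k \<bullet> b)\<^sup>2 * cmod (fourier g k)"
      by (simp add: norm_mult power2_eq_square)
    have "1 \<le> (2 * pi) ^ 2" using pi_gt3 by (intro one_le_power) linarith
    then have "(k \<bullet> b)\<^sup>2 * cmod (fourier g k) \<le> (2 * pi) ^ 2 * ((k \<bullet> b)\<^sup>2 * cmod (fourier g k))"
      using mult_right_mono[of 1 "(2 * pi) ^ 2" "(k \<bullet> b)\<^sup>2 * cmod (fourier g k)"] by simp
    then have le: "(1 + (k \<bullet> b)\<^sup>2) * cmod (fourier g k) \<le> cmod (fourier g k) + cmod (fourier ?w k)"
      unfolding w by (simp add: distrib_right mult.assoc)
    have P: "(\<Prod>b\<in>S. 1 + (k \<bullet> b)\<^sup>2) \<ge> 0" by (intro prod_nonneg) auto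
    have "(\<Prod>b\<in>insert b S. 1 + (k \<bullet> b)\<^sup>2) * cmod (fourier g k)
        = (\<Prod>b\<in>S. 1 + (k \<bullet> b)\<^sup>2) * ((1 + (k \<bullet> b)\<^sup>2) * cmod (fourier g k))"
      using insert.hyps by (simp add: mult_ac)
    also have "\<dots> \<le> (\<Prod>b\<in>S. 1 + (k \<bullet> b)\<^sup>2) * (cmod (fourier g k) + cmod (fourier ?w k))"
      by (rule mult_left_mono[OF le P])
    also have "\<dots> \<le> C1 + C2" unfolding distrib_left by (rule add_mono[OF C1(2) C2(2)])
    finally show ?thesis .
  qed
  moreover have "C1 + C2 \<ge> 0" using C1(1) C2(1) by simp
  ultimately show ?case by blast
qed

section \<open>Summability over lattice points\<close>

definition int_points :: "'a::euclidean_space set" where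
  "int_points = {k. \<forall>b\<in>Basis. k \<bullet> b \<in> \<int>}"

text \<open>The bound telescopes: passing to x = n + 1 adds 2 / (1 + x^2), at most 4 / x - 4 / (x +
  1), and 5 - 4 = 1 is the value at n = 0.\<close>

lemma sum_inverse_square_le: "(\<Sum>j\<in>{- int n..int n}. inverse (1 + (real_of_int j)\<^sup>2)) \<le> 5 - 4 / real (Suc n)"
proof (induction n)
  case 0
  then show ?case by simp
next
  case (Suc n)
  let ?f = "\<lambda>j::int. inverse (1 + (real_of_int j)\<^sup>2)"
  let ?m = "int (Suc n)"
  have "{- ?m..?m} = insert (- ?m) (insert ?m {- int n..int n})" by auto
  then have "(\<Sum>j\<in>{- ?m..?m}. ?f j) = ?f (- ?m) + (?f ?m + (\<Sum>j\<in>{- int n..int n}. ?f j))" by simp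
  also have "?f (- ?m) = ?f ?m" by (simp only: of_int_minus power2_minus)
  also have "?f ?m + (?f ?m + (\<Sum>j\<in>{- int n..int n}. ?f j)) \<le> 2 * ?f ?m + (5 - 4 / real (Suc n))"
    using Suc.IH by linarith
  also have "\<dots> \<le> 5 - 4 / real (Suc (Suc n))"
  proof -
    define x where "x = real (Suc n)"
    have x: "x \<ge> 1" "real_of_int ?m = x" "real (Suc (Suc n)) = x + 1" by (auto simp: x_def)
    have "x * (x + 1) \<le> 2 * (1 + x\<^sup>2)"
      using zero_le_power2[of "x - 1"] x(1) by (simp add: power2_eq_square algebra_simps)
    then have "2 / (2 * (1 + x\<^sup>2)) \<le> 2 / (x * (x + 1))"
      using x(1) by (intro divide_left_mono mult_pos_pos) (auto simp: add_pos_nonneg)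
    moreover have "2 / (2 * (1 + x\<^sup>2)) = inverse (1 + x\<^sup>2)"
      unfolding inverse_eq_divide
      by (rule mult_divide_mult_cancel_left[of "2::real" 1 "1 + x\<^sup>2", OF zero_neq_numeral[symmetric], unfolded mult_1_right])
    ultimately have "inverse (1 + x\<^sup>2) \<le> 2 / (x * (x + 1))" by (simp only:)
    moreover have "2 / x - 2 / (x + 1) = (2 * (x + 1) - 2 * x) / (x * (x + 1))"
      by (rule diff_frac_eq) (use x(1) in auto)
    moreover have "2 * (x + 1) - 2 * x = 2" by simp
    ultimately have le: "inverse (1 + x\<^sup>2) \<le> 2 / x - 2 / (x + 1)" by (simp only:)
    have "2 * inverse (1 + x\<^sup>2) + (5 - 4 / x) \<le> 5 - 4 / (x + 1)"
      using le by (simp only: divide_inverse)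
    then show ?thesis unfolding x(2,3) x_def[symmetric] .
  qed
  finally show ?case .
qed

text \<open>A finite set of lattice points lies in a box, over which the sum is a product of
  one-dimensional sums, each at most 5.\<close>

lemma summable_int_points:
  "(\<lambda>k::'a::euclidean_space. inverse (\<Prod>b\<in>Basis. 1 + (k \<bullet> b)\<^sup>2)) summable_on int_points"
proof (rule nonneg_bdd_above_summable_on)
  show "0 \<le> inverse (\<Prod>b\<in>Basis. 1 + (k \<bullet> b)\<^sup>2)" for k :: 'a
    by (auto intro!: prod_nonneg)
  let ?\<phi> = "\<lambda>j::int. inverse (1 + (real_of_int j)\<^sup>2)"
  have "sum (\<lambda>k. inverse (\<Prod>b\<in>Basis. 1 + (k \<bullet> b)\<^sup>2)) F \<le> 5 ^ DIM('a)"
    if F: "F \<subseteq> int_points" "finite F" for F :: "'a set"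
  proof -
    define N where "N = nat (Max (insert 0 ((\<lambda>(k, b). \<lceil>\<bar>k \<bullet> b\<bar>\<rceil>) ` (F \<times> Basis))))"
    let ?r = "\<lambda>k::'a. restrict (\<lambda>b. \<lfloor>k \<bullet> b\<rfloor>) Basis"
    have fl: "real_of_int \<lfloor>k \<bullet> b\<rfloor> = k \<bullet> b" if "k \<in> F" "b \<in> Basis" for k b
      using F(1) that by (auto simp: int_points_def elim!: Ints_cases)
    have bd: "\<bar>\<lfloor>k \<bullet> b\<rfloor>\<bar> \<le> int N" if kb: "k \<in> F" "b \<in> Basis" for k b
    proof -
      have "\<lceil>\<bar>k \<bullet> b\<bar>\<rceil> \<le> Max (insert 0 ((\<lambda>(k, b). \<lceil>\<bar>k \<bullet> b\<bar>\<rceil>) ` (F \<times> Basis)))"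
        using F(2) kb by (intro Max_ge) auto
      then have "\<lceil>\<bar>k \<bullet> b\<bar>\<rceil> \<le> int N" unfolding N_def by linarith
      then have "\<bar>k \<bullet> b\<bar> \<le> real_of_int (int N)" by linarith
      then have "\<bar>real_of_int \<lfloor>k \<bullet> b\<rfloor>\<bar> \<le> real_of_int (int N)" by (simp only: fl[OF kb])
      then show ?thesis by linarith
    qed
    have inj: "inj_on ?r F"
    proof (rule inj_onI)
      fix k l assume kl: "k \<in> F" "l \<in> F" "?r k = ?r l"
      show "k = l"
      proof (rule euclidean_eqI)
        fix b :: 'a assume b: "b \<in> Basis"
        have "\<lfloor>k \<bullet> b\<rfloor> = \<lfloor>l \<bullet> b\<rfloor>" using fun_cong[OF kl(3), of b] b by simp
        then have "real_of_int \<lfloor>k \<bullet> b\<rfloor> = real_of_int \<lfloor>l \<bullet> b\<rfloor>" by (rule arg_cong)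
        then show "k \<bullet> b = l \<bullet> b" by (simp only: fl[OF kl(1) b] fl[OF kl(2) b])
      qed
    qed
    have "sum (\<lambda>k. inverse (\<Prod>b\<in>Basis. 1 + (k \<bullet> b)\<^sup>2)) F = (\<Sum>k\<in>F. \<Prod>b\<in>Basis. ?\<phi> (?r k b))"
    proof (rule sum.cong[OF refl])
      fix k assume k: "k \<in> F"
      have "(\<Prod>b\<in>Basis. ?\<phi> (?r k b)) = (\<Prod>b\<in>Basis. inverse (1 + (k \<bullet> b)\<^sup>2))"
        by (rule prod.cong[OF refl]) (simp add: fl[OF k])
      then show "inverse (\<Prod>b\<in>Basis. 1 + (k \<bullet> b)\<^sup>2) = (\<Prod>b\<in>Basis. ?\<phi> (?r k b))"
        by (simp add: prod_inversef[symmetric] o_def)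
    qed
    also have "\<dots> = (\<Sum>f\<in>?r ` F. \<Prod>b\<in>Basis. ?\<phi> (f b))"
      by (subst sum.reindex[OF inj]) simp
    also have "\<dots> \<le> (\<Sum>f\<in>PiE Basis (\<lambda>_. {- int N..int N}). \<Prod>b\<in>(Basis :: 'a set). ?\<phi> (f b))"
    proof (rule sum_mono2)
      show "finite (PiE (Basis :: 'a set) (\<lambda>_. {- int N..int N}))" by (intro finite_PiE) auto
      show "?r ` F \<subseteq> PiE Basis (\<lambda>_. {- int N..int N})"
        using bd by (auto simp: abs_le_iff minus_le_iff)
    qed (auto intro!: prod_nonneg)
    also have "\<dots> = (\<Prod>b\<in>(Basis :: 'a set). \<Sum>j\<in>{- int N..int N}. ?\<phi> j)"
      by (rule prod_sum_PiE[symmetric]) auto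
    also have "\<dots> \<le> (\<Prod>b\<in>(Basis :: 'a set). 5)"
    proof (rule prod_mono)
      fix b :: 'a
      have "4 / real (Suc N) \<ge> 0" by simp
      then have "(\<Sum>j\<in>{- int N..int N}. ?\<phi> j) \<le> 5" using sum_inverse_square_le[of N] by linarith
      moreover have "0 \<le> (\<Sum>j\<in>{- int N..int N}. ?\<phi> j)" by (intro sum_nonneg) auto
      ultimately show "0 \<le> (\<Sum>j\<in>{- int N..int N}. ?\<phi> j) \<and> (\<Sum>j\<in>{- int N..int N}. ?\<phi> j) \<le> 5" by blast
    qed
    finally show ?thesis by simp
  qed
  then show "bdd_above (sum (\<lambda>k. inverse (\<Prod>b\<in>Basis. 1 + (k \<bullet> b)\<^sup>2)) ` {F. F \<subseteq> (int_points :: 'a set) \<and> finite F})"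
    by (intro bdd_aboveI2[of _ _ "5 ^ DIM('a)"]) auto
qed

lemma fourier_summable:
  fixes g :: "'a::euclidean_space \<Rightarrow> complex"
  assumes "test_fun g"
  shows "(\<lambda>k. cmod (fourier g k)) summable_on int_points"
proof -
  obtain C where C: "C \<ge> 0" "\<And>k. (\<Prod>b\<in>Basis. 1 + (k \<bullet> b)\<^sup>2) * cmod (fourier g k) \<le> C"
    using fourier_decay[of Basis g] assms by auto
  have "(\<lambda>k::'a. C * inverse (\<Prod>b\<in>Basis. 1 + (k \<bullet> b)\<^sup>2)) summable_on int_points"
    by (rule summable_on_cmult_right[OF summable_int_points])
  moreover have "cmod (fourier g k) \<le> C * inverse (\<Prod>b\<in>Basis. 1 + (k \<bullet> b)\<^sup>2)" for k
  proof -
    have "(\<Prod>b\<in>Basis. 1 + (k \<bullet> b)\<^sup>2) > 0" by (intro prod_pos) (auto simp: add_pos_nonneg)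
    then show ?thesis using C(2)[of k] by (simp add: divide_inverse[symmetric] pos_le_divide_eq mult.commute)
  qed
  ultimately show ?thesis by (rule Infinite_Sum.abs_summable_on_comparison_test')
qed

section \<open>Integration over the unit cube\<close>

text \<open>Half-open, so that its integer translates partition the space; centred, so that the
  point of concentration 0 is interior.\<close>

definition unit_cube :: "'a::euclidean_space set" where
  "unit_cube = {x. \<forall>b\<in>Basis. - 1 / 2 \<le> x \<bullet> b \<and> x \<bullet> b < 1 / 2}"

definition cube_int :: "('a::euclidean_space \<Rightarrow> complex) \<Rightarrow> complex" where
  "cube_int f = (LINT x|lborel. indicator unit_cube x * f x)"

lemma unit_cube_sets [measurable, simp]: "(unit_cube :: 'a::euclidean_space set) \<in> sets borel"
proof -
  have "(unit_cube :: 'a set) = (\<Inter>b\<in>Basis. {x. - 1 / 2 \<le> x \<bullet> b} \<inter> {x. x \<bullet> b < 1 / 2})"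
    by (auto simp: unit_cube_def)
  also have "\<dots> \<in> sets borel" by (intro sets.finite_INT sets.Int) auto
  finally show ?thesis .
qed

lemma unit_cube_subset_cbox: "unit_cube \<subseteq> cbox (- (1/2) *\<^sub>R One) ((1/2) *\<^sub>R One)"
  by (auto simp: unit_cube_def mem_box less_imp_le)

lemma box_subset_unit_cube: "box (- (1/2) *\<^sub>R One) ((1/2) *\<^sub>R One) \<subseteq> unit_cube"
  by (auto simp: unit_cube_def mem_box less_imp_le)

lemma emeasure_unit_cube: "emeasure lborel (unit_cube :: 'a::euclidean_space set) = 1"
proof (rule antisym)
  have "emeasure lborel (unit_cube :: 'a set) \<le> emeasure lborel (cbox (- (1/2) *\<^sub>R One) ((1/2) *\<^sub>R One :: 'a))"
    by (rule emeasure_mono[OF unit_cube_subset_cbox]) simp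
  also have "\<dots> = 1" by (subst emeasure_lborel_cbox) (auto simp: inner_diff_left inner_add_left intro!: prod.neutral)
  finally show "emeasure lborel (unit_cube :: 'a set) \<le> 1" .
  have "1 = emeasure lborel (box (- (1/2) *\<^sub>R One) ((1/2) *\<^sub>R One :: 'a))"
    by (subst emeasure_lborel_box) (auto simp: inner_diff_left inner_add_left intro!: prod.neutral)
  also have "\<dots> \<le> emeasure lborel (unit_cube :: 'a set)"
    by (rule emeasure_mono[OF box_subset_unit_cube]) simp
  finally show "1 \<le> emeasure lborel (unit_cube :: 'a set)" .
qed

lemma cube_int_1: "cube_int (\<lambda>_::'a::euclidean_space. 1) = 1"
proof -
  have "cube_int (\<lambda>_::'a. 1) = (LINT x|lborel. complex_of_real (indicator unit_cube (x::'a)))"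
    unfolding cube_int_def by (rule Bochner_Integration.integral_cong) (auto simp: indicator_def)
  also have "\<dots> = complex_of_real (LINT x|lborel. indicator unit_cube (x::'a))"
    by (rule integral_complex_of_real)
  also have "\<dots> = 1" by (simp add: measure_def emeasure_unit_cube)
  finally show ?thesis .
qed

lemma integrable_unit_cube:
  fixes f :: "'a::euclidean_space \<Rightarrow> complex"
  assumes "continuous_on UNIV f"
  shows "integrable lborel (\<lambda>x. indicator unit_cube x * f x)"
proof -
  let ?K = "cbox (- (1/2) *\<^sub>R One) ((1/2) *\<^sub>R One) :: 'a set"
  have "compact (f ` ?K)" by (rule compact_continuous_image[OF continuous_on_subset[OF assms]]) auto
  then obtain B where B: "B > 0" "\<And>y. y \<in> f ` ?K \<Longrightarrow> cmod y \<le> B"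
    using compact_imp_bounded bounded_pos by metis
  obtain R where R: "\<And>x. x \<in> ?K \<Longrightarrow> norm x \<le> R" using bounded_cbox[of "- (1/2) *\<^sub>R One" "(1/2) *\<^sub>R One :: 'a"] bounded_iff by metis
  show ?thesis
  proof (rule integrable_bounded_support[of _ B R])
    show "(\<lambda>x. indicator unit_cube x * f x) \<in> borel_measurable borel"
      using borel_measurable_continuous_onI[OF assms] by measurable
    show "cmod (indicator unit_cube x * f x) \<le> B" for x
      using B unit_cube_subset_cbox by (auto simp: indicator_def norm_mult)
    show "indicator unit_cube x * f x = 0" if "R < norm x" for x
      using R[of x] that unit_cube_subset_cbox by (auto simp: indicator_def)
  qed
qed

lemma cube_int_add:
  assumes "continuous_on UNIV f" "continuous_on UNIV g"
  shows "cube_int (\<lambda>x. f x + g x) = cube_int f + cube_int g"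
  unfolding cube_int_def distrib_left
  by (rule Bochner_Integration.integral_add[OF integrable_unit_cube[OF assms(1)] integrable_unit_cube[OF assms(2)]])

lemma cube_int_cmult: "cube_int (\<lambda>x. c * f x) = c * cube_int f"
  unfolding cube_int_def by (simp add: mult.left_commute)

lemma cube_int_norm_le:
  fixes f :: "'a::euclidean_space \<Rightarrow> complex"
  assumes "continuous_on UNIV f" "\<And>x. x \<in> unit_cube \<Longrightarrow> cmod (f x) \<le> B"
  shows "cmod (cube_int f) \<le> B"
proof -
  have "cmod (cube_int f) \<le> (LINT x|lborel. norm (indicator unit_cube x * f x))"
    unfolding cube_int_def by (rule integral_norm_bound)
  also have "\<dots> \<le> (LINT x|lborel. indicator (unit_cube :: 'a set) x * B)"
  proof (rule Bochner_Integration.integral_mono[OF integrable_norm[OF integrable_unit_cube[OF assms(1)]]])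
    show "integrable lborel (\<lambda>x::'a. indicator unit_cube x * B)"
      by (intro integrable_mult_left integrable_real_indicator) (auto simp: emeasure_unit_cube)
    show "norm (indicator unit_cube x * f x) \<le> indicator unit_cube x * B" for x
      using assms(2)[of x] by (auto simp: indicator_def norm_mult)
  qed
  also have "\<dots> = B" by (simp add: measure_def emeasure_unit_cube)
  finally show ?thesis .
qed

section \<open>Lattice translates and periodic functions\<close>

lemma int_points_diff: "k \<in> int_points \<Longrightarrow> l \<in> int_points \<Longrightarrow> k - l \<in> int_points"
  by (auto simp: int_points_def inner_diff_left)

lemma int_points_add: "k \<in> int_points \<Longrightarrow> l \<in> int_points \<Longrightarrow> k + l \<in> int_points"
  by (auto simp: int_points_def inner_add_left)

lemma Basis_int_points: "b \<in> Basis \<Longrightarrow> b \<in> int_points"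
  by (auto simp: int_points_def inner_Basis)

lemma zero_int_points: "0 \<in> int_points"
  by (auto simp: int_points_def)

lemma int_points_inner: 
  assumes "k \<in> int_points" "l \<in> int_points"
  shows "k \<bullet> l \<in> \<int>"
  by (subst euclidean_inner) (use assms in \<open>auto simp: int_points_def intro!: Ints_sum Ints_mult\<close>)

lemma unit_cube_translate_ex1: "\<exists>!n. n \<in> int_points \<and> (x::'a::euclidean_space) - n \<in> unit_cube"
proof (rule ex1I)
  \<comment> \<open>Rounding to the nearest integer, halves upwards; this matches the end of the
    cube that is included.\<close>
  let ?n = "\<Sum>b\<in>Basis. real_of_int \<lfloor>x \<bullet> b + 1 / 2\<rfloor> *\<^sub>R b"
  have n: "?n \<bullet> b = real_of_int \<lfloor>x \<bullet> b + 1 / 2\<rfloor>" if "b \<in> Basis" for b using that by simp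
  show "?n \<in> int_points \<and> x - ?n \<in> unit_cube"
  proof
    show "?n \<in> int_points" unfolding int_points_def using n by simp
    show "x - ?n \<in> unit_cube" unfolding unit_cube_def mem_Collect_eq inner_diff_left
    proof
      fix b :: 'a assume b: "b \<in> Basis"
      show "- 1 / 2 \<le> x \<bullet> b - ?n \<bullet> b \<and> x \<bullet> b - ?n \<bullet> b < 1 / 2" unfolding n[OF b] by linarith
    qed
  qed
  fix m assume m: "m \<in> int_points \<and> x - m \<in> unit_cube"
  show "m = ?n"
  proof (rule euclidean_eqI)
    fix b :: 'a assume b: "b \<in> Basis"
    obtain z where z: "m \<bullet> b = of_int z" using m b by (auto simp: int_points_def elim!: Ints_cases)
    have "- 1 / 2 \<le> x \<bullet> b - m \<bullet> b \<and> x \<bullet> b - m \<bullet> b < 1 / 2"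
      using m b by (auto simp: unit_cube_def inner_diff_left)
    then have "z = \<lfloor>x \<bullet> b + 1 / 2\<rfloor>" unfolding z by linarith
    then show "m \<bullet> b = ?n \<bullet> b" unfolding n[OF b] z by simp
  qed
qed

lemma bounded_int_points_finite:
  assumes "bounded (S :: 'a::euclidean_space set)"
  shows "finite (S \<inter> int_points)"
proof -
  obtain R where R: "\<And>x. x \<in> S \<Longrightarrow> norm x \<le> R" using assms bounded_iff by metis
  have fl: "real_of_int \<lfloor>k \<bullet> b\<rfloor> = k \<bullet> b" if "k \<in> int_points" "b \<in> Basis" for k b :: 'a
    using that by (auto simp: int_points_def elim!: Ints_cases)
  let ?r = "\<lambda>k::'a. restrict (\<lambda>b. \<lfloor>k \<bullet> b\<rfloor>) Basis"
  have "?r ` (S \<inter> int_points) \<subseteq> PiE Basis (\<lambda>_. {\<lfloor>- R\<rfloor>..\<lceil>R\<rceil>})"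
  proof (rule image_subsetI, rule restrict_PiE_iff[THEN iffD2], rule ballI)
    fix k b :: 'a assume k: "k \<in> S \<inter> int_points" and b: "b \<in> Basis"
    have "\<bar>k \<bullet> b\<bar> \<le> R" using Basis_le_norm[OF b, of k] R[of k] k by auto
    then show "\<lfloor>k \<bullet> b\<rfloor> \<in> {\<lfloor>- R\<rfloor>..\<lceil>R\<rceil>}" by (auto simp: floor_mono) linarith
  qed
  moreover have "finite (PiE (Basis :: 'a set) (\<lambda>_. {\<lfloor>- R\<rfloor>..\<lceil>R\<rceil>}))" by (intro finite_PiE) auto
  moreover have "inj_on ?r (S \<inter> int_points)"
  proof (rule inj_onI)
    fix k l assume kl: "k \<in> S \<inter> int_points" "l \<in> S \<inter> int_points" "?r k = ?r l"
    show "k = l"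
    proof (rule euclidean_eqI)
      fix b :: 'a assume b: "b \<in> Basis"
      have "\<lfloor>k \<bullet> b\<rfloor> = \<lfloor>l \<bullet> b\<rfloor>" using fun_cong[OF kl(3), of b] b by simp
      then have "real_of_int \<lfloor>k \<bullet> b\<rfloor> = real_of_int \<lfloor>l \<bullet> b\<rfloor>" by (rule arg_cong)
      then show "k \<bullet> b = l \<bullet> b" by (simp only: fl[OF IntD2[OF kl(1)] b] fl[OF IntD2[OF kl(2)] b])
    qed
  qed
  ultimately show ?thesis by (meson finite_imageD finite_subset)
qed

text \<open>The translates of the cube partition the space. The finite set \<open>X\<close> must
  contain every lattice point whose translate of the cube meets the support, which keeps the folding
  a finite sum.\<close>

lemma integral_fold:
  fixes \<phi> :: "'a::euclidean_space \<Rightarrow> complex"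
  assumes meas: "\<phi> \<in> borel_measurable borel" and bd: "\<And>x. cmod (\<phi> x) \<le> B" and supp: "\<And>x. norm x > R \<Longrightarrow> \<phi> x = 0"
    and X: "finite X" "X \<subseteq> int_points" "\<And>n x. n \<in> int_points \<Longrightarrow> x \<in> unit_cube \<Longrightarrow> \<phi> (n + x) \<noteq> 0 \<Longrightarrow> n \<in> X"
  shows "(LINT x|lborel. \<phi> x) = cube_int (\<lambda>x. \<Sum>n\<in>X. \<phi> (n + x))"
proof -
  have eq: "\<phi> x = (\<Sum>n\<in>X. indicator unit_cube (x - n) * \<phi> x)" for x
  proof -
    obtain n where n: "n \<in> int_points" "x - n \<in> unit_cube"
      "\<And>m. m \<in> int_points \<Longrightarrow> x - m \<in> unit_cube \<Longrightarrow> m = n" using unit_cube_translate_ex1[of x] by blast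
    have "(\<Sum>m\<in>X. indicator unit_cube (x - m) * \<phi> x) = (\<Sum>m\<in>X. if m = n then \<phi> x else 0)"
    proof (rule sum.cong[OF refl])
      fix m assume "m \<in> X"
      then have "m \<in> int_points" using X(2) by blast
      then have "x - m \<in> unit_cube \<longleftrightarrow> m = n" using n by blast
      then show "indicator unit_cube (x - m) * \<phi> x = (if m = n then \<phi> x else 0)" by (simp add: indicator_def)
    qed
    also have "\<dots> = (if n \<in> X then \<phi> x else 0)" using X(1) by simp
    also have "\<dots> = \<phi> x" using X(3)[OF n(1,2)] by auto
    finally show ?thesis ..
  qed
  have i1: "integrable lborel (\<lambda>x. indicator unit_cube (x - n) * \<phi> x)" for n
    by (rule integrable_bounded_support[of _ B R])
      (use meas bd supp in \<open>auto simp: indicator_def norm_mult intro: order.trans[OF norm_ge_zero]\<close>)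
  have tr: "(LINT x|lborel. indicator unit_cube (x - n) * \<phi> x) = (LINT x|lborel. indicator unit_cube x * \<phi> (n + x))" for n
    using lborel_integral_translate[of "\<lambda>x. indicator unit_cube (x - n) * \<phi> x" n] meas by simp
  have i2: "integrable lborel (\<lambda>x. indicator unit_cube x * \<phi> (n + x))" for n
  proof (rule integrable_bounded_support[of _ B "R + norm n"])
    show "cmod (indicator unit_cube x * \<phi> (n + x)) \<le> B" for x
      using bd[of "n + x"] order.trans[OF norm_ge_zero bd] by (auto simp: indicator_def norm_mult)
    show "indicator unit_cube x * \<phi> (n + x) = 0" if "R + norm n < norm x" for x
      using supp[of "n + x"] norm_diff_ineq[of x n] that by (simp add: add.commute)
  qed (use meas in simp)
  have "(LINT x|lborel. \<phi> x) = (LINT x|lborel. (\<Sum>n\<in>X. indicator unit_cube (x - n) * \<phi> x))"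
    by (subst eq) (rule refl)
  also have "\<dots> = (\<Sum>n\<in>X. LINT x|lborel. indicator unit_cube (x - n) * \<phi> x)"
    by (rule Bochner_Integration.integral_sum) (rule i1)
  also have "\<dots> = (\<Sum>n\<in>X. LINT x|lborel. indicator unit_cube x * \<phi> (n + x))" by (simp only: tr)
  also have "\<dots> = (LINT x|lborel. (\<Sum>n\<in>X. indicator unit_cube x * \<phi> (n + x)))"
    by (rule Bochner_Integration.integral_sum[symmetric]) (rule i2)
  also have "\<dots> = cube_int (\<lambda>x. \<Sum>n\<in>X. \<phi> (n + x))" unfolding cube_int_def sum_distrib_left ..
  finally show ?thesis .
qed

text \<open>The function cut off to the shifted cube is folded back to the unit cube; periodicity
  makes every fold a value of \<open>f\<close>, and exactly one translate contributes at each
  point.\<close>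

lemma cube_int_periodic:
  fixes f :: "'a::euclidean_space \<Rightarrow> complex"
  assumes cont: "continuous_on UNIV f" and per: "\<And>n x. n \<in> int_points \<Longrightarrow> f (n + x) = f x"
  shows "cube_int (\<lambda>x. f (v + x)) = cube_int f"
proof -
  let ?K = "cbox (v + - (1/2) *\<^sub>R One) (v + (1/2) *\<^sub>R One) :: 'a set"
  have meas: "f \<in> borel_measurable borel" by (rule borel_measurable_continuous_onI[OF cont])
  have K: "y \<in> ?K" if "y - v \<in> unit_cube" for y
    using that by (auto simp: unit_cube_def mem_box inner_diff_left inner_add_left algebra_simps)
  have "compact (f ` ?K)" by (rule compact_continuous_image[OF continuous_on_subset[OF cont]]) auto
  then obtain B where B: "B > 0" "\<And>y. y \<in> f ` ?K \<Longrightarrow> cmod y \<le> B"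
    using compact_imp_bounded bounded_pos by metis
  obtain R where R: "\<And>x. x \<in> ?K \<Longrightarrow> norm x \<le> R"
    using bounded_cbox[of "v + - (1/2) *\<^sub>R One" "v + (1/2) *\<^sub>R One :: 'a"] bounded_iff by metis
  define \<phi> where "\<phi> = (\<lambda>y. indicator unit_cube (y - v) * f y)"
  obtain R2 where R2: "\<And>x. x \<in> (unit_cube :: 'a set) \<Longrightarrow> norm x \<le> R2"
    using bounded_subset[OF bounded_cbox unit_cube_subset_cbox] bounded_iff by metis
  define X where "X = cball 0 (R + R2) \<inter> (int_points :: 'a set)"
  have finX: "finite X" unfolding X_def by (rule bounded_int_points_finite) simp
  have memX: "n \<in> X" if "n \<in> int_points" "n + x \<in> ?K" "x \<in> unit_cube" for n x
  proof -
    have "norm n \<le> norm (n + x) + norm x" using norm_triangle_ineq4[of "n + x" x] by simp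
    then show ?thesis using R[OF that(2)] R2[OF that(3)] that(1) by (simp add: X_def)
  qed
  have "cube_int (\<lambda>x. f (v + x)) = (LINT y|lborel. \<phi> (v + y))"
    by (simp add: cube_int_def \<phi>_def)
  also have "\<dots> = (LINT y|lborel. \<phi> y)" by (rule lborel_integral_translate) (use meas in \<open>simp add: \<phi>_def\<close>)
  also have "\<dots> = cube_int (\<lambda>x. \<Sum>n\<in>X. \<phi> (n + x))"
  proof (rule integral_fold[of _ B R])
    show "\<phi> \<in> borel_measurable borel" using meas by (simp add: \<phi>_def)
    show "cmod (\<phi> x) \<le> B" for x using B K[of x] by (auto simp: \<phi>_def indicator_def norm_mult)
    show "\<phi> x = 0" if "norm x > R" for x using R[OF K[of x]] that by (auto simp: \<phi>_def indicator_def)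
    show "finite X" by (rule finX)
    show "X \<subseteq> int_points" by (simp add: X_def)
    fix n x assume n: "n \<in> int_points" "x \<in> unit_cube" "\<phi> (n + x) \<noteq> 0"
    then have "n + x \<in> ?K" by (intro K) (auto simp: \<phi>_def indicator_def split: if_splits)
    then show "n \<in> X" using n by (intro memX)
  qed
  also have "\<dots> = cube_int f"
    unfolding cube_int_def
  proof (rule Bochner_Integration.integral_cong[OF refl])
    fix x :: 'a
    show "indicator unit_cube x * (\<Sum>n\<in>X. \<phi> (n + x)) = indicator unit_cube x * f x"
    proof (cases "x \<in> unit_cube")
      case True

      \<comment> \<open>Only the translate by \<open>- l\<close> brings \<open>x\<close> into the
        shifted cube.\<close>
      obtain l where l: "l \<in> int_points" "(x - v) - l \<in> unit_cube"
        "\<And>m. m \<in> int_points \<Longrightarrow> (x - v) - m \<in> unit_cube \<Longrightarrow> m = l" using unit_cube_translate_ex1[of "x - v"] by blast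
      have ml: "- l \<in> int_points" using int_points_diff[OF zero_int_points l(1)] by simp
      have lu: "(- l + x) - v \<in> unit_cube" using l(2) by (simp add: algebra_simps)
      have lX: "- l \<in> X" by (rule memX[OF ml K[OF lu] True])
      have "(\<Sum>n\<in>X. \<phi> (n + x)) = (\<Sum>n\<in>X. if n = - l then f x else 0)"
      proof (rule sum.cong[OF refl])
        fix m assume "m \<in> X"
        then have m: "m \<in> int_points" by (simp add: X_def)
        show "\<phi> (m + x) = (if m = - l then f x else 0)"
        proof (cases "(m + x) - v \<in> unit_cube")
          case True
          have "- m = l" using l(3)[of "- m"] int_points_diff[OF zero_int_points m] True by (simp add: algebra_simps)
          then show ?thesis using True per[OF m, of x] by (auto simp: \<phi>_def)
        next
          case False
          then show ?thesis using lu by (auto simp: \<phi>_def)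
        qed
      qed
      also have "\<dots> = f x" using lX finX by simp
      finally show ?thesis by simp
    qed simp
  qed
  finally show ?thesis .
qed

text \<open>A shift by a vector \<open>v\<close> with k . v = 1/2 changes the sign of the character,
  while periodicity leaves the integral unchanged.\<close>

lemma cube_int_unit_char:
  assumes k: "k \<in> int_points"
  shows "cube_int (\<lambda>x. unit_char (k \<bullet> x)) = (if k = 0 then 1 else 0)"
proof (cases "k = 0")
  case True
  then show ?thesis using cube_int_1 by simp
next
  case False
  define v where "v = (1 / (2 * (k \<bullet> k))) *\<^sub>R k"
  have kv: "k \<bullet> v = 1 / 2" using False by (simp add: v_def)
  have half: "unit_char (1 / 2) = - 1" by (simp add: unit_char_def)
  have "cube_int (\<lambda>x. unit_char (k \<bullet> x)) = cube_int (\<lambda>x. unit_char (k \<bullet> (v + x)))"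
    by (rule cube_int_periodic[symmetric])
      (auto intro!: continuous_intros simp: inner_add_right unit_char_add unit_char_int int_points_inner[OF k])
  also have "\<dots> = cube_int (\<lambda>x. (- 1) * unit_char (k \<bullet> x))"
    by (simp only: inner_add_right unit_char_add kv half)
  also have "\<dots> = - cube_int (\<lambda>x. unit_char (k \<bullet> x))" by (subst cube_int_cmult) simp
  finally show ?thesis using False by simp
qed

section \<open>Poisson summation\<close>

text \<open>A trigonometric polynomial whose powers concentrate at the origin of the unit cube. Integrating
  a periodic function against them recovers its value at 0 from its Fourier coefficients.\<close>

definition cube_kernel :: "'a::euclidean_space \<Rightarrow> real" where
  "cube_kernel x = (\<Prod>b\<in>Basis. (1 + cos (2 * pi * (b \<bullet> x))) / 2)"

lemma cube_kernel_continuous: "continuous_on S cube_kernel"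
  unfolding cube_kernel_def by (intro continuous_intros) auto

lemma cube_kernel_factor:
  fixes t :: real
  shows "0 \<le> (1 + cos t) / 2" "(1 + cos t) / 2 \<le> 1"
proof -
  have c: "0 \<le> (1 + c) / 2" if "- 1 \<le> c" for c :: real
  proof (rule divide_nonneg_pos)
    show "0 \<le> 1 + c" using add_left_mono[OF that, of 1] by simp
  qed simp
  have d: "(1 + c) / 2 \<le> 1" if "c \<le> 1" for c :: real using that by simp
  show "0 \<le> (1 + cos t) / 2" "(1 + cos t) / 2 \<le> 1"
    using c[OF cos_ge_minus_one] d[OF cos_le_one] .
qed

lemma cube_kernel_bounds: "0 \<le> cube_kernel x" "cube_kernel x \<le> 1"
  unfolding cube_kernel_def by (intro prod_nonneg prod_le_1 ballI conjI cube_kernel_factor)+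

lemma cube_kernel_0: "cube_kernel 0 = 1"
  by (simp add: cube_kernel_def)

text \<open>All factors lie between 0 and 1, so a product equal to 1 forces every cosine to be 1.
  Then all coordinates are integers of absolute value at most 1/2. The closed cube is taken because
  compactness is needed next.\<close>

lemma cube_kernel_eq_1:
  fixes x :: "'a::euclidean_space"
  assumes x: "x \<in> cbox (- (1/2) *\<^sub>R One) ((1/2) *\<^sub>R One)" and eq: "cube_kernel x = 1"
  shows "x = 0"
proof (rule euclidean_eqI)
  fix b :: 'a assume b: "b \<in> Basis"
  have "cube_kernel x = (1 + cos (2 * pi * (b \<bullet> x))) / 2 * (\<Prod>b\<in>Basis - {b}. (1 + cos (2 * pi * (b \<bullet> x))) / 2)"
    unfolding cube_kernel_def by (rule prod.remove[OF finite_Basis b])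
  also have "\<dots> \<le> (1 + cos (2 * pi * (b \<bullet> x))) / 2 * 1"
    by (intro mult_left_mono prod_le_1 conjI cube_kernel_factor)
  finally have "cos (2 * pi * (b \<bullet> x)) = 1" using eq cos_le_one[of "2 * pi * (b \<bullet> x)"] by simp
  then have "\<exists>n::int. 2 * pi * (b \<bullet> x) = real_of_int n * 2 * pi" by (simp only: cos_one_2pi_int)
  then obtain n :: int where n: "2 * pi * (b \<bullet> x) = real_of_int n * 2 * pi" ..
  then have n': "b \<bullet> x = real_of_int n" by simp
  have "(- (1/2) *\<^sub>R One) \<bullet> b \<le> x \<bullet> b \<and> x \<bullet> b \<le> ((1/2) *\<^sub>R One) \<bullet> b"
    using x b unfolding mem_box by blast
  then have "- 1 / 2 \<le> x \<bullet> b" "x \<bullet> b \<le> 1 / 2" using b by auto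
  then have "\<bar>b \<bullet> x\<bar> \<le> 1 / 2" unfolding inner_commute[of b x] by linarith
  then have "\<bar>n\<bar> < 1" unfolding n' by linarith
  then show "x \<bullet> b = 0 \<bullet> b" using n' by (simp add: inner_commute)
qed

text \<open>Away from 0 the kernel is at most some \<open>\<eta>\<close> < 1 and near 0 at least
  some \<open>\<theta>\<close> > \<open>\<eta>\<close>. The total mass of the m-th power is thus at
  least a constant times \<theta>^m, against which \<eta>^m is negligible.\<close>

lemma cube_kernel_concentrates:
  fixes \<phi> :: "'a::euclidean_space \<Rightarrow> complex"
  assumes cont: "continuous_on UNIV \<phi>"
  shows "(\<lambda>m. cube_int (\<lambda>x. \<phi> x * of_real (cube_kernel x ^ m)) / cube_int (\<lambda>x::'a. of_real (cube_kernel x ^ m))) \<longlonglongrightarrow> \<phi> 0"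
proof -
  let ?C = "cbox (- (1/2) *\<^sub>R One) ((1/2) *\<^sub>R One) :: 'a set"
  let ?q = "cube_kernel :: 'a \<Rightarrow> real"
  define I where "I = (\<lambda>m. LINT x|lborel. indicator unit_cube x * ?q x ^ m)"
  have cq: "continuous_on UNIV (\<lambda>x. complex_of_real (?q x ^ m))" for m
    by (intro continuous_intros cube_kernel_continuous)
  have Ic: "cube_int (\<lambda>x. of_real (?q x ^ m)) = complex_of_real (I m)" for m
  proof -
    have "cube_int (\<lambda>x. of_real (?q x ^ m)) = (LINT x|lborel. complex_of_real (indicator unit_cube x * ?q x ^ m))"
      unfolding cube_int_def by (rule Bochner_Integration.integral_cong) (auto simp: indicator_def)
    then show ?thesis unfolding I_def by (simp only: integral_complex_of_real)
  qed
  have intI: "integrable lborel (\<lambda>x. indicator unit_cube x * ?q x ^ m)" for m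
  proof -
    have "integrable lborel (\<lambda>x. norm (indicator unit_cube x * complex_of_real (?q x ^ m)))"
      by (rule integrable_norm[OF integrable_unit_cube[OF cq]])
    moreover have "(\<lambda>x. norm (indicator unit_cube x * complex_of_real (?q x ^ m))) = (\<lambda>x. indicator unit_cube x * ?q x ^ m)"
    proof
      fix x :: 'a
      show "norm (indicator unit_cube x * complex_of_real (?q x ^ m)) = indicator unit_cube x * ?q x ^ m"
        using cube_kernel_bounds(1)[of x]
        by (cases "x \<in> unit_cube") (simp_all add: norm_mult norm_power)
    qed
    ultimately show ?thesis by simp
  qed
  have "compact ((\<lambda>x. \<phi> x - \<phi> 0) ` ?C)"
    by (intro compact_continuous_image continuous_intros continuous_on_subset[OF cont]) auto
  then obtain M where M: "M > 0" "\<And>y. y \<in> (\<lambda>x. \<phi> x - \<phi> 0) ` ?C \<Longrightarrow> cmod y \<le> M"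
    using compact_imp_bounded bounded_pos by metis
  show ?thesis
  proof (rule LIMSEQ_I)
    fix \<epsilon> :: real assume \<epsilon>: "\<epsilon> > 0"
    have "isCont \<phi> 0" using cont by (simp add: continuous_on_eq_continuous_at)
    then obtain \<delta> where \<delta>: "\<delta> > 0" "\<And>x. norm (x - 0) < \<delta> \<Longrightarrow> norm (\<phi> x - \<phi> 0) < \<epsilon> / 2"
      unfolding continuous_at_eps_delta dist_norm using \<epsilon> half_gt_zero by metis
    define K where "K = ?C - ball 0 \<delta>"
    have K: "compact K" unfolding K_def by (intro compact_diff) auto
    obtain \<eta> where \<eta>: "0 \<le> \<eta>" "\<eta> < 1" "\<And>x. x \<in> K \<Longrightarrow> ?q x \<le> \<eta>"
    proof (cases "K = {}")
      case True
      then show ?thesis using that[of 0] by simp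
    next
      case False
      obtain x0 where x0: "x0 \<in> K" "\<And>x. x \<in> K \<Longrightarrow> ?q x \<le> ?q x0"
        using continuous_attains_sup[OF K False cube_kernel_continuous] by blast
      have "x0 \<noteq> 0" using x0(1) \<delta>(1) by (auto simp: K_def)
      then have "?q x0 \<noteq> 1" using cube_kernel_eq_1[of x0] x0(1) by (auto simp: K_def)
      then show ?thesis using that[of "?q x0"] x0(2) cube_kernel_bounds[of x0] by force
    qed
    \<comment> \<open>Any number strictly between \<open>\<eta>\<close> and 1 would do; the kernel
      exceeds it near 0 by continuity.\<close>
    define \<theta> where "\<theta> = (1 + \<eta>) / 2"
    have \<theta>: "\<eta> < \<theta>" "\<theta> < 1" "0 < \<theta>" using \<eta> by (auto simp: \<theta>_def)
    have "isCont ?q 0" using cube_kernel_continuous[of "UNIV :: 'a set"] by (simp add: continuous_on_eq_continuous_at)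
    then obtain \<rho> where \<rho>: "\<rho> > 0" "\<And>x. norm (x - 0) < \<rho> \<Longrightarrow> norm (?q x - ?q 0) < 1 - \<theta>"
      unfolding continuous_at_eps_delta dist_norm using \<theta>(2) diff_gt_0_iff_gt by metis
    define r where "r = min \<rho> (1 / 2)"
    have r: "r > 0" "r \<le> 1 / 2" "r \<le> \<rho>" using \<rho>(1) by (auto simp: r_def)
    have ballq: "?q x \<ge> \<theta>" if "x \<in> ball 0 r" for x
      using \<rho>(2)[of x] that r(3) by (simp add: cube_kernel_0 abs_if split: if_splits)
    have ballC: "ball 0 r \<subseteq> (unit_cube :: 'a set)"
    proof
      fix x :: 'a assume x: "x \<in> ball 0 r"
      have "- 1 / 2 \<le> x \<bullet> b \<and> x \<bullet> b < 1 / 2" if "b \<in> Basis" for b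
      proof -
        have "\<bar>x \<bullet> b\<bar> < 1 / 2" using Basis_le_norm[OF that, of x] x r(2) by simp
        then show ?thesis by linarith
      qed
      then show "x \<in> unit_cube" unfolding unit_cube_def by blast
    qed
    define \<mu> where "\<mu> = measure lborel (ball (0::'a) r)"
    have \<mu>: "\<mu> > 0" unfolding \<mu>_def using content_ball_pos[OF r(1), of "0::'a"] by simp
    have finb: "emeasure lborel (ball (0::'a) r) < \<infinity>" by (rule emeasure_bounded_finite) simp
    have Ilow: "\<mu> * \<theta> ^ m \<le> I m" for m
    proof -
      have "\<mu> * \<theta> ^ m = (LINT x|lborel. indicator (ball (0::'a) r) x * \<theta> ^ m)"
        by (simp add: \<mu>_def)
      also have "\<dots> \<le> I m" unfolding I_def
      proof (rule Bochner_Integration.integral_mono[OF _ intI])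
        show "integrable lborel (\<lambda>x. indicator (ball (0::'a) r) x * \<theta> ^ m)"
          by (intro integrable_mult_left integrable_real_indicator finb) simp
        show "indicator (ball 0 r) x * \<theta> ^ m \<le> indicator unit_cube x * ?q x ^ m" for x
        proof (cases "x \<in> ball 0 r")
          case True
          then show ?thesis using ballC power_mono[OF ballq[OF True] less_imp_le[OF \<theta>(3)], of m] by auto
        next
          case False
          then show ?thesis using cube_kernel_bounds(1)[of x] by (simp add: indicator_def)
        qed
      qed
      finally show ?thesis .
    qed
    have Ipos: "I m > 0" for m using Ilow[of m] mult_pos_pos[OF \<mu> zero_less_power[OF \<theta>(3)]] by (rule order.strict_trans2[rotated])
    \<comment> \<open>The cube is split at distance \<open>\<delta>\<close> from 0: inside,
      continuity of \<open>\<phi>\<close> gives \<epsilon>/2; outside, the kernel is at most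
      \<open>\<eta>\<close> and \<open>M\<close> bounds the difference.\<close>
    have diff: "cmod (cube_int (\<lambda>x. \<phi> x * of_real (?q x ^ m)) - \<phi> 0 * I m) \<le> \<epsilon> / 2 * I m + M * \<eta> ^ m" for m
    proof -
      have c1: "continuous_on UNIV (\<lambda>x. \<phi> x * of_real (?q x ^ m))" by (intro continuous_intros cont cq)
      have c2: "continuous_on UNIV (\<lambda>x. (- \<phi> 0) * of_real (?q x ^ m))" by (intro continuous_intros cq)
      have c3: "continuous_on UNIV (\<lambda>x. (\<phi> x - \<phi> 0) * of_real (?q x ^ m))" by (intro continuous_intros cont cq)
      have "cube_int (\<lambda>x. \<phi> x * of_real (?q x ^ m)) - \<phi> 0 * I m
          = cube_int (\<lambda>x. \<phi> x * of_real (?q x ^ m)) + cube_int (\<lambda>x. (- \<phi> 0) * of_real (?q x ^ m))"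
        by (simp only: cube_int_cmult Ic) simp
      also have "\<dots> = cube_int (\<lambda>x. (\<phi> x - \<phi> 0) * of_real (?q x ^ m))"
        unfolding cube_int_add[OF c1 c2, symmetric] by (simp add: left_diff_distrib)
      finally have "cmod (cube_int (\<lambda>x. \<phi> x * of_real (?q x ^ m)) - \<phi> 0 * I m)
          = cmod (LINT x|lborel. indicator unit_cube x * ((\<phi> x - \<phi> 0) * of_real (?q x ^ m)))"
        by (simp only: cube_int_def)
      also have "\<dots> \<le> (LINT x|lborel. norm (indicator unit_cube x * ((\<phi> x - \<phi> 0) * of_real (?q x ^ m))))"
        by (rule integral_norm_bound)
      also have "\<dots> \<le> (LINT x|lborel. \<epsilon> / 2 * (indicator unit_cube x * ?q x ^ m) + indicator (unit_cube :: 'a set) x * (M * \<eta> ^ m))"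
      proof (rule Bochner_Integration.integral_mono[OF integrable_norm[OF integrable_unit_cube[OF c3]]])
        show "integrable lborel (\<lambda>x. \<epsilon> / 2 * (indicator unit_cube x * ?q x ^ m) + indicator (unit_cube :: 'a set) x * (M * \<eta> ^ m))"
          by (intro Bochner_Integration.integrable_add integrable_mult_right intI integrable_mult_left integrable_real_indicator)
            (auto simp: emeasure_unit_cube)
        fix x :: 'a
        show "norm (indicator unit_cube x * ((\<phi> x - \<phi> 0) * of_real (?q x ^ m)))
            \<le> \<epsilon> / 2 * (indicator unit_cube x * ?q x ^ m) + indicator unit_cube x * (M * \<eta> ^ m)"
        proof (cases "x \<in> unit_cube")
          case True
          then have xC: "x \<in> ?C" using unit_cube_subset_cbox by blast
          have q: "0 \<le> ?q x ^ m" using cube_kernel_bounds(1)[of x] by simp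
          have n: "norm ((\<phi> x - \<phi> 0) * of_real (?q x ^ m)) = norm (\<phi> x - \<phi> 0) * ?q x ^ m"
            using q by (simp only: norm_mult norm_of_real abs_of_nonneg)
          show ?thesis
          proof (cases "norm x < \<delta>")
            case True
            have "norm (\<phi> x - \<phi> 0) * ?q x ^ m \<le> \<epsilon> / 2 * ?q x ^ m"
              using \<delta>(2)[of x] True by (intro mult_right_mono q) simp
            moreover have "0 \<le> M * \<eta> ^ m" using M(1) \<eta>(1) by simp
            ultimately show ?thesis using \<open>x \<in> unit_cube\<close> n by simp
          next
            case False
            then have "x \<in> K" using xC by (simp add: K_def)
            then have "?q x ^ m \<le> \<eta> ^ m" using \<eta>(3) cube_kernel_bounds(1) by (intro power_mono) auto
            then have "norm (\<phi> x - \<phi> 0) * ?q x ^ m \<le> M * \<eta> ^ m"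
              using M(1) by (intro mult_mono M(2) imageI xC q) auto
            moreover have "0 \<le> \<epsilon> / 2 * ?q x ^ m" using \<epsilon> q by simp
            ultimately show ?thesis using \<open>x \<in> unit_cube\<close> n by simp
          qed
        qed simp
      qed
      also have "\<dots> = \<epsilon> / 2 * I m + M * \<eta> ^ m"
      proof -
        have "integrable lborel (\<lambda>x. \<epsilon> / 2 * (indicator unit_cube x * ?q x ^ m))"
          "integrable lborel (\<lambda>x. indicator (unit_cube :: 'a set) x * (M * \<eta> ^ m))"
          by (intro integrable_mult_right intI integrable_mult_left integrable_real_indicator; simp add: emeasure_unit_cube)+
        then show ?thesis by (simp add: I_def measure_def emeasure_unit_cube)
      qed
      finally show ?thesis .
    qed
    have "(\<lambda>m. M / \<mu> * (\<eta> / \<theta>) ^ m) \<longlonglongrightarrow> M / \<mu> * 0"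
      using \<eta>(1) \<theta> by (intro tendsto_mult_left LIMSEQ_power_zero) simp
    then have "\<forall>\<^sub>F m in sequentially. M / \<mu> * (\<eta> / \<theta>) ^ m < \<epsilon> / 2"
      using \<epsilon> by (intro order_tendstoD(2)) auto
    then obtain m0 where m0: "\<And>m. m \<ge> m0 \<Longrightarrow> M / \<mu> * (\<eta> / \<theta>) ^ m < \<epsilon> / 2"
      unfolding eventually_sequentially by blast
    show "\<exists>no. \<forall>n\<ge>no. norm (cube_int (\<lambda>x. \<phi> x * of_real (?q x ^ n)) / cube_int (\<lambda>x. of_real (?q x ^ n)) - \<phi> 0) < \<epsilon>"
    proof (intro exI[of _ m0] allI impI)
      fix m assume m: "m \<ge> m0"
      have I0: "complex_of_real (I m) \<noteq> 0" using Ipos[of m] by simp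
      have "cube_int (\<lambda>x. \<phi> x * of_real (?q x ^ m)) / complex_of_real (I m) - \<phi> 0
          = (cube_int (\<lambda>x. \<phi> x * of_real (?q x ^ m)) - \<phi> 0 * I m) / complex_of_real (I m)"
        using I0 by (simp add: diff_divide_distrib)
      then have "norm (cube_int (\<lambda>x. \<phi> x * of_real (?q x ^ m)) / complex_of_real (I m) - \<phi> 0)
          = cmod (cube_int (\<lambda>x. \<phi> x * of_real (?q x ^ m)) - \<phi> 0 * I m) / I m"
        using Ipos[of m] by (simp only: norm_divide norm_of_real abs_of_pos)
      also have "\<dots> \<le> (\<epsilon> / 2 * I m + M * \<eta> ^ m) / I m"
        by (rule divide_right_mono[OF diff]) (use Ipos[of m] in simp)
      also have "\<dots> = \<epsilon> / 2 + M * \<eta> ^ m / I m" using Ipos[of m] by (simp add: add_divide_distrib)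
      also have "\<dots> \<le> \<epsilon> / 2 + M * \<eta> ^ m / (\<mu> * \<theta> ^ m)"
        using M(1) \<eta>(1) Ilow[of m] Ipos[of m] \<mu> \<theta>(3) by (intro add_left_mono divide_left_mono) auto
      also have "M * \<eta> ^ m / (\<mu> * \<theta> ^ m) = M / \<mu> * (\<eta> / \<theta>) ^ m" by (simp add: power_divide)
      also have "\<epsilon> / 2 + M / \<mu> * (\<eta> / \<theta>) ^ m < \<epsilon> / 2 + \<epsilon> / 2"
        by (rule add_strict_left_mono[OF m0[OF m]])
      also have "\<epsilon> / 2 + \<epsilon> / 2 = \<epsilon>" by simp
      finally show "norm (cube_int (\<lambda>x. \<phi> x * of_real (?q x ^ m)) / cube_int (\<lambda>x. of_real (?q x ^ m)) - \<phi> 0) < \<epsilon>"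
        unfolding Ic .
    qed
  qed
qed

text \<open>Exhibits each factor of the kernel as a trigonometric polynomial with weights 1/2, 1/4,
  1/4 at the frequencies 0, 1, -1.\<close>

lemma cube_kernel_cos: "complex_of_real ((1 + cos (2 * pi * t)) / 2) = 1 / 2 + (unit_char t / 4 + unit_char (- t) / 4)"
  by (rule complex_eqI) (simp_all add: unit_char_def)

text \<open>The Fourier coefficients of the periodised function are the values of
  \<open>fourier g\<close> on lattice points. Testing against normalised powers of the kernel
  converges to the value at 0 on one side and to the sum of the coefficients on the other.\<close>

theorem poisson_summation:
  fixes g :: "'a::euclidean_space \<Rightarrow> complex"
  assumes g: "test_fun g"
  shows "(fourier g has_sum (\<Sum>\<^sub>\<infinity>n\<in>int_points. g n)) int_points"
proof -
  let ?Z = "int_points :: 'a set"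
  have gc: "continuous_on UNIV g" by (rule test_fun_continuous[OF g])
  have gm: "g \<in> borel_measurable borel" by (rule test_fun_measurable[OF g])
  obtain R where R: "R > 0" "\<And>x. norm x > R \<Longrightarrow> g x = 0" by (rule test_fun_support[OF g]) (rule that)
  obtain B where B: "B > 0" "\<And>x. cmod (g x) \<le> B" by (rule test_fun_bounded[OF g]) (rule that)
  obtain R2 where R2: "\<And>x. x \<in> (unit_cube :: 'a set) \<Longrightarrow> norm x \<le> R2"
    using bounded_subset[OF bounded_cbox unit_cube_subset_cbox] bounded_iff by metis
  define X where "X = cball 0 (R + R2) \<inter> ?Z"
  have X: "finite X" "X \<subseteq> ?Z" unfolding X_def by (rule bounded_int_points_finite) auto
  have memX: "n \<in> X" if "n \<in> ?Z" "x \<in> unit_cube" "g (n + x) \<noteq> 0" for n x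
  proof -
    have "norm (n + x) \<le> R" using R(2)[of "n + x"] that(3) by force
    moreover have "norm n \<le> norm (n + x) + norm x" using norm_triangle_ineq4[of "n + x" x] by simp
    ultimately show ?thesis using R2[OF that(2)] that(1) by (simp add: X_def)
  qed
  \<comment> \<open>On the unit cube this finite sum is the full periodisation of \<open>g\<close>;
    outside it need not be periodic, and all integrals are taken over the cube.\<close>
  define G where "G = (\<lambda>x. \<Sum>n\<in>X. g (n + x))"
  have Gc: "continuous_on UNIV G" unfolding G_def
    by (intro continuous_intros continuous_on_compose2[OF gc]) auto
  have ec: "continuous_on UNIV (\<lambda>x. unit_char (k \<bullet> x))" for k :: 'a by (intro continuous_intros)
  have coeff: "cube_int (\<lambda>x. G x * unit_char (- (j \<bullet> x))) = fourier g j" if j: "j \<in> ?Z" for j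
  proof -
    have "fourier g j = cube_int (\<lambda>x. \<Sum>n\<in>X. g (n + x) * unit_char (- (j \<bullet> (n + x))))"
      unfolding fourier_def
    proof (rule integral_fold[of _ B R])
      show "(\<lambda>x. g x * unit_char (- (j \<bullet> x))) \<in> borel_measurable borel"
        by (rule borel_measurable_continuous_onI) (intro continuous_intros gc)
    qed (use B R X memX in \<open>auto simp: norm_mult\<close>)
    also have "(\<lambda>x. \<Sum>n\<in>X. g (n + x) * unit_char (- (j \<bullet> (n + x)))) = (\<lambda>x. G x * unit_char (- (j \<bullet> x)))"
    proof
      fix x
      have "unit_char (- (j \<bullet> (n + x))) = unit_char (- (j \<bullet> x))" if "n \<in> X" for n
      proof -
        have "n \<in> ?Z" using X(2) that by blast
        then have "unit_char (- (j \<bullet> n)) = 1" using int_points_inner[OF j] by (intro unit_char_int Ints_minus)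
        then show ?thesis by (simp only: inner_add_right minus_add_distrib unit_char_add mult_1_left)
      qed
      then show "(\<Sum>n\<in>X. g (n + x) * unit_char (- (j \<bullet> (n + x)))) = G x * unit_char (- (j \<bullet> x))"
        unfolding G_def sum_distrib_right by (intro sum.cong refl) simp
    qed
    finally show ?thesis ..
  qed
  have abs: "(\<lambda>k. cmod (fourier g k)) summable_on ?Z" by (rule fourier_summable[OF g])
  have smb: "(\<lambda>k. fourier g k * c k) summable_on ?Z" if "\<And>k. cmod (c k) \<le> D" for c D
  proof (rule abs_summable_summable, rule Infinite_Sum.abs_summable_on_comparison_test'[OF summable_on_cmult_left[OF abs, of D]])
    show "norm (fourier g k * c k) \<le> cmod (fourier g k) * D" for k
      using that[of k] by (simp add: norm_mult mult_left_mono)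
  qed
  \<comment> \<open>\<open>T p\<close> says that after multiplication by \<open>p\<close> the
    Fourier series of \<open>G\<close> may be integrated term by term, although its convergence to
    \<open>G\<close> is not known. Quantifying over all frequencies \<open>j\<close> is what makes
    this stable under trigonometric factors.\<close>
  define T where "T = (\<lambda>p::'a \<Rightarrow> complex. continuous_on UNIV p \<and> (\<exists>D. \<forall>x. cmod (p x) \<le> D) \<and>
    (\<forall>j\<in>?Z. cube_int (\<lambda>x. G x * p x * unit_char (- (j \<bullet> x)))
      = (\<Sum>\<^sub>\<infinity>k\<in>?Z. fourier g k * cube_int (\<lambda>x. unit_char (k \<bullet> x) * p x * unit_char (- (j \<bullet> x))))))"
  \<comment> \<open>For p = 1 orthogonality leaves the single term k = j, the Fourier coefficient of
    \<open>G\<close>.\<close>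
  have T1: "T (\<lambda>_. 1)" unfolding T_def
  proof (intro conjI ballI)
    show "\<exists>D. \<forall>x. cmod 1 \<le> D" by (rule exI[of _ 1]) simp
    fix j assume j: "j \<in> ?Z"
    have "(\<Sum>\<^sub>\<infinity>k\<in>?Z. fourier g k * cube_int (\<lambda>x. unit_char (k \<bullet> x) * 1 * unit_char (- (j \<bullet> x))))
        = (\<Sum>\<^sub>\<infinity>k\<in>{j}. fourier g k)"
    proof (rule infsum_cong_neutral)
      have *: "cube_int (\<lambda>x. unit_char (k \<bullet> x) * 1 * unit_char (- (j \<bullet> x))) = (if k = j then 1 else 0)" if "k \<in> ?Z" for k
        using cube_int_unit_char[OF int_points_diff[OF that j]]
        by (simp add: inner_diff_left flip: unit_char_add)
      show "fourier g k * cube_int (\<lambda>x. unit_char (k \<bullet> x) * 1 * unit_char (- (j \<bullet> x))) = 0" if "k \<in> ?Z - {j}" for k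
        using *[of k] that by simp
      show "fourier g k * cube_int (\<lambda>x. unit_char (k \<bullet> x) * 1 * unit_char (- (j \<bullet> x))) = fourier g k" if "k \<in> ?Z \<inter> {j}" for k
        using *[of k] that j by simp
    qed (use j in auto)
    then show "cube_int (\<lambda>x. G x * 1 * unit_char (- (j \<bullet> x)))
      = (\<Sum>\<^sub>\<infinity>k\<in>?Z. fourier g k * cube_int (\<lambda>x. unit_char (k \<bullet> x) * 1 * unit_char (- (j \<bullet> x))))"
      using coeff[OF j] by simp
  qed simp
  \<comment> \<open>A cosine factor is a combination of the frequency \<open>j\<close> and its
    neighbours \<open>j - b\<close> and \<open>j + b\<close>, for which the identity is
    known.\<close>
  have Tstep: "T (\<lambda>x. of_real ((1 + cos (2 * pi * (b \<bullet> x))) / 2) * p x)" if b: "b \<in> Basis" and p: "T p" for b p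
  proof -
    have pc: "continuous_on UNIV p" using p by (simp add: T_def)
    obtain D where D: "\<And>x. cmod (p x) \<le> D" using p by (auto simp: T_def)
    have pj: "cube_int (\<lambda>x. G x * p x * unit_char (- (j \<bullet> x)))
      = (\<Sum>\<^sub>\<infinity>k\<in>?Z. fourier g k * cube_int (\<lambda>x. unit_char (k \<bullet> x) * p x * unit_char (- (j \<bullet> x))))" if "j \<in> ?Z" for j
      using p that unfolding T_def by blast
    have split: "cube_int (\<lambda>x. H x * (of_real ((1 + cos (2 * pi * (b \<bullet> x))) / 2) * p x) * unit_char (- (j \<bullet> x)))
      = 1 / 2 * cube_int (\<lambda>x. H x * p x * unit_char (- (j \<bullet> x)))
      + (1 / 4 * cube_int (\<lambda>x. H x * p x * unit_char (- ((j - b) \<bullet> x)))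
      + 1 / 4 * cube_int (\<lambda>x. H x * p x * unit_char (- ((j + b) \<bullet> x))))" if H: "continuous_on UNIV H" for H j
    proof -
      have c: "continuous_on UNIV (\<lambda>x. a * (H x * p x * unit_char (- (i \<bullet> x))))" for a i
        by (intro continuous_intros H pc)
      have "(\<lambda>x. H x * (of_real ((1 + cos (2 * pi * (b \<bullet> x))) / 2) * p x) * unit_char (- (j \<bullet> x)))
        = (\<lambda>x. 1 / 2 * (H x * p x * unit_char (- (j \<bullet> x))) + (1 / 4 * (H x * p x * unit_char (- ((j - b) \<bullet> x)))
          + 1 / 4 * (H x * p x * unit_char (- ((j + b) \<bullet> x)))))"
      proof
        fix x
        have m: "unit_char (- ((j - b) \<bullet> x)) = unit_char (b \<bullet> x) * unit_char (- (j \<bullet> x))"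
          "unit_char (- ((j + b) \<bullet> x)) = unit_char (- (b \<bullet> x)) * unit_char (- (j \<bullet> x))"
          by (simp_all add: inner_diff_left inner_add_left algebra_simps flip: unit_char_add)
        show "H x * (of_real ((1 + cos (2 * pi * (b \<bullet> x))) / 2) * p x) * unit_char (- (j \<bullet> x))
          = 1 / 2 * (H x * p x * unit_char (- (j \<bullet> x))) + (1 / 4 * (H x * p x * unit_char (- ((j - b) \<bullet> x)))
          + 1 / 4 * (H x * p x * unit_char (- ((j + b) \<bullet> x))))"
          unfolding cube_kernel_cos m by (simp add: algebra_simps)
      qed
      then show ?thesis
        by (simp only: cube_int_add[OF c continuous_on_add[OF c c]] cube_int_add[OF c c] cube_int_cmult)
    qed
    show ?thesis unfolding T_def
    proof (intro conjI ballI)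
      show "continuous_on UNIV (\<lambda>x. of_real ((1 + cos (2 * pi * (b \<bullet> x))) / 2) * p x)"
        by (intro continuous_intros pc) auto
      have "cmod (of_real ((1 + cos (2 * pi * (b \<bullet> x))) / 2) * p x) \<le> 1 * D" for x
        unfolding norm_mult norm_of_real using cube_kernel_factor[of "2 * pi * (b \<bullet> x)"] D[of x]
        by (intro mult_mono) auto
      then show "\<exists>D. \<forall>x. cmod (of_real ((1 + cos (2 * pi * (b \<bullet> x))) / 2) * p x) \<le> D" by blast
      fix j assume j: "j \<in> ?Z"
      note jb = int_points_diff[OF j Basis_int_points[OF b]] int_points_add[OF j Basis_int_points[OF b]]
      let ?c = "\<lambda>i k. cube_int (\<lambda>x. unit_char (k \<bullet> x) * p x * unit_char (- (i \<bullet> x)))"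
      have s: "(\<lambda>k. fourier g k * (a * ?c i k)) summable_on ?Z" for a i
      proof (rule smb)
        show "cmod (a * ?c i k) \<le> cmod a * D" for k
          unfolding norm_mult
          by (intro mult_left_mono cube_int_norm_le continuous_intros pc) (auto simp: norm_mult D)
      qed
      have "cube_int (\<lambda>x. G x * (of_real ((1 + cos (2 * pi * (b \<bullet> x))) / 2) * p x) * unit_char (- (j \<bullet> x)))
        = 1 / 2 * (\<Sum>\<^sub>\<infinity>k\<in>?Z. fourier g k * ?c j k) + (1 / 4 * (\<Sum>\<^sub>\<infinity>k\<in>?Z. fourier g k * ?c (j - b) k)
          + 1 / 4 * (\<Sum>\<^sub>\<infinity>k\<in>?Z. fourier g k * ?c (j + b) k))"
        unfolding split[OF Gc] pj[OF j] pj[OF jb(1)] pj[OF jb(2)] ..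
      also have "\<dots> = (\<Sum>\<^sub>\<infinity>k\<in>?Z. fourier g k * (1 / 2 * ?c j k)) + ((\<Sum>\<^sub>\<infinity>k\<in>?Z. fourier g k * (1 / 4 * ?c (j - b) k))
          + (\<Sum>\<^sub>\<infinity>k\<in>?Z. fourier g k * (1 / 4 * ?c (j + b) k)))"
        by (simp only: infsum_cmult_right'[symmetric] mult.left_commute)
      also have "\<dots> = (\<Sum>\<^sub>\<infinity>k\<in>?Z. fourier g k * (1 / 2 * ?c j k) + (fourier g k * (1 / 4 * ?c (j - b) k)
          + fourier g k * (1 / 4 * ?c (j + b) k)))"
        by (simp only: infsum_add[OF s summable_on_add[OF s s]] infsum_add[OF s s])
      also have "\<dots> = (\<Sum>\<^sub>\<infinity>k\<in>?Z. fourier g k * cube_int (\<lambda>x. unit_char (k \<bullet> x) *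
          (of_real ((1 + cos (2 * pi * (b \<bullet> x))) / 2) * p x) * unit_char (- (j \<bullet> x))))"
        unfolding split[OF ec] distrib_left ..
      finally show "cube_int (\<lambda>x. G x * (of_real ((1 + cos (2 * pi * (b \<bullet> x))) / 2) * p x) * unit_char (- (j \<bullet> x)))
        = (\<Sum>\<^sub>\<infinity>k\<in>?Z. fourier g k * cube_int (\<lambda>x. unit_char (k \<bullet> x) *
          (of_real ((1 + cos (2 * pi * (b \<bullet> x))) / 2) * p x) * unit_char (- (j \<bullet> x))))" .
    qed
  qed
  have Tprod: "T (\<lambda>x. of_real (\<Prod>b\<in>S. (1 + cos (2 * pi * (b \<bullet> x))) / 2) * p x)"
    if "finite S" "S \<subseteq> Basis" "T p" for S p
    using that
  proof (induction S rule: finite_induct)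
    case (insert b S)
    then have "T (\<lambda>x. of_real ((1 + cos (2 * pi * (b \<bullet> x))) / 2) * (of_real (\<Prod>b\<in>S. (1 + cos (2 * pi * (b \<bullet> x))) / 2) * p x))"
      by (intro Tstep) auto
    then show ?case by (simp only: prod.insert[OF insert.hyps] of_real_mult mult.assoc)
  qed simp
  have Tpow: "T (\<lambda>x. of_real (cube_kernel x ^ m))" for m
  proof (induction m)
    case 0
    then show ?case using T1 by simp
  next
    case (Suc m)
    have "T (\<lambda>x. of_real (\<Prod>b\<in>Basis. (1 + cos (2 * pi * (b \<bullet> x))) / 2) * of_real (cube_kernel x ^ m))"
      by (rule Tprod[OF finite_Basis order_refl Suc])
    then show ?case unfolding cube_kernel_def[symmetric] by (simp only: power_Suc of_real_mult)
  qed
  let ?I = "\<lambda>m. cube_int (\<lambda>x::'a. of_real (cube_kernel x ^ m))"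
  let ?c = "\<lambda>m k. cube_int (\<lambda>x. unit_char (k \<bullet> x) * of_real (cube_kernel x ^ m)) / ?I m"
  have main: "cube_int (\<lambda>x. G x * of_real (cube_kernel x ^ m)) / ?I m = (\<Sum>\<^sub>\<infinity>k\<in>?Z. fourier g k * ?c m k)" for m
  proof -
    have "cube_int (\<lambda>x. G x * of_real (cube_kernel x ^ m) * unit_char (- (0 \<bullet> x)))
      = (\<Sum>\<^sub>\<infinity>k\<in>?Z. fourier g k * cube_int (\<lambda>x. unit_char (k \<bullet> x) * of_real (cube_kernel x ^ m) * unit_char (- (0 \<bullet> x))))"
      using Tpow[of m] zero_int_points unfolding T_def by blast
    then have "cube_int (\<lambda>x. G x * of_real (cube_kernel x ^ m)) / ?I m
      = (\<Sum>\<^sub>\<infinity>k\<in>?Z. fourier g k * cube_int (\<lambda>x. unit_char (k \<bullet> x) * of_real (cube_kernel x ^ m))) * (1 / ?I m)"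
      by simp
    then show ?thesis by (simp only: infsum_cmult_left'[symmetric]) simp
  qed
  have lim1: "(\<lambda>m. \<Sum>\<^sub>\<infinity>k\<in>?Z. fourier g k * ?c m k) \<longlonglongrightarrow> G 0"
    unfolding main[symmetric] by (rule cube_kernel_concentrates[OF Gc])
  \<comment> \<open>The kernel is nonnegative, so its Fourier coefficients are bounded by its mass.
    The bound is uniform in m and permits the interchange of limit and sum.\<close>
  have cle: "cmod (?c m k) \<le> 1" for m and k :: 'a
  proof -
    have "cmod (cube_int (\<lambda>x. unit_char (k \<bullet> x) * of_real (cube_kernel x ^ m)))
        \<le> (LINT x|lborel. norm (indicator unit_cube x * (unit_char (k \<bullet> x) * of_real (cube_kernel x ^ m))))"
      unfolding cube_int_def by (rule integral_norm_bound)
    also have "\<dots> = (LINT x|lborel. indicator unit_cube x * cube_kernel (x::'a) ^ m)"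
    proof (rule Bochner_Integration.integral_cong[OF refl])
      fix x :: 'a
      show "norm (indicator unit_cube x * (unit_char (k \<bullet> x) * of_real (cube_kernel x ^ m))) = indicator unit_cube x * cube_kernel x ^ m"
        using cube_kernel_bounds(1)[of x]
        by (cases "x \<in> unit_cube") (simp_all add: norm_mult norm_power)
    qed
    also have "\<dots> = cmod (?I m)"
    proof -
      have "?I m = (LINT x|lborel. complex_of_real (indicator unit_cube (x::'a) * cube_kernel x ^ m))"
        unfolding cube_int_def by (rule Bochner_Integration.integral_cong) (auto simp: indicator_def)
      also have "\<dots> = complex_of_real (LINT x|lborel. indicator unit_cube (x::'a) * cube_kernel x ^ m)"
        by (rule integral_complex_of_real)
      finally have "cmod (?I m) = \<bar>LINT x|lborel. indicator unit_cube (x::'a) * cube_kernel x ^ m\<bar>"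
        by (simp only: norm_of_real)
      moreover have "0 \<le> (LINT x|lborel. indicator unit_cube (x::'a) * cube_kernel x ^ m)"
        by (rule Bochner_Integration.integral_nonneg) (intro mult_nonneg_nonneg zero_le_power cube_kernel_bounds(1), simp)
      ultimately show ?thesis by (simp only: abs_of_nonneg)
    qed
    finally show ?thesis by (simp add: norm_divide divide_le_eq_1)
  qed
  \<comment> \<open>The Weierstrass test with the summable majorant
    \<open>cmod (fourier g k)\<close>: finite partial sums converge uniformly in m, so the limit may
    be taken in each term.\<close>
  have "uniform_limit UNIV (\<lambda>Y m. \<Sum>k\<in>Y. fourier g k * ?c m k) (\<lambda>m. \<Sum>\<^sub>\<infinity>k\<in>?Z. fourier g k * ?c m k) (finite_subsets_at_top ?Z)"
  proof (rule Weierstrass_m_test_general[OF _ abs])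
    fix k m
    show "norm (fourier g k * ?c m k) \<le> cmod (fourier g k)"
      unfolding norm_mult using mult_left_mono[OF cle[of k m] norm_ge_zero[of "fourier g k"]] by simp
  qed
  moreover have "\<forall>\<^sub>F Y in finite_subsets_at_top ?Z. ((\<lambda>m. \<Sum>k\<in>Y. fourier g k * ?c m k) \<longlongrightarrow> (\<Sum>k\<in>Y. fourier g k)) sequentially"
  proof (intro always_eventually allI tendsto_sum)
    fix k :: 'a
    have "(\<lambda>m. fourier g k * ?c m k) \<longlonglongrightarrow> fourier g k * unit_char (k \<bullet> 0)"
      by (intro tendsto_mult_left cube_kernel_concentrates ec)
    then show "(\<lambda>m. fourier g k * ?c m k) \<longlonglongrightarrow> fourier g k" by simp
  qed
  moreover have sum: "(fourier g has_sum infsum (fourier g) ?Z) ?Z"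
    by (rule has_sum_infsum[OF abs_summable_summable[OF abs]])
  ultimately have "((\<lambda>m. \<Sum>\<^sub>\<infinity>k\<in>?Z. fourier g k * ?c m k) \<longlongrightarrow> infsum (fourier g) ?Z) sequentially"
    by (intro swap_uniform_limit'[where F = "finite_subsets_at_top ?Z" and S = UNIV
          and f = "\<lambda>Y m. \<Sum>k\<in>Y. fourier g k * ?c m k" and g = "\<lambda>Y. \<Sum>k\<in>Y. fourier g k"])
      (auto simp: has_sum_def)
  from LIMSEQ_unique[OF this lim1] have "infsum (fourier g) ?Z = G 0" .
  moreover have "G 0 = (\<Sum>\<^sub>\<infinity>n\<in>?Z. g n)"
  proof -
    \<comment> \<open>Since 0 lies in the cube, \<open>X\<close> contains every lattice point at
      which \<open>g\<close> is nonzero.\<close>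
    have z: "(0::'a) \<in> unit_cube" by (simp add: unit_cube_def)
    have "(\<Sum>\<^sub>\<infinity>n\<in>?Z. g n) = (\<Sum>\<^sub>\<infinity>n\<in>X. g n)"
    proof (rule infsum_cong_neutral)
      show "g n = 0" if "n \<in> ?Z - X" for n using memX[of n 0] z that by auto
    qed (use X in auto)
    also have "\<dots> = (\<Sum>n\<in>X. g n)" using X(1) by simp
    finally show ?thesis by (simp add: G_def)
  qed
  ultimately show ?thesis using sum by simp
qed

section \<open>Linear changes of variables in Euclidean spaces\<close>

text \<open>Identifies the determinant indexed by numbers with the one indexed by a type; an
  enumeration transports permutations and preserves their signs.\<close>

lemma det_mat_eq_det:
  fixes A :: "real^'n^'n"
  assumes f: "bij_betw f {..<n} (UNIV :: 'n set)"
  shows "Determinant.det (Matrix.mat n n (\<lambda>(i, j). A $ f i $ f j)) = Determinants.det A"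
proof -
  let ?S = "{0..<n}"
  have f: "bij_betw f ?S UNIV" using f by (simp add: atLeast0LessThan)
  have inj: "inj_on f ?S" and im: "f ` ?S = UNIV" using f by (auto simp: bij_betw_def)
  let ?m = "\<lambda>\<pi> x. if x \<in> UNIV then f (\<pi> (inv_into ?S f x)) else x"
  have bij: "bij_betw ?m {\<pi>. \<pi> permutes ?S} {\<pi>. \<pi> permutes (UNIV :: 'n set)}"
    by (rule bij_betw_permutations[OF f])
  have m: "?m \<pi> = map_permutation ?S f \<pi>" for \<pi>
    by (simp add: map_permutation_def im fun_eq_iff restrict_id_def)
  have "Determinants.det A = (\<Sum>p\<in>{\<pi>. \<pi> permutes ?S}. of_int (sign (?m p)) * (\<Prod>i\<in>UNIV. A $ i $ ?m p i))"
    unfolding Determinants.det_def by (rule sum.reindex_bij_betw[OF bij, symmetric])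
  also have "\<dots> = (\<Sum>p\<in>{\<pi>. \<pi> permutes ?S}. of_int (sign p) * (\<Prod>i = 0..<n. A $ f i $ f (p i)))"
  proof (rule sum.cong[OF refl])
    fix p assume "p \<in> {\<pi>. \<pi> permutes ?S}"
    then have p: "p permutes ?S" by simp
    have "sign (?m p) = sign p" unfolding m by (rule sign_map_permutation[OF inj p]) simp
    moreover have "(\<Prod>i\<in>UNIV. A $ i $ ?m p i) = (\<Prod>i\<in>?S. A $ f i $ ?m p (f i))"
      by (rule prod.reindex_bij_betw[OF f, symmetric])
    moreover have "(\<Prod>i\<in>?S. A $ f i $ ?m p (f i)) = (\<Prod>i\<in>?S. A $ f i $ f (p i))"
      by (rule prod.cong[OF refl]) (simp add: inv_into_f_f[OF inj])
    ultimately show "of_int (sign (?m p)) * (\<Prod>i\<in>UNIV. A $ i $ ?m p i) = of_int (sign p) * (\<Prod>i = 0..<n. A $ f i $ f (p i))"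
      by (simp only:)
  qed
  also have "\<dots> = Determinant.det (Matrix.mat n n (\<lambda>(i, j). A $ f i $ f j))"
    unfolding Determinant.det_def by (auto intro!: sum.cong prod.cong dest: permutes_in_image)
  finally show ?thesis ..
qed

text \<open>The change of variables formula for linear maps is available only on \<open>real ^ 'n\<close> with a
  well-ordered index type; the standard basis of a Euclidean space is made into such a type.\<close>

typedef (overloaded) ('a::euclidean_space) basis_index = "Basis :: 'a set"
  by (rule ex_in_conv[THEN iffD2]) (rule nonempty_Basis)

definition basis_rank :: "'a::euclidean_space basis_index \<Rightarrow> nat" where
  "basis_rank i = to_nat_on (Basis :: 'a set) (Rep_basis_index i)"

lemma basis_rank_eq_iff: "basis_rank i = basis_rank j \<longleftrightarrow> i = j"
proof -
  have "inj_on (to_nat_on (Basis :: 'a set)) Basis" by (rule inj_on_to_nat_on) (simp add: countable_finite)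
  then have "basis_rank i = basis_rank j \<longleftrightarrow> Rep_basis_index i = Rep_basis_index j"
    unfolding basis_rank_def by (rule inj_on_eq_iff[OF _ Rep_basis_index Rep_basis_index])
  then show ?thesis by (simp only: Rep_basis_index_inject)
qed

instantiation basis_index :: (euclidean_space) wellorder
begin

definition less_eq_basis_index :: "'a basis_index \<Rightarrow> 'a basis_index \<Rightarrow> bool" where
  "less_eq_basis_index i j \<longleftrightarrow> basis_rank i \<le> basis_rank j"

definition less_basis_index :: "'a basis_index \<Rightarrow> 'a basis_index \<Rightarrow> bool" where
  "less_basis_index i j \<longleftrightarrow> basis_rank i < basis_rank j"

instance
proof
  fix P :: "'a basis_index \<Rightarrow> bool" and a
  assume step: "\<And>x. (\<And>y. y < x \<Longrightarrow> P y) \<Longrightarrow> P x"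
  show "P a"
    by (induction a rule: measure_induct_rule[of basis_rank]) (rule step, simp add: less_basis_index_def)
qed (auto simp: less_eq_basis_index_def less_basis_index_def basis_rank_eq_iff)

end

instance basis_index :: (euclidean_space) finite
proof
  have "finite (Abs_basis_index ` (Basis :: 'a set))" by simp
  moreover have "(UNIV :: 'a basis_index set) = Abs_basis_index ` Basis"
    by (metis UNIV_eq_I Rep_basis_index Rep_basis_index_inverse imageI)
  ultimately show "finite (UNIV :: 'a basis_index set)" by simp
qed

lemma bij_Rep_basis_index: "bij_betw Rep_basis_index UNIV (Basis :: 'a::euclidean_space set)"
  unfolding bij_betw_def
  by (auto simp: inj_on_def Rep_basis_index_inject Rep_basis_index intro: Abs_basis_index_inverse[symmetric] image_eqI)

section \<open>Transport of Lebesgue measure to coordinates\<close>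

definition from_coords :: "real ^ ('a basis_index) \<Rightarrow> 'a::euclidean_space" where
  "from_coords x = (\<Sum>i\<in>UNIV. (x $ i) *\<^sub>R Rep_basis_index i)"

definition to_coords :: "'a::euclidean_space \<Rightarrow> real ^ ('a basis_index)" where
  "to_coords y = (\<chi> i. y \<bullet> Rep_basis_index i)"

lemma from_coords_inner: "from_coords x \<bullet> Rep_basis_index i = x $ i"
proof -
  have *: "Rep_basis_index j \<bullet> Rep_basis_index i = (if j = i then 1 else 0)" for j
    using inner_Basis[OF Rep_basis_index[of j] Rep_basis_index[of i]] by (simp only: Rep_basis_index_inject)
  show ?thesis unfolding from_coords_def inner_sum_left inner_scaleR_left *
    by (simp add: if_distrib cong: if_cong)
qed

lemma to_from_coords: "to_coords (from_coords x) = x"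
  by (simp add: to_coords_def from_coords_inner Finite_Cartesian_Product.vec_eq_iff)

lemma from_to_coords: "from_coords (to_coords y) = y"
proof -
  have "from_coords (to_coords y) = (\<Sum>b\<in>Basis. (y \<bullet> b) *\<^sub>R b)"
    unfolding from_coords_def to_coords_def vec_lambda_beta
    by (rule sum.reindex_bij_betw[OF bij_Rep_basis_index])
  then show ?thesis by (simp add: euclidean_representation)
qed

lemma linear_from_coords: "linear from_coords"
  by (rule linearI) (simp_all add: from_coords_def scaleR_left_distrib sum.distrib scaleR_sum_right)

lemma linear_to_coords: "linear to_coords"
  by (rule linearI) (simp_all add: to_coords_def Finite_Cartesian_Product.vec_eq_iff inner_add_left)

lemma from_coords_vimage_box: "from_coords -` box l u = box (to_coords l) (to_coords u)"
proof -
  have *: "(\<forall>b\<in>Basis. P b) \<longleftrightarrow> (\<forall>i. P (Rep_basis_index i))" for P :: "'a \<Rightarrow> bool"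
    by (metis Rep_basis_index Abs_basis_index_inverse)
  have "x \<in> from_coords -` box l u \<longleftrightarrow> x \<in> box (to_coords l) (to_coords u)" for x
    unfolding vimage_eq mem_box(1)[of "from_coords x"] * by (simp add: from_coords_inner mem_box_cart to_coords_def)
  then show ?thesis by blast
qed

lemma prod_to_coords: "(\<Prod>b\<in>Basis. to_coords y \<bullet> b) = (\<Prod>b\<in>Basis. (y::'a::euclidean_space) \<bullet> b)"
proof -
  have "(\<Prod>b\<in>Basis. to_coords y \<bullet> b) = (\<Prod>i\<in>UNIV. to_coords y $ i)"
    unfolding Basis_vec_def by (simp add: prod.UNION_disjoint axis_eq_axis inner_axis)
  also have "\<dots> = (\<Prod>i\<in>UNIV. y \<bullet> Rep_basis_index i)" by (simp add: to_coords_def)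
  also have "\<dots> = (\<Prod>b\<in>Basis. y \<bullet> b)" by (rule prod.reindex_bij_betw[OF bij_Rep_basis_index])
  finally show ?thesis .
qed

lemma lborel_distr_from_coords: "distr lborel borel from_coords = (lborel :: 'a::euclidean_space measure)"
proof (rule lborel_eqI[symmetric])
  have meas: "from_coords \<in> borel_measurable (borel :: (real ^ 'a basis_index) measure)"
    by (intro borel_measurable_continuous_onI linear_continuous_on linear_linear[THEN iffD2, OF linear_from_coords])
  fix l u :: 'a assume le: "\<And>b. b \<in> Basis \<Longrightarrow> l \<bullet> b \<le> u \<bullet> b"
  have "emeasure (distr lborel borel from_coords) (box l u) = emeasure lborel (box (to_coords l) (to_coords u))"
    using meas by (subst emeasure_distr) (auto simp: from_coords_vimage_box)
  also have "\<dots> = (\<Prod>b\<in>Basis. (to_coords u - to_coords l) \<bullet> b)"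
  proof (rule emeasure_lborel_box)
    fix b :: "real ^ 'a basis_index" assume "b \<in> Basis"
    then obtain i where "b = axis i 1" by (auto simp: Basis_vec_def)
    then show "to_coords l \<bullet> b \<le> to_coords u \<bullet> b"
      using le[OF Rep_basis_index[of i]] by (simp add: inner_axis to_coords_def)
  qed
  also have "(\<Prod>b\<in>Basis. (to_coords u - to_coords l) \<bullet> b) = (\<Prod>b\<in>Basis. (u - l) \<bullet> b)"
    by (simp only: linear_diff[OF linear_to_coords, symmetric] prod_to_coords)
  finally show "emeasure (distr lborel borel from_coords) (box l u) = (\<Prod>b\<in>Basis. (u - l) \<bullet> b)" .
qed simp

text \<open>The density is given through its square, the Gram determinant of the images of the
  basis. This needs no matrix of \<open>T\<close> and is the quantity that the embedded ideal basis
  supplies.\<close>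

theorem lborel_linear_image:
  fixes T :: "'a::euclidean_space \<Rightarrow> 'a"
  assumes lin: "linear T" and inj: "inj T" and b: "bij_betw b {..<DIM('a)} Basis"
  obtains \<kappa> :: real where "\<kappa> > 0" "lborel = density (distr lborel borel T) (\<lambda>_. ennreal \<kappa>)"
    "\<kappa>\<^sup>2 = Determinant.det (Matrix.mat DIM('a) DIM('a) (\<lambda>(i, j). T (b i) \<bullet> T (b j)))"
proof -
  define f where "f = to_coords \<circ> T \<circ> from_coords"
  have lf: "linear f" unfolding f_def
    by (intro linear_compose[OF linear_compose[OF linear_from_coords lin, unfolded o_assoc] linear_to_coords, unfolded o_assoc])
  let ?M = "matrix f"
  have M: "?M $ i $ j = T (Rep_basis_index j) \<bullet> Rep_basis_index i" for i j
  proof -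
    have "from_coords (axis j 1) = Rep_basis_index j"
      unfolding from_coords_def by (simp add: axis_def if_distrib if_distribR cong: if_cong)
    then show ?thesis by (simp add: matrix_def f_def to_coords_def)
  qed

  have injf: "inj f" unfolding f_def
  proof (rule injI)
    fix x y assume "(to_coords \<circ> T \<circ> from_coords) x = (to_coords \<circ> T \<circ> from_coords) y"
    then have "from_coords (to_coords (T (from_coords x))) = from_coords (to_coords (T (from_coords y)))"
      by simp
    then have "T (from_coords x) = T (from_coords y)" by (simp only: from_to_coords)
    then have "from_coords x = from_coords y" by (rule injD[OF inj])
    then have "to_coords (from_coords x) = to_coords (from_coords y)" by simp
    then show "x = y" by (simp only: to_from_coords)
  qed
  have det0: "Determinants.det ?M \<noteq> 0"
    using injf det_nz_iff_inj[OF lf] by simp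
  \<comment> \<open>Pushing Lebesgue measure forward along \<open>T\<close> divides it by this
    factor, which the density restores.\<close>
  define \<kappa> where "\<kappa> = \<bar>Determinants.det ?M\<bar>"
  have \<kappa>: "\<kappa> > 0" using det0 by (simp add: \<kappa>_def)
  have meas: "T \<in> borel_measurable borel"
    by (intro borel_measurable_continuous_onI linear_continuous_on linear_linear[THEN iffD2, OF lin])
  have "lborel = density (distr lborel borel T) (\<lambda>_. ennreal \<kappa>)"
  proof (rule lborel_eqI)
    fix l u :: 'a assume le: "\<And>b. b \<in> Basis \<Longrightarrow> l \<bullet> b \<le> u \<bullet> b"
    let ?B = "box l u"
    have Ts: "T -` ?B \<in> sets borel" using measurable_sets[OF meas, of ?B] by simp
    have fm: "from_coords \<in> borel_measurable (borel :: (real ^ 'a basis_index) measure)"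
      by (intro borel_measurable_continuous_onI linear_continuous_on linear_linear[THEN iffD2, OF linear_from_coords])
    define A where "A = from_coords -` (T -` ?B)"
    have As: "A \<in> sets borel" unfolding A_def using measurable_sets[OF fm, of "T -` ?B"] Ts by simp
    have fA: "f ` A = box (to_coords l) (to_coords u)"
    proof (rule Set.set_eqI)
      fix y
      have surjf: "\<exists>x. f x = y"
        using linear_inj_imp_surj[OF lf injf] by (metis surjD)
      have "y \<in> f ` A \<longleftrightarrow> from_coords y \<in> ?B"
      proof
        assume "y \<in> f ` A"
        then obtain x where x: "x \<in> A" "y = f x" by blast
        then have "from_coords y = T (from_coords x)" by (simp add: f_def from_to_coords)
        then show "from_coords y \<in> ?B" using x(1) by (simp add: A_def)
      next
        assume y: "from_coords y \<in> ?B"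
        obtain x where x: "f x = y" using surjf by blast
        then have "from_coords y = T (from_coords x)" by (auto simp: f_def from_to_coords)
        then have "x \<in> A" using y by (simp add: A_def)
        then show "y \<in> f ` A" using x by blast
      qed
      then show "y \<in> f ` A \<longleftrightarrow> y \<in> box (to_coords l) (to_coords u)"
        by (simp add: from_coords_vimage_box[symmetric])
    qed
    obtain g where g: "linear g" "\<And>x. g (f x) = x"
      using linear_injective_left_inverse[OF lf injf] by (auto simp: o_def fun_eq_iff)
    have "A = g ` box (to_coords l) (to_coords u)" unfolding fA[symmetric] by (force simp: g(2) image_image)
    then have "bounded A" using bounded_linear_image[OF bounded_box linear_linear[THEN iffD2, OF g(1)]] by metis
    then have Al: "A \<in> lmeasurable" using As by (intro bounded_set_imp_lmeasurable) auto
    have m: "measure lebesgue (box (to_coords l) (to_coords u)) = \<kappa> * measure lebesgue A"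
      unfolding fA[symmetric] \<kappa>_def by (rule measure_linear_image[OF lf Al])
    have finA: "emeasure lborel A = ennreal (measure lborel A)"
      using \<open>bounded A\<close> by (intro emeasure_eq_ennreal_measure) (use emeasure_bounded_finite[of A] in auto)
    have le': "to_coords l \<bullet> b \<le> to_coords u \<bullet> b" if bB: "b \<in> Basis" for b
    proof -
      obtain i where "b = axis i 1" using bB by (auto simp: Basis_vec_def)
      then show ?thesis using le[OF Rep_basis_index[of i]] by (simp add: inner_axis to_coords_def)
    qed
    have "emeasure (density (distr lborel borel T) (\<lambda>_. ennreal \<kappa>)) ?B = ennreal \<kappa> * emeasure (distr lborel borel T) ?B"
      by (subst emeasure_density_const) auto
    also have "emeasure (distr lborel borel T) ?B = emeasure lborel (T -` ?B)"
      using meas by (subst emeasure_distr) auto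
    also have "\<dots> = emeasure (distr lborel borel from_coords) (T -` ?B)" by (simp only: lborel_distr_from_coords)
    also have "\<dots> = emeasure lborel A" using fm Ts by (subst emeasure_distr) (auto simp: A_def)
    also have "ennreal \<kappa> * emeasure lborel A = ennreal (\<kappa> * measure lborel A)"
      unfolding finA using \<kappa> by (simp add: ennreal_mult)
    also have "\<kappa> * measure lborel A = measure lborel (box (to_coords l) (to_coords u))"
      using m As by (simp add: measure_completion)
    also have "\<dots> = (\<Prod>b\<in>Basis. (to_coords u - to_coords l) \<bullet> b)"
      using le' by (intro measure_lborel_box) auto
    also have "(\<Prod>b\<in>Basis. (to_coords u - to_coords l) \<bullet> b) = (\<Prod>b\<in>Basis. (u - l) \<bullet> b)"
      by (simp only: linear_diff[OF linear_to_coords, symmetric] prod_to_coords)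
    finally show "emeasure (density (distr lborel borel T) (\<lambda>_. ennreal \<kappa>)) ?B = ennreal (\<Prod>b\<in>Basis. (u - l) \<bullet> b)" .
  qed simp
  moreover have "\<kappa>\<^sup>2 = Determinant.det (Matrix.mat DIM('a) DIM('a) (\<lambda>(i, j). T (b i) \<bullet> T (b j)))"
  proof -
    let ?g = "Abs_basis_index \<circ> b"
    have "bij_betw Abs_basis_index (Basis :: 'a set) UNIV"
      by (rule bij_betw_byWitness[where f' = Rep_basis_index])
        (auto simp: Abs_basis_index_inverse Rep_basis_index_inverse Rep_basis_index)
    then have g: "bij_betw ?g {..<DIM('a)} UNIV" by (rule bij_betw_trans[OF b])
    have Rg: "Rep_basis_index (?g i) = b i" if "i < DIM('a)" for i
    proof -
      have "b i \<in> Basis" using b that by (auto simp: bij_betw_def)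
      then show ?thesis by (simp add: Abs_basis_index_inverse)
    qed
    \<comment> \<open>Entries of transpose times matrix are inner products of columns, and the
      columns are the images of the basis vectors.\<close>
    have e: "(transpose ?M ** ?M) $ i $ j = T (Rep_basis_index i) \<bullet> T (Rep_basis_index j)" for i j
    proof -
      have "(transpose ?M ** ?M) $ i $ j = (\<Sum>k\<in>UNIV. (T (Rep_basis_index i) \<bullet> Rep_basis_index k) * (T (Rep_basis_index j) \<bullet> Rep_basis_index k))"
        by (simp add: matrix_matrix_mult_def Finite_Cartesian_Product.transpose_def M)
      also have "\<dots> = (\<Sum>c\<in>Basis. (T (Rep_basis_index i) \<bullet> c) * (T (Rep_basis_index j) \<bullet> c))"
        by (rule sum.reindex_bij_betw[OF bij_Rep_basis_index])
      also have "\<dots> = T (Rep_basis_index i) \<bullet> T (Rep_basis_index j)" by (rule euclidean_inner[symmetric])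
      finally show ?thesis .
    qed
    have "\<kappa>\<^sup>2 = Determinants.det (transpose ?M ** ?M)"
      by (simp add: \<kappa>_def Determinants.det_mul Determinants.det_transpose power2_eq_square)
    also have "\<dots> = Determinant.det (Matrix.mat DIM('a) DIM('a) (\<lambda>(i, j). (transpose ?M ** ?M) $ ?g i $ ?g j))"
      by (rule det_mat_eq_det[OF g, symmetric])
    also have "Matrix.mat DIM('a) DIM('a) (\<lambda>(i, j). (transpose ?M ** ?M) $ ?g i $ ?g j)
        = Matrix.mat DIM('a) DIM('a) (\<lambda>(i, j). T (b i) \<bullet> T (b j))"
      by (rule eq_matI) (simp_all add: e Rg[unfolded o_apply])
    finally show ?thesis .
  qed
  ultimately show thesis using \<kappa> by (intro that)
qed

lemma lborel_density_unique:
  assumes "lborel = density (distr lborel borel T) (\<lambda>_. ennreal \<kappa>)" "T \<in> borel_measurable borel" "A \<in> sets borel"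
  shows "emeasure lborel A = ennreal \<kappa> * emeasure lborel (T -` A)"
proof -
  have "emeasure lborel A = emeasure (density (distr lborel borel T) (\<lambda>_. ennreal \<kappa>)) A"
    using assms(1) by simp
  also have "\<dots> = ennreal \<kappa> * emeasure (distr lborel borel T) A"
    using assms(3) by (subst emeasure_density_const) auto
  also have "emeasure (distr lborel borel T) A = emeasure lborel (T -` A)"
    using assms(2,3) by (subst emeasure_distr) auto
  finally show ?thesis .
qed

lemma lborel_integral_linear:
  fixes f :: "'a::euclidean_space \<Rightarrow> complex"
  assumes eq: "lborel = density (distr lborel borel T) (\<lambda>_. ennreal \<kappa>)" and \<kappa>: "\<kappa> > 0"
    and T: "T \<in> borel_measurable borel" and f: "f \<in> borel_measurable borel"
  shows "(LINT x|lborel. f x) = \<kappa> * (LINT x|lborel. f (T x))"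
proof -
  have "(LINT x|lborel. f x) = (LINT x|density (distr lborel borel T) (\<lambda>_. ennreal \<kappa>). f x)"
    using eq by simp
  also have "\<dots> = (LINT x|distr lborel borel T. \<kappa> *\<^sub>R f x)"
    by (rule integral_density) (use f \<kappa> in auto)
  also have "\<dots> = (LINT x|lborel. \<kappa> *\<^sub>R f (T x))"
    by (rule integral_distr) (use T f in auto)
  finally show ?thesis by (simp add: scaleR_conv_of_real)
qed

section \<open>Products of Euclidean spaces\<close>

lemma Basis_vec_bij: "bij_betw (\<lambda>(i, u). axis i u) (UNIV \<times> Basis) (Basis :: ('a::euclidean_space ^ 'n) set)"
  unfolding bij_betw_def Basis_vec_def
  by (auto simp: inj_on_def axis_eq_axis)

lemma mem_box_vec: "x \<in> box l u \<longleftrightarrow> (\<forall>i. x $ i \<in> box (l $ i) (u $ i))"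
  for x l u :: "'a::euclidean_space ^ 'n"
  by (auto simp: mem_box Basis_vec_def inner_axis)

lemma measurable_vec_lambda:
  "(\<lambda>f. \<chi> i. f i) \<in> measurable (PiM UNIV (\<lambda>_::'n::finite. lborel)) (borel :: ('a::euclidean_space ^ 'n) measure)"
proof (rule borel_measurable_euclidean_space[THEN iffD2], rule ballI)
  fix b :: "'a ^ 'n" assume "b \<in> Basis"
  then obtain i u where "b = axis i u" by (auto simp: Basis_vec_def)
  then show "(\<lambda>f. (\<chi> i. f i) \<bullet> b) \<in> borel_measurable (PiM UNIV (\<lambda>_. lborel))"
    by (simp add: inner_axis)
qed

lemma lborel_vec: "distr (PiM UNIV (\<lambda>_::'n::finite. lborel)) borel (\<lambda>f. \<chi> i. f i) = (lborel :: ('a::euclidean_space ^ 'n) measure)"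
proof (rule lborel_eqI[symmetric])
  interpret product_sigma_finite "\<lambda>_::'n. lborel :: 'a measure" ..
  fix l u :: "'a ^ 'n" assume le: "\<And>b. b \<in> Basis \<Longrightarrow> l \<bullet> b \<le> u \<bullet> b"
  have le': "l $ i \<bullet> b \<le> u $ i \<bullet> b" if "b \<in> Basis" for i b
    using le[of "axis i b"] that by (auto simp: Basis_vec_def inner_axis)
  have "emeasure (distr (PiM UNIV (\<lambda>_::'n. lborel)) borel (\<lambda>f. \<chi> i. f i)) (box l u)
    = emeasure (PiM UNIV (\<lambda>_::'n. lborel)) (PiE UNIV (\<lambda>i. box (l $ i) (u $ i)))"
    by (subst emeasure_distr[OF measurable_vec_lambda])
      (auto simp: mem_box_vec space_PiM PiE_iff intro!: arg_cong2[where f = emeasure])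
  also have "\<dots> = (\<Prod>i\<in>UNIV. emeasure lborel (box (l $ i) (u $ i)))"
    by (rule emeasure_PiM) auto
  also have "\<dots> = (\<Prod>i\<in>UNIV. ennreal (\<Prod>b\<in>Basis. (u $ i - l $ i) \<bullet> b))"
    using le' by (intro prod.cong refl emeasure_lborel_box) auto
  also have "\<dots> = ennreal (\<Prod>i\<in>UNIV. \<Prod>b\<in>Basis. (u $ i - l $ i) \<bullet> b)"
    using le' by (intro prod_ennreal prod_nonneg) (auto simp: inner_diff_left)
  also have "(\<Prod>i\<in>UNIV. \<Prod>b\<in>Basis. (u $ i - l $ i) \<bullet> b) = (\<Prod>b\<in>Basis. (u - l) \<bullet> b)"
    unfolding prod.cartesian_product
    by (subst prod.reindex_bij_betw[OF Basis_vec_bij, symmetric]) (auto intro!: prod.cong simp: inner_axis)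
  finally show "emeasure (distr (PiM UNIV (\<lambda>_::'n. lborel)) borel (\<lambda>f. \<chi> i. f i)) (box l u) = ennreal (\<Prod>b\<in>Basis. (u - l) \<bullet> b)" .
qed simp

lemma emeasure_vec_power:
  fixes B :: "'a::euclidean_space set"
  assumes B: "B \<in> sets borel"
  shows "emeasure lborel {x :: 'a ^ 'n::finite. \<forall>i. x $ i \<in> B} = emeasure lborel B ^ CARD('n)"
    and "{x :: 'a ^ 'n. \<forall>i. x $ i \<in> B} \<in> sets borel"
proof -
  interpret product_sigma_finite "\<lambda>_::'n. lborel :: 'a measure" ..
  have "{x :: 'a ^ 'n. \<forall>i. x $ i \<in> B} = (\<Inter>i\<in>UNIV. (\<lambda>x. x $ i) -` B)" by auto
  also have "\<dots> \<in> sets borel"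
  proof (rule sets.finite_INT)
    fix i :: 'n
    have "(\<lambda>x :: 'a ^ 'n. x $ i) \<in> borel_measurable borel"
      by (intro borel_measurable_continuous_onI continuous_intros)
    from measurable_sets[OF this B] show "(\<lambda>x. x $ i) -` B \<in> sets (borel :: ('a ^ 'n) measure)" by simp
  qed auto
  finally show s: "{x :: 'a ^ 'n. \<forall>i. x $ i \<in> B} \<in> sets borel" .
  have "emeasure lborel {x :: 'a ^ 'n. \<forall>i. x $ i \<in> B}
      = emeasure (distr (PiM UNIV (\<lambda>_::'n. lborel)) borel (\<lambda>f. \<chi> i. f i)) {x :: 'a ^ 'n. \<forall>i. x $ i \<in> B}"
    by (simp only: lborel_vec)
  also have "\<dots> = emeasure (PiM UNIV (\<lambda>_::'n. lborel)) (PiE UNIV (\<lambda>i. B))"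
    by (subst emeasure_distr[OF measurable_vec_lambda s])
      (auto simp: space_PiM PiE_iff intro!: arg_cong2[where f = emeasure])
  also have "\<dots> = (\<Prod>i\<in>(UNIV :: 'n set). emeasure lborel B)" by (rule emeasure_PiM) (use B in auto)
  finally show "emeasure lborel {x :: 'a ^ 'n. \<forall>i. x $ i \<in> B} = emeasure lborel B ^ CARD('n)" by simp
qed

text \<open>The coordinatewise map has some density constant \<open>\<kappa>'\<close>; evaluating on
  one set identifies it as the power of \<open>\<kappa>\<close>.\<close>

theorem lborel_linear_image_vec:
  fixes T :: "'a::euclidean_space \<Rightarrow> 'a"
  assumes lin: "linear T" and inj: "inj T" and \<kappa>: "\<kappa> > 0" "lborel = density (distr lborel borel T) (\<lambda>_. ennreal \<kappa>)"
  shows "(lborel :: ('a ^ 'n::finite) measure) = density (distr lborel borel (\<lambda>x. \<chi> i. T (x $ i))) (\<lambda>_. ennreal (\<kappa> ^ CARD('n)))"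
proof -
  let ?T = "\<lambda>x :: 'a ^ 'n. \<chi> i. T (x $ i)"
  have linT: "linear ?T" by (rule linearI) (simp_all add: Finite_Cartesian_Product.vec_eq_iff linear_add[OF lin] linear_cmul[OF lin])
  have injT: "inj ?T" by (rule injI) (auto simp: Finite_Cartesian_Product.vec_eq_iff dest: injD[OF inj])
  obtain b :: "nat \<Rightarrow> 'a ^ 'n" where b: "bij_betw b {..<DIM('a ^ 'n)} Basis"
    using ex_bij_betw_nat_finite[OF finite_Basis[where 'a = "'a ^ 'n"]] by (auto simp: atLeast0LessThan)
  obtain \<kappa>' where \<kappa>': "\<kappa>' > 0" "(lborel :: ('a ^ 'n) measure) = density (distr lborel borel ?T) (\<lambda>_. ennreal \<kappa>')"
    "\<kappa>'\<^sup>2 = Determinant.det (Matrix.mat DIM('a ^ 'n) DIM('a ^ 'n) (\<lambda>(i, j). ?T (b i) \<bullet> ?T (b j)))"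
    by (rule lborel_linear_image[OF linT injT b]) (rule that)
  have mT: "T \<in> borel_measurable borel"
    by (intro borel_measurable_continuous_onI linear_continuous_on linear_linear[THEN iffD2, OF lin])
  have mTT: "?T \<in> borel_measurable borel"
    by (intro borel_measurable_continuous_onI linear_continuous_on linear_linear[THEN iffD2, OF linT])
  \<comment> \<open>The image of a cube of volume 1 has volume \<open>\<kappa>\<close>, and the
    preimage of its n-fold power is again a cube of volume 1.\<close>
  let ?C = "T ` cbox 0 One"
  have C: "?C \<in> sets borel"
    by (rule borel_compact[OF compact_continuous_image[OF linear_continuous_on[OF linear_linear[THEN iffD2, OF lin]] compact_cbox]])
  have "T -` ?C = cbox 0 One" using inj by (rule inj_vimage_image_eq)
  moreover have "emeasure lborel (cbox 0 One :: 'a set) = 1" by (subst emeasure_lborel_cbox) (auto intro!: prod.neutral)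
  ultimately have eC: "emeasure lborel ?C = ennreal \<kappa>"
    using lborel_density_unique[OF \<kappa>(2) mT C] by simp
  have v: "?T -` {x. \<forall>i. x $ i \<in> ?C} = {x :: 'a ^ 'n. \<forall>i. x $ i \<in> cbox 0 One}"
    using injD[OF inj] by (auto simp: image_iff) blast
  have "ennreal \<kappa> ^ CARD('n) = emeasure lborel {x :: 'a ^ 'n. \<forall>i. x $ i \<in> ?C}"
    unfolding emeasure_vec_power(1)[OF C] eC ..
  also have "\<dots> = ennreal \<kappa>' * emeasure lborel {x :: 'a ^ 'n. \<forall>i. x $ i \<in> cbox 0 One}"
    unfolding v[symmetric] by (rule lborel_density_unique[OF \<kappa>'(2) mTT emeasure_vec_power(2)[OF C]])
  also have "emeasure lborel {x :: 'a ^ 'n. \<forall>i. x $ i \<in> cbox 0 One} = 1"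
    by (subst emeasure_vec_power(1)) (use \<open>emeasure lborel (cbox 0 One :: 'a set) = 1\<close> in auto)
  finally have "ennreal (\<kappa> ^ CARD('n)) = ennreal \<kappa>'" using \<kappa>(1) by (simp add: ennreal_power)
  then show ?thesis using \<kappa>'(2) by simp
qed

section \<open>The lattice of integers in \<open>V\<close>\<close>

locale places =
  fixes r1 r2 :: nat and s :: "nat \<Rightarrow> 'k::number_field \<Rightarrow> complex" and crd :: "'v::euclidean_space \<Rightarrow> nat \<Rightarrow> complex"
  assumes place: "place_enumeration r1 r2 s" and coords: "V_coordinates r1 r2 crd"
begin

abbreviation \<iota> :: "'k \<Rightarrow> 'v" where "\<iota> \<equiv> embed_V r1 r2 s crd"

lemma crd_linear: "l < r1 + r2 \<Longrightarrow> linear (\<lambda>v. crd v l)"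
  and crd_real: "l < r1 \<Longrightarrow> crd v l \<in> \<real>"
  and crd_norm: "(norm v)\<^sup>2 = (\<Sum>l<r1 + r2. (cmod (crd v l))\<^sup>2)"
  and crd_surj: "(\<And>l. l < r1 \<Longrightarrow> w l \<in> \<real>) \<Longrightarrow> \<exists>v. \<forall>l<r1 + r2. crd v l = w l"
  using coords by (auto simp: V_coordinates_def)

lemma s_embedding: "l < r1 + r2 \<Longrightarrow> s l \<in> embeddings"
  and s_real: "l < r1 + r2 \<Longrightarrow> range (s l) \<subseteq> \<real> \<longleftrightarrow> l < r1"
  using place by (auto simp: place_enumeration_def)

text \<open>Polarisation of the norm identity, the only metric information about
  \<open>crd\<close>.\<close>

lemma crd_inner: "x \<bullet> y = (\<Sum>l<r1 + r2. Re (crd x l * cnj (crd y l)))"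
proof -
  have add: "crd (x + y) l = crd x l + crd y l" if "l < r1 + r2" for l
    by (rule linear_add[OF crd_linear[OF that]])
  have "2 * (x \<bullet> y) = (norm (x + y))\<^sup>2 - (norm x)\<^sup>2 - (norm y)\<^sup>2"
    by (simp add: power2_norm_eq_inner inner_add_left inner_add_right inner_commute)
  also have "\<dots> = (\<Sum>l<r1 + r2. (cmod (crd (x + y) l))\<^sup>2 - (cmod (crd x l))\<^sup>2 - (cmod (crd y l))\<^sup>2)"
    by (simp only: crd_norm sum_subtractf)
  also have "\<dots> = (\<Sum>l<r1 + r2. 2 * Re (crd x l * cnj (crd y l)))"
  proof (rule sum.cong[OF refl])
    fix l assume "l \<in> {..<r1 + r2}"
    then show "(cmod (crd (x + y) l))\<^sup>2 - (cmod (crd x l))\<^sup>2 - (cmod (crd y l))\<^sup>2 = 2 * Re (crd x l * cnj (crd y l))"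
      by (simp only: add cmod_power2 lessThan_iff) (simp add: power2_eq_square algebra_simps)
  qed
  also have "\<dots> = 2 * (\<Sum>l<r1 + r2. Re (crd x l * cnj (crd y l)))" by (simp only: sum_distrib_left)
  finally show ?thesis by (rule mult_left_cancel[THEN iffD1, rotated]) simp
qed

lemma crd_eqI:
  assumes "\<And>l. l < r1 + r2 \<Longrightarrow> crd x l = crd y l"
  shows "x = y"
proof -
  have "crd (x - y) l = 0" if "l < r1 + r2" for l
    using linear_diff[OF crd_linear[OF that], of x y] assms[OF that] by simp
  then have "(norm (x - y))\<^sup>2 = 0" by (simp add: crd_norm)
  then show ?thesis by simp
qed

text \<open>Justifies the \<open>THE\<close> in \<open>embed_V\<close>: a vector with these
  coordinates exists because real places have real values, and the isometry makes it unique.\<close>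

lemma crd_\<iota>: "l < r1 + r2 \<Longrightarrow> crd (\<iota> \<alpha>) l = s l \<alpha>"
proof -
  assume l: "l < r1 + r2"
  have "\<exists>v. \<forall>l<r1 + r2. crd v l = s l \<alpha>"
  proof (rule crd_surj)
    fix l assume "l < r1"
    then have "range (s l) \<subseteq> \<real>" using s_real[of l] by simp
    then show "s l \<alpha> \<in> \<real>" by blast
  qed
  then obtain v where v: "\<forall>l<r1 + r2. crd v l = s l \<alpha>" ..
  have "\<forall>l<r1 + r2. crd (\<iota> \<alpha>) l = s l \<alpha>"
    unfolding embed_V_def by (rule theI[of _ v]) (use v in \<open>auto intro: crd_eqI\<close>)
  with l show ?thesis by blast
qed

lemma \<iota>_add: "\<iota> (\<alpha> + \<beta>) = \<iota> \<alpha> + \<iota> \<beta>"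
proof (rule crd_eqI)
  fix l assume l: "l < r1 + r2"
  show "crd (\<iota> (\<alpha> + \<beta>)) l = crd (\<iota> \<alpha> + \<iota> \<beta>) l"
    by (simp only: crd_\<iota>[OF l] linear_add[OF crd_linear[OF l]] embedding_add[OF s_embedding[OF l]])
qed

lemma \<iota>_0: "\<iota> 0 = 0"
  using \<iota>_add[of 0 0] by simp

lemma \<iota>_uminus: "\<iota> (- \<alpha>) = - \<iota> \<alpha>"
  using \<iota>_add[of \<alpha> "- \<alpha>"] \<iota>_0 by (simp add: eq_neg_iff_add_eq_0 add.commute)

lemma \<iota>_sum: "\<iota> (\<Sum>i\<in>I. f i) = (\<Sum>i\<in>I. \<iota> (f i))"
  by (induction I rule: infinite_finite_induct) (auto simp: \<iota>_0 \<iota>_add)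

lemma \<iota>_of_nat: "\<iota> (of_nat n * \<alpha>) = real n *\<^sub>R \<iota> \<alpha>"
  by (induction n) (auto simp: \<iota>_0 \<iota>_add distrib_right scaleR_left_distrib)

lemma \<iota>_of_int: "\<iota> (of_int n * \<alpha>) = real_of_int n *\<^sub>R \<iota> \<alpha>"
  by (cases n rule: int_cases2) (auto simp: \<iota>_of_nat \<iota>_uminus)

lemma \<iota>_inj: "\<iota> \<alpha> = \<iota> \<beta> \<longleftrightarrow> \<alpha> = \<beta>"
proof
  assume eq: "\<iota> \<alpha> = \<iota> \<beta>"
  obtain \<tau> :: "'k \<Rightarrow> complex" where "\<tau> \<in> embeddings" using embeddings_nonempty by blast
  then have "\<exists>l. l < r1 + r2" using place unfolding place_enumeration_def by blast
  then obtain l where l: "l < r1 + r2" ..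
  note add = embedding_add[OF s_embedding[OF l]]
  have "s l \<alpha> = s l \<beta>" using crd_\<iota>[OF l, of \<alpha>] crd_\<iota>[OF l, of \<beta>] eq by simp
  then have "s l (\<alpha> + - \<beta>) = 0" by (simp only: add additive_uminus[of "s l", OF add]) simp
  from embedding_eq_0[OF s_embedding[OF l] this] show "\<alpha> = \<beta>" by simp
qed simp

text \<open>All embeddings in a row: the chosen one at each place, then the conjugates at the
  complex places. Subtracting \<open>r2\<close> sends the last \<open>r2\<close> indices to the
  complex places.\<close>

definition emb :: "nat \<Rightarrow> 'k \<Rightarrow> complex" where
  "emb j = (if j < r1 + r2 then s j else cnj \<circ> s (j - r2))"

lemma cnj_embedding: "\<tau> \<in> embeddings \<Longrightarrow> cnj \<circ> \<tau> \<in> embeddings"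
  by (auto simp: embeddings_def)

text \<open>Every embedding belongs to exactly one place, and at a complex place it differs from its
  conjugate, since equality would make its values real.\<close>

lemma bij_emb: "bij_betw emb {..<r1 + 2 * r2} embeddings"
proof -
  have uniq: "l = l'" if "l < r1 + r2" "l' < r1 + r2" "\<tau> = s l \<or> \<tau> = cnj \<circ> s l" "\<tau> = s l' \<or> \<tau> = cnj \<circ> s l'" for l l' \<tau>
  proof -
    have "\<tau> \<in> embeddings" using that s_embedding cnj_embedding by blast
    then have "\<exists>!l. l < r1 + r2 \<and> (\<tau> = s l \<or> \<tau> = cnj \<circ> s l)"
      using place unfolding place_enumeration_def by blast
    then show ?thesis using that by blast
  qed
  have nr: "cnj \<circ> s l \<noteq> s l" if "r1 \<le> l" "l < r1 + r2" for l
  proof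
    assume "cnj \<circ> s l = s l"
    then have "cnj (s l x) = s l x" for x by (metis comp_apply)
    then have "range (s l) \<subseteq> \<real>" by (auto simp: Reals_cnj_iff)
    then show False using s_real[OF that(2)] that(1) by simp
  qed
  have place_of: "\<exists>l. l < r1 + r2 \<and> emb j = (if j < r1 + r2 then s l else cnj \<circ> s l) \<and> (if j < r1 + r2 then l = j else l = j - r2 \<and> r1 \<le> l)"
    if "j < r1 + 2 * r2" for j
    using that by (auto simp: emb_def)
  have "inj_on emb {..<r1 + 2 * r2}"
  proof (rule inj_onI)
    fix i j assume i: "i \<in> {..<r1 + 2 * r2}" and j: "j \<in> {..<r1 + 2 * r2}" and eq: "emb i = emb j"
    obtain l where l: "l < r1 + r2" "emb i = (if i < r1 + r2 then s l else cnj \<circ> s l)" "if i < r1 + r2 then l = i else l = i - r2 \<and> r1 \<le> l"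
      using place_of[of i] i by auto
    obtain m where m: "m < r1 + r2" "emb j = (if j < r1 + r2 then s m else cnj \<circ> s m)" "if j < r1 + r2 then m = j else m = j - r2 \<and> r1 \<le> m"
      using place_of[of j] j by auto
    have "l = m" by (rule uniq[OF l(1) m(1), of "emb i"]) (use l(2) m(2) eq in \<open>auto split: if_splits\<close>)
    then show "i = j" using l m eq nr[of l] by (auto split: if_splits)
  qed
  moreover have "emb ` {..<r1 + 2 * r2} = embeddings"
  proof (intro equalityI subsetI)
    fix \<tau> assume "\<tau> \<in> emb ` {..<r1 + 2 * r2}"
    then obtain j where j: "j < r1 + 2 * r2" "\<tau> = emb j" by auto
    show "\<tau> \<in> embeddings"
    proof (cases "j < r1 + r2")
      case True
      then show ?thesis using s_embedding j by (simp add: emb_def)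
    next
      case False
      then have "j - r2 < r1 + r2" using j by simp
      then show ?thesis using cnj_embedding[OF s_embedding] False j by (simp add: emb_def)
    qed
  next
    fix \<tau> assume "\<tau> \<in> (embeddings :: ('k \<Rightarrow> complex) set)"
    then obtain l where l: "l < r1 + r2" "\<tau> = s l \<or> \<tau> = cnj \<circ> s l"
      using place unfolding place_enumeration_def by blast
    show "\<tau> \<in> emb ` {..<r1 + 2 * r2}"
    proof (cases "\<tau> = s l")
      case True
      then show ?thesis using l by (intro image_eqI[of _ _ l]) (auto simp: emb_def)
    next
      case False
      then have t: "\<tau> = cnj \<circ> s l" using l by blast
      have "r1 \<le> l"
      proof (rule ccontr)
        assume "\<not> r1 \<le> l"
        then have "range (s l) \<subseteq> \<real>" using s_real[OF l(1)] by simp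
        then have "cnj (s l x) = s l x" for x by (metis Reals_cnj_iff rangeI subsetD)
        then have "cnj \<circ> s l = s l" by auto
        then show False using False t by simp
      qed
      then show ?thesis using l t by (intro image_eqI[of _ _ "l + r2"]) (auto simp: emb_def)
    qed
  qed
  ultimately show ?thesis by (simp add: bij_betw_def)
qed

lemma degree_places: "nf_degree TYPE('k) = r1 + 2 * r2"
  using bij_betw_same_card[OF bij_emb] card_embeddings[where 'k = 'k] by simp

section \<open>Splitting over real and complex places\<close>

lemma sum_split_places: "(\<Sum>j<r1 + 2 * r2. g j) = (\<Sum>l<r1 + r2. g l) + (\<Sum>l=r1..<r1 + r2. g (l + r2))"
  for g :: "nat \<Rightarrow> 'a::comm_monoid_add"
proof -
  have "{..<r1 + 2 * r2} = {..<r1 + r2} \<union> {r1 + r2..<r1 + 2 * r2}" by auto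
  then have "(\<Sum>j<r1 + 2 * r2. g j) = (\<Sum>l<r1 + r2. g l) + (\<Sum>l\<in>{r1 + r2..<r1 + 2 * r2}. g l)"
    by (simp add: sum.union_disjoint ivl_disj_int)
  also have "(\<Sum>l\<in>{r1 + r2..<r1 + 2 * r2}. g l) = (\<Sum>l=r1..<r1 + r2. g (l + r2))"
    using sum.shift_bounds_nat_ivl[of g r1 r2 "r1 + r2"] by (simp add: add.assoc mult_2)
  finally show ?thesis .
qed

lemma prod_split_places: "(\<Prod>j<r1 + 2 * r2. g j) = (\<Prod>l<r1 + r2. g l) * (\<Prod>l=r1..<r1 + r2. g (l + r2))"
  for g :: "nat \<Rightarrow> 'a::comm_monoid_mult"
proof -
  have "{..<r1 + 2 * r2} = {..<r1 + r2} \<union> {r1 + r2..<r1 + 2 * r2}" by auto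
  then have "(\<Prod>j<r1 + 2 * r2. g j) = (\<Prod>l<r1 + r2. g l) * (\<Prod>l\<in>{r1 + r2..<r1 + 2 * r2}. g l)"
    by (simp add: prod.union_disjoint ivl_disj_int)
  also have "(\<Prod>l\<in>{r1 + r2..<r1 + 2 * r2}. g l) = (\<Prod>l=r1..<r1 + r2. g (l + r2))"
    using prod.shift_bounds_nat_ivl[of g r1 r2 "r1 + r2"] by (simp add: add.assoc mult_2)
  finally show ?thesis .
qed

lemma sum_real_complex: "(\<Sum>l<r1 + r2. g l) = (\<Sum>l<r1. g l) + (\<Sum>l=r1..<r1 + r2. g l)"
  for g :: "nat \<Rightarrow> 'a::comm_monoid_add"
  using sum.union_disjoint[of "{..<r1}" "{r1..<r1 + r2}" g] by (simp add: ivl_disj_un ivl_disj_int)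

lemma prod_real_complex: "(\<Prod>l<r1 + r2. g l) = (\<Prod>l<r1. g l) * (\<Prod>l=r1..<r1 + r2. g l)"
  for g :: "nat \<Rightarrow> 'a::comm_monoid_mult"
  using prod.union_disjoint[of "{..<r1}" "{r1..<r1 + r2}" g] by (simp add: ivl_disj_un ivl_disj_int)

text \<open>The index scheme of \<open>emb\<close>: real parts at all places, then imaginary parts
  at the complex places. Imaginary parts at real places are 0 and left out.\<close>

definition rcrd :: "'v \<Rightarrow> nat \<Rightarrow> real" where
  "rcrd v j = (if j < r1 + r2 then Re (crd v j) else Im (crd v (j - r2)))"

lemma rcrd_inner: "x \<bullet> y = (\<Sum>j<r1 + 2 * r2. rcrd x j * rcrd y j)"
proof -
  have im: "Im (crd v l) = 0" if "l < r1" for v l using crd_real[OF that] by (simp add: complex_is_Real_iff)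
  have "x \<bullet> y = (\<Sum>l<r1 + r2. Re (crd x l) * Re (crd y l)) + (\<Sum>l<r1 + r2. Im (crd x l) * Im (crd y l))"
    by (simp add: crd_inner sum.distrib)
  also have "(\<Sum>l<r1 + r2. Im (crd x l) * Im (crd y l)) = (\<Sum>l=r1..<r1 + r2. Im (crd x l) * Im (crd y l))"
    by (subst sum_real_complex) (simp add: im)
  also have "(\<Sum>l<r1 + r2. Re (crd x l) * Re (crd y l)) = (\<Sum>l<r1 + r2. rcrd x l * rcrd y l)"
    by (rule sum.cong) (auto simp: rcrd_def)
  also have "(\<Sum>l=r1..<r1 + r2. Im (crd x l) * Im (crd y l)) = (\<Sum>l=r1..<r1 + r2. rcrd x (l + r2) * rcrd y (l + r2))"
    by (rule sum.cong) (auto simp: rcrd_def)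
  finally show ?thesis by (simp only: sum_split_places)
qed

lemma dim_V: "DIM('v) = r1 + 2 * r2"
proof -
  let ?d = "r1 + 2 * r2"
  \<comment> \<open>Prescribed coordinates of an orthonormal basis: 1 at place j, or the imaginary
    unit at the complex place \<open>j - r2\<close>.\<close>
  define w where "w = (\<lambda>j l. if j < r1 + r2 then (if l = j then 1 else 0) else (if l = j - r2 then \<i> else 0) :: complex)"
  have "\<exists>v. \<forall>l<r1 + r2. crd v l = w j l" if "j < ?d" for j
    by (rule crd_surj) (use that in \<open>auto simp: w_def\<close>)
  then obtain v where v: "\<And>j l. j < ?d \<Longrightarrow> l < r1 + r2 \<Longrightarrow> crd (v j) l = w j l" by metis
  have r: "rcrd (v j) i = (if i = j then 1 else 0)" if "j < ?d" "i < ?d" for i j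
    using that v[OF that(1), of i] v[OF that(1), of "i - r2"] by (auto simp: rcrd_def w_def)
  have xv: "x \<bullet> v j = rcrd x j" if "j < ?d" for x j
  proof -
    have "x \<bullet> v j = (\<Sum>i<?d. if i = j then rcrd x j else 0)"
      unfolding rcrd_inner by (rule sum.cong) (use r[OF that] in auto)
    then show ?thesis using that by simp
  qed
  let ?S = "v ` {..<?d}"
  have vv: "v i \<bullet> v j = (if i = j then 1 else 0)" if "i < ?d" "j < ?d" for i j
    using xv[OF that(2)] r[OF that(1) that(2)] by auto
  have inj: "inj_on v {..<?d}"
  proof (rule inj_onI)
    fix i j assume "i \<in> {..<?d}" "j \<in> {..<?d}" "v i = v j"
    then show "i = j" using vv[of i j] vv[of i i] by (auto split: if_splits)
  qed
  have "independent ?S"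
  proof (rule pairwise_orthogonal_independent)
    show "pairwise real_inner_class.orthogonal ?S"
      by (auto simp: pairwise_def real_inner_class.orthogonal_def vv)
    show "0 \<notin> ?S" using vv by force
  qed
  moreover have "span ?S = UNIV"
  proof (rule ccontr)
    assume "span ?S \<noteq> UNIV"
    then obtain a where a: "a \<noteq> 0" "\<And>x. x \<in> span ?S \<Longrightarrow> a \<bullet> x = 0" using span_not_UNIV_orthogonal by blast
    have "rcrd a j = 0" if "j < ?d" for j using a(2)[of "v j"] xv[OF that, of a] that by (simp add: span_base)
    then have "a \<bullet> a = 0" by (simp add: rcrd_inner)
    then show False using a(1) by simp
  qed
  ultimately have "dim (UNIV :: 'v set) = card ?S" using dim_eq_card[of ?S "UNIV :: 'v set"] by (simp del: dim_UNIV)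
  then show ?thesis by (simp add: card_image[OF inj])
qed

section \<open>The covolume of the ring of integers\<close>

lemma rcrd_\<iota>: "j < r1 + 2 * r2 \<Longrightarrow> rcrd (\<iota> \<alpha>) j = (if j < r1 + r2 then Re (s j \<alpha>) else Im (s (j - r2) \<alpha>))"
  using crd_\<iota>[of j \<alpha>] crd_\<iota>[of "j - r2" \<alpha>] by (auto simp: rcrd_def)

definition coord_mat :: "(nat \<Rightarrow> 'k) \<Rightarrow> real mat" where
  "coord_mat \<gamma> = Matrix.mat (r1 + 2 * r2) (r1 + 2 * r2) (\<lambda>(i, j). rcrd (\<iota> (\<gamma> i)) j)"

lemma coord_mat_carrier: "coord_mat \<gamma> \<in> carrier_mat (r1 + 2 * r2) (r1 + 2 * r2)"
  by (simp add: coord_mat_def)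

text \<open>The real coordinates are orthonormal, so the Gram matrix is the coordinate matrix times
  its transpose.\<close>

lemma det_gram:
  "Determinant.det (Matrix.mat (r1 + 2 * r2) (r1 + 2 * r2) (\<lambda>(i, j). \<iota> (\<gamma> i) \<bullet> \<iota> (\<gamma> j))) = (Determinant.det (coord_mat \<gamma>))\<^sup>2"
proof -
  have "Matrix.mat (r1 + 2 * r2) (r1 + 2 * r2) (\<lambda>(i, j). \<iota> (\<gamma> i) \<bullet> \<iota> (\<gamma> j)) = coord_mat \<gamma> * transpose_mat (coord_mat \<gamma>)"
    by (rule eq_matI) (auto simp: coord_mat_def scalar_prod_def rcrd_inner atLeast0LessThan)
  moreover have "Determinant.det (coord_mat \<gamma> * transpose_mat (coord_mat \<gamma>)) = Determinant.det (coord_mat \<gamma>) * Determinant.det (coord_mat \<gamma>)"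
    using Determinant.det_mult[OF coord_mat_carrier transpose_carrier_mat[THEN iffD2, OF coord_mat_carrier]]
      Determinant.det_transpose[OF coord_mat_carrier] by simp
  ultimately show ?thesis by (simp add: power2_eq_square)
qed

lemma det_coord_mat_change:
  assumes A: "\<And>j. j < r1 + 2 * r2 \<Longrightarrow> \<gamma> j = (\<Sum>i<r1 + 2 * r2. of_int (A j i) * \<omega> i)"
  shows "Determinant.det (coord_mat \<gamma>)
    = of_int (Determinant.det (Matrix.mat (r1 + 2 * r2) (r1 + 2 * r2) (\<lambda>(i, j). A i j))) * Determinant.det (coord_mat \<omega>)"
proof -
  let ?d = "r1 + 2 * r2"
  let ?A = "Matrix.mat ?d ?d (\<lambda>(i, j). A i j)"
  have lin: "rcrd (\<iota> (\<Sum>i<?d. of_int (a i) * \<omega> i)) k = (\<Sum>i<?d. of_int (a i) * rcrd (\<iota> (\<omega> i)) k)" if k: "k < ?d" for a k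
  proof (cases "k < r1 + r2")
    case True
    note L = crd_linear[OF True]
    show ?thesis using True
      by (simp add: rcrd_def \<iota>_sum \<iota>_of_int linear_sum[OF L] linear_cmul[OF L])
  next
    case False
    then have "k - r2 < r1 + r2" using k by simp
    note L = crd_linear[OF this]
    show ?thesis using False
      by (simp add: rcrd_def \<iota>_sum \<iota>_of_int linear_sum[OF L] linear_cmul[OF L])
  qed
  have "coord_mat \<gamma> = map_mat of_int ?A * coord_mat \<omega>"
    by (rule eq_matI) (auto simp: coord_mat_def scalar_prod_def atLeast0LessThan A lin)
  then have "Determinant.det (coord_mat \<gamma>) = Determinant.det (map_mat of_int ?A) * Determinant.det (coord_mat \<omega>)"
    using Determinant.det_mult[of "map_mat of_int ?A" ?d "coord_mat \<omega>"] coord_mat_carrier by simp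
  also have "Determinant.det (map_mat of_int ?A) = (of_int (Determinant.det ?A) :: real)"
    by (rule of_int_hom.hom_det)
  finally show ?thesis .
qed

lemma s_real_value: "l < r1 \<Longrightarrow> s l \<alpha> = of_real (Re (s l \<alpha>))"
proof -
  assume l: "l < r1"
  then have "range (s l) \<subseteq> \<real>" using s_real[of l] by simp
  then have "s l \<alpha> \<in> \<real>" by blast
  then show ?thesis by (simp add: complex_is_Real_iff complex_eq_iff)
qed

text \<open>The trace form is diagonal in the real coordinates, with weight 1 at a real place and weights
  2, -2 at the real and imaginary parts of a complex place, since
  \<open>z w + cnj (z w) = 2 Re z Re w - 2 Im z Im w\<close>.\<close>

lemma det_embedding_matrix:
  "(cmod (Determinant.det (Matrix.mat (r1 + 2 * r2) (r1 + 2 * r2) (\<lambda>(i, j). emb j (\<omega> i)))))\<^sup>2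
    = 4 ^ r2 * (Determinant.det (coord_mat \<omega>))\<^sup>2"
proof -
  let ?d = "r1 + 2 * r2"
  define c :: "nat \<Rightarrow> real" where "c = (\<lambda>j. if j < r1 then 1 else if j < r1 + r2 then 2 else - 2)"
  let ?M = "Matrix.mat ?d ?d (\<lambda>(i, j). emb j (\<omega> i))"
  let ?R = "coord_mat \<omega>" and ?D = "Matrix.mat ?d ?d (\<lambda>(i, j). if i = j then c i else 0)"
  let ?r = "\<lambda>i j. rcrd (\<iota> (\<omega> i)) j"
  have entry: "(\<Sum>j<?d. emb j (\<omega> i) * emb j (\<omega> k)) = of_real (\<Sum>j<?d. c j * ?r i j * ?r k j)" for i k
  proof -
    have "(\<Sum>j<?d. emb j (\<omega> i) * emb j (\<omega> k))
      = (\<Sum>l<r1 + r2. s l (\<omega> i) * s l (\<omega> k)) + (\<Sum>l=r1..<r1 + r2. cnj (s l (\<omega> i)) * cnj (s l (\<omega> k)))"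
      unfolding sum_split_places by (intro arg_cong2[where f = "(+)"] sum.cong) (auto simp: emb_def)
    also have "\<dots> = (\<Sum>l<r1. s l (\<omega> i) * s l (\<omega> k))
        + (\<Sum>l=r1..<r1 + r2. s l (\<omega> i) * s l (\<omega> k) + cnj (s l (\<omega> i)) * cnj (s l (\<omega> k)))"
      by (simp only: sum_real_complex sum.distrib add.assoc)
    also have "(\<Sum>l<r1. s l (\<omega> i) * s l (\<omega> k)) = of_real (\<Sum>l<r1. c l * ?r i l * ?r k l)"
      unfolding of_real_sum
    proof (rule sum.cong[OF refl])
      fix l assume "l \<in> {..<r1}"
      then have l: "l < r1" by simp
      then have "c l * ?r i l * ?r k l = Re (s l (\<omega> i)) * Re (s l (\<omega> k))" by (simp add: c_def rcrd_\<iota>)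
      then show "s l (\<omega> i) * s l (\<omega> k) = of_real (c l * ?r i l * ?r k l)"
        using s_real_value[OF l, of "\<omega> i"] s_real_value[OF l, of "\<omega> k"] by (metis of_real_mult)
    qed
    also have "(\<Sum>l=r1..<r1 + r2. s l (\<omega> i) * s l (\<omega> k) + cnj (s l (\<omega> i)) * cnj (s l (\<omega> k)))
      = of_real (\<Sum>l=r1..<r1 + r2. c l * ?r i l * ?r k l + c (l + r2) * ?r i (l + r2) * ?r k (l + r2))"
      unfolding of_real_sum
    proof (rule sum.cong[OF refl])
      fix l assume "l \<in> {r1..<r1 + r2}"
      then have "c l * ?r i l * ?r k l = 2 * Re (s l (\<omega> i)) * Re (s l (\<omega> k))"
        "c (l + r2) * ?r i (l + r2) * ?r k (l + r2) = - 2 * Im (s l (\<omega> i)) * Im (s l (\<omega> k))"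
        by (simp_all add: c_def rcrd_\<iota>)
      then show "s l (\<omega> i) * s l (\<omega> k) + cnj (s l (\<omega> i)) * cnj (s l (\<omega> k))
        = of_real (c l * ?r i l * ?r k l + c (l + r2) * ?r i (l + r2) * ?r k (l + r2))"
        by (intro complex_eqI) simp_all
    qed
    finally show ?thesis
      by (simp only: of_real_add[symmetric] sum_split_places sum_real_complex sum.distrib add.assoc)
  qed
  have "?M * transpose_mat ?M = map_mat of_real (?R * ?D * transpose_mat ?R)"
  proof (rule eq_matI)
    fix i k assume "i < dim_row (map_mat complex_of_real (?R * ?D * transpose_mat ?R))"
      "k < dim_col (map_mat complex_of_real (?R * ?D * transpose_mat ?R))"
    then have ik: "i < ?d" "k < ?d" by (auto simp: coord_mat_def)
    have RD: "(?R * ?D) $$ (i, j) = ?r i j * c j" if "j < ?d" for j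
    proof -
      have "(?R * ?D) $$ (i, j) = (\<Sum>l<?d. ?r i l * (if l = j then c l else 0))"
        using ik that by (simp add: coord_mat_def scalar_prod_def atLeast0LessThan)
      also have "\<dots> = (\<Sum>l<?d. if l = j then ?r i j * c j else 0)" by (rule sum.cong) auto
      finally show ?thesis using that by simp
    qed
    have "(?R * ?D * transpose_mat ?R) $$ (i, k) = (\<Sum>j<?d. (?R * ?D) $$ (i, j) * ?r k j)"
      using ik by (simp add: coord_mat_def scalar_prod_def[of "row _ _" "col _ _"] atLeast0LessThan del: index_mult_mat(1))
        (simp add: scalar_prod_def atLeast0LessThan)
    also have "\<dots> = (\<Sum>j<?d. c j * ?r i j * ?r k j)"
    proof (rule sum.cong[OF refl])
      fix j assume "j \<in> {..<?d}"
      then have "j < ?d" by simp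
      from RD[OF this] show "(?R * ?D) $$ (i, j) * ?r k j = c j * ?r i j * ?r k j" by (simp only: mult_ac)
    qed
    finally have *: "(?R * ?D * transpose_mat ?R) $$ (i, k) = (\<Sum>j<?d. c j * ?r i j * ?r k j)" .
    have "map_mat complex_of_real (?R * ?D * transpose_mat ?R) $$ (i, k) = complex_of_real ((?R * ?D * transpose_mat ?R) $$ (i, k))"
      using ik by (intro index_map_mat(1)) (auto simp: coord_mat_def)
    then show "(?M * transpose_mat ?M) $$ (i, k) = map_mat complex_of_real (?R * ?D * transpose_mat ?R) $$ (i, k)"
      unfolding * entry[symmetric] using ik by (simp add: scalar_prod_def atLeast0LessThan)
  qed (auto simp: coord_mat_def)
  moreover have "Determinant.det (?M * transpose_mat ?M) = Determinant.det ?M * Determinant.det ?M"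
    using Determinant.det_mult[of ?M ?d "transpose_mat ?M"] Determinant.det_transpose[of ?M ?d] by simp
  moreover have "Determinant.det (map_mat complex_of_real (?R * ?D * transpose_mat ?R)) = of_real (Determinant.det (?R * ?D * transpose_mat ?R))"
    by (rule of_real_hom.hom_det)
  moreover have "Determinant.det (?R * ?D * transpose_mat ?R) = Determinant.det ?R * Determinant.det ?D * Determinant.det ?R"
  proof -
    have D: "?D \<in> carrier_mat ?d ?d" by simp
    show ?thesis
      by (simp only: Determinant.det_mult[OF mult_carrier_mat[OF coord_mat_carrier D] transpose_carrier_mat[THEN iffD2, OF coord_mat_carrier]]
          Determinant.det_mult[OF coord_mat_carrier D] Determinant.det_transpose[OF coord_mat_carrier])
  qed
  ultimately have "Determinant.det ?M * Determinant.det ?M = of_real (Determinant.det ?R * Determinant.det ?D * Determinant.det ?R)"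
    by (simp only:)
  then have "cmod (Determinant.det ?M * Determinant.det ?M) = \<bar>Determinant.det ?R * Determinant.det ?D * Determinant.det ?R\<bar>"
    by (simp only: norm_of_real)
  then have "(cmod (Determinant.det ?M))\<^sup>2 = \<bar>Determinant.det ?D\<bar> * (Determinant.det ?R)\<^sup>2"
    by (simp add: norm_mult power2_eq_square abs_mult mult_ac)
  also have "\<bar>Determinant.det ?D\<bar> = 4 ^ r2"
  proof -
    have "Determinant.det ?D = prod_list (diag_mat ?D)" by (rule det_lower_triangular[of ?d]) auto
    also have "\<dots> = (\<Prod>j<?d. c j)" by (simp add: prod_list_diag_prod atLeast0LessThan)
    also have "\<dots> = (\<Prod>l<r1. c l) * (\<Prod>l=r1..<r1 + r2. c l) * (\<Prod>l=r1..<r1 + r2. c (l + r2))"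
      by (simp only: prod_split_places prod_real_complex)
    also have "\<dots> = 1 * 2 ^ r2 * (- 2) ^ r2" by (simp add: c_def)
    finally have "\<bar>Determinant.det ?D\<bar> = 2 ^ r2 * 2 ^ r2" by (simp add: abs_mult power_abs)
    then show ?thesis by (simp add: power_mult_distrib[symmetric])
  qed
  finally show ?thesis .
qed

theorem covolume:
  obtains \<omega> :: "nat \<Rightarrow> 'k" where "int_basis \<omega> {x. algebraic_int x}"
    "\<bar>Determinant.det (coord_mat \<omega>)\<bar> = sqrt (abs_discriminant TYPE('k)) / 2 ^ r2" "Determinant.det (coord_mat \<omega>) \<noteq> 0"
proof -
  have bij: "bij_betw emb {..<nf_degree TYPE('k)} embeddings" unfolding degree_places by (rule bij_emb)
  obtain \<omega> :: "nat \<Rightarrow> 'k" where \<omega>: "int_basis \<omega> {x. algebraic_int x}"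
    "abs_discriminant TYPE('k) = (cmod (Determinant.det (Matrix.mat (nf_degree TYPE('k)) (nf_degree TYPE('k)) (\<lambda>(i, j). emb j (\<omega> i)))))\<^sup>2"
    by (rule abs_discriminant_eq[OF bij]) (rule that)
  have D: "abs_discriminant TYPE('k) = 4 ^ r2 * (Determinant.det (coord_mat \<omega>))\<^sup>2"
    using \<omega>(2) unfolding degree_places det_embedding_matrix .
  have "rat_basis \<omega>" using \<omega>(1) by (simp add: int_basis_def)
  from det_embeddings_nonzero[OF this bij] have "abs_discriminant TYPE('k) \<noteq> 0" using \<omega>(2) by simp
  then have nz: "Determinant.det (coord_mat \<omega>) \<noteq> 0" using D by auto
  have "sqrt (abs_discriminant TYPE('k)) = 2 ^ r2 * \<bar>Determinant.det (coord_mat \<omega>)\<bar>"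
  proof -
    have "(4::real) ^ r2 = (2 ^ r2)\<^sup>2" by (simp add: power2_eq_square power_mult_distrib[symmetric])
    then show ?thesis unfolding D by (simp add: real_sqrt_mult)
  qed
  then have "\<bar>Determinant.det (coord_mat \<omega>)\<bar> = sqrt (abs_discriminant TYPE('k)) / 2 ^ r2" by simp
  with \<omega>(1) nz show thesis by (intro that)
qed

section \<open>The trace pairing and the norm on V\<close>

definition tr_pair :: "'k \<Rightarrow> 'v \<Rightarrow> real" where
  "tr_pair m x = tr_V r1 r2 (\<lambda>l. s l m * crd x l)"

lemma linear_tr_pair: "linear (tr_pair m)"
proof (rule linearI)
  fix x y :: 'v and a :: real
  have add: "crd (x + y) l = crd x l + crd y l" and sc: "crd (a *\<^sub>R x) l = a *\<^sub>R crd x l" if "l < r1 + r2" for l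
    using linear_add[OF crd_linear[OF that]] linear_cmul[OF crd_linear[OF that]] by auto
  show "tr_pair m (x + y) = tr_pair m x + tr_pair m y"
    by (simp add: tr_pair_def tr_V_def add algebra_simps sum.distrib sum_subtractf)
  show "tr_pair m (a *\<^sub>R x) = a *\<^sub>R tr_pair m x"
    by (simp add: tr_pair_def tr_V_def sc algebra_simps sum_distrib_left sum_subtractf)
qed

lemma trace_K_places: "trace_K \<alpha> = of_real (tr_V r1 r2 (\<lambda>l. s l \<alpha>))"
proof -
  have "trace_K \<alpha> = (\<Sum>j<r1 + 2 * r2. emb j \<alpha>)"
    unfolding trace_K_def by (rule sum.reindex_bij_betw[OF bij_emb, symmetric])
  also have "\<dots> = (\<Sum>l<r1 + r2. s l \<alpha>) + (\<Sum>l=r1..<r1 + r2. cnj (s l \<alpha>))"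
    unfolding sum_split_places by (intro arg_cong2[where f = "(+)"] sum.cong) (auto simp: emb_def)
  also have "\<dots> = (\<Sum>l<r1. s l \<alpha>) + (\<Sum>l=r1..<r1 + r2. s l \<alpha> + cnj (s l \<alpha>))"
    by (simp only: sum_real_complex sum.distrib add.assoc)
  also have "(\<Sum>l<r1. s l \<alpha>) = of_real (\<Sum>l<r1. Re (s l \<alpha>))"
    unfolding of_real_sum by (rule sum.cong) (use s_real_value in auto)
  also have "(\<Sum>l=r1..<r1 + r2. s l \<alpha> + cnj (s l \<alpha>)) = of_real (\<Sum>l=r1..<r1 + r2. 2 * Re (s l \<alpha>))"
    unfolding of_real_sum by (rule sum.cong) (auto simp: complex_add_cnj)
  finally show ?thesis by (simp only: tr_V_def of_real_add)
qed

lemma tr_pair_\<iota>: "of_real (tr_pair m (\<iota> \<alpha>)) = trace_K (m * \<alpha>)"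
proof -
  have "tr_pair m (\<iota> \<alpha>) = tr_V r1 r2 (\<lambda>l. s l (m * \<alpha>))"
    unfolding tr_pair_def tr_V_def
    by (intro arg_cong2[where f = "(+)"] sum.cong refl) (auto simp: crd_\<iota> embedding_mult[OF s_embedding])
  then show ?thesis by (simp add: trace_K_places)
qed

text \<open>Conjugate embeddings combine to squared moduli, so the product over all embeddings is
  \<open>Nm_V\<close>, a real number whose sign the ideal norm forgets.\<close>

lemma ideal_norm_places:
  assumes "algebraic_int \<alpha>"
  shows "real (ideal_norm (cgenideal ring_of_integers \<alpha>)) = \<bar>Nm_V r1 r2 (\<lambda>l. s l \<alpha>)\<bar>"
proof -
  have "(\<Prod>\<tau>\<in>embeddings. \<tau> \<alpha>) = (\<Prod>j<r1 + 2 * r2. emb j \<alpha>)"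
    by (rule prod.reindex_bij_betw[OF bij_emb, symmetric])
  also have "\<dots> = (\<Prod>l<r1 + r2. s l \<alpha>) * (\<Prod>l=r1..<r1 + r2. cnj (s l \<alpha>))"
    unfolding prod_split_places by (intro arg_cong2[where f = "(*)"] prod.cong) (auto simp: emb_def)
  also have "\<dots> = (\<Prod>l<r1. s l \<alpha>) * (\<Prod>l=r1..<r1 + r2. s l \<alpha> * cnj (s l \<alpha>))"
    by (simp only: prod_real_complex prod.distrib mult.assoc)
  also have "(\<Prod>l<r1. s l \<alpha>) = of_real (\<Prod>l<r1. Re (s l \<alpha>))"
    unfolding of_real_prod by (rule prod.cong) (use s_real_value in auto)
  also have "(\<Prod>l=r1..<r1 + r2. s l \<alpha> * cnj (s l \<alpha>)) = of_real (\<Prod>l=r1..<r1 + r2. (cmod (s l \<alpha>))\<^sup>2)"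
    unfolding of_real_prod by (rule prod.cong) (simp_all only: complex_norm_square)
  finally have "(\<Prod>\<tau>\<in>embeddings. \<tau> \<alpha>) = of_real (Nm_V r1 r2 (\<lambda>l. s l \<alpha>))"
    by (simp only: Nm_V_def of_real_mult)
  then show ?thesis unfolding ideal_norm_principal[OF assms] by (simp only: norm_of_real)
qed

end

no_notation Matrix.vec_index (infixl "$" 100)

section \<open>Poisson summation over an ideal\<close>

lemma int_points_vec:
  fixes k :: "'v::euclidean_space ^ 'n::finite" and d :: nat
  assumes b: "bij_betw b {..<d} (Basis :: 'v set)"
  shows "k \<in> int_points \<longleftrightarrow> (\<forall>i. \<forall>j<d. k $ i \<bullet> b j \<in> \<int>)"
proof -
  have "(\<forall>u\<in>Basis. k $ i \<bullet> u \<in> \<int>) \<longleftrightarrow> (\<forall>j<d. k $ i \<bullet> b j \<in> \<int>)" for i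
    using bij_betw_imp_surj_on[OF b] by (metis (no_types, lifting) imageE imageI lessThan_iff)
  then show ?thesis
    by (auto simp: int_points_def Basis_vec_def inner_axis)
qed

lemma coordinates_bij_Basis:
  fixes x :: "'v::euclidean_space" and d :: nat
  assumes b: "bij_betw b {..<d} (Basis :: 'v set)"
  shows "(\<Sum>j<d. (x \<bullet> b j) *\<^sub>R b j) = x" "i < d \<Longrightarrow> (\<Sum>j<d. c j *\<^sub>R b j) \<bullet> b i = c i"
proof -
  have "(\<Sum>j<d. (x \<bullet> b j) *\<^sub>R b j) = (\<Sum>u\<in>Basis. (x \<bullet> u) *\<^sub>R u)"
    by (rule sum.reindex_bij_betw[OF b])
  then show "(\<Sum>j<d. (x \<bullet> b j) *\<^sub>R b j) = x" by (simp only: euclidean_representation)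
  assume i: "i < d"
  have "b j \<bullet> b i = (if j = i then 1 else 0)" if "j < d" for j
  proof -
    have "b j \<in> Basis" "b i \<in> Basis" using bij_betw_apply[OF b] i that by auto
    moreover have "b j = b i \<longleftrightarrow> j = i" using bij_betw_imp_inj_on[OF b] i that by (auto dest: inj_onD)
    ultimately show ?thesis by (simp add: inner_Basis)
  qed
  then have "(\<Sum>j<d. c j *\<^sub>R b j) \<bullet> b i = (\<Sum>j<d. if j = i then c i else 0)"
    unfolding inner_sum_left by (intro sum.cong) auto
  then show "(\<Sum>j<d. c j *\<^sub>R b j) \<bullet> b i = c i" using i by simp
qed

context places
begin

text \<open>The linear map from the standard lattice to the embedded ideal: the j-th basis vector
  goes to the j-th element of the integral basis.\<close>

definition lat :: "(nat \<Rightarrow> 'v) \<Rightarrow> (nat \<Rightarrow> 'k) \<Rightarrow> 'v \<Rightarrow> 'v" where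
  "lat b \<gamma> x = (\<Sum>j<r1 + 2 * r2. (x \<bullet> b j) *\<^sub>R \<iota> (\<gamma> j))"

lemma linear_lat: "linear (lat b \<gamma>)"
proof (rule linearI)
  show "lat b \<gamma> (x + y) = lat b \<gamma> x + lat b \<gamma> y" for x y
    by (simp only: lat_def inner_add_left scaleR_add_left sum.distrib)
  show "lat b \<gamma> (a *\<^sub>R x) = a *\<^sub>R lat b \<gamma> x" for a x
    by (simp only: lat_def inner_scaleR_left scaleR_scaleR scaleR_sum_right)
qed

lemma lat_basis:
  assumes b: "bij_betw b {..<r1 + 2 * r2} (Basis :: 'v set)" and j: "j < r1 + 2 * r2"
  shows "lat b \<gamma> (b j) = \<iota> (\<gamma> j)"
proof -
  have "b j \<bullet> b i = (if i = j then 1 else 0)" if "i < r1 + 2 * r2" for i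
  proof -
    have "b j \<in> Basis" "b i \<in> Basis" using bij_betw_apply[OF b] j that by auto
    moreover have "b j = b i \<longleftrightarrow> i = j" using bij_betw_imp_inj_on[OF b] j that by (auto dest: inj_onD)
    ultimately show ?thesis by (simp add: inner_Basis)
  qed
  then have "lat b \<gamma> (b j) = (\<Sum>i<r1 + 2 * r2. if i = j then \<iota> (\<gamma> j) else 0)"
    unfolding lat_def by (intro sum.cong) auto
  then show ?thesis using j by simp
qed

text \<open>A vector in the kernel gives a coordinate vector annihilated by the Gram matrix, which
  is invertible.\<close>

lemma inj_lat:
  assumes b: "bij_betw b {..<r1 + 2 * r2} (Basis :: 'v set)" and det: "Determinant.det (coord_mat \<gamma>) \<noteq> 0"
  shows "inj (lat b \<gamma>)"
proof (rule linear_injective_0[OF linear_lat, THEN iffD2], intro allI impI)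
  let ?d = "r1 + 2 * r2"
  fix x assume x: "lat b \<gamma> x = 0"
  let ?G = "Matrix.mat ?d ?d (\<lambda>(i, j). \<iota> (\<gamma> i) \<bullet> \<iota> (\<gamma> j))"
  let ?c = "Matrix.vec ?d (\<lambda>j. x \<bullet> b j)"
  have "?G *\<^sub>v ?c = 0\<^sub>v ?d"
  proof (rule eq_vecI)
    fix i assume "i < dim_vec (0\<^sub>v ?d :: real Matrix.vec)"
    then have i: "i < ?d" by simp
    have "\<iota> (\<gamma> i) \<bullet> lat b \<gamma> x = (\<Sum>j<?d. (\<iota> (\<gamma> i) \<bullet> \<iota> (\<gamma> j)) * (x \<bullet> b j))"
      by (simp add: lat_def inner_sum_right mult.commute)
    then show "vec_index (?G *\<^sub>v ?c) i = vec_index (0\<^sub>v ?d) i"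
      using i x by (simp add: scalar_prod_def atLeast0LessThan)
  qed simp
  moreover have "Determinant.det ?G \<noteq> 0" unfolding det_gram using det by simp
  moreover have "?G \<in> carrier_mat ?d ?d" "?c \<in> carrier_vec ?d" by auto
  ultimately have "?c = 0\<^sub>v ?d" using det_0_iff_vec_prod_zero[of ?G ?d] by blast
  then have "x \<bullet> b j = 0" if "j < ?d" for j using that by (metis index_vec index_zero_vec(1))
  then have "(\<Sum>j<?d. (x \<bullet> b j) *\<^sub>R b j) = 0" by (intro sum.neutral) auto
  then show "x = 0" by (simp only: coordinates_bij_Basis(1)[OF b])
qed

definition density_factor :: "'k set \<Rightarrow> real" where
  "density_factor \<bb> = real (ideal_norm \<bb>) * sqrt (abs_discriminant TYPE('k)) / 2 ^ r2"

text \<open>The square of the density is the Gram determinant of \<open>\<gamma>\<close>, hence the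
  square of the coordinate determinant; both quantities are nonnegative, so they agree.\<close>

lemma lattice_density:
  assumes \<bb>: "\<bb> \<in> nonzero_ideals" and b: "bij_betw b {..<r1 + 2 * r2} (Basis :: 'v set)"
  obtains \<gamma> where "int_basis \<gamma> \<bb>" "inj (lat b \<gamma>)" "density_factor \<bb> > 0"
    "lborel = density (distr lborel borel (lat b \<gamma>)) (\<lambda>_. ennreal (density_factor \<bb>))"
proof -
  let ?d = "r1 + 2 * r2"
  obtain \<omega> :: "nat \<Rightarrow> 'k" where \<omega>: "int_basis \<omega> {x. algebraic_int x}"
    "\<bar>Determinant.det (coord_mat \<omega>)\<bar> = sqrt (abs_discriminant TYPE('k)) / 2 ^ r2" "Determinant.det (coord_mat \<omega>) \<noteq> 0"
    by (rule covolume) (rule that)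
  obtain \<gamma> A where \<gamma>: "int_basis \<gamma> \<bb>"
    "\<And>j. j < ?d \<Longrightarrow> \<gamma> j = (\<Sum>i<?d. of_int (A j i) * \<omega> i)"
    "int (ideal_norm \<bb>) = \<bar>Determinant.det (Matrix.mat ?d ?d (\<lambda>(i, j). A i j))\<bar>" "ideal_norm \<bb> > 0"
    by (rule ideal_int_basis[OF \<omega>(1) \<bb>, unfolded degree_places]) (rule that)
  have det: "Determinant.det (coord_mat \<gamma>) = of_int (Determinant.det (Matrix.mat ?d ?d (\<lambda>(i, j). A i j))) * Determinant.det (coord_mat \<omega>)"
    by (rule det_coord_mat_change[OF \<gamma>(2)])
  have absdet: "\<bar>Determinant.det (coord_mat \<gamma>)\<bar> = density_factor \<bb>"
  proof -
    have "\<bar>real_of_int (Determinant.det (Matrix.mat ?d ?d (\<lambda>(i, j). A i j)))\<bar> = real (ideal_norm \<bb>)"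
      by (metis \<gamma>(3) of_int_abs of_int_of_nat_eq)
    then show ?thesis unfolding det abs_mult \<omega>(2) density_factor_def by simp
  qed
  have nz: "Determinant.det (coord_mat \<gamma>) \<noteq> 0"
  proof -
    have "Determinant.det (Matrix.mat ?d ?d (\<lambda>(i, j). A i j)) \<noteq> 0" using \<gamma>(3,4) by linarith
    then show ?thesis unfolding det using \<omega>(3) by simp
  qed
  have inj: "inj (lat b \<gamma>)" by (rule inj_lat[OF b nz])
  obtain \<kappa> where \<kappa>: "\<kappa> > 0" "lborel = density (distr lborel borel (lat b \<gamma>)) (\<lambda>_. ennreal \<kappa>)"
    "\<kappa>\<^sup>2 = Determinant.det (Matrix.mat ?d ?d (\<lambda>(i, j). lat b \<gamma> (b i) \<bullet> lat b \<gamma> (b j)))"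
    by (rule lborel_linear_image[OF linear_lat inj, of b, unfolded dim_V, OF b]) (rule that)
  have "Matrix.mat ?d ?d (\<lambda>(i, j). lat b \<gamma> (b i) \<bullet> lat b \<gamma> (b j)) = Matrix.mat ?d ?d (\<lambda>(i, j). \<iota> (\<gamma> i) \<bullet> \<iota> (\<gamma> j))"
    by (rule eq_matI) (auto simp: lat_basis[OF b])
  then have "\<kappa>\<^sup>2 = (density_factor \<bb>)\<^sup>2" using \<kappa>(3) by (simp add: det_gram absdet[symmetric])
  moreover have "density_factor \<bb> \<ge> 0" using absdet by (metis abs_ge_zero)
  ultimately have "\<kappa> = density_factor \<bb>" using \<kappa>(1) by (simp add: power2_eq_iff_nonneg)
  with \<gamma>(1) inj \<kappa>(1,2) show thesis by (intro that) auto
qed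

abbreviation vec\<iota> :: "'k ^ 'n::finite \<Rightarrow> 'v ^ 'n" where
  "vec\<iota> y \<equiv> (\<chi> i. \<iota> (y $ i))"

lemma vec\<iota>_add: "vec\<iota> (x + y) = vec\<iota> x + vec\<iota> y"
  unfolding Finite_Cartesian_Product.vec_eq_iff vec_lambda_beta vector_add_component \<iota>_add by (intro allI refl)

lemma inj_vec\<iota>: "inj (\<lambda>y::'k ^ 'n::finite. vec\<iota> y)"
  unfolding inj_def Finite_Cartesian_Product.vec_eq_iff \<iota>_inj vec_lambda_beta by blast

lemma lat_int_points:
  assumes b: "bij_betw b {..<r1 + 2 * r2} (Basis :: 'v set)" and \<gamma>: "int_basis \<gamma> \<bb>" and z: "zlattice \<bb>"
  shows "(\<lambda>x::'v ^ 'n::finite. \<chi> i. lat b \<gamma> (x $ i)) ` int_points = (\<lambda>y. vec\<iota> y) ` {y. \<forall>i. y $ i \<in> \<bb>}"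
proof (intro equalityI subsetI)
  let ?d = "r1 + 2 * r2"
  have lat: "lat b \<gamma> x = \<iota> (\<Sum>j<?d. of_int (a j) * \<gamma> j)" if "\<And>j. j < ?d \<Longrightarrow> x \<bullet> b j = of_int (a j)" for x a
    unfolding lat_def \<iota>_sum by (rule sum.cong) (use that in \<open>auto simp: \<iota>_of_int\<close>)
  {
    fix v assume "v \<in> (\<lambda>x::'v ^ 'n. \<chi> i. lat b \<gamma> (x $ i)) ` int_points"
    then obtain x where x: "v = (\<chi> i. lat b \<gamma> (x $ i))" "\<And>i j. j < ?d \<Longrightarrow> x $ i \<bullet> b j \<in> \<int>"
      unfolding image_iff by (auto simp: int_points_vec[OF b])
    define y :: "'k ^ 'n" where "y = (\<chi> i. \<Sum>j<?d. of_int \<lfloor>x $ i \<bullet> b j\<rfloor> * \<gamma> j)"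
    have "y $ i \<in> \<bb>" for i
      unfolding y_def vec_lambda_beta int_basis_iff[OF \<gamma> z] degree_places by (rule exI) (rule refl)
    moreover have "x $ i \<bullet> b j = of_int \<lfloor>x $ i \<bullet> b j\<rfloor>" if "j < ?d" for i j
      using x(2)[OF that, of i] by (elim Ints_cases) simp
    then have "v = vec\<iota> y"
      unfolding x(1) y_def Finite_Cartesian_Product.vec_eq_iff vec_lambda_beta by (intro allI lat)
    ultimately show "v \<in> (\<lambda>y. vec\<iota> y) ` {y. \<forall>i. y $ i \<in> \<bb>}" by blast
  next
    fix v assume "v \<in> (\<lambda>y::'k ^ 'n. vec\<iota> y) ` {y. \<forall>i. y $ i \<in> \<bb>}"
    then obtain y where y: "v = vec\<iota> y" "\<And>i. y $ i \<in> \<bb>" by blast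
    have "\<forall>i. \<exists>a::nat \<Rightarrow> int. y $ i = (\<Sum>j<?d. of_int (a j) * \<gamma> j)"
      using y(2) unfolding int_basis_iff[OF \<gamma> z] degree_places ..
    from choice[OF this] obtain a :: "'n \<Rightarrow> nat \<Rightarrow> int" where a: "\<And>i. y $ i = (\<Sum>j<?d. of_int (a i j) * \<gamma> j)"
      by (elim exE) (rule that, erule spec)
    define x :: "'v ^ 'n" where "x = (\<chi> i. \<Sum>j<?d. of_int (a i j) *\<^sub>R b j)"
    have xb: "x $ i \<bullet> b j = of_int (a i j)" if "j < ?d" for i j
      unfolding x_def vec_lambda_beta by (rule coordinates_bij_Basis(2)[OF b that])
    then have "x \<in> int_points" by (auto simp: int_points_vec[OF b])
    moreover have "v = (\<chi> i. lat b \<gamma> (x $ i))"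
      unfolding y(1) by (simp add: Finite_Cartesian_Product.vec_eq_iff a lat[OF xb])
    ultimately show "v \<in> (\<lambda>x. \<chi> i. lat b \<gamma> (x $ i)) ` int_points" by blast
  }
qed

section \<open>The dual lattice of an ideal\<close>

definition vec_pair :: "'k ^ 'n::finite \<Rightarrow> 'v ^ 'n \<Rightarrow> real" where
  "vec_pair m v = (\<Sum>i\<in>UNIV. tr_pair (m $ i) (v $ i))"

lemma vec_pair_add: "vec_pair m (v + w) = vec_pair m v + vec_pair m w"
  by (simp only: vec_pair_def vector_add_component linear_add[OF linear_tr_pair] sum.distrib)

lemma continuous_vec_pair: "continuous_on S (vec_pair m)"
  unfolding vec_pair_def[abs_def]
  by (intro continuous_on_sum linear_continuous_on
      bounded_linear_compose[OF linear_linear[THEN iffD2, OF linear_tr_pair] bounded_linear_vec_nth])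

text \<open>The adjoint of the lattice map applied to the functional \<open>vec_pair m\<close>: its
  inner product with x is the trace pairing of \<open>m\<close> with the image of x.\<close>

definition dual_point :: "(nat \<Rightarrow> 'v) \<Rightarrow> (nat \<Rightarrow> 'k) \<Rightarrow> 'k ^ 'n::finite \<Rightarrow> 'v ^ 'n" where
  "dual_point b \<gamma> m = (\<chi> i. \<Sum>j<r1 + 2 * r2. tr_pair (m $ i) (\<iota> (\<gamma> j)) *\<^sub>R b j)"

lemma dual_point_inner:
  "dual_point b \<gamma> m \<bullet> x = vec_pair m (\<chi> i. lat b \<gamma> (x $ i))"
proof -
  have "tr_pair (m $ i) (lat b \<gamma> (x $ i)) = (\<Sum>j<r1 + 2 * r2. tr_pair (m $ i) (\<iota> (\<gamma> j)) * (b j \<bullet> x $ i))" for i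
    by (simp add: lat_def linear_sum[OF linear_tr_pair] linear_cmul[OF linear_tr_pair] inner_commute mult.commute)
  then show ?thesis
    by (simp add: dual_point_def vec_pair_def inner_vec_def inner_sum_left)
qed

text \<open>The coordinates of the frequency are the traces of m_i \<gamma>_j, so integrality is
  membership in the dual ideal. Any integer values are attained by an element of K through
  \<open>trace_K_functional\<close>; nondegeneracy gives injectivity.\<close>

lemma bij_dual_point:
  assumes b: "bij_betw b {..<r1 + 2 * r2} (Basis :: 'v set)" and \<gamma>: "int_basis \<gamma> \<bb>"
  shows "bij_betw (dual_point b \<gamma>) {m :: 'k ^ 'n::finite. \<forall>i. m $ i \<in> dual_ideal \<bb>} int_points"
proof (rule bij_betw_imageI)
  let ?d = "r1 + 2 * r2"
  have rb: "rat_basis \<gamma>" using \<gamma> by (simp add: int_basis_def)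
  have coord: "dual_point b \<gamma> m $ i \<bullet> b j = tr_pair (m $ i) (\<iota> (\<gamma> j))" if "j < ?d" for m :: "'k ^ 'n" and i j
    unfolding dual_point_def vec_lambda_beta by (rule coordinates_bij_Basis(2)[OF b that])
  show "inj_on (dual_point b \<gamma>) {m :: 'k ^ 'n. \<forall>i. m $ i \<in> dual_ideal \<bb>}"
  proof (rule inj_onI)
    fix m m' :: "'k ^ 'n" assume eq: "dual_point b \<gamma> m = dual_point b \<gamma> m'"
    have "m $ i = m' $ i" for i
    proof (rule trace_K_determines[OF rb])
      fix j assume "j < nf_degree TYPE('k)"
      then have j: "j < ?d" by (simp add: degree_places)
      show "trace_K (m $ i * \<gamma> j) = trace_K (m' $ i * \<gamma> j)"
        unfolding tr_pair_\<iota>[symmetric] coord[OF j, symmetric] eq ..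
    qed
    then show "m = m'" by (simp add: Finite_Cartesian_Product.vec_eq_iff)
  qed
  have dual: "x \<in> dual_ideal \<bb> \<longleftrightarrow> (\<forall>j<?d. tr_pair x (\<iota> (\<gamma> j)) \<in> \<int>)" for x
    unfolding dual_ideal_iff[OF \<gamma>] degree_places tr_pair_\<iota>[symmetric] by simp
  have int: "dual_point b \<gamma> m \<in> int_points \<longleftrightarrow> (\<forall>i. m $ i \<in> dual_ideal \<bb>)" for m :: "'k ^ 'n"
    unfolding int_points_vec[OF b] dual by (simp add: coord)
  show "dual_point b \<gamma> ` {m :: 'k ^ 'n. \<forall>i. m $ i \<in> dual_ideal \<bb>} = int_points"
  proof (intro equalityI subsetI)
    fix k :: "'v ^ 'n" assume k: "k \<in> int_points"
    have "\<exists>\<alpha>. \<forall>j<?d. tr_pair \<alpha> (\<iota> (\<gamma> j)) = k $ i \<bullet> b j" for i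
    proof -
      obtain \<alpha> where \<alpha>: "\<forall>j<?d. trace_K (\<alpha> * \<gamma> j) = of_rat (of_int \<lfloor>k $ i \<bullet> b j\<rfloor>)"
        using trace_K_functional[OF rb, of "\<lambda>j. of_int \<lfloor>k $ i \<bullet> b j\<rfloor>"] unfolding degree_places by (elim exE)
      have "tr_pair \<alpha> (\<iota> (\<gamma> j)) = k $ i \<bullet> b j" if j: "j < ?d" for j
      proof -
        have "complex_of_real (tr_pair \<alpha> (\<iota> (\<gamma> j))) = of_real (of_int \<lfloor>k $ i \<bullet> b j\<rfloor>)"
          unfolding tr_pair_\<iota> \<alpha>[rule_format, OF j] by simp
        then have "tr_pair \<alpha> (\<iota> (\<gamma> j)) = of_int \<lfloor>k $ i \<bullet> b j\<rfloor>" by (simp only: of_real_eq_iff)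
        moreover have "k $ i \<bullet> b j \<in> \<int>" using k j unfolding int_points_vec[OF b] by (elim allE impE)
        ultimately show ?thesis by (elim Ints_cases) simp
      qed
      then show ?thesis by (intro exI allI impI)
    qed
    then have "\<forall>i. \<exists>\<alpha>. \<forall>j<?d. tr_pair \<alpha> (\<iota> (\<gamma> j)) = k $ i \<bullet> b j" ..
    from choice[OF this] obtain \<alpha> where \<alpha>: "\<And>i j. j < ?d \<Longrightarrow> tr_pair (\<alpha> i) (\<iota> (\<gamma> j)) = k $ i \<bullet> b j"
      by (elim exE) (rule that, blast)
    have "dual_point b \<gamma> (\<chi> i. \<alpha> i) = k"
      by (simp add: Finite_Cartesian_Product.vec_eq_iff dual_point_def \<alpha> coordinates_bij_Basis(1)[OF b])
    then show "k \<in> dual_point b \<gamma> ` {m. \<forall>i. m $ i \<in> dual_ideal \<bb>}"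
      using k int[of "\<chi> i. \<alpha> i"] by (intro image_eqI[of _ _ "\<chi> i. \<alpha> i"]) simp_all
  next
    fix k :: "'v ^ 'n" assume "k \<in> dual_point b \<gamma> ` {m. \<forall>i. m $ i \<in> dual_ideal \<bb>}"
    then show "k \<in> int_points" by (elim imageE) (simp add: int)
  qed
qed

definition ideal_fourier :: "('v ^ 'n::finite \<Rightarrow> complex) \<Rightarrow> 'k ^ 'n \<Rightarrow> complex" where
  "ideal_fourier f m = (LINT x|lborel. f x * unit_char (- vec_pair m x))"

text \<open>Smoothness is the chain rule; for the support, an injective linear map is bounded below,
  so preimages of bounded sets are bounded.\<close>

lemma test_fun_compose_affine:
  fixes f :: "'a::euclidean_space \<Rightarrow> complex" and L :: "'b::euclidean_space \<Rightarrow> 'a"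
  assumes f: "test_fun f" and L: "linear L" "inj L"
  shows "test_fun (\<lambda>x. f (a + L x))"
proof -
  have bl: "bounded_linear L" by (rule linear_linear[THEN iffD2, OF L(1)])
  have "smooth_on (\<lambda>x. f (a + L x)) UNIV"
    using f unfolding test_fun_def smooth_on_def by (auto intro!: Ck_on_compose_affine[OF bl])
  moreover have "bounded {x. f (a + L x) \<noteq> 0}"
  proof -
    obtain B where B: "B > 0" "\<And>x. B * norm x \<le> norm (L x)" using linear_inj_bounded_below_pos[OF L] by metis
    obtain R where R: "R > 0" "\<And>x. norm x > R \<Longrightarrow> f x = 0" by (rule test_fun_support[OF f]) (rule that)
    have "norm x \<le> (R + norm a) / B" if "f (a + L x) \<noteq> 0" for x
    proof -
      have "norm (a + L x) \<le> R" using R(2) that by force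
      then have "norm (L x) \<le> R + norm a" using norm_triangle_ineq4[of "a + L x" a] by simp
      then have "norm x * B \<le> R + norm a" using B(2)[of x] by (simp add: mult.commute)
      then show ?thesis using B(1) by (simp add: pos_le_divide_eq)
    qed
    then show ?thesis unfolding bounded_iff by blast
  qed
  ultimately show ?thesis by (simp add: test_fun_def)
qed

text \<open>Poisson summation for f(a + L x) over the standard lattice, with \<open>L\<close> the
  n-fold lattice map. The frequencies are reindexed by the dual ideal.\<close>

theorem ideal_poisson:
  fixes f :: "'v ^ 'n::finite \<Rightarrow> complex"
  assumes \<bb>: "\<bb> \<in> nonzero_ideals" and f: "test_fun f"
  shows "(\<lambda>m. cmod (ideal_fourier f m)) summable_on {m. \<forall>i. m $ i \<in> dual_ideal \<bb>}"
    and "((\<lambda>m. unit_char (vec_pair m a) * ideal_fourier f m)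
      has_sum of_real (density_factor \<bb> ^ CARD('n)) * (\<Sum>\<^sub>\<infinity>y\<in>{y. \<forall>i. y $ i \<in> \<bb>}. f (a + vec\<iota> y)))
      {m. \<forall>i. m $ i \<in> dual_ideal \<bb>}"
    and "density_factor \<bb> > 0"
proof -
  let ?D = "{m :: 'k ^ 'n. \<forall>i. m $ i \<in> dual_ideal \<bb>}"
  obtain b where b: "bij_betw b {..<r1 + 2 * r2} (Basis :: 'v set)"
    using ex_bij_betw_nat_finite[of "Basis :: 'v set"] by (auto simp: dim_V atLeast0LessThan)
  obtain \<gamma> where \<gamma>: "int_basis \<gamma> \<bb>" "inj (lat b \<gamma>)" "density_factor \<bb> > 0"
    "lborel = density (distr lborel borel (lat b \<gamma>)) (\<lambda>_. ennreal (density_factor \<bb>))"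
    by (rule lattice_density[OF \<bb> b]) (rule that)
  show pos: "density_factor \<bb> > 0" by (rule \<gamma>(3))
  define L where "L = (\<lambda>x::'v ^ 'n. \<chi> i. lat b \<gamma> (x $ i))"
  have linL: "linear L"
    by (rule linearI) (simp_all add: L_def Finite_Cartesian_Product.vec_eq_iff linear_add[OF linear_lat] linear_cmul[OF linear_lat])
  have injL: "inj L"
    by (rule injI) (auto simp: L_def Finite_Cartesian_Product.vec_eq_iff dest: injD[OF \<gamma>(2)])
  have mL: "L \<in> borel_measurable borel"
    by (intro borel_measurable_continuous_onI linear_continuous_on linear_linear[THEN iffD2, OF linL])
  have dens: "(lborel :: ('v ^ 'n) measure) = density (distr lborel borel L) (\<lambda>_. ennreal (density_factor \<bb> ^ CARD('n)))"
    unfolding L_def by (rule lborel_linear_image_vec[OF linear_lat \<gamma>(2,3,4)])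
  let ?g = "\<lambda>a x. f (a + L x)"
  let ?K = "complex_of_real (density_factor \<bb> ^ CARD('n))"
  have Kpos: "density_factor \<bb> ^ CARD('n) > 0" using pos by simp
  have g: "test_fun (?g a)" for a by (rule test_fun_compose_affine[OF f linL injL])
  have mpair: "(\<lambda>v. unit_char (- vec_pair m v)) \<in> borel_measurable borel" for m :: "'k ^ 'n"
    by (intro borel_measurable_continuous_onI continuous_intros continuous_vec_pair)
  \<comment> \<open>Substituting v = L x produces the power of the covolume, translating by
    \<open>a\<close> the character at \<open>a\<close>.\<close>
  have fourier: "?K * fourier (?g a) (dual_point b \<gamma> m) = unit_char (vec_pair m a) * ideal_fourier f m" for a m
  proof -
    let ?G = "\<lambda>v. f (a + v) * unit_char (- vec_pair m v)"
    let ?H = "\<lambda>v. unit_char (vec_pair m a) * (f v * unit_char (- vec_pair m v))"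
    have mf: "(\<lambda>v. f (a + v)) \<in> borel_measurable borel"
      using test_fun_measurable[OF test_fun_compose_affine[OF f linear_id inj_on_id[of UNIV]], of a] by (simp only: id_apply)
    \<comment> \<open>Written as a function of a + v, the integrand is ready for translation
      invariance; the extra character value compensates the shift.\<close>
    have GH: "?G v = ?H (a + v)" for v
      by (simp add: vec_pair_add unit_char_add mult_ac minus_add_distrib)
        (simp add: mult.assoc[symmetric] unit_char_add[symmetric])
    have "?K * fourier (?g a) (dual_point b \<gamma> m) = ?K * (LINT x|lborel. ?G (L x))"
      unfolding fourier_def dual_point_inner L_def ..
    also have "\<dots> = (LINT v|lborel. ?G v)"
      by (rule lborel_integral_linear[OF dens Kpos mL, symmetric]) (intro borel_measurable_times mf mpair)
    also have "\<dots> = (LINT v|lborel. ?H (a + v))" by (simp only: GH)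
    also have "\<dots> = (LINT v|lborel. ?H v)"
      by (rule lborel_integral_translate) (intro borel_measurable_times borel_measurable_const test_fun_measurable[OF f] mpair)
    also have "\<dots> = unit_char (vec_pair m a) * ideal_fourier f m"
      unfolding ideal_fourier_def by simp
    finally show ?thesis .
  qed
  have bij: "bij_betw (dual_point b \<gamma>) ?D int_points" by (rule bij_dual_point[OF b \<gamma>(1)])
  have "(\<lambda>m. cmod (fourier (?g 0) (dual_point b \<gamma> m))) summable_on ?D"
    using fourier_summable[OF g[of 0]] by (subst summable_on_reindex_bij_betw[OF bij])
  then have "(\<lambda>m. (density_factor \<bb> ^ CARD('n)) * cmod (fourier (?g 0) (dual_point b \<gamma> m))) summable_on ?D"
    by (rule summable_on_cmult_right)
  moreover have "(density_factor \<bb> ^ CARD('n)) * cmod (fourier (?g 0) (dual_point b \<gamma> m)) = cmod (ideal_fourier f m)" for m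
    using arg_cong[OF fourier[of 0 m], of cmod] Kpos by (simp only: norm_mult norm_of_real norm_unit_char abs_of_pos mult_1_left)
  ultimately show "(\<lambda>m. cmod (ideal_fourier f m)) summable_on ?D" by (simp only:)
  have "(fourier (?g a) has_sum (\<Sum>\<^sub>\<infinity>n\<in>int_points. ?g a n)) int_points" by (rule poisson_summation[OF g])
  then have "((\<lambda>m. fourier (?g a) (dual_point b \<gamma> m)) has_sum (\<Sum>\<^sub>\<infinity>n\<in>int_points. ?g a n)) ?D"
    by (subst has_sum_reindex_bij_betw[OF bij])
  then have "((\<lambda>m. ?K * fourier (?g a) (dual_point b \<gamma> m)) has_sum ?K * (\<Sum>\<^sub>\<infinity>n\<in>int_points. ?g a n)) ?D"
    by (rule has_sum_cmult_right)
  moreover have "(\<Sum>\<^sub>\<infinity>n\<in>int_points. ?g a n) = (\<Sum>\<^sub>\<infinity>y\<in>{y. \<forall>i. y $ i \<in> \<bb>}. f (a + vec\<iota> y))"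
  proof -
    have "(\<Sum>\<^sub>\<infinity>n\<in>int_points. ?g a n) = (\<Sum>\<^sub>\<infinity>v\<in>L ` int_points. f (a + v))"
      by (subst infsum_reindex) (use injL in \<open>auto simp: o_def intro: inj_on_subset\<close>)
    also have "L ` int_points = (\<lambda>y. vec\<iota> y) ` {y. \<forall>i. y $ i \<in> \<bb>}"
      unfolding L_def by (rule lat_int_points[OF b \<gamma>(1) nonzero_ideal_props(2)[OF \<bb>]])
    also have "(\<Sum>\<^sub>\<infinity>v\<in>\<dots>. f (a + v)) = (\<Sum>\<^sub>\<infinity>y\<in>{y. \<forall>i. y $ i \<in> \<bb>}. f (a + vec\<iota> y))"
      by (subst infsum_reindex[OF inj_on_subset[OF inj_vec\<iota>]]) (auto simp: o_def)
    finally show ?thesis .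
  qed
  ultimately show "((\<lambda>m. unit_char (vec_pair m a) * ideal_fourier f m)
      has_sum ?K * (\<Sum>\<^sub>\<infinity>y\<in>{y. \<forall>i. y $ i \<in> \<bb>}. f (a + vec\<iota> y))) ?D"
    by (simp only: fourier)
qed

end

section \<open>Smooth functions attached to the polynomial\<close>

lemma Ck_on_linear: "bounded_linear L \<Longrightarrow> Ck_on k L S"
  by (cases k) (auto intro: linear_continuous_on Ck_on_const bounded_linear_imp_has_derivative intro!: exI[of _ "\<lambda>_. L"])

lemma bounded_linear_vec_nth': "bounded_linear L \<Longrightarrow> bounded_linear (\<lambda>x. L (x $ i))"
  by (rule bounded_linear_compose[OF _ bounded_linear_vec_nth])

lemma finite_vectors: "finite R \<Longrightarrow> finite {a :: 'a ^ 'n::finite. \<forall>i. a $ i \<in> R}"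
proof -
  assume R: "finite R"
  have "{a :: 'a ^ 'n. \<forall>i. a $ i \<in> R} \<subseteq> vec_lambda ` (UNIV \<rightarrow>\<^sub>E R)"
  proof
    fix a :: "'a ^ 'n" assume "a \<in> {a. \<forall>i. a $ i \<in> R}"
    then have "vec_nth a \<in> UNIV \<rightarrow>\<^sub>E R" by auto
    then show "a \<in> vec_lambda ` (UNIV \<rightarrow>\<^sub>E R)" by (intro image_eqI[of _ _ "vec_nth a"]) (simp add: vec_nth_inverse)
  qed
  moreover have "finite ((UNIV :: 'n set) \<rightarrow>\<^sub>E R)" by (intro finite_PiE) (use R in auto)
  ultimately show ?thesis by (rule finite_subset[OF _ finite_imageI])
qed

context places
begin

definition Nm_F :: "(('n::finite \<Rightarrow>\<^sub>0 nat) \<Rightarrow>\<^sub>0 'k) \<Rightarrow> 'v ^ 'n \<Rightarrow> real" where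
  "Nm_F F x = Nm_V r1 r2 (\<lambda>l. mpoly_eval (s l) F (\<lambda>i. crd (x $ i) l))"

text \<open>Squared moduli are sums of squares of real and imaginary parts, so the norm is
  polynomial in the coordinates and smooth also where a complex coordinate vanishes.\<close>

lemma Ck_on_Nm_F: "Ck_on k (Nm_F F) S"
proof -
  have p: "Ck_on k (\<lambda>x. mpoly_eval (s l) F (\<lambda>i. crd (x $ i) l)) S" if "l < r1 + r2" for l
  proof -
    have "bounded_linear (\<lambda>v. crd v l)" by (rule linear_linear[THEN iffD2, OF crd_linear[OF that]])
    then have "bounded_linear (\<lambda>x::'v ^ 'n. crd (x $ i) l)" for i by (rule bounded_linear_vec_nth')
    then show ?thesis unfolding mpoly_eval_def
      by (intro Ck_on_sum Ck_on_mult Ck_on_const Ck_on_prod Ck_on_power Ck_on_linear)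
  qed
  show ?thesis
    unfolding Nm_F_def[abs_def] Nm_V_def cmod_power2
    by (intro Ck_on_mult Ck_on_prod Ck_on_add Ck_on_power Ck_on_bounded_linear[OF bounded_linear_Re]
        Ck_on_bounded_linear[OF bounded_linear_Im] p) auto
qed

text \<open>\<open>u\<close> stands for \<open>h\<close> with its first argument frozen by an ideal,
  and \<open>q\<close> for the power of Q in the second argument.\<close>

definition weight :: "('v ^ 'n::finite \<Rightarrow> real) \<Rightarrow> (real \<Rightarrow> real) \<Rightarrow> (('n \<Rightarrow>\<^sub>0 nat) \<Rightarrow>\<^sub>0 'k) \<Rightarrow> real \<Rightarrow> real \<Rightarrow> 'v ^ 'n \<Rightarrow> real" where
  "weight W u F P q x = W (x /\<^sub>R P) * u (Nm_F F x / q)"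

lemma scaled_support:
  assumes "compact (closure {x :: 'v ^ 'n::finite. W x \<noteq> (0::real)})" "P \<ge> 1"
  obtains R where "R > 0" "\<And>x. W (x /\<^sub>R P) \<noteq> 0 \<Longrightarrow> norm x \<le> R"
proof -
  have "bounded {x. W x \<noteq> 0}" using assms(1) by (metis bounded_closure_image bounded_subset closure_subset compact_imp_bounded)
  then obtain R where R: "R > 0" "\<And>x. W x \<noteq> 0 \<Longrightarrow> norm x \<le> R" unfolding bounded_pos by blast
  have "norm x \<le> P * R" if "W (x /\<^sub>R P) \<noteq> 0" for x
  proof -
    have "norm (x /\<^sub>R P) = norm x / P" using assms(2) by (simp add: divide_inverse mult.commute)
    then show ?thesis using R(2)[OF that] assms(2) by (simp add: pos_divide_le_eq mult.commute)
  qed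
  moreover have "P * R > 0" using R(1) assms(2) by simp
  ultimately show thesis by (intro that)
qed

lemma test_fun_weight:
  assumes W: "smooth_on W UNIV" and supp: "compact (closure {x. W x \<noteq> 0})" and P: "P \<ge> 1"
    and u: "\<And>k. Ck_on k u UNIV"
  shows "test_fun (\<lambda>x. complex_of_real (weight W u F P q x))"
proof -
  obtain R where R: "R > 0" "\<And>x. W (x /\<^sub>R P) \<noteq> 0 \<Longrightarrow> norm x \<le> R" by (rule scaled_support[OF supp P]) (rule that)
  have "bounded {x. complex_of_real (weight W u F P q x) \<noteq> 0}"
    unfolding bounded_iff using R(2) by (intro exI[of _ R]) (auto simp: weight_def)
  moreover have "Ck_on k (\<lambda>x. complex_of_real (weight W u F P q x)) UNIV" for k
  proof -
    have WP: "Ck_on k (\<lambda>x. W (0 + x /\<^sub>R P)) UNIV"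
      by (rule Ck_on_compose_affine[OF bounded_linear_scaleR_right, of _ _ UNIV]) (use W in \<open>auto simp: smooth_on_def\<close>)
    have "Ck_on k (\<lambda>x. Nm_F F x / q) UNIV"
      by (rule Ck_on_bounded_linear[OF bounded_linear_divide]) (rule Ck_on_Nm_F)
    then have "Ck_on k (\<lambda>x. weight W u F P q x) UNIV"
      unfolding weight_def using Ck_on_mult[OF WP Ck_on_compose_real[OF u]] by simp
    then show ?thesis by (rule Ck_on_bounded_linear[OF bounded_linear_of_real])
  qed
  ultimately show ?thesis by (simp add: test_fun_def smooth_on_def)
qed

section \<open>The exponential sums and integrals in terms of the trace pairing\<close>

lemma e_V_unit_char: "e_V r1 r2 w = unit_char (tr_V r1 r2 w)"
  by (simp add: e_V_def unit_char_def cis_conv_exp mult_ac)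

lemma vec_pair_vec\<iota>:
  "vec_pair m (vec\<iota> a) = tr_V r1 r2 (\<lambda>l. s l (\<Sum>i\<in>UNIV. m $ i * a $ i))"
proof -
  have "complex_of_real (vec_pair m (vec\<iota> a)) = (\<Sum>i\<in>UNIV. trace_K (m $ i * a $ i))"
    by (simp add: vec_pair_def tr_pair_\<iota>)
  also have "\<dots> = trace_K (\<Sum>i\<in>UNIV. m $ i * a $ i)"
    by (rule additive_sum'[OF trace_K_add, symmetric])
  also have "\<dots> = of_real (tr_V r1 r2 (\<lambda>l. s l (\<Sum>i\<in>UNIV. m $ i * a $ i)))" by (rule trace_K_places)
  finally show ?thesis by (simp only: of_real_eq_iff)
qed

lemma vec_pair_tr_V:
  "- vec_pair m x = tr_V r1 r2 (\<lambda>l. - (\<Sum>i\<in>UNIV. s l (m $ i) * crd (x $ i) l))"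
proof -
  have "vec_pair m x = (\<Sum>l<r1. \<Sum>i\<in>UNIV. Re (s l (m $ i) * crd (x $ i) l))
    + (\<Sum>l=r1..<r1 + r2. \<Sum>i\<in>UNIV. 2 * Re (s l (m $ i) * crd (x $ i) l))"
    unfolding vec_pair_def tr_pair_def tr_V_def sum.distrib
    by (intro arg_cong2[where f = "(+)"] sum.swap)
  then show ?thesis
    by (simp only: tr_V_def uminus_complex.sel Re_sum mult_minus_right sum_negf sum_distrib_left minus_add_distrib)
qed

lemma exp_integral_eq:
  "exp_integral r1 r2 s crd W F h P Q \<bb> m
    = ideal_fourier (\<lambda>x. complex_of_real (weight W (h (ideal_norm \<bb> / Q ^ nf_degree TYPE('k))) F P (Q ^ (2 * nf_degree TYPE('k))) x)) m"
  unfolding exp_integral_def ideal_fourier_def weight_def Nm_F_def vec_pair_tr_V e_V_unit_char ..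

lemma exp_sum_eq:
  "exp_sum r1 r2 s F \<bb> m = (\<Sum>\<sigma>\<in>primitive_chars \<bb>. \<Sum>a\<in>{a. \<forall>i. a $ i \<in> residue_reps \<bb>}.
     \<sigma> (mpoly_eval id F (vec_nth a)) * unit_char (vec_pair m (vec\<iota> a)))"
  unfolding exp_sum_def vec_pair_vec\<iota> e_V_unit_char ..

lemma embedding_mpoly_eval:
  assumes \<tau>: "\<tau> \<in> embeddings"
  shows "\<tau> (mpoly_eval id F x) = mpoly_eval \<tau> F (\<lambda>i. \<tau> (x i))"
proof -
  have pow: "\<tau> (y ^ n) = \<tau> y ^ n" for y n by (induction n) (simp_all add: embedding_1[OF \<tau>] embedding_mult[OF \<tau>])
  have prod: "\<tau> (\<Prod>i\<in>I. g i) = (\<Prod>i\<in>I. \<tau> (g i))" for g and I :: "'b set"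
    by (induction I rule: infinite_finite_induct) (simp_all add: embedding_1[OF \<tau>] embedding_mult[OF \<tau>])
  show ?thesis
    unfolding mpoly_eval_def additive_sum'[of \<tau>, OF embedding_add[OF \<tau>]]
    by (simp add: embedding_mult[OF \<tau>] prod pow)
qed

lemma Nm_F_vec\<iota>: "Nm_F F (vec\<iota> x) = Nm_V r1 r2 (\<lambda>l. s l (mpoly_eval id F (vec_nth x)))"
  unfolding Nm_F_def Nm_V_def
  by (intro arg_cong2[where f = "(*)"] prod.cong refl) (simp_all add: crd_\<iota> embedding_mpoly_eval[OF s_embedding])

end

section \<open>Reduction modulo an ideal\<close>

lemma algebraic_int_mpoly_eval:
  fixes F :: "('n::finite \<Rightarrow>\<^sub>0 nat) \<Rightarrow>\<^sub>0 'k::number_field"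
  assumes F: "\<And>t. algebraic_int (poly_mapping.lookup F t)" and x: "\<And>i. algebraic_int (x i)"
  shows "algebraic_int (mpoly_eval id F x)"
  unfolding mpoly_eval_def id_apply
  by (intro algebraic_int_sum algebraic_int_times algebraic_int_prod algebraic_int_pow F x)

text \<open>Congruence is carried together with integrality of both sides, since only this
  combination is closed under products: ac - bd = c(a - b) + b(c - d).\<close>

lemma mpoly_eval_cong_ideal:
  fixes F :: "('n::finite \<Rightarrow>\<^sub>0 nat) \<Rightarrow>\<^sub>0 'k::number_field"
  assumes \<bb>: "\<bb> \<in> nonzero_ideals" and F: "\<And>t. algebraic_int (poly_mapping.lookup F t)"
    and x: "\<And>i. algebraic_int (x i)" and y: "\<And>i. algebraic_int (y i)" and xy: "\<And>i. x i - y i \<in> \<bb>"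
  shows "mpoly_eval id F x - mpoly_eval id F y \<in> \<bb>"
proof -
  note p = nonzero_ideal_props[OF \<bb>]
  have mult: "algebraic_int (a * c) \<and> algebraic_int (b * d) \<and> a * c - b * d \<in> \<bb>"
    if "algebraic_int a \<and> algebraic_int b \<and> a - b \<in> \<bb>" "algebraic_int c \<and> algebraic_int d \<and> c - d \<in> \<bb>" for a b c d
  proof -
    have "a * c - b * d = c * (a - b) + b * (c - d)" by (simp add: algebra_simps)
    moreover have "c * (a - b) + b * (c - d) \<in> \<bb>" using that by (intro zlattice_add[OF p(2)] p(3)) auto
    ultimately show ?thesis using that by (auto intro: algebraic_int_times)
  qed
  have one: "algebraic_int (1::'k) \<and> algebraic_int (1::'k) \<and> (1::'k) - 1 \<in> \<bb>" using zlattice_0[OF p(2)] by simp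
  have pow: "algebraic_int (x i ^ n) \<and> algebraic_int (y i ^ n) \<and> x i ^ n - y i ^ n \<in> \<bb>" for i n
  proof (induction n)
    case (Suc n)
    have "algebraic_int (x i) \<and> algebraic_int (y i) \<and> x i - y i \<in> \<bb>" using x y xy by blast
    from mult[OF this Suc] show ?case by simp
  qed (use one in simp)
  have prod: "algebraic_int (\<Prod>i\<in>I. x i ^ e i) \<and> algebraic_int (\<Prod>i\<in>I. y i ^ e i) \<and> (\<Prod>i\<in>I. x i ^ e i) - (\<Prod>i\<in>I. y i ^ e i) \<in> \<bb>" for e I
  proof (induction I rule: infinite_finite_induct)
    case (insert i I)
    from mult[OF pow insert(3), of i "e i"] show ?case by (simp only: prod.insert[OF insert(1,2)])
  qed (use one in simp_all)
  show ?thesis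
    unfolding mpoly_eval_def id_apply sum_subtractf[symmetric] right_diff_distrib[symmetric]
    by (intro zlattice_sum[OF p(2)] p(3) F) (use prod in blast)
qed

text \<open>Every integral point lies in exactly one class with a chosen representative, so the
  double sum meets each point of \<open>X\<close> once.\<close>

lemma sum_over_residue_classes:
  fixes g :: "'k::number_field ^ 'n::finite \<Rightarrow> complex"
  assumes \<bb>: "\<bb> \<in> nonzero_ideals" and X: "finite X" "\<And>x i. x \<in> X \<Longrightarrow> algebraic_int (x $ i)"
    and g: "\<And>x. x \<notin> X \<Longrightarrow> (\<forall>i. algebraic_int (x $ i)) \<Longrightarrow> g x = 0"
  shows "(\<Sum>a\<in>{a. \<forall>i. a $ i \<in> residue_reps \<bb>}. \<Sum>\<^sub>\<infinity>y\<in>{y. \<forall>i. y $ i \<in> \<bb>}. g (a + y)) = (\<Sum>x\<in>X. g x)"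
proof -
  let ?R = "{a :: 'k ^ 'n. \<forall>i. a $ i \<in> residue_reps \<bb>}"
  let ?B = "{y :: 'k ^ 'n. \<forall>i. y $ i \<in> \<bb>}"
  let ?c = "\<lambda>a x :: 'k ^ 'n. \<forall>i. x $ i - a $ i \<in> \<bb>"
  have fin: "finite ?R" by (intro finite_vectors finite_residue_reps \<bb>)
  have "(\<Sum>\<^sub>\<infinity>y\<in>?B. g (a + y)) = (\<Sum>x\<in>X. if ?c a x then g x else 0)" if a: "a \<in> ?R" for a
  proof -
    have aI: "algebraic_int (a $ i)" for i using a residue_reps_integral[OF \<bb>] by blast
    have "(\<Sum>\<^sub>\<infinity>y\<in>?B. g (a + y)) = (\<Sum>\<^sub>\<infinity>x\<in>(+) a ` ?B. g x)"
      by (subst infsum_reindex) (auto simp: o_def inj_on_def)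
    also have "(+) a ` ?B = {x. ?c a x}"
    proof (intro equalityI subsetI)
      fix x assume "x \<in> {x. ?c a x}"
      then have "x - a \<in> ?B" by simp
      then show "x \<in> (+) a ` ?B" by (intro image_eqI[of _ _ "x - a"]) auto
    qed auto
    also have "(\<Sum>\<^sub>\<infinity>x\<in>{x. ?c a x}. g x) = (\<Sum>\<^sub>\<infinity>x\<in>X \<inter> {x. ?c a x}. g x)"
    proof (rule infsum_cong_neutral)
      fix x assume x: "x \<in> {x. ?c a x} - X \<inter> {x. ?c a x}"
      have "algebraic_int (x $ i)" for i
      proof -
        have "algebraic_int (x $ i - a $ i)" using x nonzero_ideal_props(1)[OF \<bb>] by blast
        from algebraic_int_add[OF this aI[of i]] show ?thesis by simp
      qed
      with g[of x] x show "g x = 0" by blast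
    qed auto
    also have "\<dots> = (\<Sum>x\<in>X \<inter> {x. ?c a x}. g x)" using X(1) by (intro infsum_finite) simp
    also have "\<dots> = (\<Sum>x\<in>X. if ?c a x then g x else 0)"
      by (simp only: sum.inter_restrict[OF X(1)] mem_Collect_eq)
    finally show ?thesis .
  qed
  then have "(\<Sum>a\<in>?R. \<Sum>\<^sub>\<infinity>y\<in>?B. g (a + y)) = (\<Sum>a\<in>?R. \<Sum>x\<in>X. if ?c a x then g x else 0)"
    by (rule sum.cong[OF refl])
  also have "\<dots> = (\<Sum>x\<in>X. \<Sum>a\<in>?R. if ?c a x then g x else 0)" by (rule sum.swap)
  also have "\<dots> = (\<Sum>x\<in>X. g x)"
  proof (rule sum.cong[OF refl])
    fix x assume x: "x \<in> X"
    have "\<forall>i. \<exists>a. a \<in> residue_reps \<bb> \<and> x $ i - a \<in> \<bb>"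
      using residue_reps_ex1[OF \<bb> X(2)[OF x]] by blast
    from choice[OF this] obtain f where f: "\<And>i. f i \<in> residue_reps \<bb> \<and> x $ i - f i \<in> \<bb>" by blast
    \<comment> \<open>The representative vector is unique because each of its entries is.\<close>
    have "(a \<in> ?R \<and> ?c a x) \<longleftrightarrow> a = (\<chi> i. f i)" for a
    proof
      assume a: "a \<in> ?R \<and> ?c a x"
      have "a $ i = f i" for i
        using a f[of i] residue_reps_ex1[OF \<bb> X(2)[OF x, of i]] by blast
      then show "a = (\<chi> i. f i)" by (simp add: Finite_Cartesian_Product.vec_eq_iff)
    qed (use f in auto)
    then have "{a \<in> ?R. ?c a x} = {\<chi> i. f i}" by blast
    moreover have "(\<Sum>a\<in>?R. if ?c a x then g x else 0) = (\<Sum>a\<in>{a \<in> ?R. ?c a x}. g x)"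
      by (rule sum.inter_filter[OF fin, symmetric])
    ultimately show "(\<Sum>a\<in>?R. if ?c a x then g x else 0) = g x" by (simp only:) simp
  qed
  finally show ?thesis .
qed

section \<open>The counting function\<close>

text \<open>For an infinite index set both finite sums are 0 by convention, so the rule applies to
  the sum over primitive characters as it stands.\<close>

lemma has_sum_swap_sum:
  fixes f :: "'i \<Rightarrow> 'a \<Rightarrow> complex"
  shows "(\<And>i. i \<in> I \<Longrightarrow> (f i has_sum S i) A) \<Longrightarrow> ((\<lambda>x. \<Sum>i\<in>I. f i x) has_sum (\<Sum>i\<in>I. S i)) A"
  by (induction I rule: infinite_finite_induct) (simp_all add: has_sum_add)

context places
begin

definition covol :: real where "covol = sqrt (abs_discriminant TYPE('k)) / 2 ^ r2"

lemma abs_discriminant_pos: "abs_discriminant TYPE('k) > 0"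
proof -
  obtain \<omega> :: "nat \<Rightarrow> 'k" where "\<bar>Determinant.det (coord_mat \<omega>)\<bar> = sqrt (abs_discriminant TYPE('k)) / 2 ^ r2"
    "Determinant.det (coord_mat \<omega>) \<noteq> 0"
    by (rule covolume) (rule that)
  then have "sqrt (abs_discriminant TYPE('k)) / 2 ^ r2 > 0" by (metis zero_less_abs_iff)
  then show ?thesis by (simp add: zero_less_divide_iff)
qed

text \<open>The lattice map is bounded below, so a bounded part of the lattice comes from a bounded
  set of integer vectors.\<close>

lemma finite_lattice_points:
  "finite {x :: 'k ^ 'n::finite. (\<forall>i. algebraic_int (x $ i)) \<and> norm (vec\<iota> x) \<le> R}"
proof -
  obtain \<omega> :: "nat \<Rightarrow> 'k" where \<omega>: "int_basis \<omega> {x. algebraic_int x}" "Determinant.det (coord_mat \<omega>) \<noteq> 0"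
    by (rule covolume) (rule that)
  obtain b where b: "bij_betw b {..<r1 + 2 * r2} (Basis :: 'v set)"
    using ex_bij_betw_nat_finite[of "Basis :: 'v set"] by (auto simp: dim_V atLeast0LessThan)
  define L where "L = (\<lambda>x::'v ^ 'n. \<chi> i. lat b \<omega> (x $ i))"
  have linL: "linear L"
    by (rule linearI) (simp_all add: L_def Finite_Cartesian_Product.vec_eq_iff linear_add[OF linear_lat] linear_cmul[OF linear_lat])
  have injL: "inj L"
    by (rule injI) (auto simp: L_def Finite_Cartesian_Product.vec_eq_iff dest: injD[OF inj_lat[OF b \<omega>(2)]])
  obtain B where B: "B > 0" "\<And>x. B * norm x \<le> norm (L x)" using linear_inj_bounded_below_pos[OF linL injL] by metis
  have image: "L ` int_points = (\<lambda>y. vec\<iota> y) ` {y. \<forall>i. y $ i \<in> {x. algebraic_int x}}"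
    unfolding L_def by (rule lat_int_points[OF b \<omega>(1) zlattice_integers])
  have "bounded {k. norm (L k) \<le> R}"
    unfolding bounded_iff
  proof (intro exI[of _ "R / B"] ballI)
    fix k assume "k \<in> {k. norm (L k) \<le> R}"
    then have "norm k * B \<le> R" using B(2)[of k] by (simp add: mult.commute)
    then show "norm k \<le> R / B" using B(1) by (simp add: pos_le_divide_eq)
  qed
  then have "finite ({k. norm (L k) \<le> R} \<inter> int_points)" by (rule bounded_int_points_finite)
  then have "finite (L ` ({k. norm (L k) \<le> R} \<inter> int_points))" by (rule finite_imageI)
  moreover have "(\<lambda>y. vec\<iota> y) ` {x. (\<forall>i. algebraic_int (x $ i)) \<and> norm (vec\<iota> x) \<le> R} \<subseteq> L ` ({k. norm (L k) \<le> R} \<inter> int_points)"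
  proof
    fix v assume "v \<in> (\<lambda>y::'k ^ 'n. vec\<iota> y) ` {x. (\<forall>i. algebraic_int (x $ i)) \<and> norm (vec\<iota> x) \<le> R}"
    then have v: "v \<in> (\<lambda>y. vec\<iota> y) ` {y. \<forall>i. y $ i \<in> {x. algebraic_int x}}" "norm v \<le> R" by auto
    then show "v \<in> L ` ({k. norm (L k) \<le> R} \<inter> int_points)" unfolding image[symmetric] by blast
  qed
  ultimately have "finite ((\<lambda>y::'k ^ 'n. vec\<iota> y) ` {x. (\<forall>i. algebraic_int (x $ i)) \<and> norm (vec\<iota> x) \<le> R})"
    by (rule finite_subset[rotated])
  then show ?thesis by (rule finite_imageD) (rule inj_on_subset[OF inj_vec\<iota> subset_UNIV])
qed

text \<open>Poisson summation is applied in each class a, weighted with the character values and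
  summed over a; the characters at a assemble into the exponential sum. As \<sigma>(F(x)) is
  constant on classes, the lattice sums recombine into one sum over \<open>X\<close>.\<close>

theorem ideal_term:
  fixes F :: "('n::finite \<Rightarrow>\<^sub>0 nat) \<Rightarrow>\<^sub>0 'k"
  assumes \<bb>: "\<bb> \<in> nonzero_ideals" and F: "\<And>t. algebraic_int (poly_mapping.lookup F t)" and f: "test_fun f"
    and X: "finite X" "\<And>x i. x \<in> X \<Longrightarrow> algebraic_int (x $ i)"
    and supp: "\<And>x. x \<notin> X \<Longrightarrow> (\<forall>i. algebraic_int (x $ i)) \<Longrightarrow> f (vec\<iota> x) = 0"
  shows "(\<lambda>m. cmod (inverse (real (ideal_norm \<bb>) ^ CARD('n)) * exp_sum r1 r2 s F \<bb> m * ideal_fourier f m))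
      summable_on {m. \<forall>i. m $ i \<in> dual_ideal \<bb>}"
    and "((\<lambda>m. inverse (real (ideal_norm \<bb>) ^ CARD('n)) * exp_sum r1 r2 s F \<bb> m * ideal_fourier f m)
      has_sum of_real (covol ^ CARD('n)) * (\<Sum>x\<in>X. \<Sum>\<sigma>\<in>primitive_chars \<bb>. \<sigma> (mpoly_eval id F (vec_nth x)) * f (vec\<iota> x)))
      {m. \<forall>i. m $ i \<in> dual_ideal \<bb>}"
proof -
  let ?D = "{m :: 'k ^ 'n. \<forall>i. m $ i \<in> dual_ideal \<bb>}"
  let ?R = "{a :: 'k ^ 'n. \<forall>i. a $ i \<in> residue_reps \<bb>}"
  let ?B = "{y :: 'k ^ 'n. \<forall>i. y $ i \<in> \<bb>}"
  let ?F = "\<lambda>x. mpoly_eval id F (vec_nth x)"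
  let ?N = "complex_of_real (inverse (real (ideal_norm \<bb>) ^ CARD('n)))"
  let ?K = "complex_of_real (density_factor \<bb> ^ CARD('n))"
  note poisson = ideal_poisson[OF \<bb> f]
  have N: "ideal_norm \<bb> > 0" by (rule ideal_norm_pos[OF \<bb>])
  \<comment> \<open>The frequency m enters the exponential sum only through factors of modulus 1, so
    this bound is independent of m.\<close>
  define M where "M = (\<Sum>\<sigma>\<in>primitive_chars \<bb>. \<Sum>a\<in>?R. cmod (\<sigma> (?F a)))"
  have M: "cmod (exp_sum r1 r2 s F \<bb> m) \<le> M" for m
    unfolding exp_sum_eq M_def
    by (intro order_trans[OF norm_sum] sum_mono) (simp add: norm_mult)
  show "(\<lambda>m. cmod (?N * exp_sum r1 r2 s F \<bb> m * ideal_fourier f m)) summable_on ?D"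
  proof (rule summable_on_comparison_test[where f = "\<lambda>m. cmod ?N * M * cmod (ideal_fourier f m)"])
    show "(\<lambda>m. cmod ?N * M * cmod (ideal_fourier f m)) summable_on ?D"
      by (rule summable_on_cmult_right[OF poisson(1)])
    show "cmod (?N * exp_sum r1 r2 s F \<bb> m * ideal_fourier f m) \<le> cmod ?N * M * cmod (ideal_fourier f m)" for m
      unfolding norm_mult by (intro mult_right_mono mult_left_mono M norm_ge_zero)
  qed simp
  have res: "(\<Sum>a\<in>?R. \<sigma> (?F a) * (\<Sum>\<^sub>\<infinity>y\<in>?B. f (vec\<iota> a + vec\<iota> y))) = (\<Sum>x\<in>X. \<sigma> (?F x) * f (vec\<iota> x))"
    if \<sigma>: "\<sigma> \<in> primitive_chars \<bb>" for \<sigma>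
  proof -
    have cong: "\<sigma> (?F (a + y)) = \<sigma> (?F a)" if a: "a \<in> ?R" and y: "y \<in> ?B" for a y
    proof -
      have aI: "algebraic_int (a $ i)" for i using a residue_reps_integral[OF \<bb>] by blast
      have yI: "algebraic_int (y $ i)" for i using y nonzero_ideal_props(1)[OF \<bb>] by blast
      have ayI: "algebraic_int ((a + y) $ i)" for i unfolding vector_add_component by (intro algebraic_int_add aI yI)
      have "?F (a + y) - ?F a \<in> \<bb>"
        by (rule mpoly_eval_cong_ideal[OF \<bb> F ayI aI]) (use y in simp)
      moreover have "algebraic_int (?F (a + y))" "algebraic_int (?F a)"
        by (rule algebraic_int_mpoly_eval[OF F ayI], rule algebraic_int_mpoly_eval[OF F aI])
      ultimately show ?thesis
        using \<sigma> by (simp add: primitive_chars_def add_chars_def ring_of_integers_def)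
    qed
    have "(\<Sum>a\<in>?R. \<sigma> (?F a) * (\<Sum>\<^sub>\<infinity>y\<in>?B. f (vec\<iota> a + vec\<iota> y)))
      = (\<Sum>a\<in>?R. \<Sum>\<^sub>\<infinity>y\<in>?B. \<sigma> (?F (a + y)) * f (vec\<iota> (a + y)))"
    proof (rule sum.cong[OF refl])
      fix a assume a: "a \<in> ?R"
      have "\<sigma> (?F a) * (\<Sum>\<^sub>\<infinity>y\<in>?B. f (vec\<iota> a + vec\<iota> y)) = (\<Sum>\<^sub>\<infinity>y\<in>?B. \<sigma> (?F a) * f (vec\<iota> a + vec\<iota> y))"
        by (rule infsum_cmult_right'[symmetric])
      also have "\<dots> = (\<Sum>\<^sub>\<infinity>y\<in>?B. \<sigma> (?F (a + y)) * f (vec\<iota> (a + y)))"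
      proof (rule infsum_cong)
        fix y assume "y \<in> ?B"
        then show "\<sigma> (?F a) * f (vec\<iota> a + vec\<iota> y) = \<sigma> (?F (a + y)) * f (vec\<iota> (a + y))"
          by (simp only: cong[OF a] vec\<iota>_add)
      qed
      finally show "\<sigma> (?F a) * (\<Sum>\<^sub>\<infinity>y\<in>?B. f (vec\<iota> a + vec\<iota> y)) = (\<Sum>\<^sub>\<infinity>y\<in>?B. \<sigma> (?F (a + y)) * f (vec\<iota> (a + y)))" .
    qed
    also have "\<dots> = (\<Sum>x\<in>X. \<sigma> (?F x) * f (vec\<iota> x))"
      by (rule sum_over_residue_classes[OF \<bb> X, where g = "\<lambda>x. \<sigma> (?F x) * f (vec\<iota> x)"]) (simp_all add: supp)
    finally show ?thesis .
  qed
  have "((\<lambda>m. \<Sum>\<sigma>\<in>primitive_chars \<bb>. \<Sum>a\<in>?R. \<sigma> (?F a) * (unit_char (vec_pair m (vec\<iota> a)) * ideal_fourier f m))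
    has_sum (\<Sum>\<sigma>\<in>primitive_chars \<bb>. \<Sum>a\<in>?R. \<sigma> (?F a) * (?K * (\<Sum>\<^sub>\<infinity>y\<in>?B. f (vec\<iota> a + vec\<iota> y))))) ?D"
    by (intro has_sum_swap_sum has_sum_cmult_right poisson(2))
  moreover have "(\<Sum>\<sigma>\<in>primitive_chars \<bb>. \<Sum>a\<in>?R. \<sigma> (?F a) * (?K * (\<Sum>\<^sub>\<infinity>y\<in>?B. f (vec\<iota> a + vec\<iota> y))))
    = ?K * (\<Sum>\<sigma>\<in>primitive_chars \<bb>. \<Sum>x\<in>X. \<sigma> (?F x) * f (vec\<iota> x))"
  proof -
    have "(\<Sum>a\<in>?R. \<sigma> (?F a) * (?K * (\<Sum>\<^sub>\<infinity>y\<in>?B. f (vec\<iota> a + vec\<iota> y)))) = ?K * (\<Sum>x\<in>X. \<sigma> (?F x) * f (vec\<iota> x))"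
      if "\<sigma> \<in> primitive_chars \<bb>" for \<sigma>
      unfolding res[OF that, symmetric] sum_distrib_left by (simp only: mult.left_commute)
    then show ?thesis unfolding sum_distrib_left[of ?K "\<lambda>\<sigma>. \<Sum>x\<in>X. \<sigma> (?F x) * f (vec\<iota> x)"] by (intro sum.cong refl)
  qed
  moreover have "(\<Sum>\<sigma>\<in>primitive_chars \<bb>. \<Sum>a\<in>?R. \<sigma> (?F a) * (unit_char (vec_pair m (vec\<iota> a)) * ideal_fourier f m))
    = exp_sum r1 r2 s F \<bb> m * ideal_fourier f m" for m
    unfolding exp_sum_eq sum_distrib_right by (simp only: mult.assoc)
  ultimately have "((\<lambda>m. exp_sum r1 r2 s F \<bb> m * ideal_fourier f m) has_sum ?K * (\<Sum>\<sigma>\<in>primitive_chars \<bb>. \<Sum>x\<in>X. \<sigma> (?F x) * f (vec\<iota> x))) ?D"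
    by (simp only:)
  then have "((\<lambda>m. ?N * (exp_sum r1 r2 s F \<bb> m * ideal_fourier f m)) has_sum ?N * (?K * (\<Sum>\<sigma>\<in>primitive_chars \<bb>. \<Sum>x\<in>X. \<sigma> (?F x) * f (vec\<iota> x)))) ?D"
    by (rule has_sum_cmult_right)
  \<comment> \<open>The covolume of the ideal is its norm times that of the ring of integers; the
    n-th power of the norm cancels.\<close>
  moreover have "?N * ?K = of_real (covol ^ CARD('n))"
  proof -
    have "density_factor \<bb> = real (ideal_norm \<bb>) * covol" by (simp add: density_factor_def covol_def)
    then have "inverse (real (ideal_norm \<bb>) ^ CARD('n)) * density_factor \<bb> ^ CARD('n) = covol ^ CARD('n)"
      using N by (simp add: power_mult_distrib)
    then show ?thesis by (simp only: of_real_mult[symmetric])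
  qed
  moreover have "(\<Sum>\<sigma>\<in>primitive_chars \<bb>. \<Sum>x\<in>X. \<sigma> (?F x) * f (vec\<iota> x)) = (\<Sum>x\<in>X. \<Sum>\<sigma>\<in>primitive_chars \<bb>. \<sigma> (?F x) * f (vec\<iota> x))"
    by (rule sum.swap)
  ultimately show "((\<lambda>m. ?N * exp_sum r1 r2 s F \<bb> m * ideal_fourier f m)
      has_sum of_real (covol ^ CARD('n)) * (\<Sum>x\<in>X. \<Sum>\<sigma>\<in>primitive_chars \<bb>. \<sigma> (?F x) * f (vec\<iota> x))) ?D"
    by (simp only: mult.assoc[symmetric])
qed

text \<open>On the support of the scaled weight the norm form is bounded by compactness, so the
  support condition on \<open>h\<close> bounds its first argument and hence the ideal norm.\<close>

lemma weight_vanishes: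
  assumes supp: "compact (closure {x :: 'v ^ 'n::finite. W x \<noteq> 0})" and P: "P \<ge> 1" and Q: "Q > 0" and q: "q > 0"
    and h: "\<And>x y. x > 0 \<Longrightarrow> h x y \<noteq> 0 \<Longrightarrow> x \<le> max 1 (2 * \<bar>y\<bar> :: real)"
  obtains M :: nat where "\<And>N x. N > M \<Longrightarrow> weight W (h (real N / Q)) F P q x = 0"
proof -
  obtain R where R: "R > 0" "\<And>x. W (x /\<^sub>R P) \<noteq> 0 \<Longrightarrow> norm x \<le> R" by (rule scaled_support[OF supp P]) (rule that)
  have "continuous_on (cball 0 R) (Nm_F F)" using Ck_on_Nm_F[of 0 F "cball 0 R"] by simp
  then have "compact (Nm_F F ` cball 0 R)" by (rule compact_continuous_image) (rule compact_cbox compact_cball)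
  then have "bounded (Nm_F F ` cball 0 R)" by (rule compact_imp_bounded)
  then obtain B where "\<And>y. y \<in> Nm_F F ` cball 0 R \<Longrightarrow> \<bar>y\<bar> \<le> B" by (auto simp: bounded_iff)
  then have B: "\<And>x. norm x \<le> R \<Longrightarrow> \<bar>Nm_F F x\<bar> \<le> B" by simp
  have "weight W (h (real N / Q)) F P q x = 0" if N: "N > nat \<lceil>Q * max 1 (2 * (B / q))\<rceil>" for N x
  proof (rule ccontr)
    assume "\<not> ?thesis"
    then have nz: "W (x /\<^sub>R P) \<noteq> 0" "h (real N / Q) (Nm_F F x / q) \<noteq> 0" by (auto simp: weight_def)
    have "\<bar>Nm_F F x / q\<bar> \<le> B / q" using B[OF R(2)[OF nz(1)]] q by (simp add: divide_right_mono)
    then have "max 1 (2 * \<bar>Nm_F F x / q\<bar>) \<le> max 1 (2 * (B / q))" by linarith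
    moreover have "real N / Q > 0" using N Q by simp
    ultimately have "real N / Q \<le> max 1 (2 * (B / q))" using h[OF _ nz(2)] by linarith
    then have "real N \<le> Q * max 1 (2 * (B / q))" using Q by (simp only: pos_divide_le_eq mult.commute)
    then show False using N by linarith
  qed
  then show thesis by (rule that)
qed

end

text \<open>An infinite sum without summability is 0 by convention; the first conjunct excludes this
  reading. Summability over pairs is unconditional, so the order of the double sum is
  immaterial.\<close>

theorem theorem5p1:
  fixes r1 r2 :: nat
    and s :: "nat \<Rightarrow> 'k::number_field \<Rightarrow> complex"
    and crd :: "'v::euclidean_space \<Rightarrow> nat \<Rightarrow> complex"
    and F :: "('n::finite \<Rightarrow>\<^sub>0 nat) \<Rightarrow>\<^sub>0 'k"
    and W :: "'v ^ 'n \<Rightarrow> real"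
    and P Q :: real
    and c :: "real \<Rightarrow> real"
    and h :: "real \<Rightarrow> real \<Rightarrow> real"
  assumes "place_enumeration r1 r2 s"
    and "V_coordinates r1 r2 crd"
    and "\<forall>t. poly_mapping.lookup F t \<in> carrier ring_of_integers"
    and "smooth_on W UNIV"
    and "compact (closure {x. W x \<noteq> 0})"
    and "P \<ge> 1"
    and "Q \<ge> 1"
    and "delta_weight c h"
    and "delta_identity TYPE('k) Q (c Q) h"
  shows
    "(\<lambda>(\<bb>, m). inverse (real (ideal_norm \<bb>) ^ CARD('n)) *
        exp_sum r1 r2 s F \<bb> m * exp_integral r1 r2 s crd W F h P Q \<bb> m)
       summable_on (SIGMA \<bb>:nonzero_ideals. {m. \<forall>i. m $ i \<in> dual_ideal \<bb>}) \<and>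
     complex_of_real (N_count r1 r2 s crd W F P) =
       complex_of_real
         (c Q * 2 ^ (r2 * CARD('n)) /
          (abs_discriminant TYPE('k) powr (CARD('n) / 2) * Q ^ (2 * nf_degree TYPE('k)))) *
       (\<Sum>\<^sub>\<infinity>\<bb>\<in>nonzero_ideals. \<Sum>\<^sub>\<infinity>m\<in>{m. \<forall>i. m $ i \<in> dual_ideal \<bb>}.
          inverse (real (ideal_norm \<bb>) ^ CARD('n)) *
          exp_sum r1 r2 s F \<bb> m * exp_integral r1 r2 s crd W F h P Q \<bb> m)"
proof -
  interpret places r1 r2 s crd by unfold_locales (fact assms)+
  let ?d = "nf_degree TYPE('k)"
  let ?n = "CARD('n)"
  let ?F = "\<lambda>x. mpoly_eval id F (vec_nth x)"
  let ?D = "\<lambda>\<bb>. {m :: 'k ^ 'n. \<forall>i. m $ i \<in> dual_ideal \<bb>}"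
  let ?w = "\<lambda>(\<bb> :: 'k set) x. weight W (h (real (ideal_norm \<bb>) / Q ^ ?d)) F P (Q ^ (2 * ?d)) x"
  define f where "f = (\<lambda>\<bb> x. complex_of_real (?w \<bb> x))"
  define t where "t = (\<lambda>\<bb> m. inverse (real (ideal_norm \<bb>) ^ ?n) * exp_sum r1 r2 s F \<bb> m * exp_integral r1 r2 s crd W F h P Q \<bb> m)"
  have Q: "Q ^ ?d > 0" "Q ^ (2 * ?d) > 0" using assms(7) by simp_all
  have smooth: "smooth_on (\<lambda>(x, y). h x y) ({0<..} \<times> UNIV)"
    and hsupp: "\<And>x y. x > 0 \<Longrightarrow> h x y \<noteq> 0 \<Longrightarrow> x \<le> max 1 (2 * \<bar>y\<bar>)"
    and even: "\<And>x y. x > 0 \<Longrightarrow> h x (- y) = h x y"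
    using assms(8) unfolding delta_weight_def by blast+
  have F: "algebraic_int (poly_mapping.lookup F t)" for t
    using assms(3) by (simp add: ring_of_integers_def)
  have Npos: "real (ideal_norm \<bb>) / Q ^ ?d > 0" if "\<bb> \<in> nonzero_ideals" for \<bb> :: "'k set"
    using ideal_norm_pos[OF that] Q(1) by simp
  have tf: "test_fun (f \<bb>)" if \<bb>: "\<bb> \<in> nonzero_ideals" for \<bb>
    unfolding f_def
  proof (rule test_fun_weight[OF assms(4,5,6)])
    fix k
    \<comment> \<open>The weight uses \<open>h\<close> along the vertical line through N(b) / Q^d,
      which lies in the half plane of smoothness because the norm is positive.\<close>
    have bl: "bounded_linear (\<lambda>y::real. (0::real, y))"
      by (intro bounded_linear_Pair bounded_linear_zero bounded_linear_ident)
    have "Ck_on k (\<lambda>y. (\<lambda>(x, y). h x y) ((real (ideal_norm \<bb>) / Q ^ ?d, 0) + (0, y))) UNIV"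
      by (rule Ck_on_compose_affine[OF bl, of _ _ "{0<..} \<times> UNIV"])
        (use smooth Npos[OF \<bb>] in \<open>auto simp: smooth_on_def\<close>)
    then show "Ck_on k (h (real (ideal_norm \<bb>) / Q ^ ?d)) UNIV" by simp
  qed
  obtain R where R: "R > 0" "\<And>x. W (x /\<^sub>R P) \<noteq> 0 \<Longrightarrow> norm x \<le> R"
    by (rule scaled_support[OF assms(5,6)]) (rule that)
  define X where "X = {x :: 'k ^ 'n. (\<forall>i. algebraic_int (x $ i)) \<and> W (vec\<iota> x /\<^sub>R P) \<noteq> 0}"
  have X: "finite X" "\<And>x i. x \<in> X \<Longrightarrow> algebraic_int (x $ i)"
    "\<And>x \<bb>. x \<notin> X \<Longrightarrow> (\<forall>i. algebraic_int (x $ i)) \<Longrightarrow> f \<bb> (vec\<iota> x) = 0"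
  proof -
    show "finite X" by (rule finite_subset[OF _ finite_lattice_points[of R]]) (auto simp: X_def intro: R(2))
  qed (auto simp: X_def f_def weight_def)
  have t_eq: "t \<bb> = (\<lambda>m. inverse (real (ideal_norm \<bb>) ^ ?n) * exp_sum r1 r2 s F \<bb> m * ideal_fourier (f \<bb>) m)" for \<bb>
    unfolding t_def f_def exp_integral_eq ..
  obtain M :: nat where M: "\<And>N x. N > M \<Longrightarrow> weight W (h (real N / Q ^ ?d)) F P (Q ^ (2 * ?d)) x = 0"
    using weight_vanishes[of W P "Q ^ ?d" "Q ^ (2 * ?d)" h F] assms(5,6) Q hsupp by metis
  \<comment> \<open>The ideals that contribute. This finite set depends on neither x nor m, so one
    truncation serves the Poisson side and the delta identity.\<close>
  define B where "B = {\<bb> \<in> (nonzero_ideals :: 'k set set). ideal_norm \<bb> \<le> M}"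
  have finB: "finite B" unfolding B_def by (rule finite_ideals_bounded_norm)
  have BI: "B \<subseteq> nonzero_ideals" by (auto simp: B_def)
  have w0: "?w \<bb> x = 0" if "\<bb> \<in> nonzero_ideals - B" for \<bb> x using that by (intro M) (auto simp: B_def)
  have t0: "t \<bb> m = 0" if "\<bb> \<in> nonzero_ideals - B" for \<bb> m
    unfolding t_eq ideal_fourier_def f_def w0[OF that] by simp
  have per_ideal: "(\<lambda>m. cmod (t \<bb> m)) summable_on ?D \<bb>"
    "(t \<bb> has_sum of_real (covol ^ ?n) * (\<Sum>x\<in>X. \<Sum>\<sigma>\<in>primitive_chars \<bb>. \<sigma> (?F x) * f \<bb> (vec\<iota> x))) (?D \<bb>)"
    if \<bb>: "\<bb> \<in> nonzero_ideals" for \<bb>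
    unfolding t_eq by (rule ideal_term[OF \<bb> F tf[OF \<bb>] X]; assumption)+
  have summable: "(\<lambda>(\<bb>, m). t \<bb> m) summable_on (SIGMA \<bb>:nonzero_ideals. ?D \<bb>)"
  proof (rule Infinite_Sum.abs_summable_summable)
    \<comment> \<open>Absolute summability over pairs is checked for each ideal and then for the
      sums of absolute values, which vanish outside \<open>B\<close>.\<close>
    have "(\<lambda>\<bb>. norm (\<Sum>\<^sub>\<infinity>m\<in>?D \<bb>. cmod (t \<bb> m))) summable_on nonzero_ideals
      \<longleftrightarrow> (\<lambda>\<bb>. norm (\<Sum>\<^sub>\<infinity>m\<in>?D \<bb>. cmod (t \<bb> m))) summable_on B"
      by (rule summable_on_cong_neutral) (use BI in \<open>auto simp: t0\<close>)
    then have "(\<lambda>\<bb>. norm (\<Sum>\<^sub>\<infinity>m\<in>?D \<bb>. cmod (t \<bb> m))) summable_on nonzero_ideals"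
      using summable_on_finite[OF finB] by blast
    then show "(\<lambda>p. norm ((\<lambda>(\<bb>, m). t \<bb> m) p)) summable_on (SIGMA \<bb>:nonzero_ideals. ?D \<bb>)"
      unfolding Infinite_Sum.abs_summable_on_Sigma_iff prod.case using per_ideal(1) by blast
  qed
  have sum_t: "(\<Sum>\<^sub>\<infinity>\<bb>\<in>nonzero_ideals. \<Sum>\<^sub>\<infinity>m\<in>?D \<bb>. t \<bb> m)
    = of_real (covol ^ ?n) * (\<Sum>x\<in>X. \<Sum>\<bb>\<in>B. \<Sum>\<sigma>\<in>primitive_chars \<bb>. \<sigma> (?F x) * f \<bb> (vec\<iota> x))"
  proof -
    have "(\<Sum>\<^sub>\<infinity>\<bb>\<in>nonzero_ideals. \<Sum>\<^sub>\<infinity>m\<in>?D \<bb>. t \<bb> m) = (\<Sum>\<^sub>\<infinity>\<bb>\<in>B. \<Sum>\<^sub>\<infinity>m\<in>?D \<bb>. t \<bb> m)"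
      by (rule infsum_cong_neutral) (use BI in \<open>auto simp: t0\<close>)
    also have "\<dots> = (\<Sum>\<bb>\<in>B. of_real (covol ^ ?n) * (\<Sum>x\<in>X. \<Sum>\<sigma>\<in>primitive_chars \<bb>. \<sigma> (?F x) * f \<bb> (vec\<iota> x)))"
      unfolding infsum_finite[OF finB] by (intro sum.cong refl infsumI per_ideal(2)) (use BI in blast)
    also have "\<dots> = of_real (covol ^ ?n) * (\<Sum>\<bb>\<in>B. \<Sum>x\<in>X. \<Sum>\<sigma>\<in>primitive_chars \<bb>. \<sigma> (?F x) * f \<bb> (vec\<iota> x))"
      by (rule sum_distrib_left[symmetric])
    also have "(\<Sum>\<bb>\<in>B. \<Sum>x\<in>X. \<Sum>\<sigma>\<in>primitive_chars \<bb>. \<sigma> (?F x) * f \<bb> (vec\<iota> x))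
      = (\<Sum>x\<in>X. \<Sum>\<bb>\<in>B. \<Sum>\<sigma>\<in>primitive_chars \<bb>. \<sigma> (?F x) * f \<bb> (vec\<iota> x))"
      by (rule sum.swap)
    finally show ?thesis .
  qed
  have delta: "complex_of_real (c Q / Q ^ (2 * ?d)) * (\<Sum>\<bb>\<in>B. \<Sum>\<sigma>\<in>primitive_chars \<bb>. \<sigma> (?F x) * f \<bb> (vec\<iota> x))
    = complex_of_real (delta_K (?F x) * W (vec\<iota> x /\<^sub>R P))" if x: "x \<in> X" for x
  proof -
    have int: "algebraic_int (?F x)" by (rule algebraic_int_mpoly_eval[OF F X(2)[OF x]])
    have Wx: "W (vec\<iota> x /\<^sub>R P) \<noteq> 0" using x by (simp add: X_def)
    let ?h = "\<lambda>\<bb> :: 'k set. h (real (ideal_norm \<bb>) / Q ^ ?d) (real (ideal_norm (cgenideal ring_of_integers (?F x))) / Q ^ (2 * ?d))"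
    \<comment> \<open>The norm of the principal ideal is the absolute value of the norm form at the
      integral point; evenness of \<open>h\<close> removes the absolute value.\<close>
    have h: "?h \<bb> = h (real (ideal_norm \<bb>) / Q ^ ?d) (Nm_F F (vec\<iota> x) / Q ^ (2 * ?d))"
      if "\<bb> \<in> nonzero_ideals" for \<bb> :: "'k set"
    proof -
      have "real (ideal_norm (cgenideal ring_of_integers (?F x))) = \<bar>Nm_F F (vec\<iota> x)\<bar>"
        unfolding Nm_F_vec\<iota> by (rule ideal_norm_places[OF int])
      then show ?thesis using even[OF Npos[OF that]] by (simp add: abs_if)
    qed
    have "complex_of_real (delta_K (?F x)) = complex_of_real (c Q / Q ^ (2 * ?d)) *
      (\<Sum>\<^sub>\<infinity>\<bb>\<in>nonzero_ideals. \<Sum>\<sigma>\<in>primitive_chars \<bb>. \<sigma> (?F x) * complex_of_real (?h \<bb>))"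
      using assms(9) int unfolding delta_identity_def by (simp add: ring_of_integers_def)
    also have "(\<Sum>\<^sub>\<infinity>\<bb>\<in>nonzero_ideals. \<Sum>\<sigma>\<in>primitive_chars \<bb>. \<sigma> (?F x) * complex_of_real (?h \<bb>))
      = (\<Sum>\<^sub>\<infinity>\<bb>\<in>B. \<Sum>\<sigma>\<in>primitive_chars \<bb>. \<sigma> (?F x) * complex_of_real (?h \<bb>))"
    proof (rule infsum_cong_neutral)
      fix \<bb> :: "'k set" assume \<bb>: "\<bb> \<in> nonzero_ideals - B"
      \<comment> \<open>The weight is \<open>W\<close> times \<open>h\<close>, and \<open>W\<close>
        is nonzero at points of \<open>X\<close>, so the vanishing weight forces \<open>h\<close> to
        vanish.\<close>
      then have "?h \<bb> = 0" using w0[OF \<bb>, of "vec\<iota> x"] Wx h[of \<bb>] by (simp add: weight_def)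
      then show "(\<Sum>\<sigma>\<in>primitive_chars \<bb>. \<sigma> (?F x) * complex_of_real (?h \<bb>)) = 0" by simp
    qed (use BI in auto)
    also have "\<dots> = (\<Sum>\<bb>\<in>B. \<Sum>\<sigma>\<in>primitive_chars \<bb>. \<sigma> (?F x) * complex_of_real (?h \<bb>))"
      by (rule infsum_finite[OF finB])
    finally have "complex_of_real (delta_K (?F x)) * complex_of_real (W (vec\<iota> x /\<^sub>R P)) = complex_of_real (c Q / Q ^ (2 * ?d)) *
      ((\<Sum>\<bb>\<in>B. \<Sum>\<sigma>\<in>primitive_chars \<bb>. \<sigma> (?F x) * complex_of_real (?h \<bb>)) * complex_of_real (W (vec\<iota> x /\<^sub>R P)))"
      by (simp only: mult.assoc)
    also have "(\<Sum>\<bb>\<in>B. \<Sum>\<sigma>\<in>primitive_chars \<bb>. \<sigma> (?F x) * complex_of_real (?h \<bb>)) * complex_of_real (W (vec\<iota> x /\<^sub>R P))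
      = (\<Sum>\<bb>\<in>B. \<Sum>\<sigma>\<in>primitive_chars \<bb>. \<sigma> (?F x) * f \<bb> (vec\<iota> x))"
      unfolding sum_distrib_right
    proof (intro sum.cong refl)
      fix \<bb> \<sigma> assume "\<bb> \<in> B"
      then have "f \<bb> (vec\<iota> x) = complex_of_real (?h \<bb>) * complex_of_real (W (vec\<iota> x /\<^sub>R P))"
        using h[of \<bb>] BI by (auto simp: f_def weight_def)
      then show "\<sigma> (?F x) * complex_of_real (?h \<bb>) * complex_of_real (W (vec\<iota> x /\<^sub>R P)) = \<sigma> (?F x) * f \<bb> (vec\<iota> x)"
        by (simp only: mult.assoc)
    qed
    finally show ?thesis by (simp only: of_real_mult)
  qed
  have "N_count r1 r2 s crd W F P = (\<Sum>x\<in>X. delta_K (?F x) * W (vec\<iota> x /\<^sub>R P))"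
    unfolding N_count_def infsum_finite[OF X(1), symmetric]
    by (rule infsum_cong_neutral) (auto simp: X_def ring_of_integers_def)
  then have "complex_of_real (N_count r1 r2 s crd W F P) = complex_of_real (c Q / Q ^ (2 * ?d)) *
      (\<Sum>x\<in>X. \<Sum>\<bb>\<in>B. \<Sum>\<sigma>\<in>primitive_chars \<bb>. \<sigma> (?F x) * f \<bb> (vec\<iota> x))"
    by (simp only: of_real_sum sum_distrib_left[of "complex_of_real (c Q / Q ^ (2 * ?d))" _ X] delta cong: sum.cong)
  \<comment> \<open>The n-th power of \<open>covol\<close> is D^(n/2) / 2^(r2 n), the reciprocal of
    the corresponding factor of the claimed constant.\<close>
  also have "complex_of_real (c Q / Q ^ (2 * ?d))
    = complex_of_real (c Q * 2 ^ (r2 * ?n) / (abs_discriminant TYPE('k) powr (?n / 2) * Q ^ (2 * ?d))) * of_real (covol ^ ?n)"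
  proof -
    have "abs_discriminant TYPE('k) powr (?n / 2) = (abs_discriminant TYPE('k) powr (1 / 2)) powr real ?n"
      by (simp add: powr_powr)
    also have "\<dots> = sqrt (abs_discriminant TYPE('k)) ^ ?n"
      using abs_discriminant_pos by (simp add: powr_half_sqrt powr_realpow)
    finally have "c Q * 2 ^ (r2 * ?n) / (abs_discriminant TYPE('k) powr (?n / 2) * Q ^ (2 * ?d)) * covol ^ ?n = c Q / Q ^ (2 * ?d)"
      using abs_discriminant_pos Q(2) by (simp add: covol_def power_divide power_mult)
    then show ?thesis by (simp only: of_real_mult[symmetric])
  qed
  finally have "complex_of_real (N_count r1 r2 s crd W F P) =
    complex_of_real (c Q * 2 ^ (r2 * ?n) / (abs_discriminant TYPE('k) powr (?n / 2) * Q ^ (2 * ?d))) *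
    (\<Sum>\<^sub>\<infinity>\<bb>\<in>nonzero_ideals. \<Sum>\<^sub>\<infinity>m\<in>?D \<bb>. t \<bb> m)"
    unfolding sum_t by (simp only: mult.assoc)
  with summable show ?thesis unfolding t_def by (intro conjI)
qed

end
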